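(* Let $D=\mathbb{T}^d$ or $D=\mathbb{R}^d$, let $T>0$, and let $\pmb{\nu}=(\nu^1,\nu^2,\dots)$ be a statistical solution of the incompressible Euler equations on $[0,T]\times D$. Let $\rho_\varepsilon(z)=\varepsilon^{-d}\rho(z/\varepsilon)$, where $\rho$ is a rotationally symmetric mollifier. Then the distribution $\mathcal{E}(\pmb{\nu})\in\mathcal{D}'((0,T)\times D)$ given for $\psi\in C_c^\infty((0,T)\times D)$ by $$\mathcal{E}(\pmb{\nu})(\psi):=-\frac12\lim_{\varepsilon\to0}\int_0^T\int_D\int_{B_\varepsilon(0)}\psi(t,x)\,\nabla\rho_\varepsilon(z)\cdot\big\langle\nu^2_{t,x,x-z},\,(v_1-v_2)|v_1-v_2|^2\big\rangle\,dz\,dx\,dt$$ is well-defined and independent of the choice of $\rho$, and $\pmb{\nu}$ satisfies $$\partial_t\big\langle\nu^1_{t,x},|v|^2\big\rangle+\sum_{k=1}^d\partial_{x^k}\big\langle\nu^1_{t,x},|v|^2v^k+2v^kp\big\rangle=\mathcal{E}(\pmb{\nu})$$ in the sense of distributions on $(0,T)\times D$. If moreover $\pmb{\nu}$ satisfies the regularity condition $$\liminf_{\varepsilon\to0}\frac1\varepsilon\int_0^T\int_D\frac{1}{|B_\varepsilon(x)|}\int_{B_\varepsilon(x)}\big\langle\nu^2_{t,x,y},|v_1-v_2|^3\big\rangle\,dy\,dx\,dt=0,$$ then $\mathcal{E}(\pmb{\nu})\equiv0$.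
   Context: Notation. $\mathbf{U}=\mathbb{R}^{d+1}$ is the phase space. Elements of $\mathbf{U}^k$ are written $\xi=(\xi_1,\dots,\xi_k)$ with $\xi_j=(v_j,p_j)$, where $v_j=(v_j^1,\dots,v_j^d)\in\mathbb{R}^d$ is interpreted as the velocity and $p_j\in\mathbb{R}$ as the pressure at the point $x_j$; for $k=1$ write $\xi=(v,p)$. $\langle\mu,f\rangle$ denotes the integral of $f$ against the probability measure $\mu$ (componentwise if $f$ is vector-valued). A Young measure from $E$ to $\mathbf{U}^k$ is a weak* measurable map from $E$ to the probability measures on $\mathbf{U}^k$. $C_0$ denotes continuous functions vanishing at infinity, $C_b$ bounded continuous functions. A rotationally symmetric mollifier is a nonnegative, rotationally symmetric $\rho\in C_c^\infty(\mathbb{R}^d)$ with unit mass and support in the unit ball $B_1(0)$ (on the torus, $\varepsilon$ is taken small and $\rho_\varepsilon$ is regarded as a function on $\mathbb{T}^d$). A statistical solution of the incompressible Euler equations on $[0,T]\times D$ is a collection $\pmb{\nu}=(\nu^1,\nu^2,\dots)$ satisfying all of the following. (1) For each $k\in\mathbb{N}$, $\nu^k=\nu^k_{t,x_1,\dots,x_k}$ is a Young measure from $[0,T]\times D^k$ to $\mathbf{U}^k$. (2) Symmetry: if $\sigma$ is a permutation of $\{1,\dots,k\}$ and $f\in C_0(\mathbf{U}^k)$, then $\langle\nu^k_{t,\sigma(x)},f(\sigma(\xi))\rangle=\langle\nu^k_{t,x},f(\xi)\rangle$ for a.e. $(t,x)\in[0,T]\times D^k$, where $\sigma(x)=(x_{\sigma(1)},\dots,x_{\sigma(k)})$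 and similarly for $\sigma(\xi)$. (3) Consistency: if $f\in C_b(\mathbf{U}^k)$ has the form $f(\xi_1,\dots,\xi_k)=g(\xi_1,\dots,\xi_{k-1})$ with $g\in C_0(\mathbf{U}^{k-1})$, then $\langle\nu^k_{t,x_1,\dots,x_k},f\rangle=\langle\nu^{k-1}_{t,x_1,\dots,x_{k-1}},g\rangle$ for a.e. $(t,x_1,\dots,x_k)\in[0,T]\times D^k$. (4) Integrability: there is $c>0$ such that $\int_D\langle\nu^1_{t,x},|v|^2\rangle\,dx\le c$ for a.e. $t\in[0,T]$, and $\int_0^T\int_D\langle\nu^1_{t,x},|v|^3+|p|^{3/2}\rangle\,dx\,dt<\infty$. (5) Diagonal continuity: $$\lim_{\varepsilon\to0}\int_0^T\int_D\frac{1}{|B_\varepsilon(x)|}\int_{B_\varepsilon(x)}\big\langle\nu^2_{t,x,y},|v_1-v_2|^2+|v_1-v_2|^3+|p_1-p_2|^{3/2}\big\rangle\,dy\,dx\,dt=0.$$ (6) Evolution equations: for all $k\in\mathbb{N}$, all $i_1,\dots,i_k\in\{1,\dots,d\}$ and all $\phi\in C_c^\infty((0,T)\times D^k)$, $$\int_0^T\int_{D^k}\Big(\big\langle\nu^k,v_1^{i_1}\cdots v_k^{i_k}\big\rangle\partial_t\phi+\sum_{l=1}^k\big\langle\nu^k,v_l\,v_1^{i_1}\cdots v_k^{i_k}\big\rangle\cdot\nabla_{x_l}\phi+\sum_{l=1}^k\big\langle\nu^k,v_1^{i_1}\cdots v_{l-1}^{i_{l-1}}\,p_l\,v_{l+1}^{i_{l+1}}\cdots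 v_k^{i_k}\big\rangle\frac{\partial\phi}{\partial x_l^{i_l}}\Big)\,dx\,dt=0,$$ where $\nu^k=\nu^k_{t,x_1,\dots,x_k}$ and $x=(x_1,\dots,x_k)$. (7) Divergence-free condition: for every $k\in\mathbb{N}$, every $\phi\in C_c^\infty(\mathbb{R}_+\times D^k)$ and every $\kappa\in C(\mathbf{U}^{k-1})$ with $\langle\nu^{k-1},|\kappa|\rangle<\infty$ and such that the following integral is well-defined (for $k=1$, $\kappa$ is a constant), $$\int_0^T\int_{D^k}\nabla_{x_k}\phi(t,x)\cdot\big\langle\nu^k_{t,x},\kappa(\xi_1,\dots,\xi_{k-1})\,v_k\big\rangle\,dx\,dt=0.$$ *)

theory Defs
  imports "HOL-Analysis.Analysis" "HOL-Probability.Probability_Measure"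
begin

section \<open>The spatial domain\<close>

text \<open>
  The dimension d is the cardinality of the finite index type of real^'n.  The torus is the
  quotient of R^d by Z^d.  Its points are represented by the half-open unit cell, its functions
  by functions on R^d of period 1 in every coordinate.
\<close>

datatype space_domain = Torus | Whole

definition pts :: "space_domain \<Rightarrow> (real^'n) set" where
  "pts D = (case D of Torus \<Rightarrow> {x. \<forall>i. 0 \<le> x $ i \<and> x $ i < 1} | Whole \<Rightarrow> UNIV)"

definition wrap :: "space_domain \<Rightarrow> real^'n \<Rightarrow> real^'n" where
  "wrap D x = (case D of Torus \<Rightarrow> (\<chi> i. frac (x $ i)) | Whole \<Rightarrow> x)"

definition dball :: "space_domain \<Rightarrow> real^'n \<Rightarrow> real \<Rightarrow> (real^'n) set" where
  "dball D x \<epsilon> = wrap D ` ball x \<epsilon>"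

text \<open>
  A k-tuple is a function on nat whose entries are those with index below k, so
  indices are shifted by one with respect to the usual notation.
  The elements of the measure spaces below are extensional (undefined from index k on).
\<close>

definition tuple :: "'a list \<Rightarrow> nat \<Rightarrow> 'a" where
  "tuple xs = (\<lambda>i\<in>{..<length xs}. xs ! i)"

definition spacetime :: "space_domain \<Rightarrow> real \<Rightarrow> nat \<Rightarrow> (real \<times> (nat \<Rightarrow> real^'n)) measure" where
  "spacetime D T k =
     completion (restrict_space lborel {0..T} \<Otimes>\<^sub>M
                 (\<Pi>\<^sub>M j\<in>{..<k}. restrict_space lborel (pts D)))"

text \<open>Functions of the first k entries only, that is, functions on the k-fold power.\<close>

definition depends_on_first :: "nat \<Rightarrow> ((nat \<Rightarrow> 'a) \<Rightarrow> 'b) \<Rightarrow> bool" where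
  "depends_on_first k f \<longleftrightarrow> (\<forall>x y. (\<forall>j<k. x j = y j) \<longrightarrow> f x = f y)"


section \<open>Smooth functions and distributions\<close>

text \<open>
  Smoothness means that all iterated partial derivatives exist and are continuous.  Since
  tuples of variable length do not form a normed space, a coordinate direction is given by
  the one-parameter group of translations along it.  On functions of the first k entries,
  continuity for the product topology is continuity on the k-fold power.
\<close>

definition flow_deriv :: "(real \<Rightarrow> 'a \<Rightarrow> 'a) \<Rightarrow> ('a \<Rightarrow> real) \<Rightarrow> 'a \<Rightarrow> real" where
  "flow_deriv s f p = deriv (\<lambda>h. f (s h p)) 0"

definition smooth_along ::
  "(real \<Rightarrow> 'a \<Rightarrow> 'a) set \<Rightarrow> ('a::topological_space \<Rightarrow> real) \<Rightarrow> bool" where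
  "smooth_along S f \<longleftrightarrow>
     (\<forall>ss\<in>lists S. continuous_on UNIV (foldr flow_deriv ss f) \<and>
        (\<forall>s\<in>S. \<forall>p. (\<lambda>h. foldr flow_deriv ss f (s h p)) differentiable (at 0)))"

definition coord_shift :: "'n \<Rightarrow> real \<Rightarrow> real^'n \<Rightarrow> real^'n" where
  "coord_shift i h z = z + h *\<^sub>R axis i 1"

definition grad :: "(real^'n \<Rightarrow> real) \<Rightarrow> real^'n \<Rightarrow> real^'n" where
  "grad f z = (\<chi> i. flow_deriv (coord_shift i) f z)"

definition time_shift :: "real \<Rightarrow> real \<times> (nat \<Rightarrow> real^'n) \<Rightarrow> real \<times> (nat \<Rightarrow> real^'n)" where
  "time_shift h = (\<lambda>(t, x). (t + h, x))"

definition space_shift ::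
  "nat \<Rightarrow> 'n \<Rightarrow> real \<Rightarrow> real \<times> (nat \<Rightarrow> real^'n) \<Rightarrow> real \<times> (nat \<Rightarrow> real^'n)" where
  "space_shift l i h = (\<lambda>(t, x). (t, x(l := coord_shift i h (x l))))"

definition shifts ::
  "nat \<Rightarrow> (real \<Rightarrow> real \<times> (nat \<Rightarrow> real^'n) \<Rightarrow> real \<times> (nat \<Rightarrow> real^'n)) set" where
  "shifts k = insert time_shift {space_shift l i | l i. l < k}"

definition dt :: "(real \<times> (nat \<Rightarrow> real^'n) \<Rightarrow> real) \<Rightarrow> real \<times> (nat \<Rightarrow> real^'n) \<Rightarrow> real" where
  "dt \<phi> = flow_deriv time_shift \<phi>"

definition grad_at ::
  "nat \<Rightarrow> (real \<times> (nat \<Rightarrow> real^'n) \<Rightarrow> real) \<Rightarrow> real \<times> (nat \<Rightarrow> real^'n) \<Rightarrow> real^'n" where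
  "grad_at l \<phi> p = (\<chi> i. flow_deriv (space_shift l i) \<phi> p)"

text \<open>
  On the torus, which is compact, only the support in time is restricted.
  Every compact subset of I x D^k is contained in one of the sets described by J and R.
\<close>

definition support_within ::
  "space_domain \<Rightarrow> nat \<Rightarrow> real set \<Rightarrow> real \<Rightarrow> (real \<times> (nat \<Rightarrow> real^'n) \<Rightarrow> real) \<Rightarrow> bool" where
  "support_within D k J R \<phi> \<longleftrightarrow>
     (\<forall>t x. \<phi> (t, x) \<noteq> 0 \<longrightarrow> t \<in> J \<and> (D = Whole \<longrightarrow> (\<forall>l<k. norm (x l) \<le> R)))"

text \<open>Smooth compactly supported functions on I x D^k, for an open time interval I.\<close>

definition test_functions ::
  "space_domain \<Rightarrow> nat \<Rightarrow> real set \<Rightarrow> (real \<times> (nat \<Rightarrow> real^'n) \<Rightarrow> real) set" where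
  "test_functions D k I = {\<phi>.
     smooth_along (shifts k) \<phi> \<and>
     (\<forall>t. depends_on_first k (\<lambda>x. \<phi> (t, x))) \<and>
     (D = Torus \<longrightarrow> (\<forall>t x. \<forall>l<k. \<forall>i. \<phi> (t, x(l := x l + axis i 1)) = \<phi> (t, x))) \<and>
     (\<exists>J R. compact J \<and> J \<subseteq> I \<and> support_within D k J R \<phi>)}"

text \<open>
  Distributions on (0,T) x D: linear functionals bounded, on test functions supported in a
  fixed compact set, by finitely many suprema of derivatives.
\<close>

definition distribution ::
  "space_domain \<Rightarrow> real \<Rightarrow> ((real \<times> (nat \<Rightarrow> real^'n) \<Rightarrow> real) \<Rightarrow> real) \<Rightarrow> bool" where
  "distribution D T E \<longleftrightarrow>
     (\<forall>\<phi>\<in>test_functions D 1 {0<..<T}. \<forall>\<psi>\<in>test_functions D 1 {0<..<T}. \<forall>a b.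
        E (\<lambda>p. a * \<phi> p + b * \<psi> p) = a * E \<phi> + b * E \<psi>) \<and>
     (\<forall>J R. compact J \<and> J \<subseteq> {0<..<T} \<longrightarrow>
        (\<exists>C N. \<forall>\<psi>\<in>test_functions D 1 {0<..<T}. support_within D 1 J R \<psi> \<longrightarrow>
           (\<forall>M. (\<forall>ss\<in>lists (shifts 1). length ss \<le> N \<longrightarrow>
                   (\<forall>p. \<bar>foldr flow_deriv ss \<psi> p\<bar> \<le> M)) \<longrightarrow> \<bar>E \<psi>\<bar> \<le> C * M)))"


section \<open>Statistical solutions\<close>

type_synonym 'n phase = "(real^'n) \<times> real"

type_synonym 'n correlation =
  "nat \<Rightarrow> real \<Rightarrow> (nat \<Rightarrow> real^'n) \<Rightarrow> (nat \<Rightarrow> 'n phase) measure"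

definition vel :: "(nat \<Rightarrow> 'n::finite phase) \<Rightarrow> nat \<Rightarrow> real^'n" where
  "vel \<xi> j = fst (\<xi> j)"

definition pres :: "(nat \<Rightarrow> 'n::finite phase) \<Rightarrow> nat \<Rightarrow> real" where
  "pres \<xi> j = snd (\<xi> j)"

definition C0 :: "nat \<Rightarrow> ((nat \<Rightarrow> 'n::finite phase) \<Rightarrow> real) set" where
  "C0 k = {f. continuous_on UNIV f \<and> depends_on_first k f \<and>
     (\<forall>e>0. \<exists>R. \<forall>\<xi>. (\<exists>j<k. R < norm (\<xi> j)) \<longrightarrow> \<bar>f \<xi>\<bar> < e)}"

definition young_measure ::
  "space_domain \<Rightarrow> real \<Rightarrow> nat \<Rightarrow> (real \<Rightarrow> (nat \<Rightarrow> real^'n) \<Rightarrow> (nat \<Rightarrow> 'n::finite phase) measure) \<Rightarrow> bool"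
where
  "young_measure D T k \<mu> \<longleftrightarrow>
     (\<forall>t\<in>{0..T}. \<forall>x\<in>{..<k} \<rightarrow>\<^sub>E pts D.
        prob_space (\<mu> t x) \<and> sets (\<mu> t x) = sets (\<Pi>\<^sub>M j\<in>{..<k}. borel)) \<and>
     (\<forall>f\<in>C0 k. (\<lambda>(t, x). \<integral>\<xi>. f \<xi> \<partial>\<mu> t x) \<in> borel_measurable (spacetime D T k))"

text \<open>
  If xi has the law attached to x, then the permuted xi has the law attached to the permuted x.
  For transpositions, which generate all permutations, this agrees with the formula in which
  both permutations are written on the same side.
\<close>

definition symmetry_cond :: "space_domain \<Rightarrow> real \<Rightarrow> 'n::finite correlation \<Rightarrow> bool" where
  "symmetry_cond D T \<nu> \<longleftrightarrow>
     (\<forall>k\<ge>1. \<forall>\<sigma>. \<sigma> permutes {..<k} \<longrightarrow> (\<forall>f\<in>C0 k.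
        AE (t, x) in spacetime D T k.
          (\<integral>\<xi>. f \<xi> \<partial>\<nu> k t (x \<circ> \<sigma>)) = (\<integral>\<xi>. f (\<xi> \<circ> \<sigma>) \<partial>\<nu> k t x)))"

definition consistency_cond :: "space_domain \<Rightarrow> real \<Rightarrow> 'n::finite correlation \<Rightarrow> bool" where
  "consistency_cond D T \<nu> \<longleftrightarrow>
     (\<forall>k\<ge>2. \<forall>g\<in>C0 (k - 1).
        AE (t, x) in spacetime D T k.
          (\<integral>\<xi>. g \<xi> \<partial>\<nu> k t x) = (\<integral>\<xi>. g \<xi> \<partial>\<nu> (k - 1) t (restrict x {..<k - 1})))"

definition integrability_cond :: "space_domain \<Rightarrow> real \<Rightarrow> 'n::finite correlation \<Rightarrow> bool" where
  "integrability_cond D T \<nu> \<longleftrightarrow>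
     (\<exists>c>0. AE t in lebesgue_on {0..T}.
        (\<integral>\<^sup>+ x. (\<integral>\<^sup>+ \<xi>. ennreal (norm (vel \<xi> 0) ^ 2) \<partial>\<nu> 1 t (tuple [x]))
           \<partial>lebesgue_on (pts D)) \<le> ennreal c) \<and>
     (\<integral>\<^sup>+ t. (\<integral>\<^sup>+ x. (\<integral>\<^sup>+ \<xi>. ennreal (norm (vel \<xi> 0) ^ 3 + \<bar>pres \<xi> 0\<bar> powr (3/2))
           \<partial>\<nu> 1 t (tuple [x])) \<partial>lebesgue_on (pts D)) \<partial>lebesgue_on {0..T}) < \<infinity>"

text \<open>The integral over space-time of the mean of <nu^2, F> over the balls around the diagonal.\<close>

definition diag_mean ::
  "space_domain \<Rightarrow> real \<Rightarrow> 'n::finite correlation \<Rightarrow> ((nat \<Rightarrow> 'n::finite phase) \<Rightarrow> real) \<Rightarrow> real \<Rightarrow> ennreal" where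
  "diag_mean D T \<nu> F \<epsilon> =
     (\<integral>\<^sup>+ t. (\<integral>\<^sup>+ x.
        (\<integral>\<^sup>+ y. (\<integral>\<^sup>+ \<xi>. ennreal (F \<xi>) \<partial>\<nu> 2 t (tuple [x, y])) \<partial>lebesgue_on (dball D x \<epsilon>))
          / emeasure lebesgue (dball D x \<epsilon>)
        \<partial>lebesgue_on (pts D)) \<partial>lebesgue_on {0..T})"

definition diagonal_cond :: "space_domain \<Rightarrow> real \<Rightarrow> 'n::finite correlation \<Rightarrow> bool" where
  "diagonal_cond D T \<nu> \<longleftrightarrow>
     (diag_mean D T \<nu> (\<lambda>\<xi>. norm (vel \<xi> 0 - vel \<xi> 1) ^ 2 + norm (vel \<xi> 0 - vel \<xi> 1) ^ 3
        + \<bar>pres \<xi> 0 - pres \<xi> 1\<bar> powr (3/2)) \<longlongrightarrow> 0) (at_right 0)"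

definition AE_bracket_defined ::
  "space_domain \<Rightarrow> real \<Rightarrow> 'n::finite correlation \<Rightarrow> nat \<Rightarrow>
   ((nat \<Rightarrow> 'n::finite phase) \<Rightarrow> 'b::{banach, second_countable_topology}) \<Rightarrow> bool" where
  "AE_bracket_defined D T \<nu> k f \<longleftrightarrow> (AE (t, x) in spacetime D T k. integrable (\<nu> k t x) f)"

text \<open>
  The Bochner integral of a non-integrable function is 0.  Hence the equations state
  explicitly that the integrals in them exist (moments of high order are not controlled by the
  integrability condition).
\<close>

definition evolution_integrand ::
  "'n::finite correlation \<Rightarrow> nat \<Rightarrow> (nat \<Rightarrow> 'n) \<Rightarrow>
   (real \<times> (nat \<Rightarrow> real^'n) \<Rightarrow> real) \<Rightarrow> real \<times> (nat \<Rightarrow> real^'n) \<Rightarrow> real" where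
  "evolution_integrand \<nu> k i \<phi> = (\<lambda>(t, x).
     (\<integral>\<xi>. (\<Prod>j<k. vel \<xi> j $ i j) \<partial>\<nu> k t x) * dt \<phi> (t, x)
     + (\<Sum>l<k. (\<integral>\<xi>. (\<Prod>j<k. vel \<xi> j $ i j) *\<^sub>R vel \<xi> l \<partial>\<nu> k t x) \<bullet> grad_at l \<phi> (t, x))
     + (\<Sum>l<k. (\<integral>\<xi>. pres \<xi> l * (\<Prod>j\<in>{..<k} - {l}. vel \<xi> j $ i j) \<partial>\<nu> k t x)
                * (grad_at l \<phi> (t, x) $ i l)))"

definition evolution_cond :: "space_domain \<Rightarrow> real \<Rightarrow> 'n::finite correlation \<Rightarrow> bool" where
  "evolution_cond D T \<nu> \<longleftrightarrow>
     (\<forall>k\<ge>1. \<forall>i.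
        AE_bracket_defined D T \<nu> k (\<lambda>\<xi>. \<Prod>j<k. vel \<xi> j $ i j) \<and>
        (\<forall>l<k. AE_bracket_defined D T \<nu> k (\<lambda>\<xi>. (\<Prod>j<k. vel \<xi> j $ i j) *\<^sub>R vel \<xi> l)) \<and>
        (\<forall>l<k. AE_bracket_defined D T \<nu> k
                 (\<lambda>\<xi>. pres \<xi> l * (\<Prod>j\<in>{..<k} - {l}. vel \<xi> j $ i j))) \<and>
        (\<forall>\<phi>\<in>test_functions D k {0<..<T}.
           integrable (spacetime D T k) (evolution_integrand \<nu> k i \<phi>) \<and>
           (\<integral>p. evolution_integrand \<nu> k i \<phi> p \<partial>spacetime D T k) = 0))"

text \<open>
  The test functions are smooth up to time 0, hence are the restrictions of smooth functions
  on all times.  For k = 1 the function kappa is constant and there is no condition involving nu^0.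
\<close>

definition divergence_free_cond :: "space_domain \<Rightarrow> real \<Rightarrow> 'n::finite correlation \<Rightarrow> bool" where
  "divergence_free_cond D T \<nu> \<longleftrightarrow>
     (\<forall>k\<ge>1. \<forall>\<phi>\<in>test_functions D k UNIV. \<forall>\<kappa>.
        continuous_on UNIV \<kappa> \<and> depends_on_first (k - 1) \<kappa> \<and>
        (k \<ge> 2 \<longrightarrow> AE_bracket_defined D T \<nu> (k - 1) \<kappa>) \<and>
        AE_bracket_defined D T \<nu> k (\<lambda>\<xi>. \<kappa> \<xi> *\<^sub>R vel \<xi> (k - 1)) \<and>
        integrable (spacetime D T k) (\<lambda>(t, x).
          grad_at (k - 1) \<phi> (t, x) \<bullet> (\<integral>\<xi>. \<kappa> \<xi> *\<^sub>R vel \<xi> (k - 1) \<partial>\<nu> k t x)) \<longrightarrow>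
        (\<integral>(t, x). grad_at (k - 1) \<phi> (t, x) \<bullet> (\<integral>\<xi>. \<kappa> \<xi> *\<^sub>R vel \<xi> (k - 1) \<partial>\<nu> k t x)
          \<partial>spacetime D T k) = 0)"

definition statistical_solution :: "space_domain \<Rightarrow> real \<Rightarrow> 'n::finite correlation \<Rightarrow> bool" where
  "statistical_solution D T \<nu> \<longleftrightarrow>
     (\<forall>k\<ge>1. young_measure D T k (\<nu> k)) \<and>
     symmetry_cond D T \<nu> \<and>
     consistency_cond D T \<nu> \<and>
     integrability_cond D T \<nu> \<and>
     diagonal_cond D T \<nu> \<and>
     evolution_cond D T \<nu> \<and>
     divergence_free_cond D T \<nu>"


section \<open>The energy defect\<close>

text \<open>A smooth function vanishes off the open unit ball iff its support lies in the closed one.\<close>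

definition rot_sym_mollifier :: "(real^'n \<Rightarrow> real) \<Rightarrow> bool" where
  "rot_sym_mollifier \<rho> \<longleftrightarrow>
     smooth_along (range coord_shift) \<rho> \<and> (\<forall>z. 0 \<le> \<rho> z) \<and>
     (\<forall>A z. orthogonal_transformation A \<longrightarrow> \<rho> (A z) = \<rho> z) \<and>
     (\<forall>z. z \<notin> ball 0 1 \<longrightarrow> \<rho> z = 0) \<and> (\<integral>z. \<rho> z \<partial>lebesgue) = 1"

definition rescale :: "(real^'n \<Rightarrow> real) \<Rightarrow> real \<Rightarrow> real^'n \<Rightarrow> real" where
  "rescale \<rho> \<epsilon> z = \<rho> (z /\<^sub>R \<epsilon>) / \<epsilon> ^ CARD('n)"

abbreviation cubic_increment :: "(nat \<Rightarrow> 'n::finite phase) \<Rightarrow> real^'n" where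
  "cubic_increment \<xi> \<equiv> (norm (vel \<xi> 0 - vel \<xi> 1))\<^sup>2 *\<^sub>R (vel \<xi> 0 - vel \<xi> 1)"

definition defect_region :: "space_domain \<Rightarrow> real \<Rightarrow> real \<Rightarrow> (real \<times> (real^'n) \<times> (real^'n)) set" where
  "defect_region D T \<epsilon> = {0..T} \<times> pts D \<times> ball 0 \<epsilon>"

definition defect_integrand ::
  "space_domain \<Rightarrow> 'n::finite correlation \<Rightarrow> (real^'n \<Rightarrow> real) \<Rightarrow> (real \<times> (nat \<Rightarrow> real^'n) \<Rightarrow> real) \<Rightarrow>
   real \<Rightarrow> real \<times> (real^'n) \<times> (real^'n) \<Rightarrow> real" where
  "defect_integrand D \<nu> \<rho> \<psi> \<epsilon> = (\<lambda>(t, x, z). \<psi> (t, tuple [x]) *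
     (grad (rescale \<rho> \<epsilon>) z \<bullet> (\<integral>\<xi>. cubic_increment \<xi> \<partial>\<nu> 2 t (tuple [x, wrap D (x - z)]))))"

definition defect_integral_defined ::
  "space_domain \<Rightarrow> real \<Rightarrow> 'n::finite correlation \<Rightarrow> (real^'n \<Rightarrow> real) \<Rightarrow>
   (real \<times> (nat \<Rightarrow> real^'n) \<Rightarrow> real) \<Rightarrow> real \<Rightarrow> bool" where
  "defect_integral_defined D T \<nu> \<rho> \<psi> \<epsilon> \<longleftrightarrow>
     (AE (t, x, z) in lebesgue_on (defect_region D T \<epsilon>).
        integrable (\<nu> 2 t (tuple [x, wrap D (x - z)])) cubic_increment) \<and>
     integrable (lebesgue_on (defect_region D T \<epsilon>)) (defect_integrand D \<nu> \<rho> \<psi> \<epsilon>)"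

definition defect_integral ::
  "space_domain \<Rightarrow> real \<Rightarrow> 'n::finite correlation \<Rightarrow> (real^'n \<Rightarrow> real) \<Rightarrow>
   (real \<times> (nat \<Rightarrow> real^'n) \<Rightarrow> real) \<Rightarrow> real \<Rightarrow> real" where
  "defect_integral D T \<nu> \<rho> \<psi> \<epsilon> =
     (\<integral>q. defect_integrand D \<nu> \<rho> \<psi> \<epsilon> q \<partial>lebesgue_on (defect_region D T \<epsilon>))"

definition energy_defect ::
  "space_domain \<Rightarrow> real \<Rightarrow> 'n::finite correlation \<Rightarrow> (real^'n \<Rightarrow> real) \<Rightarrow>
   (real \<times> (nat \<Rightarrow> real^'n) \<Rightarrow> real) \<Rightarrow> real" where
  "energy_defect D T \<nu> \<rho> \<psi> = - (1/2) * Lim (at_right 0) (defect_integral D T \<nu> \<rho> \<psi>)"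

definition energy_integrand ::
  "'n::finite correlation \<Rightarrow> (real \<times> (nat \<Rightarrow> real^'n) \<Rightarrow> real) \<Rightarrow> real \<times> (nat \<Rightarrow> real^'n) \<Rightarrow> real" where
  "energy_integrand \<nu> \<psi> = (\<lambda>(t, x).
     (\<integral>\<xi>. (norm (vel \<xi> 0))\<^sup>2 \<partial>\<nu> 1 t x) * dt \<psi> (t, x)
     + (\<Sum>k\<in>UNIV. (\<integral>\<xi>. (norm (vel \<xi> 0))\<^sup>2 * vel \<xi> 0 $ k + 2 * vel \<xi> 0 $ k * pres \<xi> 0 \<partial>\<nu> 1 t x)
                    * (grad_at 0 \<psi> (t, x) $ k)))"

text \<open>
  The energy balance with right-hand side E, in the sense of distributions; the sign comes
  from moving the derivatives to the test function.
\<close>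

definition energy_balance ::
  "space_domain \<Rightarrow> real \<Rightarrow> 'n::finite correlation \<Rightarrow> ((real \<times> (nat \<Rightarrow> real^'n) \<Rightarrow> real) \<Rightarrow> real) \<Rightarrow> bool" where
  "energy_balance D T \<nu> E \<longleftrightarrow>
     AE_bracket_defined D T \<nu> 1 (\<lambda>\<xi>. (norm (vel \<xi> 0))\<^sup>2) \<and>
     (\<forall>k. AE_bracket_defined D T \<nu> 1
        (\<lambda>\<xi>. (norm (vel \<xi> 0))\<^sup>2 * vel \<xi> 0 $ k + 2 * vel \<xi> 0 $ k * pres \<xi> 0)) \<and>
     (\<forall>\<psi>\<in>test_functions D 1 {0<..<T}.
        integrable (spacetime D T 1) (energy_integrand \<nu> \<psi>) \<and>
        - (\<integral>p. energy_integrand \<nu> \<psi> p \<partial>spacetime D T 1) = E \<psi>)"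

definition regularity_cond :: "space_domain \<Rightarrow> real \<Rightarrow> 'n::finite correlation \<Rightarrow> bool" where
  "regularity_cond D T \<nu> \<longleftrightarrow>
     Liminf (at_right 0)
       (\<lambda>\<epsilon>. ennreal (1 / \<epsilon>) * diag_mean D T \<nu> (\<lambda>\<xi>. norm (vel \<xi> 0 - vel \<xi> 1) ^ 3) \<epsilon>) = 0"

end

theory Submission
  imports Defs "HOL-Probability.Giry_Monad"
begin

text \<open>
  The proof is point splitting, as in the work of Duchon and Robert, carried out under the
  two-point correlation measures.  Write (v, p) and (w, q) for the phases at the points x and y, and
  consider the integral of psi(t,x) grad rho_eps(x - y) . (v - w) |v - w|^2.  Of the terms of the
  expanded cube, those in v alone or in w alone carry a weight whose integral in the other point
  is zero (lemmas flux_left_zero and flux_right_zero).  The terms |v|^2 w and |w|^2 v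
  are handled by the divergence-free condition with weight |v|^2, applied to psi(t,x) rho_eps(x - y)
  with the two entries in either order (speed_flux_zero).  The remaining terms (v.w) v and (v.w) w
  are the transport terms of the evolution equation of v.w with the same test function
  (evolution_zero); its pressure terms are treated by the divergence-free condition with weight p
  (pressure_flux_zero).  All terms in which a derivative falls on rho_eps cancel, and cubic_balance
  expresses the integral through rho_eps times derivatives of psi.

  In this expression the limit is harmless: by Young's inequality, replacing (w, q) by (v, p) costs
  an arbitrarily small multiple of the moments, which are finite by the integrability condition, and
  a large multiple of the mean of |v - w|^2 + |v - w|^3 + |p - q|^(3/2) near the diagonal, which
  tends to zero (flux_difference, cubic_remainder).  As rho_eps has mass one, the limit is twice the
  integral of |v|^2 d/dt psi + (|v|^2 v + 2 p v) . grad psi (defect_limit).  Hence the defect is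
  minus that integral, whatever the mollifier: this is the energy balance, and it shows
  that the defect is a distribution of order one.  Under the regularity condition, the bound
  eps^(-d-1) on the gradient of rho_eps makes the defect integrals small along a sequence of eps,
  so their limit is zero (energy_defect_regular).

  The measures of the statistical solution live on tuples, over completed product spaces, and
  depend on the point in a weak sense only.  They are first replaced by Borel kernels kappa1 and
  kappa2 on phases and pairs of phases (exists_kernel1 and exists_kernel2), so that all integrals
  become integrals for one measure on times, pairs of points and pairs of phases.  On the
  torus, rho_eps(x - y) means rho_eps at the representative of x - y in the cell around 0, which is
  smooth as long as eps is less than 1/2.
\<close>

section \<open>Functions smooth along a family of flows\<close>

text \<open>
  Smoothness is proved by exhibiting a class of functions that is closed under the derivatives.
\<close>

lemma smooth_along_coinduct:
  assumes "P f"
    and "\<And>f. P f \<Longrightarrow> continuous_on UNIV f"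
    and "\<And>f s p. P f \<Longrightarrow> s \<in> S \<Longrightarrow> (\<lambda>h. f (s h p)) differentiable (at 0)"
    and "\<And>f s. P f \<Longrightarrow> s \<in> S \<Longrightarrow> P (flow_deriv s f)"
  shows "smooth_along S f"
proof -
  have "P (foldr flow_deriv ss f)" if "ss \<in> lists S" for ss
    using that by (induction ss) (use assms in auto)
  then show ?thesis
    unfolding smooth_along_def using assms by blast
qed

lemma smooth_along_continuous: "smooth_along S f \<Longrightarrow> continuous_on UNIV f"
  unfolding smooth_along_def by (drule bspec[where x="[]"]) auto

lemma smooth_along_DERIV:
  assumes "smooth_along S f" "s \<in> S"
  shows "((\<lambda>h. f (s h p)) has_real_derivative flow_deriv s f p) (at 0)"
proof -
  have "(\<lambda>h. f (s h p)) differentiable (at 0)"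
    using assms unfolding smooth_along_def by (auto dest!: bspec[where x="[]"])
  then show ?thesis
    unfolding flow_deriv_def by (simp add: DERIV_deriv_iff_real_differentiable)
qed

lemma smooth_along_flow_deriv:
  assumes "smooth_along S f" "s \<in> S"
  shows "smooth_along S (flow_deriv s f)"
proof -
  have "foldr flow_deriv ss (flow_deriv s f) = foldr flow_deriv (ss @ [s]) f" for ss
    by simp
  moreover have "ss @ [s] \<in> lists S" if "ss \<in> lists S" for ss
    using that assms by simp
  ultimately show ?thesis
    using assms(1) unfolding smooth_along_def by metis
qed

lemma flow_derivI:
  assumes "\<And>p. ((\<lambda>h. f (s h p)) has_real_derivative f' p) (at 0)"
  shows "flow_deriv s f = f'"
  using assms by (auto simp: flow_deriv_def fun_eq_iff intro: DERIV_imp_deriv)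

lemma smooth_along_linear_combination:
  assumes "smooth_along S f" "smooth_along S g"
  shows "smooth_along S (\<lambda>p. a * f p + b * g p)"
proof (rule smooth_along_coinduct[where
      P = "\<lambda>F. \<exists>f g. smooth_along S f \<and> smooth_along S g \<and> F = (\<lambda>p. a * f p + b * g p)"])
  fix F :: "'a \<Rightarrow> real" and s p
  assume "\<exists>f g. smooth_along S f \<and> smooth_along S g \<and> F = (\<lambda>p. a * f p + b * g p)"
  then obtain f g where fg: "smooth_along S f" "smooth_along S g"
    and F: "F = (\<lambda>p. a * f p + b * g p)" by blast
  show "continuous_on UNIV F"
    unfolding F using fg by (intro continuous_intros smooth_along_continuous)
  assume s: "s \<in> S"
  have D: "((\<lambda>h. F (s h p)) has_real_derivative (a * flow_deriv s f p + b * flow_deriv s g p)) (at 0)" for p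
    unfolding F using fg s by (auto intro!: derivative_eq_intros smooth_along_DERIV)
  then show "(\<lambda>h. F (s h p)) differentiable (at 0)"
    using real_differentiable_def by blast
  have "flow_deriv s F = (\<lambda>p. a * flow_deriv s f p + b * flow_deriv s g p)"
    by (rule flow_derivI) (rule D)
  then show "\<exists>f g. smooth_along S f \<and> smooth_along S g \<and> flow_deriv s F = (\<lambda>p. a * f p + b * g p)"
    using smooth_along_flow_deriv[OF fg(1) s] smooth_along_flow_deriv[OF fg(2) s] by blast
qed (use assms in blast)

text \<open>
  The sums of products of smooth functions: unlike the products alone, they are closed under the
  product rule.
\<close>

inductive sum_of_products for S where
  product: "smooth_along S f \<Longrightarrow> smooth_along S g \<Longrightarrow> sum_of_products S (\<lambda>p. f p * g p)"
| add: "sum_of_products S F \<Longrightarrow> sum_of_products S G \<Longrightarrow> sum_of_products S (\<lambda>p. F p + G p)"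

lemma flow_deriv_mult:
  assumes "smooth_along S f" "smooth_along S g" "s \<in> S" "\<And>p. s 0 p = p"
  shows "((\<lambda>h. f (s h p) * g (s h p)) has_real_derivative
            (flow_deriv s f p * g p + f p * flow_deriv s g p)) (at 0)"
  using DERIV_mult'[OF smooth_along_DERIV[OF assms(1,3), of p] smooth_along_DERIV[OF assms(2,3), of p]]
    assms(4) by (simp add: algebra_simps)

lemma smooth_along_mult:
  assumes "smooth_along S f" "smooth_along S g" and S: "\<And>s p. s \<in> S \<Longrightarrow> s 0 p = p"
  shows "smooth_along S (\<lambda>p. f p * g p)"
proof -
  have P: "continuous_on UNIV F \<and> (\<forall>s\<in>S. (\<forall>p. (\<lambda>h. F (s h p)) differentiable (at 0)) \<and>
     sum_of_products S (flow_deriv s F))" if "sum_of_products S F" for F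
    using that
  proof induction
    case (product f g)
    have D: "((\<lambda>h. f (s h p) * g (s h p)) has_real_derivative
            (flow_deriv s f p * g p + f p * flow_deriv s g p)) (at 0)" if "s \<in> S" for s p
      using flow_deriv_mult[OF product that] S that by blast
    have "flow_deriv s (\<lambda>p. f p * g p) = (\<lambda>p. flow_deriv s f p * g p + f p * flow_deriv s g p)"
      if "s \<in> S" for s by (rule flow_derivI) (rule D[OF that])
    moreover have "continuous_on UNIV (\<lambda>p. f p * g p)"
      using product by (intro continuous_on_mult smooth_along_continuous)
    moreover have "sum_of_products S (\<lambda>p. flow_deriv s f p * g p + f p * flow_deriv s g p)"
      if "s \<in> S" for s
      using product that by (intro sum_of_products.intros smooth_along_flow_deriv)
    moreover have "(\<lambda>h. f (s h p) * g (s h p)) differentiable (at 0)" if "s \<in> S" for s p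
      using D[OF that] real_differentiable_def by blast
    ultimately show ?case by simp
  next
    case (add F G)
    have D: "((\<lambda>h. F (s h p) + G (s h p)) has_real_derivative
            (flow_deriv s F p + flow_deriv s G p)) (at 0)" if "s \<in> S" for s p
      using add that unfolding flow_deriv_def
      by (intro DERIV_add) (auto simp: DERIV_deriv_iff_real_differentiable)
    have "flow_deriv s (\<lambda>p. F p + G p) = (\<lambda>p. flow_deriv s F p + flow_deriv s G p)"
      if "s \<in> S" for s by (rule flow_derivI) (rule D[OF that])
    moreover have "continuous_on UNIV (\<lambda>p. F p + G p)"
      using add by (intro continuous_on_add) auto
    moreover have "sum_of_products S (\<lambda>p. flow_deriv s F p + flow_deriv s G p)" if "s \<in> S" for s
      using add that by (intro sum_of_products.add) auto
    moreover have "(\<lambda>h. F (s h p) + G (s h p)) differentiable (at 0)" if "s \<in> S" for s p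
      using D[OF that] real_differentiable_def by blast
    ultimately show ?case by simp
  qed
  show ?thesis
    by (rule smooth_along_coinduct[where P = "sum_of_products S"])
      (use assms sum_of_products.product P in auto)
qed

lemma flow_deriv_compose:
  assumes "smooth_along S f" "s \<in> S" "\<And>h p. \<Phi> (\<tau> h p) = s (c * h) (\<Phi> p)"
  shows "((\<lambda>h. f (\<Phi> (\<tau> h p))) has_real_derivative c * flow_deriv s f (\<Phi> p)) (at 0)"
proof -
  have "((\<lambda>h. f (s h (\<Phi> p))) has_real_derivative flow_deriv s f (\<Phi> p)) (at (c * 0))"
    using smooth_along_DERIV[OF assms(1,2)] by simp
  moreover have "((\<lambda>h::real. c * h) has_real_derivative c) (at 0)"
    by (auto intro!: derivative_eq_intros)
  ultimately have "((\<lambda>h. f (s (c * h) (\<Phi> p))) has_real_derivative flow_deriv s f (\<Phi> p) * c) (at 0)"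
    by (rule DERIV_chain2)
  then show ?thesis by (simp add: assms(3) mult.commute)
qed

lemma smooth_along_compose:
  assumes "smooth_along S f" and \<Phi>: "continuous_on UNIV \<Phi>"
    and flow: "\<And>\<tau>. \<tau> \<in> T \<Longrightarrow> \<exists>s\<in>S. \<exists>c. \<forall>h p. \<Phi> (\<tau> h p) = s (c * h) (\<Phi> p)"
  shows "smooth_along T (\<lambda>p. a * f (\<Phi> p))"
proof (rule smooth_along_coinduct[where P = "\<lambda>F. \<exists>a f. smooth_along S f \<and> F = (\<lambda>p. a * f (\<Phi> p))"])
  fix F :: "'b \<Rightarrow> real" and \<tau> p
  assume "\<exists>a f. smooth_along S f \<and> F = (\<lambda>p. a * f (\<Phi> p))"
  then obtain a f where f: "smooth_along S f" and F: "F = (\<lambda>p. a * f (\<Phi> p))" by blast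
  show "continuous_on UNIV F"
    unfolding F using continuous_on_compose2[OF smooth_along_continuous[OF f] \<Phi>]
    by (intro continuous_intros) auto
  assume "\<tau> \<in> T"
  with flow obtain s c where s: "s \<in> S" and c: "\<And>h p. \<Phi> (\<tau> h p) = s (c * h) (\<Phi> p)" by blast
  have D: "((\<lambda>h. F (\<tau> h p)) has_real_derivative (a * c) * flow_deriv s f (\<Phi> p)) (at 0)" for p
    unfolding F using DERIV_cmult[OF flow_deriv_compose[of S f s \<Phi> \<tau> c, OF f s c], of a p] by (simp add: mult.assoc)
  then show "(\<lambda>h. F (\<tau> h p)) differentiable (at 0)"
    using real_differentiable_def by blast
  have "flow_deriv \<tau> F = (\<lambda>p. (a * c) * flow_deriv s f (\<Phi> p))"
    by (rule flow_derivI) (rule D)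
  then show "\<exists>a f. smooth_along S f \<and> flow_deriv \<tau> F = (\<lambda>p. a * f (\<Phi> p))"
    using smooth_along_flow_deriv[OF f s] by blast
qed (use assms in blast)

lemma coord_shift_0 [simp]: "coord_shift i 0 z = z"
  by (simp add: coord_shift_def)

lemma shift_0: "s \<in> shifts k \<Longrightarrow> s 0 p = p"
  by (cases p) (auto simp: shifts_def time_shift_def space_shift_def)

section \<open>Functions near the diagonal of the domain\<close>

text \<open>The representative of smallest size of a difference of two points of the domain.\<close>

definition rep :: "space_domain \<Rightarrow> real^'n \<Rightarrow> real^'n" where
  "rep D z = (case D of Torus \<Rightarrow> (\<chi> i. z $ i - of_int (round (z $ i))) | Whole \<Rightarrow> z)"

definition vanishes_off :: "real \<Rightarrow> (real^'n \<Rightarrow> real) \<Rightarrow> bool" where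
  "vanishes_off e g \<longleftrightarrow> (\<forall>z. e < norm z \<longrightarrow> g z = 0)"

lemma locally_zero_deriv:
  assumes "\<And>z. z \<notin> K \<Longrightarrow> f z = 0" "closed K" "z \<notin> K" "continuous (at 0) (\<lambda>h. s h z)" "s 0 z = z"
  shows "flow_deriv s f z = 0"
proof -
  have "\<forall>\<^sub>F h in at (0::real). s h z \<in> - K"
    using assms(2-5) by (intro topological_tendstoD[where S="-K" and l=z])
      (auto simp: continuous_within)
  then have "\<forall>\<^sub>F h in nhds (0::real). f (s h z) = 0"
    unfolding eventually_nhds_conv_at using assms by (auto elim: eventually_mono)
  then have "((\<lambda>h. f (s h z)) has_real_derivative 0) (at 0)"
    by (subst DERIV_cong_ev[OF refl _ refl]) auto
  then show ?thesis
    unfolding flow_deriv_def by (rule DERIV_imp_deriv)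
qed

lemma coord_shift_continuous: "continuous (at 0) (\<lambda>h. coord_shift i h z)"
  unfolding coord_shift_def by (intro continuous_intros)

lemma vanishes_off_deriv:
  fixes g :: "real^'n \<Rightarrow> real"
  assumes "vanishes_off e g"
  shows "vanishes_off e (flow_deriv (coord_shift i) g)"
  unfolding vanishes_off_def
proof (intro allI impI)
  fix z :: "real^'n" assume "e < norm z"
  then show "flow_deriv (coord_shift i) g z = 0"
    using assms by (intro locally_zero_deriv[where K="cball 0 e"])
      (auto simp: vanishes_off_def coord_shift_continuous)
qed

text \<open>
  Where rep is continuous, it is locally a translation.  Where it jumps, some coordinate of its value
  has modulus 1/2 > e, so that g vanishes at both sides of the jump.
\<close>

lemma rep_periodisation_local:
  fixes g :: "real^'n \<Rightarrow> real"
  assumes g: "vanishes_off e g" and e: "e < 1/2"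
  shows "\<forall>\<^sub>F z' in nhds z. g (rep D z') = g (z' - z + rep D z)"
proof (cases D)
  case Whole
  then show ?thesis by (simp add: rep_def)
next
  case Torus
  have "\<forall>\<^sub>F z' in nhds z. dist z' z < 1/2 - e"
    unfolding eventually_nhds_metric using e by (intro exI[where x="1/2-e"]) auto
  then show ?thesis
  proof (rule eventually_mono)
    fix z' :: "real^'n" assume d: "dist z' z < 1/2 - e"
    have 1: "(z' - z + rep D z) $ i = z' $ i - of_int (round (z $ i))" for i
      by (simp add: rep_def Torus)
    have 2: "rep D z' $ i = z' $ i - of_int (round (z' $ i))" for i
      by (simp add: rep_def Torus)
    show "g (rep D z') = g (z' - z + rep D z)"
    proof (cases "\<forall>i. round (z $ i) = round (z' $ i)")
      case True
      then have "rep D z' = z' - z + rep D z"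
        unfolding vec_eq_iff 1 2 by simp
      then show ?thesis by simp
    next
      case False
      then obtain i where i: "round (z $ i) \<noteq> round (z' $ i)" by blast
      have a: "\<bar>z' $ i - of_int (round (z' $ i))\<bar> \<le> 1/2" "\<bar>z $ i - of_int (round (z $ i))\<bar> \<le> 1/2"
        using of_int_round_abs_le[of "z' $ i"] of_int_round_abs_le[of "z $ i"] by linarith+
      have b: "\<bar>z' $ i - z $ i\<bar> < 1/2 - e"
        using component_le_norm_cart[of "z' - z" i] d by (simp add: dist_norm)
      have c: "1 \<le> \<bar>real_of_int (round (z $ i)) - real_of_int (round (z' $ i))\<bar>"
        using i by linarith
      have "e < \<bar>(z' - z + rep D z) $ i\<bar>" "e < \<bar>rep D z' $ i\<bar>"
        unfolding 1 2 using a b c e by linarith+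
      then have "e < norm (z' - z + rep D z)" "e < norm (rep D z')"
        using component_le_norm_cart by (metis order_less_le_trans)+
      then show ?thesis using g by (simp add: vanishes_off_def)
    qed
  qed
qed

lemma flow_deriv_rep:
  assumes g: "smooth_along (range coord_shift) g" "vanishes_off e g" "e < 1/2"
  shows "((\<lambda>h. g (rep D (coord_shift i h z))) has_real_derivative
           flow_deriv (coord_shift i) g (rep D z)) (at 0)"
proof -
  have "((\<lambda>h. coord_shift i h z) \<longlongrightarrow> z) (nhds 0)"
    using coord_shift_continuous[of i z] by (simp add: continuous_within tendsto_nhds_iff)
  then have "\<forall>\<^sub>F h in nhds 0. g (rep D (coord_shift i h z)) = g (coord_shift i h z - z + rep D z)"
    using rep_periodisation_local[OF g(2,3), where D=D and z=z] by (rule eventually_compose_filterlim[rotated])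
  moreover have "coord_shift i h z - z + rep D z = coord_shift i h (rep D z)" for h
    by (simp add: coord_shift_def)
  ultimately have "\<forall>\<^sub>F h in nhds 0. g (rep D (coord_shift i h z)) = g (coord_shift i h (rep D z))"
    by simp
  then show ?thesis
    using smooth_along_DERIV[OF g(1), of "coord_shift i" "rep D z"]
    by (subst DERIV_cong_ev[OF refl _ refl]) auto
qed

lemma smooth_along_rep:
  fixes g :: "real^'n \<Rightarrow> real"
  assumes "smooth_along (range coord_shift) g" "vanishes_off e g" "e < 1/2"
  shows "smooth_along (range coord_shift) (\<lambda>z. g (rep D z))"
proof (rule smooth_along_coinduct[where P = "\<lambda>F. \<exists>g::real^'n \<Rightarrow> real. smooth_along (range coord_shift) g \<and>
          vanishes_off e g \<and> F = (\<lambda>z. g (rep D z))"])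
  fix F :: "real^'n \<Rightarrow> real" and s :: "real \<Rightarrow> real^'n \<Rightarrow> real^'n" and p
  assume "\<exists>g::real^'n \<Rightarrow> real. smooth_along (range coord_shift) g \<and> vanishes_off e g \<and> F = (\<lambda>z. g (rep D z))"
  then obtain g where g: "smooth_along (range coord_shift) g" "vanishes_off e g"
    and F: "F = (\<lambda>z. g (rep D z))" by blast
  have "isCont F z" for z
  proof -
    have "isCont (\<lambda>z'. g (z' - z + rep D z)) z"
      using continuous_on_compose2[OF smooth_along_continuous[OF g(1)], of UNIV "\<lambda>z'. z' - z + rep D z"]
      by (auto simp: continuous_on_eq_continuous_at intro!: continuous_intros)
    then show ?thesis
      unfolding F using isCont_cong[OF rep_periodisation_local[OF g(2) assms(3), where D=D and z=z]] by simp
  qed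
  then show "continuous_on UNIV F" by (simp add: continuous_at_imp_continuous_on)
  assume "s \<in> range coord_shift"
  then obtain i where s: "s = coord_shift i" by blast
  have D: "((\<lambda>h. F (s h p)) has_real_derivative (flow_deriv s g (rep D p))) (at 0)" for p
    unfolding F s by (rule flow_deriv_rep[OF g assms(3)])
  then show "(\<lambda>h. F (s h p)) differentiable (at 0)"
    using real_differentiable_def by blast
  have "flow_deriv s F = (\<lambda>z. flow_deriv s g (rep D z))"
    by (rule flow_derivI) (rule D)
  then show "\<exists>g::real^'n \<Rightarrow> real. smooth_along (range coord_shift) g \<and> vanishes_off e g \<and> flow_deriv s F = (\<lambda>z. g (rep D z))"
    using smooth_along_flow_deriv[OF g(1), of s] vanishes_off_deriv[OF g(2)] s by blast
qed (use assms in blast)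

text \<open>
  Only unit translations are assumed in the definition of a test function on the torus.
\<close>

lemma periodic_int_shift:
  fixes f :: "real^'n \<Rightarrow> 'b"
  assumes "\<And>z i. f (z + axis i 1) = f z"
  shows "f (z + (\<chi> i. of_int (m i))) = f z"
proof -
  have 1: "f (z + of_int n *\<^sub>R axis i 1) = f z" for z i n
  proof (induction n rule: int_induct[where k=0])
    case (step1 n)
    then show ?case using assms[of "z + of_int n *\<^sub>R axis i 1" i] by (simp add: algebra_simps)
  next
    case (step2 n)
    then show ?case using assms[of "z + of_int (n - 1) *\<^sub>R axis i 1" i] by (simp add: algebra_simps)
  qed simp
  have 2: "f (z + (\<Sum>i\<in>A. of_int (m i) *\<^sub>R axis i 1)) = f z" if "finite A" for A z
    using that
  proof (induction A arbitrary: z)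
    case (insert i A)
    then show ?case using insert.IH[of "z + of_int (m i) *\<^sub>R axis i 1"] 1 by (simp add: add.assoc)
  qed simp
  have "(\<chi> i. real_of_int (m i)) = (\<Sum>i\<in>UNIV. of_int (m i) *\<^sub>R axis i 1)"
    using basis_expansion[of "\<chi> i. real_of_int (m i)"] by (simp add: scalar_mult_eq_scaleR)
  then show ?thesis using 2[of UNIV z] by simp
qed

lemma periodic_wrap:
  fixes f :: "real^'n \<Rightarrow> 'b"
  assumes "\<And>z i. f (z + axis i 1) = f z"
  shows "f (wrap Torus z) = f z"
proof -
  have "wrap Torus z = z + (\<chi> i. of_int (- \<lfloor>z $ i\<rfloor>))"
    by (simp add: wrap_def vec_eq_iff frac_def)
  then show ?thesis using periodic_int_shift[of f z "\<lambda>i. - \<lfloor>z $ i\<rfloor>", OF assms] by simp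
qed

lemma rep_Torus_axis [simp]: "rep Torus (z + axis i 1) = rep Torus z" "rep Torus (z - axis i 1) = rep Torus z"
proof -
  have "round (z $ j + of_int n) = round (z $ j) + n" for j n
    unfolding round_def by linarith
  from this[of _ 1] this[of _ "-1"]
  show "rep Torus (z + axis i 1) = rep Torus z" "rep Torus (z - axis i 1) = rep Torus z"
    by (auto simp: rep_def vec_eq_iff axis_def)
qed

section \<open>Test functions\<close>

lemma test_functionsD:
  assumes "\<psi> \<in> test_functions D k I"
  shows "smooth_along (shifts k) \<psi>"
    and "(\<And>j. j < k \<Longrightarrow> x j = y j) \<Longrightarrow> \<psi> (t, x) = \<psi> (t, y)"
    and "D = Torus \<Longrightarrow> l < k \<Longrightarrow> \<psi> (t, x(l := x l + axis i 1)) = \<psi> (t, x)"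
    and "\<exists>J R. compact J \<and> J \<subseteq> I \<and> support_within D k J R \<psi>"
  using assms unfolding test_functions_def depends_on_first_def by blast+

lemma continuous_on_snd_apply:
  "continuous_on UNIV (\<lambda>p :: 'c::topological_space \<times> ('i \<Rightarrow> 'a::topological_space). snd p j)"
  by (rule continuous_on_compose2[OF continuous_on_product_coordinates continuous_on_snd[OF continuous_on_id]]) auto

lemma shift_continuous:
  assumes "s \<in> shifts k"
  shows "continuous (at 0) (\<lambda>h. s h (p :: real \<times> (nat \<Rightarrow> real^'n)))"
proof -
  have "continuous_on UNIV (\<lambda>h. s h p)"
  proof (cases p)
    case (Pair t x)
    consider "s = time_shift" | l i where "s = space_shift l i"
      using assms by (auto simp: shifts_def)
    then show ?thesis
    proof cases
      case 1
      then show ?thesis by (auto simp: time_shift_def Pair intro!: continuous_intros)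
    next
      case 2
      have "continuous_on UNIV (\<lambda>h. (x(l := x l + h *\<^sub>R axis i 1)) j)" for j
        by (cases "j = l") (auto intro!: continuous_intros)
      then have "continuous_on UNIV (\<lambda>h. x(l := x l + h *\<^sub>R axis i 1))"
        by (rule continuous_on_coordinatewise_then_product)
      then show ?thesis
        by (auto simp: space_shift_def coord_shift_def Pair 2 intro!: continuous_intros)
    qed
  qed
  then show ?thesis by (simp add: continuous_on_eq_continuous_at)
qed

lemma support_within_deriv:
  assumes "support_within D k J R \<psi>" "closed J" "s \<in> shifts k"
  shows "support_within D k J R (flow_deriv s \<psi> :: real \<times> (nat \<Rightarrow> real^'n) \<Rightarrow> real)"
proof -
  define K where "K = {p :: real \<times> (nat \<Rightarrow> real^'n). fst p \<in> J \<and> (D = Whole \<longrightarrow> (\<forall>l. l < k \<longrightarrow> norm (snd p l) \<le> R))}"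
  have "K = (J \<times> UNIV) \<inter> {p. D = Whole \<longrightarrow> (\<forall>l. l < k \<longrightarrow> norm (snd p l) \<le> R)}"
    by (auto simp: K_def)
  moreover have "closed {p :: real \<times> (nat \<Rightarrow> real^'n). D = Whole \<longrightarrow> (\<forall>l. l < k \<longrightarrow> norm (snd p l) \<le> R)}"
    by (intro closed_Collect_imp closed_Collect_all closed_Collect_le open_Collect_const
        continuous_intros continuous_on_snd_apply)
  ultimately have K: "closed K"
    using assms(2) by (auto intro!: closed_Int closed_Times)
  have z: "\<psi> p = 0" if "p \<notin> K" for p
    using assms(1) that by (cases p) (auto simp: K_def support_within_def)
  have "flow_deriv s \<psi> p = 0" if "p \<notin> K" for p
    by (rule locally_zero_deriv[where K=K])
      (use z K that shift_continuous[OF assms(3)] shift_0[OF assms(3)] in auto)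
  then show ?thesis
    unfolding support_within_def K_def by fastforce
qed

lemma test_functions_flow_deriv:
  fixes \<psi> :: "real \<times> (nat \<Rightarrow> real^'n) \<Rightarrow> real"
  assumes \<psi>: "\<psi> \<in> test_functions D k I" and s: "s \<in> shifts k"
  shows "flow_deriv s \<psi> \<in> test_functions D k I"
proof -
  have s': "s = time_shift \<or> (\<exists>l i. l < k \<and> s = space_shift l i)"
    using s by (auto simp: shifts_def)
  have dep: "\<psi> (s h (t, x)) = \<psi> (s h (t, y))" if "\<And>j. j < k \<Longrightarrow> x j = y j" for t x y h
    using s' that by (auto simp: time_shift_def space_shift_def intro!: test_functionsD(2)[OF \<psi>])
  have per: "\<psi> (s h (t, x(l := x l + axis i 1))) = \<psi> (s h (t, x))" if "D = Torus" "l < k" for t x l i h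
    using s'
  proof (elim disjE exE conjE)
    fix l' i' assume l': "l' < k" "s = space_shift l' i'"
    define x' where "x' = x(l' := coord_shift i' h (x l'))"
    have "(x(l := x l + axis i 1))(l' := coord_shift i' h ((x(l := x l + axis i 1)) l')) = x'(l := x' l + axis i 1)"
      by (auto simp: fun_eq_iff x'_def coord_shift_def)
    then show ?thesis using test_functionsD(3)[OF \<psi> that, of t x' i]
      by (simp add: l' space_shift_def x'_def)
  qed (simp add: time_shift_def test_functionsD(3)[OF \<psi> that])
  obtain J R where JR: "compact J" "J \<subseteq> I" "support_within D k J R \<psi>"
    using test_functionsD(4)[OF \<psi>] by blast
  have "depends_on_first k (\<lambda>x. flow_deriv s \<psi> (t, x))" for t
  proof -
    have "(\<lambda>h. \<psi> (s h (t, x))) = (\<lambda>h. \<psi> (s h (t, y)))" if "\<forall>j<k. x j = y j" for x y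
      using dep that by blast
    then show ?thesis unfolding depends_on_first_def flow_deriv_def by metis
  qed
  moreover have "flow_deriv s \<psi> (t, x(l := x l + axis i 1)) = flow_deriv s \<psi> (t, x)"
    if "D = Torus" "l < k" for t x l i
    unfolding flow_deriv_def using per[OF that] by presburger
  moreover have "smooth_along (shifts k) (flow_deriv s \<psi>)"
    using test_functionsD(1)[OF \<psi>] s by (rule smooth_along_flow_deriv)
  ultimately show ?thesis
    unfolding test_functions_def
    using JR support_within_deriv[OF JR(3) compact_imp_closed[OF JR(1)] s] by auto
qed

text \<open>The point whose only space entry is the entry of index a.\<close>

definition lift_at :: "nat \<Rightarrow> real \<times> (nat \<Rightarrow> real^'n) \<Rightarrow> real \<times> (nat \<Rightarrow> real^'n)" where
  "lift_at a p = (fst p, \<lambda>j. if j = 0 then snd p a else 0)"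

definition at_point :: "(real \<times> (nat \<Rightarrow> real^'n) \<Rightarrow> 'b) \<Rightarrow> real \<Rightarrow> real^'n \<Rightarrow> 'b" where
  "at_point \<psi> t x = \<psi> (t, \<lambda>j. if j = 0 then x else 0)"

lemma at_point_eq: 
  assumes "\<psi> \<in> test_functions D 1 I"
  shows "\<psi> (t, x) = at_point \<psi> t (x 0)"
  unfolding at_point_def by (rule test_functionsD(2)[OF assms]) simp

lemma at_point_continuous:
  fixes \<psi> :: "real \<times> (nat \<Rightarrow> real^'n) \<Rightarrow> real"
  assumes "\<psi> \<in> test_functions D 1 I"
  shows "continuous_on UNIV (\<lambda>(t, x). at_point \<psi> t x)"
proof -
  have "continuous_on UNIV (\<lambda>p::real \<times> (real^'n). (if j = 0 then snd p else 0))" for j :: nat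
    by (cases "j = 0") (auto intro!: continuous_intros)
  then have "continuous_on UNIV (\<lambda>p::real \<times> (real^'n). (fst p, \<lambda>j::nat. if j = 0 then snd p else 0))"
    by (intro continuous_intros continuous_on_coordinatewise_then_product)
  from continuous_on_compose2[OF smooth_along_continuous[OF test_functionsD(1)[OF assms]] this]
  show ?thesis by (simp add: at_point_def case_prod_unfold)
qed

lemma at_point_wrap:
  fixes \<psi> :: "real \<times> (nat \<Rightarrow> real^'n) \<Rightarrow> real"
  assumes "\<psi> \<in> test_functions D 1 I"
  shows "at_point \<psi> t (wrap D x) = at_point \<psi> t x"
proof (cases D)
  case Torus
  have "at_point \<psi> t (z + axis i 1) = at_point \<psi> t z" for z i
  proof -
    have "\<psi> (t, (\<lambda>j. if j = 0 then z else 0)(0 := z + axis i 1)) = \<psi> (t, (\<lambda>j. if j = 0 then z else 0))"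
      using test_functionsD(3)[OF assms Torus, of 0 t "\<lambda>j. if j = 0 then z else 0" i] by simp
    then show ?thesis
      using at_point_eq[OF assms, of t "(\<lambda>j. if j = 0 then z else 0)(0 := z + axis i 1)"]
      by (simp add: at_point_def)
  qed
  then show ?thesis using periodic_wrap[of "at_point \<psi> t"] Torus by simp
qed (simp add: wrap_def)

lemma test_functions_bounded:
  fixes \<psi> :: "real \<times> (nat \<Rightarrow> real^'n) \<Rightarrow> real"
  assumes \<psi>: "\<psi> \<in> test_functions D 1 I"
  obtains B where "B \<ge> 0" "\<And>p. \<bar>\<psi> p\<bar> \<le> B" "\<And>t x. \<bar>at_point \<psi> t x\<bar> \<le> B"
proof -
  obtain J R where JR: "compact J" "support_within D 1 J R \<psi>"
    using test_functionsD(4)[OF \<psi>] by blast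
  define K :: "(real^'n) set" where "K = (case D of Torus \<Rightarrow> {x. \<forall>i. 0 \<le> x $ i \<and> x $ i \<le> 1} | Whole \<Rightarrow> cball 0 R)"
  have "{x::real^'n. \<forall>i. 0 \<le> x $ i \<and> x $ i \<le> 1} = cbox 0 (\<chi> i. 1)"
    by (auto simp: interval_cbox_cart mem_box_cart less_eq_vec_def)
  then have "compact K" by (cases D) (auto simp: K_def)
  then have "compact ((\<lambda>(t, x). at_point \<psi> t x) ` (J \<times> K))"
    using JR(1) by (intro compact_continuous_image continuous_on_subset[OF at_point_continuous[OF \<psi>]] compact_Times) auto
  then obtain B where B: "\<And>t x. t \<in> J \<Longrightarrow> x \<in> K \<Longrightarrow> \<bar>at_point \<psi> t x\<bar> \<le> B"
    unfolding bounded_iff[symmetric] by (drule_tac compact_imp_bounded) (auto simp: bounded_iff)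
  have "\<bar>at_point \<psi> t x\<bar> \<le> max B 0" for t x
  proof (cases "at_point \<psi> t x = 0")
    case False
    then have t: "t \<in> J" and x: "D = Whole \<longrightarrow> norm x \<le> R"
      using JR(2) unfolding support_within_def at_point_def by fastforce+
    have "wrap D x \<in> K"
      using x by (cases D) (auto simp: K_def wrap_def frac_ge_0 frac_lt_1 intro: less_imp_le)
    from B[OF t this] show ?thesis using at_point_wrap[OF \<psi>] by simp
  qed simp
  then show ?thesis
    using that[of "max B 0"] at_point_eq[OF \<psi>] by (metis max.cobounded2 surj_pair)
qed

text \<open>
  Both orders of the entries are needed: the evolution equation contains derivatives in both points,
  but the divergence-free condition only in the last one.
\<close>

definition pair_test ::
  "space_domain \<Rightarrow> (real \<times> (nat \<Rightarrow> real^'n) \<Rightarrow> real) \<Rightarrow> (real^'n \<Rightarrow> real) \<Rightarrow> nat \<Rightarrow> nat \<Rightarrow>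
   real \<times> (nat \<Rightarrow> real^'n) \<Rightarrow> real" where
  "pair_test D \<psi> g a b p = \<psi> (lift_at a p) * g (rep D (snd p a - snd p b))"

lemma lift_at_shift:
  assumes "a \<noteq> b"
  shows "lift_at a (time_shift h p) = time_shift (1 * h) (lift_at a p)"
    "lift_at a (space_shift a i h p) = space_shift 0 i (1 * h) (lift_at a p)"
    "lift_at a (space_shift b i h p) = time_shift (0 * h) (lift_at a p)"
  using assms
  by (auto simp: lift_at_def time_shift_def space_shift_def case_prod_unfold fun_eq_iff)

lemma difference_shift:
  fixes p :: "real \<times> (nat \<Rightarrow> real^'n)"
  assumes "a \<noteq> b"
  shows "snd (time_shift h p) a - snd (time_shift h p) b = coord_shift i (0 * h) (snd p a - snd p b)"
    "snd (space_shift a i h p) a - snd (space_shift a i h p) b = coord_shift i (1 * h) (snd p a - snd p b)"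
    "snd (space_shift b i h p) a - snd (space_shift b i h p) b = coord_shift i (- 1 * h) (snd p a - snd p b)"
  using assms
  by (auto simp: time_shift_def space_shift_def case_prod_unfold coord_shift_def)

lemma lift_at_continuous: "continuous_on UNIV (lift_at a :: _ \<Rightarrow> real \<times> (nat \<Rightarrow> real^'n))"
proof -
  have "continuous_on UNIV (\<lambda>p::real \<times> (nat \<Rightarrow> real^'n). (if j = 0 then snd p a else 0))" for j :: nat
    by (cases "j = 0") (auto intro!: continuous_intros continuous_on_snd_apply)
  then show ?thesis unfolding lift_at_def
    by (intro continuous_intros continuous_on_coordinatewise_then_product)
qed

lemma shifts_2:
  assumes "{a, b} = {0, 1::nat}"
  shows "shifts 2 = insert time_shift (range (space_shift a) \<union> range (space_shift b))"
proof -
  have "l < 2 \<longleftrightarrow> l = a \<or> l = b" for l :: nat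
    using assms by (auto simp: doubleton_eq_iff less_2_cases_iff)
  then show ?thesis unfolding shifts_def by auto
qed

lemma shifts_1: "time_shift \<in> shifts 1" "space_shift 0 i \<in> shifts 1"
  by (auto simp: shifts_def)

lemma pair_test_parts_smooth:
  fixes g :: "real^'n \<Rightarrow> real" and \<psi> :: "real \<times> (nat \<Rightarrow> real^'n) \<Rightarrow> real"
  assumes \<psi>: "\<psi> \<in> test_functions D 1 I"
    and g: "smooth_along (range coord_shift) g" "vanishes_off e g" "e < 1/2"
    and ab: "{a, b} = {0, 1::nat}"
  shows "smooth_along (shifts 2) (\<lambda>p. \<psi> (lift_at a p))"
    "smooth_along (shifts 2) (\<lambda>p. g (rep D (snd p a - snd p b)))"
proof -
  have ne: "a \<noteq> b" using ab by (auto simp: doubleton_eq_iff)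
  have "\<exists>s\<in>shifts 1. \<exists>c. \<forall>h p. lift_at a (\<tau> h p) = s (c * h) (lift_at a p :: real \<times> (nat \<Rightarrow> real^'n))"
    if "\<tau> \<in> shifts 2" for \<tau>
  proof -
    from that consider "\<tau> = time_shift" | i where "\<tau> = space_shift a i" | i where "\<tau> = space_shift b i"
      unfolding shifts_2[OF ab] by blast
    then show ?thesis
      by cases (use lift_at_shift[OF ne] shifts_1 in blast)+
  qed
  from smooth_along_compose[OF test_functionsD(1)[OF \<psi>] lift_at_continuous this, where a=1]
  show "smooth_along (shifts 2) (\<lambda>p. \<psi> (lift_at a p))" by simp
  have "\<exists>s\<in>range coord_shift. \<exists>c. \<forall>h p. snd (\<tau> h p) a - snd (\<tau> h p) b = s (c * h) (snd p a - snd p b :: real^'n)"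
    if "\<tau> \<in> shifts 2" for \<tau>
  proof -
    from that consider "\<tau> = time_shift" | i where "\<tau> = space_shift a i" | i where "\<tau> = space_shift b i"
      unfolding shifts_2[OF ab] by blast
    then show ?thesis
      by cases (use difference_shift[OF ne] in blast)+
  qed
  from smooth_along_compose[OF smooth_along_rep[OF g] _ this, where a=1]
  show "smooth_along (shifts 2) (\<lambda>p. g (rep D (snd p a - snd p b)))"
    by (simp add: continuous_intros continuous_on_snd_apply)
qed

lemma pair_test_mem:
  fixes g :: "real^'n \<Rightarrow> real"
  assumes \<psi>: "\<psi> \<in> test_functions D 1 I"
    and g: "smooth_along (range coord_shift) g" "vanishes_off e g" "e < 1/2"
    and ab: "{a, b} = {0, 1::nat}"
  shows "pair_test D \<psi> g a b \<in> test_functions D 2 I"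
proof -
  obtain J R where JR: "compact J" "J \<subseteq> I" "support_within D 1 J R \<psi>"
    using test_functionsD(4)[OF \<psi>] by blast
  have l2: "l < 2 \<longleftrightarrow> l = a \<or> l = b" for l :: nat
    using ab by (auto simp: doubleton_eq_iff less_2_cases_iff)
  have ne: "a \<noteq> b" using ab by (auto simp: doubleton_eq_iff)
  have eq: "pair_test D \<psi> g a b (t, x) = at_point \<psi> t (x a) * g (rep D (x a - x b))" for t x
    unfolding pair_test_def lift_at_def at_point_def fst_conv snd_conv ..
  have "smooth_along (shifts 2) (pair_test D \<psi> g a b)"
    using smooth_along_mult[OF pair_test_parts_smooth[OF assms]] shift_0
    unfolding pair_test_def[abs_def] by blast
  moreover have "depends_on_first 2 (\<lambda>x. pair_test D \<psi> g a b (t, x))" for t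
    unfolding eq depends_on_first_def l2 by auto
  moreover have "pair_test D \<psi> g a b (t, x(l := x l + axis i 1)) = pair_test D \<psi> g a b (t, x)"
    if D: "D = Torus" and "l < 2" for t x l i
  proof -
    have "wrap Torus (z + axis i 1) = wrap Torus z" for z :: "real^'n"
    proof -
      have "frac (z $ j + 1) = frac (z $ j)" for j by (simp add: frac_1_eq)
      then show ?thesis by (auto simp: wrap_def vec_eq_iff axis_def)
    qed
    then have *: "at_point \<psi> t (z + axis i 1) = at_point \<psi> t z" for z
      using at_point_wrap[OF \<psi>, of t] D by metis
    have [simp]: "x a + axis i 1 - x b = x a - x b + axis i 1" "x a - (x b + axis i 1) = x a - x b - axis i 1"
      by (simp_all add: algebra_simps)
    from \<open>l < 2\<close> show ?thesis unfolding eq l2 using ne * by (auto simp: D)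
  qed
  moreover have "support_within D 2 J (R + \<bar>e\<bar>) (pair_test D \<psi> g a b)"
    unfolding support_within_def eq l2
  proof (intro allI impI conjI)
    fix t x l
    assume nz: "at_point \<psi> t (x a) * g (rep D (x a - x b)) \<noteq> 0"
    then show "t \<in> J" using JR(3) unfolding support_within_def at_point_def by force
    assume D: "D = Whole" and l: "l = a \<or> l = b"
    have "norm (x a) \<le> R" 
      using JR(3) D nz unfolding support_within_def at_point_def by fastforce
    moreover have "norm (x a - x b) \<le> e"
      using g(2) nz D by (auto simp: vanishes_off_def rep_def not_le[symmetric])
    moreover have "norm (x b) \<le> norm (x a) + norm (x a - x b)"
      by (metis norm_minus_commute norm_triangle_sub)
    ultimately show "norm (x l) \<le> R + \<bar>e\<bar>"
      using l by auto
  qed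
  ultimately show ?thesis
    unfolding test_functions_def using JR by blast
qed

lemma pair_test_derivs:
  fixes g :: "real^'n \<Rightarrow> real"
  assumes \<psi>: "\<psi> \<in> test_functions D 1 I"
    and g: "smooth_along (range coord_shift) g" "vanishes_off e g" "e < 1/2"
    and ab: "{a, b} = {0, 1::nat}"
  shows "dt (pair_test D \<psi> g a b) (t, x) = g (rep D (x a - x b)) * at_point (dt \<psi>) t (x a)"
    and "grad_at a (pair_test D \<psi> g a b) (t, x) = g (rep D (x a - x b)) *\<^sub>R at_point (grad_at 0 \<psi>) t (x a)
           + at_point \<psi> t (x a) *\<^sub>R grad g (rep D (x a - x b))"
    and "grad_at b (pair_test D \<psi> g a b) (t, x) = - (at_point \<psi> t (x a) *\<^sub>R grad g (rep D (x a - x b)))"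
proof -
  let ?f = "\<lambda>p. \<psi> (lift_at a p)" and ?g = "\<lambda>p::real \<times> (nat \<Rightarrow> real^'n). g (rep D (snd p a - snd p b))"
  have ne: "a \<noteq> b" using ab by (auto simp: doubleton_eq_iff)
  have sg: "smooth_along (range coord_shift) (\<lambda>z. g (rep D z))"
    by (rule smooth_along_rep[OF g])
  have fg: "flow_deriv (coord_shift i) (\<lambda>z. g (rep D z)) z = flow_deriv (coord_shift i) g (rep D z)" for i z
    by (rule flow_derivI[THEN fun_cong]) (rule flow_deriv_rep[OF g])
  have prod: "flow_deriv s (pair_test D \<psi> g a b) p = flow_deriv s ?f p * ?g p + ?f p * flow_deriv s ?g p"
    if "s \<in> shifts 2" for s p
    unfolding pair_test_def[abs_def]
    by (rule flow_derivI[THEN fun_cong])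
      (rule flow_deriv_mult[OF pair_test_parts_smooth[OF assms] that shift_0[OF that]])
  have s2: "time_shift \<in> shifts 2" "space_shift a i \<in> shifts 2" "space_shift b i \<in> shifts 2" for i
    unfolding shifts_2[OF ab] by auto
  have f: "flow_deriv s ?f p = c * flow_deriv s' \<psi> (lift_at a p)"
    if "\<And>h p. lift_at a (s h p) = s' (c * h) (lift_at a p)" "s' \<in> shifts 1" for s s' c p
  proof -
    have "((\<lambda>h. \<psi> (lift_at a (s h q))) has_real_derivative c * flow_deriv s' \<psi> (lift_at a q)) (at 0)" for q
      by (rule flow_deriv_compose[where S="shifts 1" and f=\<psi> and s=s' and \<Phi>="lift_at a" and \<tau>=s and c=c])
        (use that test_functionsD(1)[OF \<psi>] in auto)
    from flow_derivI[of ?f s, OF this] show ?thesis by simp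
  qed
  have g: "flow_deriv s ?g p = c * flow_deriv (coord_shift i) g (rep D (snd p a - snd p b))"
    if "\<And>h p. snd (s h p) a - snd (s h p) b = coord_shift i (c * h) (snd p a - snd p b)" for s i c p
  proof -
    have "((\<lambda>h. g (rep D (snd (s h q) a - snd (s h q) b))) has_real_derivative
        c * flow_deriv (coord_shift i) (\<lambda>z. g (rep D z)) (snd q a - snd q b)) (at 0)" for q
      by (rule flow_deriv_compose[where S="range coord_shift" and f="\<lambda>z. g (rep D z)" and
            s="coord_shift i" and \<Phi>="\<lambda>q. snd q a - snd q b" and \<tau>=s and c=c])
        (use that sg in auto)
    from flow_derivI[of ?g s, OF this] show ?thesis by (simp add: fg)
  qed
  have [simp]: "flow_deriv time_shift ?f p = flow_deriv time_shift \<psi> (lift_at a p)"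
      "flow_deriv (space_shift a i) ?f p = flow_deriv (space_shift 0 i) \<psi> (lift_at a p)"
      "flow_deriv (space_shift b i) ?f p = 0" for p i
    using f[of time_shift time_shift 1 p, OF lift_at_shift(1)[OF ne] shifts_1(1)]
      f[of "space_shift a i" "space_shift 0 i" 1 p, OF lift_at_shift(2)[OF ne] shifts_1(2)]
      f[of "space_shift b i" time_shift 0 p, OF lift_at_shift(3)[OF ne] shifts_1(1)]
    by simp_all
  have [simp]: "flow_deriv time_shift ?g p = 0"
      "flow_deriv (space_shift a i) ?g p = flow_deriv (coord_shift i) g (rep D (snd p a - snd p b))"
      "flow_deriv (space_shift b i) ?g p = - flow_deriv (coord_shift i) g (rep D (snd p a - snd p b))" for p i
    using g[of time_shift i 0 p, OF difference_shift(1)[OF ne]]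
      g[of "space_shift a i" i 1 p, OF difference_shift(2)[OF ne]]
      g[of "space_shift b i" i "-1" p, OF difference_shift(3)[OF ne]]
    by simp_all
  have [simp]: "lift_at a (t, x) = (t, \<lambda>j. if j = 0 then x a else 0)"
    unfolding lift_at_def fst_conv snd_conv ..
  show "dt (pair_test D \<psi> g a b) (t, x) = g (rep D (x a - x b)) * at_point (dt \<psi>) t (x a)"
    by (simp add: dt_def prod[OF s2(1)] at_point_def)
  show "grad_at a (pair_test D \<psi> g a b) (t, x) = g (rep D (x a - x b)) *\<^sub>R at_point (grad_at 0 \<psi>) t (x a)
           + at_point \<psi> t (x a) *\<^sub>R grad g (rep D (x a - x b))"
    by (simp add: grad_at_def grad_def prod[OF s2(2)] at_point_def vec_eq_iff)
  show "grad_at b (pair_test D \<psi> g a b) (t, x) = - (at_point \<psi> t (x a) *\<^sub>R grad g (rep D (x a - x b)))"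
    by (simp add: grad_at_def grad_def prod[OF s2(3)] at_point_def vec_eq_iff)
qed

section \<open>Integration by parts and the measure of the domain\<close>

lemma vec_measurable_iff:
  fixes f :: "'a \<Rightarrow> real^'n"
  shows "f \<in> borel_measurable M \<longleftrightarrow> (\<forall>i. (\<lambda>x. f x $ i) \<in> borel_measurable M)"
  by (subst borel_measurable_euclidean_space)
    (auto simp: Basis_vec_def cart_eq_inner_axis)

lemma vec_nth_measurable [measurable (raw)]:
  fixes f :: "'a \<Rightarrow> real^'n"
  assumes "f \<in> borel_measurable M" shows "(\<lambda>x. f x $ i) \<in> borel_measurable M"
  using assms vec_measurable_iff by blast

lemma continuous_on_cball_bounded:
  fixes f :: "'a::euclidean_space \<Rightarrow> real"
  assumes "continuous_on UNIV f"
  shows "\<exists>B. \<forall>z\<in>cball 0 R. \<bar>f z\<bar> \<le> B"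
proof -
  have "bounded (f ` cball 0 R)"
    by (intro compact_imp_bounded compact_continuous_image continuous_on_subset[OF assms]) auto
  then show ?thesis unfolding bounded_iff real_norm_def by blast
qed

text \<open>
  By translation invariance the difference quotients have integral zero, and they converge boundedly
  on a fixed ball.
\<close>

lemma integral_directional_derivative:
  fixes f :: "real^'n \<Rightarrow> real"
  assumes f: "continuous_on UNIV f" and f': "continuous_on UNIV f'"
    and D: "\<And>z. ((\<lambda>h. f (z + h *\<^sub>R a)) has_real_derivative f' z) (at 0)"
    and z: "\<And>z. R < norm z \<Longrightarrow> f z = 0"
  shows "(\<integral>z. f' z \<partial>lborel) = 0"
proof -
  have meas [measurable]: "f \<in> borel_measurable borel" "f' \<in> borel_measurable borel"
    using f f' by (simp_all add: borel_measurable_continuous_onI)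
  have D': "((\<lambda>h. f (z + h *\<^sub>R a)) has_real_derivative f' (z + s *\<^sub>R a)) (at s)" for z s
  proof -
    have "((\<lambda>h. f (z + (s + h) *\<^sub>R a)) has_real_derivative f' (z + s *\<^sub>R a)) (at 0)"
      using D[of "z + s *\<^sub>R a"] by (simp add: algebra_simps)
    then show ?thesis
      using DERIV_at_within_shift[of "\<lambda>h. f (z + h *\<^sub>R a)" "f' (z + s *\<^sub>R a)" s 0 UNIV] by simp
  qed
  have z': "f' z = 0" if "R < norm z" for z
  proof -
    have "\<forall>\<^sub>F h in nhds (0::real). z + h *\<^sub>R a \<in> - cball 0 R"
    proof (rule topological_tendstoD)
      show "((\<lambda>h. z + h *\<^sub>R a) \<longlongrightarrow> z) (nhds 0)"
        by (auto intro!: tendsto_eq_intros filterlim_ident)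
    qed (use that in auto)
    then have "\<forall>\<^sub>F h in nhds (0::real). f (z + h *\<^sub>R a) = 0"
      by (rule eventually_mono) (use z in auto)
    then have "((\<lambda>h. f (z + h *\<^sub>R a)) has_real_derivative 0) (at 0)"
      by (subst DERIV_cong_ev[OF refl _ refl]) auto
    then show ?thesis using D DERIV_unique by blast
  qed
  obtain B where B: "\<And>z. \<bar>f' z\<bar> \<le> B"
  proof -
    obtain B where B: "\<forall>z\<in>cball 0 R. \<bar>f' z\<bar> \<le> B"
      using continuous_on_cball_bounded[OF f'] by blast
    have "\<bar>f' z\<bar> \<le> max B 0" for z
      using bspec[OF B, of z] z'[of z] by (cases "R < norm z") auto
    then show ?thesis by (rule that)
  qed
  have ball: "integrable lborel (\<lambda>z. c * indicator (cball 0 r) z :: real)" for c and r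
    by (intro integrable_mult_right integrable_real_indicator emeasure_bounded_finite) auto
  have int_f: "integrable lborel f"
  proof -
    obtain B where B: "\<forall>z\<in>cball 0 R. \<bar>f z\<bar> \<le> B"
      using continuous_on_cball_bounded[OF f] by blast
    have "\<bar>f z\<bar> \<le> B * indicator (cball 0 R) z" for z
      using bspec[OF B, of z] z[of z] by (cases "R < norm z") (auto simp: indicator_def)
    then show ?thesis
      by (intro Bochner_Integration.integrable_bound[OF ball[of B R]]) (auto intro: order_trans[OF _ abs_ge_self])
  qed
  have shift: "integrable lborel (\<lambda>z. f (z + c))" "(\<integral>z. f (z + c) \<partial>lborel) = (\<integral>z. f z \<partial>lborel)" for c
  proof -
    have eq: "lborel = distr lborel borel (\<lambda>z. c + z)"
      by (simp add: lborel_distr_plus)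
    show "integrable lborel (\<lambda>z. f (z + c))"
      using int_f by (subst (asm) eq, subst (asm) integrable_distr_eq) (auto simp: add.commute)
    show "(\<integral>z. f (z + c) \<partial>lborel) = (\<integral>z. f z \<partial>lborel)"
      by (subst (2) eq, subst integral_distr) (auto simp: add.commute)
  qed
  define h where "h n = 1 / real (Suc n)" for n
  have h: "0 < h n" "h n \<le> 1" for n by (auto simp: h_def)
  have h0: "filterlim h (at 0) sequentially"
    unfolding h_def filterlim_at using LIMSEQ_inverse_real_of_nat
    by (auto simp: inverse_eq_divide)
  define q where "q n z = (f (z + h n *\<^sub>R a) - f z) / h n" for n z
  have "(\<lambda>n. \<integral>z. q n z \<partial>lborel) \<longlonglongrightarrow> (\<integral>z. f' z \<partial>lborel)"
  proof (rule integral_dominated_convergence)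
    show "integrable lborel (\<lambda>z. B * indicator (cball 0 (R + norm a)) z)" by (rule ball)
    show "AE z in lborel. (\<lambda>n. q n z) \<longlonglongrightarrow> f' z"
    proof (rule AE_I2)
      fix z
      have "((\<lambda>h. (f (z + h *\<^sub>R a) - f z) / h) \<longlongrightarrow> f' z) (at 0)"
        using D[of z] by (simp add: has_field_derivative_iff)
      then show "(\<lambda>n. q n z) \<longlonglongrightarrow> f' z"
        unfolding q_def by (rule filterlim_compose[OF _ h0])
    qed
    show "AE z in lborel. norm (q n z) \<le> B * indicator (cball 0 (R + norm a)) z" for n
    proof (rule AE_I2)
      fix z
      obtain s where s: "0 < s" "s < h n"
        and eq: "f (z + h n *\<^sub>R a) - f (z + 0 *\<^sub>R a) = (h n - 0) * f' (z + s *\<^sub>R a)"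
        using MVT2[of 0 "h n" "\<lambda>h. f (z + h *\<^sub>R a)" "\<lambda>s. f' (z + s *\<^sub>R a)"] h D' by blast
      have q: "q n z = f' (z + s *\<^sub>R a)"
        using eq h[of n] by (simp add: q_def field_simps)
      show "norm (q n z) \<le> B * indicator (cball 0 (R + norm a)) z"
      proof (cases "z \<in> cball 0 (R + norm a)")
        case False
        have "norm (s *\<^sub>R a) \<le> 1 * norm a"
          using s h[of n] unfolding norm_scaleR by (intro mult_right_mono) auto
        moreover have "norm z \<le> norm (z + s *\<^sub>R a) + norm (s *\<^sub>R a)"
          using norm_triangle_ineq4[of "z + s *\<^sub>R a" "s *\<^sub>R a"] by simp
        ultimately have "R < norm (z + s *\<^sub>R a)" using False by simp
        then show ?thesis using False by (simp add: q z')
      qed (use B q in simp)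
    qed
  next
    show "q n \<in> borel_measurable lborel" for n
      unfolding q_def[abs_def] by measurable
  qed measurable
  moreover have "(\<integral>z. q n z \<partial>lborel) = 0" for n
    unfolding q_def using shift int_f by simp
  ultimately show ?thesis
    by (simp add: LIMSEQ_const_iff)
qed

lemma pts_borel [measurable]: "pts D \<in> sets borel"
proof (cases D)
  case Torus
  have "{x :: real^'n. \<forall>i. 0 \<le> x $ i \<and> x $ i < 1} \<in> sets borel"
    by measurable
  then show ?thesis by (simp add: Torus pts_def)
qed (simp add: pts_def)

lemma wrap_pts: "wrap D x \<in> pts D"
  by (cases D) (auto simp: wrap_def pts_def frac_ge_0 frac_lt_1)

lemma wrap_measurable [measurable]: "(wrap D :: real^'n \<Rightarrow> real^'n) \<in> borel_measurable borel"
proof (cases D)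
  case Torus
  have "(\<lambda>x::real^'n. frac (x $ i)) \<in> borel_measurable borel" for i
    unfolding frac_def by measurable
  then show ?thesis by (subst vec_measurable_iff) (simp add: Torus wrap_def)
qed (simp add: wrap_def[abs_def])

lemma rep_measurable [measurable]: "(rep D :: real^'n \<Rightarrow> real^'n) \<in> borel_measurable borel"
proof (cases D)
  case Torus
  have "(\<lambda>x::real^'n. x $ i - of_int (round (x $ i))) \<in> borel_measurable borel" for i
    unfolding round_def by measurable
  then show ?thesis by (subst vec_measurable_iff) (simp add: Torus rep_def)
qed (simp add: rep_def[abs_def])

text \<open>
  Densities are used instead of restricted spaces, since their measurable sets are the Borel sets.
\<close>

definition dom_measure :: "space_domain \<Rightarrow> (real^'n) measure" where
  "dom_measure D = density lborel (indicator (pts D))"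

definition time_measure :: "real \<Rightarrow> real measure" where
  "time_measure T = density lborel (indicator {0..T})"

lemma sets_dom_measure [simp, measurable_cong]: "sets (dom_measure D) = sets borel"
  and space_dom_measure [simp]: "space (dom_measure D) = UNIV"
  by (simp_all add: dom_measure_def)

lemma sets_time_measure [simp, measurable_cong]: "sets (time_measure T) = sets borel"
  and space_time_measure [simp]: "space (time_measure T) = UNIV"
  by (simp_all add: time_measure_def)

lemma sigma_finite_density_indicator:
  assumes "A \<in> sets (borel :: 'a::euclidean_space measure)"
  shows "sigma_finite_measure (density lborel (indicator A :: 'a \<Rightarrow> ennreal))"
  using assms
  by (subst sigma_finite_measure.sigma_finite_iff_density_finite[OF lborel.sigma_finite_measure_axioms])
    (auto simp: indicator_def)

interpretation dom: sigma_finite_measure "dom_measure D"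
  unfolding dom_measure_def by (rule sigma_finite_density_indicator) simp

interpretation time: sigma_finite_measure "time_measure T"
  unfolding time_measure_def by (rule sigma_finite_density_indicator) simp

interpretation dom_dom: pair_sigma_finite "dom_measure D" "dom_measure D'" ..

interpretation dom2: sigma_finite_measure "dom_measure D \<Otimes>\<^sub>M dom_measure D'"
  by (rule sigma_finite_pair_measure) unfold_locales

lemma AE_dom_measure: "AE x in dom_measure D. x \<in> pts D"
  unfolding dom_measure_def by (subst AE_density) (auto simp: indicator_def)

lemma AE_time_measure: "AE t in time_measure T. t \<in> {0..T}"
  unfolding time_measure_def by (subst AE_density) (auto simp: indicator_def)

lemma rep_wrap:
  assumes "norm z < e" "e \<le> 1/2"
  shows "rep D (x - wrap D (x - z)) = z" "rep D (wrap D (x + z) - x) = z"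
proof -
  have "rep Torus (x - wrap Torus (x - z)) = z" "rep Torus (wrap Torus (x + z) - x) = z"
  proof -
    have r: "round (real_of_int m + z $ i) = m" for i m
    proof -
      have "\<bar>z $ i\<bar> < 1/2" using component_le_norm_cart[of z i] assms by linarith
      then show ?thesis by (intro round_unique) (auto simp: abs_if split: if_splits)
    qed
    have "x $ i - frac (x $ i - z $ i) = real_of_int \<lfloor>x $ i - z $ i\<rfloor> + z $ i" for i
      by (simp add: frac_def)
    then show "rep Torus (x - wrap Torus (x - z)) = z"
      by (simp add: rep_def wrap_def vec_eq_iff r)
    have "frac (x $ i + z $ i) - x $ i = real_of_int (- \<lfloor>x $ i + z $ i\<rfloor>) + z $ i" for i
      by (simp add: frac_def)
    then show "rep Torus (wrap Torus (x + z) - x) = z"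
      unfolding rep_def wrap_def by (simp add: vec_eq_iff r del: of_int_minus)
  qed
  then show "rep D (x - wrap D (x - z)) = z" "rep D (wrap D (x + z) - x) = z"
    by (cases D; simp add: rep_def wrap_def)+
qed


definition lattice_points :: "(real^'n) set" where
  "lattice_points = {m. \<forall>i. m $ i \<in> \<int>}"

lemma nn_integral_dom_measure:
  assumes "f \<in> borel_measurable borel"
  shows "(\<integral>\<^sup>+ y. f y \<partial>dom_measure D) = (\<integral>\<^sup>+ y. indicator (pts D) y * f y \<partial>lborel)"
  using assms unfolding dom_measure_def by (subst nn_integral_density) auto

lemma nn_integral_lborel_translate:
  fixes f :: "'a::euclidean_space \<Rightarrow> ennreal"
  assumes "f \<in> borel_measurable borel"
  shows "(\<integral>\<^sup>+ z. f (z + c) \<partial>lborel) = (\<integral>\<^sup>+ z. f z \<partial>lborel)"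
  using assms by (subst (2) lborel_distr_plus[of c, symmetric], subst nn_integral_distr) (auto simp: add.commute)

lemma nn_integral_lborel_reflect:
  fixes f :: "'a::euclidean_space \<Rightarrow> ennreal"
  assumes [measurable]: "f \<in> borel_measurable borel"
  shows "(\<integral>\<^sup>+ z. f (c - z) \<partial>lborel) = (\<integral>\<^sup>+ z. f z \<partial>lborel)"
  by (subst (2) lborel_affine[of "-1" c]) (simp_all add: nn_integral_density nn_integral_distr)

text \<open>The translates of the unit cell by the lattice tile the space.\<close>

lemma nn_integral_tiling:
  fixes f :: "real^'n \<Rightarrow> ennreal"
  assumes [measurable]: "f \<in> borel_measurable borel"
  shows "(\<integral>\<^sup>+ z. f z \<partial>lborel) = (\<integral>\<^sup>+ y. (\<integral>\<^sup>+ m. f (y + m) \<partial>count_space lattice_points) \<partial>dom_measure Torus)"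
proof -
  let ?I = "indicator (pts Torus) :: real^'n \<Rightarrow> ennreal"
  have count: "countable (lattice_points :: (real^'n) set)"
    unfolding lattice_points_def by (rule countable_vector) (rule countable_int)
  have floor: "z - m \<in> pts Torus \<longleftrightarrow> m = (\<chi> i. of_int \<lfloor>z $ i\<rfloor>)" if "m \<in> lattice_points" for z m :: "real^'n"
  proof -
    have "0 \<le> z $ i - m $ i \<and> z $ i - m $ i < 1 \<longleftrightarrow> m $ i = of_int \<lfloor>z $ i\<rfloor>" for i
    proof -
      from that obtain k where k: "m $ i = of_int k" by (auto simp: lattice_points_def elim: Ints_cases)
      show ?thesis unfolding k of_int_eq_iff by linarith
    qed
    then show ?thesis by (auto simp: pts_def vec_eq_iff)
  qed
  have "(\<integral>\<^sup>+ m. ?I (z - m) * f z \<partial>count_space lattice_points) = f z" for z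
    by (subst nn_integral_count_space'[where A="{\<chi> i. of_int \<lfloor>z $ i\<rfloor>}"])
      (auto simp: floor indicator_def lattice_points_def)
  then have "(\<integral>\<^sup>+ z. f z \<partial>lborel) = (\<integral>\<^sup>+ z. (\<integral>\<^sup>+ m. ?I (z - m) * f z \<partial>count_space lattice_points) \<partial>lborel)"
    by simp
  also have "\<dots> = (\<integral>\<^sup>+ m. (\<integral>\<^sup>+ z. ?I (z - m) * f z \<partial>lborel) \<partial>count_space lattice_points)"
    by (rule nn_integral_count_space_nn_integral[OF count]) simp
  also have "\<dots> = (\<integral>\<^sup>+ m. (\<integral>\<^sup>+ y. ?I y * f (y + m) \<partial>lborel) \<partial>count_space lattice_points)"
  proof (rule nn_integral_cong)
    fix m :: "real^'n"
    show "(\<integral>\<^sup>+ z. ?I (z - m) * f z \<partial>lborel) = (\<integral>\<^sup>+ y. ?I y * f (y + m) \<partial>lborel)"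
      using nn_integral_lborel_translate[of "\<lambda>z. ?I (z - m) * f z" m] by simp
  qed
  also have "\<dots> = (\<integral>\<^sup>+ m. (\<integral>\<^sup>+ y. f (y + m) \<partial>dom_measure Torus) \<partial>count_space lattice_points)"
    by (simp add: nn_integral_dom_measure)
  also have "\<dots> = (\<integral>\<^sup>+ y. (\<integral>\<^sup>+ m. f (y + m) \<partial>count_space lattice_points) \<partial>dom_measure Torus)"
    by (rule nn_integral_count_space_nn_integral[OF count, symmetric]) simp
  finally show ?thesis .
qed

text \<open>
  The points of D close to x are parametrised by the small vectors z, through the point x - z: on
  the torus, the small translates of x under the lattice are unique.
\<close>

lemma indicator_ball_measurable [measurable]:
  "(indicator (ball c e) :: 'a::euclidean_space \<Rightarrow> ennreal) \<in> borel_measurable borel"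
  "(indicator (ball c e) :: 'a::euclidean_space \<Rightarrow> real) \<in> borel_measurable borel"
  by (intro borel_measurable_indicator borel_open open_ball)+

lemma nn_integral_near_point:
  fixes k :: "(real^'n) \<times> (real^'n) \<Rightarrow> ennreal"
  assumes [measurable]: "k \<in> borel_measurable (borel \<Otimes>\<^sub>M borel)" and e: "0 < e" "e \<le> 1/2"
  shows "(\<integral>\<^sup>+ z. k (wrap D (x - z), z) * indicator (ball 0 e) z \<partial>lborel) =
         (\<integral>\<^sup>+ y. k (y, rep D (x - y)) * indicator (ball 0 e) (rep D (x - y)) \<partial>dom_measure D)"
proof -
  let ?f = "\<lambda>y. k (wrap D y, x - y) * indicator (ball 0 e) (x - y) :: ennreal"
  have meas [measurable]: "?f \<in> borel_measurable borel" by measurable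
  have "(\<integral>\<^sup>+ z. k (wrap D (x - z), z) * indicator (ball 0 e) z \<partial>lborel) = (\<integral>\<^sup>+ y. ?f y \<partial>lborel)"
    using nn_integral_lborel_reflect[of ?f x] by simp
  also have "\<dots> = (\<integral>\<^sup>+ y. k (y, rep D (x - y)) * indicator (ball 0 e) (rep D (x - y)) \<partial>dom_measure D)"
  proof (cases D)
    case Whole
    then show ?thesis by (simp add: wrap_def rep_def nn_integral_dom_measure pts_def)
  next
    case Torus
    have "(\<integral>\<^sup>+ m. ?f (y + m) \<partial>count_space lattice_points) =
        k (y, rep D (x - y)) * indicator (ball 0 e) (rep D (x - y))" if y: "y \<in> pts D" for y
    proof -
      have w: "wrap D (y + m) = y" if "m \<in> lattice_points" for m
      proof -
        have "frac (y $ i + m $ i) = y $ i" for i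
        proof -
          from that obtain k where k: "m $ i = of_int k" by (auto simp: lattice_points_def elim: Ints_cases)
          have "0 \<le> y $ i" "y $ i < 1" using y by (auto simp: pts_def Torus)
          then show ?thesis unfolding k by (simp add: frac_unique_iff)
        qed
        then show ?thesis by (simp add: wrap_def Torus vec_eq_iff)
      qed
      define r :: "real^'n" where "r = (\<chi> i. of_int (round (x $ i - y $ i)))"
      have r: "r \<in> lattice_points" "x - (y + r) = rep D (x - y)"
        by (auto simp: r_def lattice_points_def rep_def Torus vec_eq_iff)
      have "x - (y + m) \<notin> ball 0 e" if m: "m \<in> lattice_points" "m \<noteq> r" for m
      proof
        assume "x - (y + m) \<in> ball 0 e"
        then have n: "norm (x - (y + m)) < e" by simp
        have "m $ i = r $ i" for i
        proof -
          from m obtain k where k: "m $ i = of_int k" by (auto simp: lattice_points_def elim: Ints_cases)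
          have "\<bar>x $ i - y $ i - of_int k\<bar> < 1/2"
            using component_le_norm_cart[of "x - (y + m)" i] n e k by (simp add: algebra_simps)
          then have "round (x $ i - y $ i) = k" by (intro round_unique) (auto simp: abs_if split: if_splits)
          then show ?thesis by (simp add: r_def k)
        qed
        then show False using m by (simp add: vec_eq_iff)
      qed
      then have "(\<integral>\<^sup>+ m. ?f (y + m) \<partial>count_space lattice_points) = (\<Sum>m\<in>{r}. ?f (y + m))"
        using r by (intro nn_integral_count_space') (auto simp: indicator_def)
      then show ?thesis using r w by simp
    qed
    then have "AE y in dom_measure D. (\<integral>\<^sup>+ m. ?f (y + m) \<partial>count_space lattice_points) =
        k (y, rep D (x - y)) * indicator (ball 0 e) (rep D (x - y))"
      by (rule eventually_mono[OF AE_dom_measure])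
    then show ?thesis
      unfolding nn_integral_tiling[OF meas] Torus[symmetric] by (rule nn_integral_cong_AE)
  qed
  finally show ?thesis .
qed

lemma distr_near_point:
  assumes e: "0 < e" "e \<le> 1/2"
  shows "distr (density lborel (indicator (ball 0 e))) borel (\<lambda>z. wrap D (x - z)) =
     density (dom_measure D) (\<lambda>y. indicator (ball 0 e) (rep D (x - y)))"
proof (rule measure_eqI)
  fix A assume "A \<in> sets (distr (density lborel (indicator (ball 0 e))) borel (\<lambda>z. wrap D (x - z)))"
  then have A [measurable]: "A \<in> sets borel" by simp
  have "emeasure (distr (density lborel (indicator (ball 0 e))) borel (\<lambda>z. wrap D (x - z))) A =
      (\<integral>\<^sup>+ z. indicator A (wrap D (x - z)) \<partial>density lborel (indicator (ball 0 e)))"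
  proof -
    have "emeasure (distr (density lborel (indicator (ball 0 e))) borel (\<lambda>z. wrap D (x - z))) A =
      (\<integral>\<^sup>+ y. indicator A y \<partial>distr (density lborel (indicator (ball 0 e))) borel (\<lambda>z. wrap D (x - z)))"
      by simp
    then show ?thesis by (simp only:) (rule nn_integral_distr, measurable)
  qed
  also have "\<dots> = (\<integral>\<^sup>+ z. indicator A (wrap D (x - z)) * indicator (ball 0 e) z \<partial>lborel)"
    by (subst nn_integral_density) (simp_all add: mult.commute)
  also have "\<dots> = (\<integral>\<^sup>+ y. indicator A y * indicator (ball 0 e) (rep D (x - y)) \<partial>dom_measure D)"
    using nn_integral_near_point[OF _ e, of "\<lambda>p. indicator A (fst p)" D x] by simp
  also have "\<dots> = emeasure (density (dom_measure D) (\<lambda>y. indicator (ball 0 e) (rep D (x - y)))) A"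
    by (subst emeasure_density) (simp_all add: mult.commute)
  finally show "emeasure (distr (density lborel (indicator (ball 0 e))) borel (\<lambda>z. wrap D (x - z))) A =
    emeasure (density (dom_measure D) (\<lambda>y. indicator (ball 0 e) (rep D (x - y)))) A" .
qed simp

lemma integral_near_point:
  fixes k :: "(real^'n) \<times> (real^'n) \<Rightarrow> real"
  assumes [measurable]: "k \<in> borel_measurable (borel \<Otimes>\<^sub>M borel)"
    and e: "0 < e" "e \<le> 1/2" and k: "\<And>y z. e \<le> norm z \<Longrightarrow> k (y, z) = 0"
  shows "(\<integral>y. k (y, rep D (x - y)) \<partial>dom_measure D) = (\<integral>z. k (wrap D (x - z), z) \<partial>lborel)"
proof -
  have i: "indicator (ball 0 e) z * k (y, z) = k (y, z)" for y z
    using k by (auto simp: indicator_def)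
  have "(\<integral>y. k (y, rep D (x - y)) \<partial>dom_measure D)
      = (\<integral>y. indicator (ball 0 e) (rep D (x - y)) *\<^sub>R k (y, rep D (x - y)) \<partial>dom_measure D)"
    by (simp add: i)
  also have "\<dots> = (\<integral>y. k (y, rep D (x - y)) \<partial>density (dom_measure D) (\<lambda>y. ennreal (indicator (ball 0 e) (rep D (x - y)))))"
    by (rule integral_density[symmetric]) (measurable, auto intro!: AE_I2)
  also have "\<dots> = (\<integral>z. k (wrap D (x - z), rep D (x - wrap D (x - z))) \<partial>density lborel (\<lambda>z. ennreal (indicator (ball 0 e) z)))"
    using distr_near_point[OF e, of D x, symmetric]
    by (simp add: ennreal_indicator) (subst integral_distr, auto)
  also have "\<dots> = (\<integral>z. indicator (ball 0 e) z *\<^sub>R k (wrap D (x - z), rep D (x - wrap D (x - z))) \<partial>lborel)"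
    by (subst integral_density) auto
  also have "\<dots> = (\<integral>z. k (wrap D (x - z), z) \<partial>lborel)"
  proof (rule Bochner_Integration.integral_cong[OF refl])
    fix z show "indicator (ball 0 e) z *\<^sub>R k (wrap D (x - z), rep D (x - wrap D (x - z))) = k (wrap D (x - z), z)"
      using rep_wrap(1)[OF _ e(2), of z D x] i[of z] k[of z] by (cases "norm z < e") auto
  qed
  finally show ?thesis .
qed

section \<open>Borel kernels\<close>

definition vanishing :: "('b::euclidean_space \<Rightarrow> real) set" where
  "vanishing = {g. continuous_on UNIV g \<and> (\<forall>e>0. \<exists>R. \<forall>\<xi>. R < norm \<xi> \<longrightarrow> \<bar>g \<xi>\<bar> < e)}"

text \<open>
  These functions tend to the indicator function of the open set U, and vanish at infinity.
\<close>

definition bump :: "'b::euclidean_space set \<Rightarrow> nat \<Rightarrow> 'b \<Rightarrow> real" where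
  "bump U n \<xi> = (if U = UNIV then 1 else min 1 (real n * infdist \<xi> (- U))) * max 0 (1 - norm \<xi> / real (Suc n))"

lemma bump_bounds: "0 \<le> bump U n \<xi>" "bump U n \<xi> \<le> 1"
  by (auto simp: bump_def infdist_nonneg intro!: mult_nonneg_nonneg mult_le_one)

lemma bump_continuous: "continuous_on UNIV (bump U n)"
  unfolding bump_def by (cases "U = UNIV") (auto intro!: continuous_intros)

lemma bump_vanishing: "bump U n \<in> vanishing"
proof -
  have "bump U n \<xi> = 0" if "real (Suc n) < norm \<xi>" for \<xi>
  proof -
    have "1 - norm \<xi> / real (Suc n) \<le> 0" using that by (simp add: field_simps)
    then show ?thesis by (simp add: bump_def del: of_nat_Suc)
  qed
  then show ?thesis unfolding vanishing_def
    using bump_continuous by (fastforce intro: exI[of _ "real (Suc n)"])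
qed

lemma bump_tendsto:
  assumes "open U"
  shows "(\<lambda>n. bump U n \<xi>) \<longlonglongrightarrow> indicator U \<xi>"
proof -
  have "(\<lambda>n. 1 - norm \<xi> * inverse (real (Suc n))) \<longlonglongrightarrow> 1 - norm \<xi> * 0"
    by (intro tendsto_intros LIMSEQ_inverse_real_of_nat)
  then have "(\<lambda>n. max 0 (1 - norm \<xi> / real (Suc n))) \<longlonglongrightarrow> max 0 1"
    by (intro tendsto_max tendsto_const) (simp add: divide_inverse)
  moreover have "(\<lambda>n. if U = UNIV then 1 else min 1 (real n * infdist \<xi> (- U))) \<longlonglongrightarrow> indicator U \<xi>"
  proof (cases "\<xi> \<in> U \<and> U \<noteq> UNIV")
    case True
    then have "0 < infdist \<xi> (- U)"
      using assms in_closed_iff_infdist_zero[of "- U" \<xi>] infdist_nonneg[of \<xi> "- U"]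
      by (auto simp: closed_def less_le)
    then obtain N where N: "1 < real N * infdist \<xi> (- U)"
      using reals_Archimedean3 by blast
    have "\<forall>\<^sub>F n in sequentially. min 1 (real n * infdist \<xi> (- U)) = 1"
      using eventually_ge_at_top[of N]
    proof eventually_elim
      case (elim n)
      then have "real N * infdist \<xi> (- U) \<le> real n * infdist \<xi> (- U)"
        using infdist_nonneg by (intro mult_right_mono) auto
      then show ?case using N by simp
    qed
    then show ?thesis using True by (simp add: tendsto_eventually)
  next
    case False
    then show ?thesis by (cases "U = UNIV") (auto simp: indicator_def)
  qed
  ultimately have "(\<lambda>n. (if U = UNIV then 1 else min 1 (real n * infdist \<xi> (- U))) *
      max 0 (1 - norm \<xi> / real (Suc n))) \<longlonglongrightarrow> indicator U \<xi> * max 0 1"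
    by (intro tendsto_mult)
  then show ?thesis
    unfolding bump_def by simp
qed

lemma bump_integral_tendsto:
  assumes "prob_space N" "sets N = sets borel" "open U"
  shows "(\<lambda>n. \<integral>\<xi>. bump U n \<xi> \<partial>N) \<longlonglongrightarrow> measure N U"
proof -
  interpret prob_space N by fact
  have [measurable]: "bump U n \<in> borel_measurable N" for n
    using borel_measurable_continuous_onI[OF bump_continuous] assms(2) by (simp cong: measurable_cong_sets)
  have U [measurable]: "U \<in> sets N" using assms by simp
  have "(\<lambda>n. \<integral>\<xi>. bump U n \<xi> \<partial>N) \<longlonglongrightarrow> (\<integral>\<xi>. indicator U \<xi> \<partial>N)"
  proof (rule integral_dominated_convergence[where w="\<lambda>_. 1"])
    show "AE \<xi> in N. norm (bump U n \<xi>) \<le> 1" for n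
      by (intro AE_I2) (metis abs_of_nonneg bump_bounds real_norm_def)
  qed (use bump_tendsto[OF assms(3)] in auto)
  then show ?thesis using U by simp
qed

lemma countable_Int_stable_generator:
  "\<exists>G :: 'b::second_countable_topology set set.
     countable G \<and> Int_stable G \<and> (\<forall>U\<in>G. open U) \<and> sets borel = sigma_sets UNIV G"
proof -
  obtain B :: "'b set set" where B: "countable B" "topological_basis B"
    using ex_countable_basis by blast
  define G where "G = Inter ` {F. finite F \<and> F \<subseteq> B}"
  show ?thesis
  proof (intro exI[of _ G] conjI ballI)
    show "countable G"
      unfolding G_def by (intro countable_image countable_Collect_finite_subset B)
    show "Int_stable G"
    proof (rule Int_stableI)
      fix a b assume "a \<in> G" "b \<in> G"
      then obtain F F' where "finite F" "F \<subseteq> B" "finite F'" "F' \<subseteq> B" "a = \<Inter>F" "b = \<Inter>F'"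
        by (auto simp: G_def)
      then show "a \<inter> b \<in> G"
        unfolding G_def by (intro image_eqI[of _ _ "F \<union> F'"]) auto
    qed
    show op: "open U" if "U \<in> G" for U
      using that B(2) topological_basis_open unfolding G_def by (auto intro!: open_Inter)
    have "B \<subseteq> G"
      unfolding G_def by (auto intro!: image_eqI[of _ _ "{x}" for x])
    have "sets borel = sigma_sets UNIV B"
      unfolding borel_eq_countable_basis[OF B] by (rule sets_measure_of) simp
    also have "\<dots> \<subseteq> sigma_sets UNIV G"
      by (rule sigma_sets_mono') fact
    finally have "sets borel \<subseteq> sigma_sets UNIV G" .
    moreover have "sigma_sets UNIV G \<subseteq> sets borel"
      using sets.sigma_sets_subset[of G borel] op borel_open by (simp add: subset_iff)
    ultimately show "sets borel = sigma_sets UNIV G" by blast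
  qed
qed

text \<open>
  The exceptional set may depend on the test function.  The measures agree as soon as
  countably many bumps do, namely those for a countable generator that is stable under intersections.
\<close>

lemma AE_measure_eqI:
  fixes \<mu> \<mu>' :: "'a \<Rightarrow> 'b::euclidean_space measure"
  assumes "AE s in M. prob_space (\<mu> s) \<and> sets (\<mu> s) = sets borel"
    and "AE s in M. prob_space (\<mu>' s) \<and> sets (\<mu>' s) = sets borel"
    and "\<And>g. g \<in> vanishing \<Longrightarrow> AE s in M. (\<integral>\<xi>. g \<xi> \<partial>\<mu> s) = (\<integral>\<xi>. g \<xi> \<partial>\<mu>' s)"
  shows "AE s in M. \<mu> s = \<mu>' s"
proof -
  obtain G :: "'b set set" where G: "countable G" "Int_stable G" "\<And>U. U \<in> G \<Longrightarrow> open U"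
    "sets borel = sigma_sets UNIV G"
    using countable_Int_stable_generator by blast
  have "AE s in M. \<forall>U\<in>G. \<forall>n. (\<integral>\<xi>. bump U n \<xi> \<partial>\<mu> s) = (\<integral>\<xi>. bump U n \<xi> \<partial>\<mu>' s)"
    using assms(3)[OF bump_vanishing] by (simp add: AE_ball_countable[OF G(1)] AE_all_countable)
  with assms(1,2) show ?thesis
  proof eventually_elim
    case (elim s)
    interpret \<mu>: prob_space "\<mu> s" using elim by simp
    interpret \<mu>': prob_space "\<mu>' s" using elim by simp
    have eq: "emeasure (\<mu> s) U = emeasure (\<mu>' s) U" if "U \<in> G" for U
    proof -
      have "measure (\<mu> s) U = measure (\<mu>' s) U"
        using elim that G(3)[OF that] LIMSEQ_unique[OF bump_integral_tendsto[of "\<mu> s" U]]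
          bump_integral_tendsto[of "\<mu>' s" U] by simp
      then show ?thesis by (simp add: \<mu>.emeasure_eq_measure \<mu>'.emeasure_eq_measure)
    qed
    have sp: "space (\<mu> s) = UNIV" "space (\<mu>' s) = UNIV"
      using elim sets_eq_imp_space_eq[of "\<mu> s" borel] sets_eq_imp_space_eq[of "\<mu>' s" borel] by auto
    have st: "Int_stable (insert UNIV G)"
      using G(2) by (auto simp: Int_stable_def)
    have sg: "sigma_sets UNIV (insert UNIV G) = sigma_sets UNIV G"
      by (intro sigma_sets_eqI) (auto intro: sigma_sets_top)
    show "\<mu> s = \<mu>' s"
    proof (rule measure_eqI_generator_eq[where E="insert UNIV G" and \<Omega>=UNIV and A="\<lambda>_. UNIV"])
      show "emeasure (\<mu> s) X = emeasure (\<mu>' s) X" if "X \<in> insert UNIV G" for X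
        using that eq sp \<mu>.emeasure_space_1 \<mu>'.emeasure_space_1 by auto
      show "sets (\<mu> s) = sigma_sets UNIV (insert UNIV G)" "sets (\<mu>' s) = sigma_sets UNIV (insert UNIV G)"
        unfolding sg G(4)[symmetric] using elim by blast+
      show "emeasure (\<mu> s) UNIV \<noteq> \<infinity>" by (simp add: \<mu>.emeasure_eq_measure)
    qed (use st in simp_all)
  qed
qed

text \<open>
  A measurable version of a family of measures on a completed space: the countably many integrals
  that determine the measures have Borel versions, and on the exceptional null set the measure is
  replaced by a point mass.
\<close>

lemma borel_kernel_version:
  fixes J :: "'a \<Rightarrow> 'b::euclidean_space measure"
  assumes J: "AE s in M. prob_space (J s) \<and> sets (J s) = sets borel"
    and m: "\<And>g. g \<in> vanishing \<Longrightarrow> \<exists>g'\<in>borel_measurable M. AE s in M. (\<integral>\<xi>. g \<xi> \<partial>J s) = g' s"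
  obtains \<kappa> where "\<kappa> \<in> M \<rightarrow>\<^sub>M prob_algebra borel" "AE s in M. J s = \<kappa> s"
proof -
  obtain G :: "'b set set" where G: "countable G" "Int_stable G" "\<And>U. U \<in> G \<Longrightarrow> open U"
    "sets borel = sigma_sets UNIV G"
    using countable_Int_stable_generator by blast
  have "\<exists>g'. g' \<in> borel_measurable M \<and> (AE s in M. (\<integral>\<xi>. bump U n \<xi> \<partial>J s) = g' s)" for U :: "'b set" and n
    using m[OF bump_vanishing] by blast
  then obtain g' where g': "\<And>U n. g' U n \<in> borel_measurable M"
    "\<And>U n. AE s in M. (\<integral>\<xi>. bump U n \<xi> \<partial>J s) = (g' U n s :: real)"
    by metis
  have "AE s in M. \<forall>U\<in>G. \<forall>n. (\<integral>\<xi>. bump U n \<xi> \<partial>J s) = g' U n s"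
    using g'(2) by (simp add: AE_ball_countable[OF G(1)] AE_all_countable)
  with J have "AE s in M. prob_space (J s) \<and> sets (J s) = sets borel \<and>
      (\<forall>U\<in>G. \<forall>n. (\<integral>\<xi>. bump U n \<xi> \<partial>J s) = g' U n s)"
    by eventually_elim auto
  from AE_E3[OF this] obtain N where N: "N \<in> null_sets M"
    and good: "\<And>s. s \<in> space M - N \<Longrightarrow> prob_space (J s) \<and> sets (J s) = sets borel \<and>
      (\<forall>U\<in>G. \<forall>n. (\<integral>\<xi>. bump U n \<xi> \<partial>J s) = g' U n s)"
    by blast
  have [measurable]: "N \<in> sets M" using N by auto
  note g'(1)[measurable]
  define \<kappa> where "\<kappa> s = (if s \<in> N then return borel 0 else J s)" for s
  have "\<kappa> \<in> M \<rightarrow>\<^sub>M prob_algebra borel"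
  proof (rule measurable_prob_algebra_generated[OF G(4,2)])
    fix U assume U: "U \<in> G"
    have "emeasure (\<kappa> s) U = (if s \<in> N then indicator U 0 else ennreal (lim (\<lambda>n. g' U n s)))"
      if "s \<in> space M" for s
    proof (cases "s \<in> N")
      case True
      then show ?thesis using G(3)[OF U] by (simp add: \<kappa>_def)
    next
      case False
      interpret prob_space "J s" using good that False by simp
      have "(\<lambda>n. g' U n s) \<longlonglongrightarrow> measure (J s) U"
        using bump_integral_tendsto[of "J s" U] good[of s] that False U G(3)[OF U] by simp
      then show ?thesis using False by (simp add: \<kappa>_def emeasure_eq_measure limI)
    qed
    then show "(\<lambda>s. emeasure (\<kappa> s) U) \<in> borel_measurable M"
      by (subst measurable_cong) auto
  next
    show "prob_space (\<kappa> s)" "sets (\<kappa> s) = sets borel" if "s \<in> space M" for s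
      using good[of s] that by (auto simp: \<kappa>_def intro: prob_space_return)
  qed simp
  moreover have "AE s in M. J s = \<kappa> s"
    using AE_not_in[OF N] by eventually_elim (simp add: \<kappa>_def)
  ultimately show ?thesis by (rule that)
qed

definition joint :: "'a measure \<Rightarrow> ('a \<Rightarrow> 'b measure) \<Rightarrow> 'b measure \<Rightarrow> ('a \<times> 'b) measure" where
  "joint M \<kappa> N = M \<bind> (\<lambda>s. \<kappa> s \<bind> (\<lambda>\<xi>. return (M \<Otimes>\<^sub>M N) (s, \<xi>)))"

context
  fixes M :: "'a measure" and N :: "'b measure" and \<kappa>
  assumes \<kappa> [measurable]: "\<kappa> \<in> M \<rightarrow>\<^sub>M prob_algebra N"
begin

lemma kernel_subprob [measurable]: "\<kappa> \<in> M \<rightarrow>\<^sub>M subprob_algebra N"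
  by (rule measurable_prob_algebraD) fact

lemma kernel_prob: "s \<in> space M \<Longrightarrow> prob_space (\<kappa> s)" "s \<in> space M \<Longrightarrow> sets (\<kappa> s) = sets N"
  using measurable_space[OF \<kappa>] by (auto simp: space_prob_algebra)

lemma joint_kernel: "(\<lambda>s. \<kappa> s \<bind> (\<lambda>\<xi>. return (M \<Otimes>\<^sub>M N) (s, \<xi>))) \<in> M \<rightarrow>\<^sub>M subprob_algebra (M \<Otimes>\<^sub>M N)"
  by measurable

lemma sets_joint: "space M \<noteq> {} \<Longrightarrow> sets (joint M \<kappa> N) = sets (M \<Otimes>\<^sub>M N)"
  unfolding joint_def by (rule sets_bind[OF sets_kernel[OF joint_kernel]])

lemma nn_integral_joint:
  assumes F [measurable]: "F \<in> borel_measurable (M \<Otimes>\<^sub>M N)"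
  shows "(\<integral>\<^sup>+ q. F q \<partial>joint M \<kappa> N) = (\<integral>\<^sup>+ s. (\<integral>\<^sup>+ \<xi>. F (s, \<xi>) \<partial>\<kappa> s) \<partial>M)"
  unfolding joint_def
proof (subst nn_integral_bind[OF F joint_kernel], rule nn_integral_cong)
  fix s assume s: "s \<in> space M"
  have sN: "sets (\<kappa> s) = sets N" by (rule kernel_prob(2)[OF s])
  then have sp: "space (\<kappa> s) = space N" by (rule sets_eq_imp_space_eq)
  have "(\<lambda>\<xi>. (s, \<xi>)) \<in> N \<rightarrow>\<^sub>M M \<Otimes>\<^sub>M N" using s by (rule measurable_Pair1')
  then have "(\<lambda>\<xi>. (s, \<xi>)) \<in> \<kappa> s \<rightarrow>\<^sub>M M \<Otimes>\<^sub>M N"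
    by (subst measurable_cong_sets[OF sN refl])
  then have "(\<lambda>\<xi>. return (M \<Otimes>\<^sub>M N) (s, \<xi>)) \<in> \<kappa> s \<rightarrow>\<^sub>M subprob_algebra (M \<Otimes>\<^sub>M N)"
    by (rule measurable_compose[OF _ return_measurable])
  then have "(\<integral>\<^sup>+ q. F q \<partial>(\<kappa> s \<bind> (\<lambda>\<xi>. return (M \<Otimes>\<^sub>M N) (s, \<xi>)))) =
      (\<integral>\<^sup>+ \<xi>. (\<integral>\<^sup>+ q. F q \<partial>return (M \<Otimes>\<^sub>M N) (s, \<xi>)) \<partial>\<kappa> s)"
    by (rule nn_integral_bind[OF F])
  also have "\<dots> = (\<integral>\<^sup>+ \<xi>. F (s, \<xi>) \<partial>\<kappa> s)"
    by (rule nn_integral_cong) (subst nn_integral_return, auto simp: space_pair_measure s sp)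
  finally show "(\<integral>\<^sup>+ q. F q \<partial>(\<kappa> s \<bind> (\<lambda>\<xi>. return (M \<Otimes>\<^sub>M N) (s, \<xi>)))) = (\<integral>\<^sup>+ \<xi>. F (s, \<xi>) \<partial>\<kappa> s)" .
qed

lemma integral_joint:
  fixes F :: "'a \<times> 'b \<Rightarrow> real"
  assumes F: "integrable (joint M \<kappa> N) F" and ne: "space M \<noteq> {}"
  shows "AE s in M. integrable (\<kappa> s) (\<lambda>\<xi>. F (s, \<xi>))"
    and "integrable M (\<lambda>s. \<integral>\<xi>. F (s, \<xi>) \<partial>\<kappa> s)"
    and "(\<integral>q. F q \<partial>joint M \<kappa> N) = (\<integral>s. (\<integral>\<xi>. F (s, \<xi>) \<partial>\<kappa> s) \<partial>M)"
proof -
  have [measurable_cong]: "sets (joint M \<kappa> N) = sets (M \<Otimes>\<^sub>M N)" by (rule sets_joint[OF ne])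
  have Fm [measurable]: "F \<in> borel_measurable (M \<Otimes>\<^sub>M N)"
    using borel_measurable_integrable[OF F] by simp
  have pm [measurable]: "(\<lambda>s. \<integral>\<^sup>+ \<xi>. f (s, \<xi>) \<partial>\<kappa> s) \<in> borel_measurable M"
    if [measurable]: "f \<in> borel_measurable (M \<Otimes>\<^sub>M N)" for f :: "_ \<Rightarrow> ennreal"
    by (rule nn_integral_measurable_subprob_algebra2[where N=N]) (use that in auto)
  have Fs: "(\<lambda>\<xi>. F (s, \<xi>)) \<in> borel_measurable (\<kappa> s)" if "s \<in> space M" for s
    by (subst measurable_cong_sets[OF kernel_prob(2)[OF that] refl])
      (rule measurable_compose[OF measurable_Pair1'[OF that] Fm])
  let ?A = "\<lambda>s. \<integral>\<^sup>+ \<xi>. ennreal (norm (F (s, \<xi>))) \<partial>\<kappa> s"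
  have fin: "(\<integral>\<^sup>+ s. ?A s \<partial>M) < \<infinity>"
    using F nn_integral_joint[of "\<lambda>q. ennreal (norm (F q))"] by (simp add: integrable_iff_bounded)
  have "AE s in M. ?A s \<noteq> \<infinity>"
    by (rule nn_integral_PInf_AE) (use fin in auto)
  then show int: "AE s in M. integrable (\<kappa> s) (\<lambda>\<xi>. F (s, \<xi>))"
    using AE_space by eventually_elim (auto simp: integrable_iff_bounded Fs less_top)
  let ?P = "\<lambda>s. \<integral>\<^sup>+ \<xi>. ennreal (F (s, \<xi>)) \<partial>\<kappa> s" and ?N = "\<lambda>s. \<integral>\<^sup>+ \<xi>. ennreal (- F (s, \<xi>)) \<partial>\<kappa> s"
  have PA: "?P s \<le> ?A s" "?N s \<le> ?A s" for s
    by (auto intro!: nn_integral_mono ennreal_leI)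
  have P: "(\<integral>\<^sup>+ s. ?P s \<partial>M) < \<infinity>" "(\<integral>\<^sup>+ s. ?N s \<partial>M) < \<infinity>"
    using fin by (auto intro: le_less_trans[OF nn_integral_mono[OF PA(1)]] le_less_trans[OF nn_integral_mono[OF PA(2)]])
  have Pae: "AE s in M. ?P s \<noteq> \<infinity>" "AE s in M. ?N s \<noteq> \<infinity>"
    using P by (intro nn_integral_PInf_AE; simp)+
  have Pint: "integrable M (\<lambda>s. enn2real (?P s))" "integrable M (\<lambda>s. enn2real (?N s))"
    and Pval: "(\<integral>s. enn2real (?P s) \<partial>M) = enn2real (\<integral>\<^sup>+ s. ?P s \<partial>M)"
       "(\<integral>s. enn2real (?N s) \<partial>M) = enn2real (\<integral>\<^sup>+ s. ?N s \<partial>M)"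
  proof -
    have e: "(\<integral>\<^sup>+ s. ennreal (enn2real (?P s)) \<partial>M) = (\<integral>\<^sup>+ s. ?P s \<partial>M)"
       "(\<integral>\<^sup>+ s. ennreal (enn2real (?N s)) \<partial>M) = (\<integral>\<^sup>+ s. ?N s \<partial>M)"
      using Pae(1) Pae(2)
      by (intro nn_integral_cong_AE, elim eventually_mono, simp add: less_top)+
    show "integrable M (\<lambda>s. enn2real (?P s))"
      by (rule integrableI_bounded) (use P e in simp_all)
    show "integrable M (\<lambda>s. enn2real (?N s))"
      by (rule integrableI_bounded) (use P e in simp_all)
    show "(\<integral>s. enn2real (?P s) \<partial>M) = enn2real (\<integral>\<^sup>+ s. ?P s \<partial>M)"
      by (subst integral_eq_nn_integral) (simp_all add: e)
    show "(\<integral>s. enn2real (?N s) \<partial>M) = enn2real (\<integral>\<^sup>+ s. ?N s \<partial>M)"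
      by (subst integral_eq_nn_integral) (simp_all add: e)
  qed
  have v: "AE s in M. (\<integral>\<xi>. F (s, \<xi>) \<partial>\<kappa> s) = enn2real (?P s) - enn2real (?N s)"
    using int by eventually_elim (rule real_lebesgue_integral_def)
  have vm [measurable]: "(\<lambda>s. \<integral>\<xi>. F (s, \<xi>) \<partial>\<kappa> s) \<in> borel_measurable M"
  proof -
    have "(\<integral>\<xi>. F (s, \<xi>) \<partial>\<kappa> s) = (if ?A s < \<infinity> then enn2real (?P s) - enn2real (?N s) else 0)"
      if "s \<in> space M" for s
    proof (cases "?A s < \<infinity>")
      case True
      then have "integrable (\<kappa> s) (\<lambda>\<xi>. F (s, \<xi>))" using Fs[OF that] by (simp add: integrable_iff_bounded)
      then show ?thesis using True by (simp add: real_lebesgue_integral_def)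
    next
      case False
      then have "\<not> integrable (\<kappa> s) (\<lambda>\<xi>. F (s, \<xi>))" by (simp add: integrable_iff_bounded)
      then show ?thesis using False by (simp add: not_integrable_integral_eq)
    qed
    then show ?thesis by (subst measurable_cong) auto
  qed
  show "integrable M (\<lambda>s. \<integral>\<xi>. F (s, \<xi>) \<partial>\<kappa> s)"
    using v Pint by (subst integrable_cong_AE[OF _ _ v]) auto
  have "(\<integral>q. F q \<partial>joint M \<kappa> N) = enn2real (\<integral>\<^sup>+ q. ennreal (F q) \<partial>joint M \<kappa> N) - enn2real (\<integral>\<^sup>+ q. ennreal (- F q) \<partial>joint M \<kappa> N)"
    by (rule real_lebesgue_integral_def[OF F])
  also have "\<dots> = (\<integral>s. enn2real (?P s) - enn2real (?N s) \<partial>M)"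
    using Pint by (simp add: nn_integral_joint Pval)
  also have "\<dots> = (\<integral>s. (\<integral>\<xi>. F (s, \<xi>) \<partial>\<kappa> s) \<partial>M)"
    using v Pint by (intro integral_cong_AE) (auto elim!: eventually_mono)
  finally show "(\<integral>q. F q \<partial>joint M \<kappa> N) = (\<integral>s. (\<integral>\<xi>. F (s, \<xi>) \<partial>\<kappa> s) \<partial>M)" .
qed

end

section \<open>From space-time tuples to points and pairs of points\<close>

lemma completion_AE_eq:
  fixes f g :: "'a \<Rightarrow> real"
  assumes g: "g \<in> borel_measurable M" and ae: "AE x in M. f x = g x"
  shows "f \<in> borel_measurable (completion M)"
    and "integrable (completion M) f \<longleftrightarrow> integrable M g"
    and "(\<integral>x. f x \<partial>completion M) = (\<integral>x. g x \<partial>M)"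
proof -
  have ae': "AE x in completion M. f x = g x" by (rule AE_completion[OF ae])
  have g': "g \<in> borel_measurable (completion M)" by (rule measurable_completion[OF g])
  show f: "f \<in> borel_measurable (completion M)"
  proof (rule measurableI)
    fix A :: "real set" assume A: "A \<in> sets borel"
    have "AE x in completion M. x \<in> g -` A \<inter> space (completion M) \<longleftrightarrow> x \<in> f -` A \<inter> space (completion M)"
      using ae' by eventually_elim auto
    then show "f -` A \<inter> space (completion M) \<in> sets (completion M)"
      by (rule completion.in_sets_AE) (use measurable_sets[OF g' A] in auto)
  qed simp
  show "integrable (completion M) f \<longleftrightarrow> integrable M g"
    using integrable_cong_AE[OF f g' ae'] integrable_completion[OF g] by simp
  show "(\<integral>x. f x \<partial>completion M) = (\<integral>x. g x \<partial>M)"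
    using integral_cong_AE[OF f g' ae'] integral_completion[OF g] by simp
qed

text \<open>
  The maps enc and dec identify the measure spaces S and B up to null sets, and make integrals over
  the completion of B into integrals over S.
\<close>

locale coding =
  fixes S :: "'a measure" and B :: "'b measure" and enc dec
  assumes enc [measurable]: "enc \<in> S \<rightarrow>\<^sub>M B" and dec [measurable]: "dec \<in> B \<rightarrow>\<^sub>M S"
    and distr_enc: "distr S B enc = B"
    and enc_dec: "\<And>p. p \<in> space B \<Longrightarrow> enc (dec p) = p"
    and dec_enc: "AE s in S. dec (enc s) = s"
begin

lemma AE_enc: "AE p in completion B. P p \<Longrightarrow> AE s in S. P (enc s)"
  using AE_distrD[OF enc, of P] unfolding distr_enc AE_completion_iff .

lemma distr_dec: "distr B S dec = S"
proof -
  have "distr B S dec = distr (distr S B enc) S dec" by (simp add: distr_enc)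
  also have "\<dots> = distr S S (dec \<circ> enc)" by (simp add: distr_distr)
  also have "\<dots> = distr S S (\<lambda>s. s)"
    using dec_enc by (intro distr_cong_AE) (auto simp: comp_def)
  finally show ?thesis by (simp add: distr_id)
qed

lemma AE_dec: "AE s in S. Q s \<Longrightarrow> AE p in B. Q (dec p)"
  using AE_distrD[OF dec, of Q] unfolding distr_dec .

lemma AE_code:
  assumes "AE s in S. P (enc s)"
  shows "AE p in completion B. P p"
  using AE_dec[OF assms] AE_space unfolding AE_completion_iff by eventually_elim (simp add: enc_dec)

lemma
  fixes f :: "'b \<Rightarrow> real"
  assumes f': "f' \<in> borel_measurable S" and ae: "AE s in S. f (enc s) = f' s"
  shows integrable_code: "integrable (completion B) f \<longleftrightarrow> integrable S f'"
    and integral_code: "(\<integral>p. f p \<partial>completion B) = (\<integral>s. f' s \<partial>S)"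
proof -
  have m: "(\<lambda>p. f' (dec p)) \<in> borel_measurable B" using f' dec by measurable
  have ae: "AE p in B. f p = f' (dec p)"
    using AE_dec[OF ae] AE_space by eventually_elim (simp add: enc_dec)
  have "integrable B (\<lambda>p. f' (dec p)) \<longleftrightarrow> integrable S f'"
    using integrable_distr_eq[OF dec f'] by (simp add: distr_dec)
  with completion_AE_eq(2)[OF m ae] show "integrable (completion B) f \<longleftrightarrow> integrable S f'"
    by simp
  have "(\<integral>p. f' (dec p) \<partial>B) = (\<integral>s. f' s \<partial>S)"
    using integral_distr[OF dec f'] by (simp add: distr_dec)
  with completion_AE_eq(3)[OF m ae] show "(\<integral>p. f p \<partial>completion B) = (\<integral>s. f' s \<partial>S)"
    by simp
qed

end

definition S1 :: "space_domain \<Rightarrow> real \<Rightarrow> (real \<times> (real^'n)) measure" where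
  "S1 D T = time_measure T \<Otimes>\<^sub>M dom_measure D"

definition S2 :: "space_domain \<Rightarrow> real \<Rightarrow> (real \<times> (real^'n) \<times> (real^'n)) measure" where
  "S2 D T = time_measure T \<Otimes>\<^sub>M (dom_measure D \<Otimes>\<^sub>M dom_measure D)"

lemma sets_S1 [simp, measurable_cong]: "sets (S1 D T) = sets (borel \<Otimes>\<^sub>M borel)"
  unfolding S1_def by (intro sets_pair_measure_cong) simp_all

lemma sets_S2 [simp, measurable_cong]: "sets (S2 D T) = sets (borel \<Otimes>\<^sub>M (borel \<Otimes>\<^sub>M borel))"
  unfolding S2_def by (intro sets_pair_measure_cong) simp_all

lemma space_S [simp]: "space (S1 D T) = UNIV" "space (S2 D T) = UNIV"
  by (simp_all add: S1_def S2_def space_pair_measure)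

lemma sigma_finite_dom_dom: "sigma_finite_measure (dom_measure D \<Otimes>\<^sub>M dom_measure D')"
  by (rule sigma_finite_pair_measure) unfold_locales

lemma nn_integral_S1:
  assumes "f \<in> borel_measurable (borel \<Otimes>\<^sub>M borel)"
  shows "(\<integral>\<^sup>+ s. f s \<partial>S1 D T) = (\<integral>\<^sup>+ t. (\<integral>\<^sup>+ x. f (t, x) \<partial>dom_measure D) \<partial>time_measure T)"
  using assms sets_S1[of D T] unfolding S1_def
  by (intro dom.nn_integral_fst[symmetric]) (simp cong: measurable_cong_sets)

lemma nn_integral_S2:
  fixes f :: "real \<times> (real^'n) \<times> (real^'n) \<Rightarrow> ennreal"
  assumes [measurable]: "f \<in> borel_measurable (borel \<Otimes>\<^sub>M (borel \<Otimes>\<^sub>M borel))"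
  shows "(\<integral>\<^sup>+ s. f s \<partial>S2 D T) =
    (\<integral>\<^sup>+ t. (\<integral>\<^sup>+ x. (\<integral>\<^sup>+ y. f (t, x, y) \<partial>dom_measure D) \<partial>dom_measure D) \<partial>time_measure T)"
proof -
  have "(\<integral>\<^sup>+ s. f s \<partial>S2 D T) = (\<integral>\<^sup>+ t. (\<integral>\<^sup>+ p. f (t, p) \<partial>(dom_measure D \<Otimes>\<^sub>M dom_measure D)) \<partial>time_measure T)"
    unfolding S2_def by (rule sigma_finite_measure.nn_integral_fst[OF sigma_finite_dom_dom, symmetric]) measurable
  also have "\<dots> = (\<integral>\<^sup>+ t. (\<integral>\<^sup>+ x. (\<integral>\<^sup>+ y. f (t, x, y) \<partial>dom_measure D) \<partial>dom_measure D) \<partial>time_measure T)"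
    by (rule nn_integral_cong, rule dom.nn_integral_fst[symmetric]) measurable
  finally show ?thesis .
qed

interpretation S1: sigma_finite_measure "S1 D T"
  unfolding S1_def by (rule sigma_finite_pair_measure) unfold_locales

interpretation S2: sigma_finite_measure "S2 D T"
  unfolding S2_def by (rule sigma_finite_pair_measure) unfold_locales

interpretation time_dom: pair_sigma_finite "time_measure T" "dom_measure D" ..

interpretation time_dom2: pair_sigma_finite "time_measure T" "dom_measure D \<Otimes>\<^sub>M dom_measure D'" ..

lemma null_S2_of_S1:
  fixes N :: "(real \<times> (real^'n)) set"
  assumes "N \<in> null_sets (S1 D T)"
  shows "{(t, x, y). (t, x) \<in> N} \<in> null_sets (S2 D T)"
proof -
  have N [measurable]: "N \<in> sets (borel \<Otimes>\<^sub>M borel)" and e: "emeasure (S1 D T) N = 0"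
    using assms by auto
  let ?N = "{(t, x, y). (t, x) \<in> N}"
  have "?N = (\<lambda>(t, x, y). (t, x)) -` N \<inter> space (borel \<Otimes>\<^sub>M (borel \<Otimes>\<^sub>M borel))"
    by (auto simp: space_pair_measure)
  also have "\<dots> \<in> sets (borel \<Otimes>\<^sub>M (borel \<Otimes>\<^sub>M borel))"
    by (rule measurable_sets[OF _ N]) measurable
  finally have m [measurable]: "?N \<in> sets (borel \<Otimes>\<^sub>M (borel \<Otimes>\<^sub>M borel))" .
  have "emeasure (S2 D T) ?N = (\<integral>\<^sup>+ s. indicator ?N s \<partial>S2 D T)"
    using m by simp
  also have "\<dots> = (\<integral>\<^sup>+ t. (\<integral>\<^sup>+ x. (\<integral>\<^sup>+ y. indicator N (t, x) \<partial>(dom_measure D :: (real^'n) measure)) \<partial>dom_measure D) \<partial>time_measure T)"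
    by (subst nn_integral_S2) (auto intro!: nn_integral_cong simp: indicator_def)
  also have "\<dots> = (\<integral>\<^sup>+ s. indicator N s * emeasure (dom_measure D :: (real^'n) measure) UNIV \<partial>S1 D T)"
    by (subst nn_integral_S1) (simp_all add: mult.commute)
  also have "\<dots> = 0"
    using e by (simp add: nn_integral_multc)
  finally show ?thesis using m by (auto intro: null_setsI)
qed

lemma AE_S2_of_S1:
  assumes "AE s in S1 D T. P s"
  shows "AE (t, x, y) in S2 D T. P (t, x)"
proof -
  obtain N where "N \<in> null_sets (S1 D T)" "\<And>s. s \<in> space (S1 D T) - N \<Longrightarrow> P s"
    using AE_E3[OF assms] by blast
  then show ?thesis
    by (intro AE_I'[OF null_S2_of_S1[of N]]) auto
qed

lemma distr_S2_swap: "distr (S2 D T) (S2 D T) (\<lambda>(t, x, y). (t, y, x)) = S2 D T"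
proof -
  have sw: "distr (dom_measure D \<Otimes>\<^sub>M dom_measure D) (dom_measure D \<Otimes>\<^sub>M dom_measure D) (\<lambda>(x, y). (y, x))
      = dom_measure D \<Otimes>\<^sub>M dom_measure D"
    by (rule dom_dom.distr_pair_swap[symmetric])
  have "distr (time_measure T) (time_measure T) (\<lambda>t. t) \<Otimes>\<^sub>M
      distr (dom_measure D \<Otimes>\<^sub>M dom_measure D) (dom_measure D \<Otimes>\<^sub>M dom_measure D) (\<lambda>(x, y). (y, x))
    = distr (time_measure T \<Otimes>\<^sub>M (dom_measure D \<Otimes>\<^sub>M dom_measure D)) (time_measure T \<Otimes>\<^sub>M (dom_measure D \<Otimes>\<^sub>M dom_measure D))
       (\<lambda>(t, p). (t, case p of (x, y) \<Rightarrow> (y, x)))"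
    by (rule pair_measure_distr) (use sigma_finite_dom_dom in \<open>auto simp: sw\<close>)
  from this[symmetric] show ?thesis
    unfolding S2_def sw distr_id by (simp add: case_prod_unfold)
qed

lemma swap_S2_measurable [measurable]: "(\<lambda>(t, x, y). (t, y, x)) \<in> S2 D T \<rightarrow>\<^sub>M S2 D T"
  unfolding S2_def by measurable

lemma AE_S2_swap: "AE (t, x, y) in S2 D T. P t x y \<Longrightarrow> AE (t, x, y) in S2 D T. P t y x"
  using AE_distrD[OF swap_S2_measurable, of "\<lambda>(t, x, y). P t x y" D T] unfolding distr_S2_swap
  by (simp add: case_prod_unfold)

lemma AE_S1_pts: "AE (t, x) in S1 D T. t \<in> {0..T} \<and> x \<in> pts D"
  unfolding S1_def
proof (rule time_dom.AE_pair_measure)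
  show "{s \<in> space (time_measure T \<Otimes>\<^sub>M dom_measure D). case s of (t, x) \<Rightarrow> t \<in> {0..T} \<and> x \<in> pts D}
    \<in> sets (time_measure T \<Otimes>\<^sub>M dom_measure D)"
    by measurable
  show "AE t in time_measure T. AE x in dom_measure D. case (t, x) of (t, x) \<Rightarrow> t \<in> {0..T} \<and> x \<in> pts D"
    using AE_time_measure[of T] by eventually_elim (use AE_dom_measure[of D] in auto)
qed

lemma AE_S2_pts: "AE (t, x, y) in S2 D T. t \<in> {0..T} \<and> x \<in> pts D \<and> y \<in> pts D"
proof -
  have "AE (t, x, y) in S2 D T. t \<in> {0..T} \<and> x \<in> pts D"
    using AE_S2_of_S1[OF AE_S1_pts[where D=D and T=T]] by simp
  from this AE_S2_swap[OF this] show ?thesis by eventually_elim auto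
qed

text \<open>
  Like wrap, a retraction onto the domain that is defined everywhere: the maps into the restricted
  spaces of tuples have to send every point into these spaces.
\<close>

definition clamp_time :: "real \<Rightarrow> real \<Rightarrow> real" where
  "clamp_time T t = max 0 (min T t)"

lemma distr_density_restrict:
  fixes r :: "'a::euclidean_space \<Rightarrow> 'a"
  assumes [measurable]: "A \<in> sets borel" "r \<in> borel_measurable borel" and r: "\<And>x. r x \<in> A" "\<And>x. x \<in> A \<Longrightarrow> r x = x"
  shows "r \<in> density lborel (indicator A) \<rightarrow>\<^sub>M restrict_space lborel A"
    and "distr (density lborel (indicator A)) (restrict_space lborel A) r = restrict_space lborel A"
proof -
  show m: "r \<in> density lborel (indicator A) \<rightarrow>\<^sub>M restrict_space lborel A"
    by (rule measurable_restrict_space2) (use r in auto)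
  show "distr (density lborel (indicator A)) (restrict_space lborel A) r = restrict_space lborel A"
  proof (rule measure_eqI)
    fix B assume "B \<in> sets (distr (density lborel (indicator A)) (restrict_space lborel A) r)"
    then have B: "B \<in> sets (restrict_space lborel A)" by simp
    then have B' [measurable]: "B \<in> sets borel" and BA: "B \<subseteq> A"
      by (auto simp: sets_restrict_space)
    have rB: "r -` B \<in> sets borel" using measurable_sets[OF assms(2) B'] by simp
    have "emeasure (distr (density lborel (indicator A)) (restrict_space lborel A) r) B
        = emeasure (density lborel (indicator A)) (r -` B)"
      using emeasure_distr[OF m B] by simp
    also have "\<dots> = (\<integral>\<^sup>+ x. indicator A x * indicator (r -` B) x \<partial>lborel)"
      using rB by (subst emeasure_density) auto
    also have "\<dots> = (\<integral>\<^sup>+ x. indicator B x \<partial>lborel)"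
      using r BA by (intro nn_integral_cong) (auto simp: indicator_def)
    also have "\<dots> = emeasure (restrict_space lborel A) B"
      using BA by (simp add: emeasure_restrict_space)
    finally show "emeasure (distr (density lborel (indicator A)) (restrict_space lborel A) r) B
        = emeasure (restrict_space lborel A) B" .
  qed simp
qed

lemma wrap_id: "x \<in> pts D \<Longrightarrow> wrap D x = x"
  by (cases D) (auto simp: pts_def wrap_def vec_eq_iff frac_eq)

definition space_factor :: "space_domain \<Rightarrow> (real^'n) measure" where
  "space_factor D = restrict_space lborel (pts D)"

lemma distr_wrap:
  "wrap D \<in> dom_measure D \<rightarrow>\<^sub>M space_factor D"
  "distr (dom_measure D) (space_factor D) (wrap D) = space_factor D"
  unfolding dom_measure_def space_factor_def
  by (intro distr_density_restrict; simp add: wrap_pts wrap_id)+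

lemma distr_clamp:
  assumes "0 < T"
  shows "clamp_time T \<in> time_measure T \<rightarrow>\<^sub>M restrict_space lborel {0..T}"
  "distr (time_measure T) (restrict_space lborel {0..T}) (clamp_time T) = restrict_space lborel {0..T}"
proof -
  have "clamp_time T \<in> borel_measurable borel" unfolding clamp_time_def by measurable
  then show "clamp_time T \<in> time_measure T \<rightarrow>\<^sub>M restrict_space lborel {0..T}"
    "distr (time_measure T) (restrict_space lborel {0..T}) (clamp_time T) = restrict_space lborel {0..T}"
    unfolding time_measure_def using assms
    by (intro distr_density_restrict; auto simp: clamp_time_def)+
qed

lemma sigma_finite_space_factor: "sigma_finite_measure (space_factor D)"
  unfolding space_factor_def
  by (intro sigma_finite_measure_restrict_space lborel.sigma_finite_measure_axioms) simp

interpretation space_factor: product_sigma_finite "\<lambda>_::nat. space_factor D"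
  by unfold_locales (rule sigma_finite_measure.sigma_finite_countable[OF sigma_finite_space_factor])

lemma emeasure_space_factor:
  assumes "A \<in> sets (space_factor D)"
  shows "emeasure (space_factor D) A = emeasure (dom_measure D) (wrap D -` A)"
  using emeasure_distr[OF distr_wrap(1) assms] by (simp add: distr_wrap)

lemma tuple_measurable:
  "(\<lambda>x. tuple [wrap D x]) \<in> dom_measure D \<rightarrow>\<^sub>M (\<Pi>\<^sub>M j\<in>{..<1}. space_factor D)"
  "(\<lambda>(x, y). tuple [wrap D x, wrap D y]) \<in> dom_measure D \<Otimes>\<^sub>M dom_measure D \<rightarrow>\<^sub>M (\<Pi>\<^sub>M j\<in>{..<2}. space_factor D)"
proof -
  note distr_wrap(1)[measurable]
  have "(\<lambda>x. \<lambda>j\<in>{..<1}. [wrap D x] ! j) \<in> dom_measure D \<rightarrow>\<^sub>M (\<Pi>\<^sub>M j\<in>{..<1}. space_factor D)"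
    by (rule measurable_restrict) (use distr_wrap(1) in simp)
  then show "(\<lambda>x. tuple [wrap D x]) \<in> dom_measure D \<rightarrow>\<^sub>M (\<Pi>\<^sub>M j\<in>{..<1}. space_factor D)"
    by (simp add: tuple_def)
  have "(\<lambda>p. \<lambda>j\<in>{..<2}. [wrap D (fst p), wrap D (snd p)] ! j)
      \<in> dom_measure D \<Otimes>\<^sub>M dom_measure D \<rightarrow>\<^sub>M (\<Pi>\<^sub>M j\<in>{..<2}. space_factor D)"
    by (rule measurable_restrict) (auto simp: less_2_cases_iff)
  then show "(\<lambda>(x, y). tuple [wrap D x, wrap D y]) \<in> dom_measure D \<Otimes>\<^sub>M dom_measure D \<rightarrow>\<^sub>M (\<Pi>\<^sub>M j\<in>{..<2}. space_factor D)"
    by (simp add: tuple_def case_prod_unfold numeral_2_eq_2)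
qed

lemma distr_tuple:
  "distr (dom_measure D) (\<Pi>\<^sub>M j\<in>{..<1}. space_factor D) (\<lambda>x::real^'n. tuple [wrap D x]) = (\<Pi>\<^sub>M j\<in>{..<1}. space_factor D)"
  "distr (dom_measure D \<Otimes>\<^sub>M dom_measure D) (\<Pi>\<^sub>M j\<in>{..<2}. space_factor D) (\<lambda>(x::real^'n, y::real^'n). tuple [wrap D x, wrap D y])
     = (\<Pi>\<^sub>M j\<in>{..<2}. space_factor D)"
proof -
  show "distr (dom_measure D) (\<Pi>\<^sub>M j\<in>{..<1}. space_factor D) (\<lambda>x::real^'n. tuple [wrap D x]) = (\<Pi>\<^sub>M j\<in>{..<1}. space_factor D)"
  proof (rule space_factor.PiM_eqI)
    fix A :: "nat \<Rightarrow> (real^'n) set" assume A: "\<And>j. j \<in> {..<1} \<Longrightarrow> A j \<in> sets (space_factor D)"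
    then have *: "Pi\<^sub>E {..<1} A \<in> sets (\<Pi>\<^sub>M j\<in>{..<1}. space_factor D)" by (intro sets_PiM_I_finite) auto
    have "(\<lambda>x::real^'n. tuple [wrap D x]) -` Pi\<^sub>E {..<1} A \<inter> space (dom_measure D) = wrap D -` A 0"
      by (auto simp: tuple_def PiE_iff)
    then show "emeasure (distr (dom_measure D) (\<Pi>\<^sub>M j\<in>{..<1}. space_factor D) (\<lambda>x::real^'n. tuple [wrap D x])) (Pi\<^sub>E {..<1} A)
      = (\<Prod>i\<in>{..<1}. emeasure (space_factor D) (A i))"
      using A by (subst emeasure_distr[OF tuple_measurable(1) *]) (simp_all add: emeasure_space_factor)
  qed auto
  show "distr (dom_measure D \<Otimes>\<^sub>M dom_measure D) (\<Pi>\<^sub>M j\<in>{..<2}. space_factor D) (\<lambda>(x::real^'n, y::real^'n). tuple [wrap D x, wrap D y])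
     = (\<Pi>\<^sub>M j\<in>{..<2}. space_factor D)"
  proof (rule space_factor.PiM_eqI)
    fix A :: "nat \<Rightarrow> (real^'n) set" assume A: "\<And>j. j \<in> {..<2} \<Longrightarrow> A j \<in> sets (space_factor D)"
    then have *: "Pi\<^sub>E {..<2} A \<in> sets (\<Pi>\<^sub>M j\<in>{..<2}. space_factor D)" by (intro sets_PiM_I_finite) auto
    have l2: "{..<2} = {0, 1::nat}" by auto
    have "(\<lambda>(x::real^'n, y::real^'n). tuple [wrap D x, wrap D y]) -` Pi\<^sub>E {..<2} A \<inter> space (dom_measure D \<Otimes>\<^sub>M dom_measure D)
        = (wrap D -` A 0) \<times> (wrap D -` A 1)"
      by (auto simp: tuple_def PiE_iff space_pair_measure l2 extensional_def)
    moreover have "wrap D -` A 0 \<in> sets (dom_measure D)" "wrap D -` A 1 \<in> sets (dom_measure D)"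
      using A[of 0] A[of 1] measurable_sets[OF distr_wrap(1)[of D]] by fastforce+
    ultimately show "emeasure (distr (dom_measure D \<Otimes>\<^sub>M dom_measure D) (\<Pi>\<^sub>M j\<in>{..<2}. space_factor D) (\<lambda>(x::real^'n, y::real^'n). tuple [wrap D x, wrap D y])) (Pi\<^sub>E {..<2} A)
      = (\<Prod>i\<in>{..<2}. emeasure (space_factor D) (A i))"
      using A by (subst emeasure_distr[OF tuple_measurable(2) *])
        (simp_all add: emeasure_space_factor l2 dom.emeasure_pair_measure_Times)
  qed auto
qed

definition enc1 :: "space_domain \<Rightarrow> real \<Rightarrow> real \<times> (real^'n) \<Rightarrow> real \<times> (nat \<Rightarrow> real^'n)" where
  "enc1 D T = (\<lambda>(t, x). (clamp_time T t, tuple [wrap D x]))"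

definition enc2 :: "space_domain \<Rightarrow> real \<Rightarrow> real \<times> (real^'n) \<times> (real^'n) \<Rightarrow> real \<times> (nat \<Rightarrow> real^'n)" where
  "enc2 D T = (\<lambda>(t, x, y). (clamp_time T t, tuple [wrap D x, wrap D y]))"

definition base :: "space_domain \<Rightarrow> real \<Rightarrow> nat \<Rightarrow> (real \<times> (nat \<Rightarrow> real^'n)) measure" where
  "base D T k = restrict_space lborel {0..T} \<Otimes>\<^sub>M (\<Pi>\<^sub>M j\<in>{..<k}. space_factor D)"

lemma spacetime_base: "spacetime D T k = completion (base D T k)"
  by (simp add: spacetime_def base_def space_factor_def)

lemma enc_on_points:
  assumes "t \<in> {0..T}" "x \<in> pts D" "y \<in> pts D"
  shows "enc1 D T (t, x) = (t, tuple [x])" "enc2 D T (t, x, y) = (t, tuple [x, y])"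
  using assms by (simp_all add: enc1_def enc2_def clamp_time_def wrap_id)

lemma coordinate_measurable:
  assumes "j < k"
  shows "(\<lambda>p. snd p j :: real^'n) \<in> borel_measurable (base D T k)"
proof -
  have "(\<lambda>p. snd p j :: real^'n) \<in> base D T k \<rightarrow>\<^sub>M space_factor D"
    using assms unfolding base_def
    by (intro measurable_compose[OF measurable_snd measurable_component_singleton]) simp
  then show ?thesis unfolding space_factor_def by (simp add: measurable_restrict_space2_iff)
qed

lemma time_measurable: "(fst :: real \<times> (nat \<Rightarrow> real^'n) \<Rightarrow> real) \<in> borel_measurable (base D T k)"
proof -
  have "(fst :: real \<times> (nat \<Rightarrow> real^'n) \<Rightarrow> real) \<in> base D T k \<rightarrow>\<^sub>M restrict_space lborel {0..T}"
    unfolding base_def by measurable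
  then show ?thesis by (simp add: measurable_restrict_space2_iff)
qed

lemma coding1:
  assumes "0 < T"
  shows "coding (S1 D T) (base D T 1) (enc1 D T) (\<lambda>p. (fst p, snd p 0))"
proof
  note distr_clamp[OF assms, measurable] tuple_measurable[measurable]
  show "enc1 D T \<in> S1 D T \<rightarrow>\<^sub>M base D T 1"
    unfolding S1_def base_def enc1_def by measurable
  show "(\<lambda>p. (fst p, snd p 0)) \<in> base D T 1 \<rightarrow>\<^sub>M S1 D T"
    by (subst measurable_cong_sets[OF refl sets_S1])
      (intro measurable_Pair time_measurable coordinate_measurable; simp)
  have "distr (time_measure T) (restrict_space lborel {0..T}) (clamp_time T) \<Otimes>\<^sub>M
      distr (dom_measure D) (\<Pi>\<^sub>M j\<in>{..<1}. space_factor D) (\<lambda>x. tuple [wrap D x]) =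
    distr (S1 D T) (base D T 1) (\<lambda>(t, x). (clamp_time T t, tuple [wrap D x]))"
    unfolding S1_def base_def
    by (rule pair_measure_distr)
      (use distr_clamp[OF assms] tuple_measurable space_factor.sigma_finite[OF finite_lessThan[of 1]] in \<open>simp_all only: distr_tuple\<close>)
  from this[symmetric] show "distr (S1 D T) (base D T 1) (enc1 D T) = base D T 1"
    unfolding distr_clamp(2)[OF assms] distr_tuple enc1_def base_def .
  show "enc1 D T (fst p, snd p 0) = p" if "p \<in> space (base D T 1)" for p
  proof (cases p)
    case (Pair t x)
    then have "t \<in> {0..T}" "x \<in> {..<1} \<rightarrow>\<^sub>E pts D"
      using that by (auto simp: base_def space_pair_measure space_PiM space_factor_def space_restrict_space)
    then show ?thesis
      by (auto simp: Pair enc1_def clamp_time_def tuple_def wrap_id fun_eq_iff PiE_iff extensional_def)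
  qed
  show "AE s in S1 D T. (fst (enc1 D T s), snd (enc1 D T s) 0) = s"
    using AE_S1_pts by eventually_elim (auto simp: enc1_def clamp_time_def tuple_def wrap_id)
qed

lemma coding2:
  assumes "0 < T"
  shows "coding (S2 D T) (base D T 2) (enc2 D T) (\<lambda>p. (fst p, snd p 0, snd p 1))"
proof
  note distr_clamp[OF assms, measurable] tuple_measurable[measurable]
  have e: "enc2 D T = (\<lambda>(t, p). (clamp_time T t, case p of (x, y) \<Rightarrow> tuple [wrap D x, wrap D y]))"
    by (auto simp: enc2_def)
  show "enc2 D T \<in> S2 D T \<rightarrow>\<^sub>M base D T 2"
    unfolding S2_def base_def e by measurable
  show "(\<lambda>p. (fst p, snd p 0, snd p 1)) \<in> base D T 2 \<rightarrow>\<^sub>M S2 D T"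
    by (subst measurable_cong_sets[OF refl sets_S2])
      (intro measurable_Pair time_measurable coordinate_measurable; simp)
  have "distr (time_measure T) (restrict_space lborel {0..T}) (clamp_time T) \<Otimes>\<^sub>M
      distr (dom_measure D \<Otimes>\<^sub>M dom_measure D) (\<Pi>\<^sub>M j\<in>{..<2}. space_factor D) (\<lambda>(x, y). tuple [wrap D x, wrap D y]) =
    distr (S2 D T) (base D T 2) (\<lambda>(t, p). (clamp_time T t, case p of (x, y) \<Rightarrow> tuple [wrap D x, wrap D y]))"
    unfolding S2_def base_def
    by (rule pair_measure_distr)
      (use distr_clamp[OF assms] tuple_measurable space_factor.sigma_finite[OF finite_lessThan[of 2]] in \<open>simp_all only: distr_tuple\<close>)
  from this[symmetric] show "distr (S2 D T) (base D T 2) (enc2 D T) = base D T 2"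
    unfolding distr_clamp(2)[OF assms] distr_tuple e base_def .
  show "enc2 D T (fst p, snd p 0, snd p 1) = p" if "p \<in> space (base D T 2)" for p
  proof (cases p)
    case (Pair t x)
    then have "t \<in> {0..T}" "x \<in> {..<2} \<rightarrow>\<^sub>E pts D"
      using that by (auto simp: base_def space_pair_measure space_PiM space_factor_def space_restrict_space)
    then have t: "clamp_time T t = t" and x: "x 0 \<in> pts D" "x 1 \<in> pts D" and ext: "\<And>j. 2 \<le> j \<Longrightarrow> x j = undefined"
      by (auto simp: clamp_time_def PiE_iff extensional_def)
    have "tuple [wrap D (x 0), wrap D (x 1)] j = x j" for j
    proof -
      consider "j = 0" | "j = 1" | "2 \<le> j" by linarith
      then show ?thesis using x ext by cases (simp_all add: tuple_def wrap_id)
    qed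
    then show ?thesis
      by (simp add: Pair enc2_def t fun_eq_iff)
  qed
  show "AE s in S2 D T. (fst (enc2 D T s), snd (enc2 D T s) 0, snd (enc2 D T s) 1) = s"
    using AE_S2_pts by eventually_elim (auto simp: enc2_def clamp_time_def tuple_def wrap_id)
qed

section \<open>Kernels of a statistical solution\<close>

lemma vanishingD:
  assumes "g \<in> vanishing"
  shows "continuous_on UNIV g" "0 < e \<Longrightarrow> \<exists>R. \<forall>\<xi>. R < norm \<xi> \<longrightarrow> \<bar>g \<xi>\<bar> < e"
  using assms by (simp_all add: vanishing_def)

lemma C0_of_vanishing:
  fixes g :: "'n::finite phase \<Rightarrow> real"
  assumes g: "g \<in> vanishing"
  shows "(\<lambda>\<xi>. g (\<xi> 0) :: real) \<in> C0 1"
proof -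
  have "continuous_on UNIV g" by (rule vanishingD(1)[OF g])
  then have "continuous_on UNIV (\<lambda>\<xi> :: nat \<Rightarrow> 'n phase. g (\<xi> 0))"
    by (rule continuous_on_compose2[OF _ continuous_on_product_coordinates subset_UNIV])
  moreover have "\<exists>R. \<forall>\<xi> :: nat \<Rightarrow> 'n phase. (\<exists>j<1. R < norm (\<xi> j)) \<longrightarrow> \<bar>g (\<xi> 0)\<bar> < e" if pos: "0 < e" for e
  proof -
    obtain R where "\<forall>\<xi>. R < norm \<xi> \<longrightarrow> \<bar>g \<xi>\<bar> < e"
      using vanishingD(2)[OF g pos] by (rule exE)
    then show ?thesis by (intro exI[of _ R] allI impI) (auto simp del: split_paired_All)
  qed
  ultimately show ?thesis
    unfolding C0_def depends_on_first_def by simp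
qed

lemma C0_of_vanishing_pair:
  fixes g :: "'n::finite phase \<times> 'n phase \<Rightarrow> real"
  assumes g: "g \<in> vanishing"
  shows "(\<lambda>\<xi>. g (\<xi> 0, \<xi> 1) :: real) \<in> C0 2"
proof -
  have "continuous_on UNIV (\<lambda>\<xi> :: nat \<Rightarrow> 'n phase. (\<xi> 0, \<xi> 1))"
    by (intro continuous_on_Pair continuous_on_product_coordinates)
  then have "continuous_on UNIV (\<lambda>\<xi> :: nat \<Rightarrow> 'n phase. g (\<xi> 0, \<xi> 1))"
    by (rule continuous_on_compose2[OF vanishingD(1)[OF g] _ subset_UNIV])
  moreover have "\<exists>R. \<forall>\<xi> :: nat \<Rightarrow> 'n phase. (\<exists>j<2. R < norm (\<xi> j)) \<longrightarrow> \<bar>g (\<xi> 0, \<xi> 1)\<bar> < e" if pos: "0 < e" for e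
  proof -
    obtain R where R: "\<forall>\<xi>. R < norm \<xi> \<longrightarrow> \<bar>g \<xi>\<bar> < e"
      using vanishingD(2)[OF g pos] by (rule exE)
    have "\<bar>g (\<xi> 0, \<xi> 1)\<bar> < e" if "j < 2" "R < norm (\<xi> j)" for \<xi> :: "nat \<Rightarrow> 'n phase" and j
    proof (rule R[rule_format])
      show "R < norm (\<xi> 0, \<xi> 1)"
        using that norm_fst_le[of "\<xi> 0" "\<xi> 1"] norm_snd_le[of "\<xi> 1" "\<xi> 0"]
        by (auto simp: less_2_cases_iff)
    qed
    then show ?thesis by blast
  qed
  ultimately show ?thesis
    unfolding C0_def depends_on_first_def by auto
qed

definition law1 :: "'n::finite correlation \<Rightarrow> real \<Rightarrow> real^'n \<Rightarrow> 'n phase measure" where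
  "law1 \<nu> t x = distr (\<nu> 1 t (tuple [x])) borel (\<lambda>\<xi>. \<xi> 0)"

definition law2 :: "'n::finite correlation \<Rightarrow> real \<Rightarrow> real^'n \<Rightarrow> real^'n \<Rightarrow> ('n phase \<times> 'n phase) measure" where
  "law2 \<nu> t x y = distr (\<nu> 2 t (tuple [x, y])) borel (\<lambda>\<xi>. (\<xi> 0, \<xi> 1))"

lemma tuple_points: "x \<in> A \<Longrightarrow> tuple [x] \<in> {..<1} \<rightarrow>\<^sub>E A"
  "x \<in> A \<Longrightarrow> y \<in> A \<Longrightarrow> tuple [x, y] \<in> {..<2} \<rightarrow>\<^sub>E A"
  by (auto simp: tuple_def restrict_PiE_iff less_Suc_eq numeral_2_eq_2)

(* Entries of tuples are indexed by 0 and 1; the simplifier shall not turn the index 1 into Suc 0. *)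
declare One_nat_def [simp del]

lemma coordinate_borel:
  assumes "sets M = sets (\<Pi>\<^sub>M j\<in>{..<k}. borel)" "j < k"
  shows "(\<lambda>\<xi>. \<xi> j) \<in> M \<rightarrow>\<^sub>M borel"
  using assms(2) by (subst measurable_cong_sets[OF assms(1) refl]) (rule measurable_component_singleton, simp)

lemma pair_coordinates_borel:
  fixes M :: "(nat \<Rightarrow> 'a::second_countable_topology) measure"
  assumes "sets M = sets (\<Pi>\<^sub>M j\<in>{..<2}. borel)"
  shows "(\<lambda>\<xi>. (\<xi> 0, \<xi> 1)) \<in> M \<rightarrow>\<^sub>M borel"
  unfolding borel_prod[symmetric]
  by (intro measurable_Pair coordinate_borel[OF assms]) auto

lemma swap_borel: "prod.swap \<in> borel_measurable (borel :: ('b::second_countable_topology \<times> 'b) measure)"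
  unfolding prod.swap_def borel_prod[symmetric] by measurable

lemma fst_borel: "fst \<in> borel_measurable (borel :: ('b::second_countable_topology \<times> 'c::second_countable_topology) measure)"
  unfolding borel_prod[symmetric] by measurable

lemma snd_borel: "snd \<in> borel_measurable (borel :: ('b::second_countable_topology \<times> 'c::second_countable_topology) measure)"
  unfolding borel_prod[symmetric] by measurable

context
  fixes D T and \<nu> :: "'n::finite correlation"
  assumes T: "0 < T" and sol: "statistical_solution D T \<nu>"
begin

lemma young: "1 \<le> k \<Longrightarrow> young_measure D T k (\<nu> k)"
  using sol by (auto simp: statistical_solution_def)

lemma young_sets:
  assumes "t \<in> {0..T}" "x \<in> pts D" "y \<in> pts D"
  shows "prob_space (\<nu> 1 t (tuple [x]))" "sets (\<nu> 1 t (tuple [x])) = sets (\<Pi>\<^sub>M j\<in>{..<1}. borel)"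
    "prob_space (\<nu> 2 t (tuple [x, y]))" "sets (\<nu> 2 t (tuple [x, y])) = sets (\<Pi>\<^sub>M j\<in>{..<2}. borel)"
proof -
  have y1: "\<forall>t\<in>{0..T}. \<forall>x\<in>{..<1} \<rightarrow>\<^sub>E pts D. prob_space (\<nu> 1 t x) \<and> sets (\<nu> 1 t x) = sets (\<Pi>\<^sub>M j\<in>{..<1}. borel)"
    using young[OF order_refl] unfolding young_measure_def by (rule conjunct1)
  have y2: "\<forall>t\<in>{0..T}. \<forall>x\<in>{..<2} \<rightarrow>\<^sub>E pts D. prob_space (\<nu> 2 t x) \<and> sets (\<nu> 2 t x) = sets (\<Pi>\<^sub>M j\<in>{..<2}. borel)"
    using young[OF one_le_numeral] unfolding young_measure_def by (rule conjunct1)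
  show "prob_space (\<nu> 1 t (tuple [x]))" "sets (\<nu> 1 t (tuple [x])) = sets (\<Pi>\<^sub>M j\<in>{..<1}. borel)"
    using bspec[OF bspec[OF y1 assms(1)] tuple_points(1)[OF assms(2)]] by (rule conjunct1, rule conjunct2)
  show "prob_space (\<nu> 2 t (tuple [x, y]))" "sets (\<nu> 2 t (tuple [x, y])) = sets (\<Pi>\<^sub>M j\<in>{..<2}. borel)"
    using bspec[OF bspec[OF y2 assms(1)] tuple_points(2)[OF assms(2,3)]] by (rule conjunct1, rule conjunct2)
qed

lemma law_prob:
  assumes "t \<in> {0..T}" "x \<in> pts D" "y \<in> pts D"
  shows "prob_space (law1 \<nu> t x)" "prob_space (law2 \<nu> t x y)"
proof -
  show "prob_space (law1 \<nu> t x)"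
    unfolding law1_def
    by (rule prob_space.prob_space_distr[OF young_sets(1)[OF assms] coordinate_borel[OF young_sets(2)[OF assms]]]) simp
  show "prob_space (law2 \<nu> t x y)"
    unfolding law2_def
    by (rule prob_space.prob_space_distr[OF young_sets(3)[OF assms] pair_coordinates_borel[OF young_sets(4)[OF assms]]])
qed

lemma sets_law [simp]: "sets (law1 \<nu> t x) = sets borel" "sets (law2 \<nu> t x y) = sets borel"
  by (simp_all add: law1_def law2_def)

lemma law1_integrals:
  fixes f :: "'n phase \<Rightarrow> real" and h :: "'n phase \<Rightarrow> ennreal"
  assumes "t \<in> {0..T}" "x \<in> pts D"
  shows "f \<in> borel_measurable borel \<Longrightarrow> (\<integral>\<xi>. f (\<xi> 0) \<partial>\<nu> 1 t (tuple [x])) = (\<integral>\<xi>. f \<xi> \<partial>law1 \<nu> t x)"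
    "f \<in> borel_measurable borel \<Longrightarrow> integrable (\<nu> 1 t (tuple [x])) (\<lambda>\<xi>. f (\<xi> 0)) \<longleftrightarrow> integrable (law1 \<nu> t x) f"
    "h \<in> borel_measurable borel \<Longrightarrow> (\<integral>\<^sup>+ \<xi>. h (\<xi> 0) \<partial>\<nu> 1 t (tuple [x])) = (\<integral>\<^sup>+ \<xi>. h \<xi> \<partial>law1 \<nu> t x)"
proof -
  have c: "(\<lambda>\<xi>. \<xi> 0) \<in> \<nu> 1 t (tuple [x]) \<rightarrow>\<^sub>M borel"
    by (rule coordinate_borel[OF young_sets(2)[OF assms assms(2)]]) simp
  show "f \<in> borel_measurable borel \<Longrightarrow> (\<integral>\<xi>. f (\<xi> 0) \<partial>\<nu> 1 t (tuple [x])) = (\<integral>\<xi>. f \<xi> \<partial>law1 \<nu> t x)"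
    unfolding law1_def by (rule integral_distr[OF c, symmetric])
  show "f \<in> borel_measurable borel \<Longrightarrow> integrable (\<nu> 1 t (tuple [x])) (\<lambda>\<xi>. f (\<xi> 0)) \<longleftrightarrow> integrable (law1 \<nu> t x) f"
    unfolding law1_def by (rule integrable_distr_eq[OF c, symmetric])
  show "h \<in> borel_measurable borel \<Longrightarrow> (\<integral>\<^sup>+ \<xi>. h (\<xi> 0) \<partial>\<nu> 1 t (tuple [x])) = (\<integral>\<^sup>+ \<xi>. h \<xi> \<partial>law1 \<nu> t x)"
    unfolding law1_def by (rule nn_integral_distr[OF c, symmetric]) simp
qed

lemma law2_integrals:
  fixes f :: "'n phase \<times> 'n phase \<Rightarrow> real" and h :: "'n phase \<times> 'n phase \<Rightarrow> ennreal"
  assumes "t \<in> {0..T}" "x \<in> pts D" "y \<in> pts D"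
  shows "f \<in> borel_measurable borel \<Longrightarrow> (\<integral>\<xi>. f (\<xi> 0, \<xi> 1) \<partial>\<nu> 2 t (tuple [x, y])) = (\<integral>\<xi>. f \<xi> \<partial>law2 \<nu> t x y)"
    "f \<in> borel_measurable borel \<Longrightarrow> integrable (\<nu> 2 t (tuple [x, y])) (\<lambda>\<xi>. f (\<xi> 0, \<xi> 1)) \<longleftrightarrow> integrable (law2 \<nu> t x y) f"
    "h \<in> borel_measurable borel \<Longrightarrow> (\<integral>\<^sup>+ \<xi>. h (\<xi> 0, \<xi> 1) \<partial>\<nu> 2 t (tuple [x, y])) = (\<integral>\<^sup>+ \<xi>. h \<xi> \<partial>law2 \<nu> t x y)"
proof -
  have c: "(\<lambda>\<xi>. (\<xi> 0, \<xi> 1)) \<in> \<nu> 2 t (tuple [x, y]) \<rightarrow>\<^sub>M borel"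
    by (rule pair_coordinates_borel[OF young_sets(4)[OF assms]])
  show "f \<in> borel_measurable borel \<Longrightarrow> (\<integral>\<xi>. f (\<xi> 0, \<xi> 1) \<partial>\<nu> 2 t (tuple [x, y])) = (\<integral>\<xi>. f \<xi> \<partial>law2 \<nu> t x y)"
    unfolding law2_def by (rule integral_distr[OF c, symmetric])
  show "f \<in> borel_measurable borel \<Longrightarrow> integrable (\<nu> 2 t (tuple [x, y])) (\<lambda>\<xi>. f (\<xi> 0, \<xi> 1)) \<longleftrightarrow> integrable (law2 \<nu> t x y) f"
    unfolding law2_def by (rule integrable_distr_eq[OF c, symmetric])
  show "h \<in> borel_measurable borel \<Longrightarrow> (\<integral>\<^sup>+ \<xi>. h (\<xi> 0, \<xi> 1) \<partial>\<nu> 2 t (tuple [x, y])) = (\<integral>\<^sup>+ \<xi>. h \<xi> \<partial>law2 \<nu> t x y)"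
    unfolding law2_def by (rule nn_integral_distr[OF c, symmetric]) simp
qed

lemma AE_spacetime2:
  assumes "AE (t, x) in spacetime D T 2. P t x"
  shows "AE (t, x, y) in S2 D T. P t (tuple [x, y])"
proof -
  interpret coding "S2 D T" "base D T 2" "enc2 D T" "\<lambda>p. (fst p, snd p 0, snd p 1)" by (rule coding2[OF T])
  show ?thesis
    using AE_enc[OF assms[unfolded spacetime_base]] AE_S2_pts
    by eventually_elim (auto simp: enc_on_points)
qed

lemma
  fixes f :: "real \<times> (nat \<Rightarrow> real^'n) \<Rightarrow> real"
  assumes f': "f' \<in> borel_measurable (S1 D T)" and ae: "AE (t, x) in S1 D T. f (t, tuple [x]) = f' (t, x)"
  shows integrable_spacetime1: "integrable (spacetime D T 1) f \<longleftrightarrow> integrable (S1 D T) f'"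
    and integral_spacetime1: "(\<integral>p. f p \<partial>spacetime D T 1) = (\<integral>s. f' s \<partial>S1 D T)"
proof -
  interpret coding "S1 D T" "base D T 1" "enc1 D T" "\<lambda>p. (fst p, snd p 0)" by (rule coding1[OF T])
  have "AE s in S1 D T. f (enc1 D T s) = f' s"
    using ae AE_S1_pts by eventually_elim (auto simp: enc_on_points)
  from integrable_code[OF f' this] integral_code[OF f' this]
  show "integrable (spacetime D T 1) f \<longleftrightarrow> integrable (S1 D T) f'"
    "(\<integral>p. f p \<partial>spacetime D T 1) = (\<integral>s. f' s \<partial>S1 D T)"
    unfolding spacetime_base .
qed

lemma
  fixes f :: "real \<times> (nat \<Rightarrow> real^'n) \<Rightarrow> real"
  assumes f': "f' \<in> borel_measurable (S2 D T)" and ae: "AE (t, x, y) in S2 D T. f (t, tuple [x, y]) = f' (t, x, y)"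
  shows integrable_spacetime2: "integrable (spacetime D T 2) f \<longleftrightarrow> integrable (S2 D T) f'"
    and integral_spacetime2: "(\<integral>p. f p \<partial>spacetime D T 2) = (\<integral>s. f' s \<partial>S2 D T)"
proof -
  interpret coding "S2 D T" "base D T 2" "enc2 D T" "\<lambda>p. (fst p, snd p 0, snd p 1)" by (rule coding2[OF T])
  have "AE s in S2 D T. f (enc2 D T s) = f' s"
    using ae AE_S2_pts by eventually_elim (auto simp: enc_on_points)
  from integrable_code[OF f' this] integral_code[OF f' this]
  show "integrable (spacetime D T 2) f \<longleftrightarrow> integrable (S2 D T) f'"
    "(\<integral>p. f p \<partial>spacetime D T 2) = (\<integral>s. f' s \<partial>S2 D T)"
    unfolding spacetime_base .
qed

lemma exists_kernel1:
  "\<exists>\<kappa>. \<kappa> \<in> S1 D T \<rightarrow>\<^sub>M prob_algebra borel \<and> (AE (t, x) in S1 D T. law1 \<nu> t x = \<kappa> (t, x))"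
proof -
  interpret coding "S1 D T" "base D T 1" "enc1 D T" "\<lambda>p. (fst p, snd p 0)" by (rule coding1[OF T])
  have p: "AE s in S1 D T. prob_space (law1 \<nu> (fst s) (snd s)) \<and> sets (law1 \<nu> (fst s) (snd s)) = sets borel"
    using AE_S1_pts by eventually_elim (auto intro: law_prob)
  have m: "\<exists>g'\<in>borel_measurable (S1 D T). AE s in S1 D T. (\<integral>\<xi>. g \<xi> \<partial>law1 \<nu> (fst s) (snd s)) = g' s"
    if g: "g \<in> vanishing" for g :: "'n phase \<Rightarrow> real"
  proof -
    have gm: "g \<in> borel_measurable borel" by (intro borel_measurable_continuous_onI vanishingD(1)[OF g])
    have "(\<lambda>(t, x). \<integral>\<xi>. g (\<xi> 0) \<partial>\<nu> 1 t x) \<in> borel_measurable (completion (base D T 1))"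
      using young[OF order_refl] C0_of_vanishing[OF g] unfolding young_measure_def spacetime_base by blast
    then obtain g' where g': "g' \<in> borel_measurable (base D T 1)"
      "AE p in base D T 1. (case p of (t, x) \<Rightarrow> \<integral>\<xi>. g (\<xi> 0) \<partial>\<nu> 1 t x) = g' p"
      using completion_ex_borel_measurable_real by blast
    have "AE s in S1 D T. (case enc1 D T s of (t, x) \<Rightarrow> \<integral>\<xi>. g (\<xi> 0) \<partial>\<nu> 1 t x) = g' (enc1 D T s)"
      using AE_enc[OF AE_completion[OF g'(2)]] .
    then have "AE s in S1 D T. (\<integral>\<xi>. g \<xi> \<partial>law1 \<nu> (fst s) (snd s)) = g' (enc1 D T s)"
      using AE_S1_pts by eventually_elim (auto simp: enc_on_points law1_integrals(1)[OF _ _ gm])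
    moreover have "(\<lambda>s. g' (enc1 D T s)) \<in> borel_measurable (S1 D T)"
      using g'(1) enc by measurable
    ultimately show ?thesis by (rule bexI[where x="\<lambda>s. g' (enc1 D T s)"])
  qed
  obtain \<kappa> where "\<kappa> \<in> S1 D T \<rightarrow>\<^sub>M prob_algebra borel" "AE s in S1 D T. law1 \<nu> (fst s) (snd s) = \<kappa> s"
    using borel_kernel_version[OF p m] by blast
  then show ?thesis by (auto simp: case_prod_unfold)
qed

lemma exists_kernel2:
  "\<exists>\<kappa>. \<kappa> \<in> S2 D T \<rightarrow>\<^sub>M prob_algebra borel \<and> (AE (t, x, y) in S2 D T. law2 \<nu> t x y = \<kappa> (t, x, y))"
proof -
  interpret coding "S2 D T" "base D T 2" "enc2 D T" "\<lambda>p. (fst p, snd p 0, snd p 1)" by (rule coding2[OF T])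
  let ?J = "\<lambda>s. law2 \<nu> (fst s) (fst (snd s)) (snd (snd s))"
  have p: "AE s in S2 D T. prob_space (?J s) \<and> sets (?J s) = sets borel"
    using AE_S2_pts by eventually_elim (auto intro: law_prob)
  have m: "\<exists>g'\<in>borel_measurable (S2 D T). AE s in S2 D T. (\<integral>\<xi>. g \<xi> \<partial>?J s) = g' s"
    if g: "g \<in> vanishing" for g :: "'n phase \<times> 'n phase \<Rightarrow> real"
  proof -
    have gm: "g \<in> borel_measurable borel" by (intro borel_measurable_continuous_onI vanishingD(1)[OF g])
    have "(\<lambda>(t, x). \<integral>\<xi>. g (\<xi> 0, \<xi> 1) \<partial>\<nu> 2 t x) \<in> borel_measurable (completion (base D T 2))"
      using young[OF one_le_numeral] C0_of_vanishing_pair[OF g] unfolding young_measure_def spacetime_base by blast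
    then obtain g' where g': "g' \<in> borel_measurable (base D T 2)"
      "AE p in base D T 2. (case p of (t, x) \<Rightarrow> \<integral>\<xi>. g (\<xi> 0, \<xi> 1) \<partial>\<nu> 2 t x) = g' p"
      using completion_ex_borel_measurable_real by blast
    have "AE s in S2 D T. (case enc2 D T s of (t, x) \<Rightarrow> \<integral>\<xi>. g (\<xi> 0, \<xi> 1) \<partial>\<nu> 2 t x) = g' (enc2 D T s)"
      using AE_enc[OF AE_completion[OF g'(2)]] .
    then have "AE s in S2 D T. (\<integral>\<xi>. g \<xi> \<partial>?J s) = g' (enc2 D T s)"
      using AE_S2_pts by eventually_elim (auto simp: enc_on_points law2_integrals(1)[OF _ _ _ gm])
    moreover have "(\<lambda>s. g' (enc2 D T s)) \<in> borel_measurable (S2 D T)"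
      using g'(1) enc by measurable
    ultimately show ?thesis by (rule bexI[where x="\<lambda>s. g' (enc2 D T s)"])
  qed
  obtain \<kappa> where "\<kappa> \<in> S2 D T \<rightarrow>\<^sub>M prob_algebra borel" "AE s in S2 D T. ?J s = \<kappa> s"
    using borel_kernel_version[OF p m] by blast
  then show ?thesis by (auto simp: case_prod_unfold)
qed

end

text \<open>
  A statistical solution together with Borel versions of its one-point and two-point laws.
\<close>

locale kernels =
  fixes D :: space_domain and T :: real and \<nu> :: "'n::finite correlation" and \<kappa>1 and \<kappa>2
  assumes T: "0 < T" and sol: "statistical_solution D T \<nu>"
    and k1: "\<kappa>1 \<in> S1 D T \<rightarrow>\<^sub>M prob_algebra borel"
    and k2: "\<kappa>2 \<in> S2 D T \<rightarrow>\<^sub>M prob_algebra borel"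
    and law1: "AE (t, x) in S1 D T. law1 \<nu> t x = \<kappa>1 (t, x)"
    and law2: "AE (t, x, y) in S2 D T. law2 \<nu> t x y = \<kappa>2 (t, x, y)"
begin

lemmas [measurable] = kernel_subprob[OF k1] kernel_subprob[OF k2]

lemma prob_kernel: "prob_space (\<kappa>1 r)" "prob_space (\<kappa>2 s)"
  and sets_kernels [simp, measurable_cong]: "sets (\<kappa>1 r) = sets borel" "sets (\<kappa>2 s) = sets borel"
  using kernel_prob[OF k1, of r] kernel_prob[OF k2, of s] by simp_all

lemma space_kernels [simp]: "space (\<kappa>1 r) = UNIV" "space (\<kappa>2 s) = UNIV"
  using sets_eq_imp_space_eq[OF sets_kernels(1)] sets_eq_imp_space_eq[OF sets_kernels(2)] by simp_all

lemma bracket1: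
  "AE (t, x) in S1 D T. (\<forall>f\<in>borel_measurable borel. (\<integral>\<xi>. (f (\<xi> 0) :: real) \<partial>\<nu> 1 t (tuple [x])) = (\<integral>\<xi>. f \<xi> \<partial>\<kappa>1 (t, x)) \<and>
      (integrable (\<nu> 1 t (tuple [x])) (\<lambda>\<xi>. f (\<xi> 0)) \<longleftrightarrow> integrable (\<kappa>1 (t, x)) f)) \<and>
    (\<forall>h\<in>borel_measurable borel. (\<integral>\<^sup>+ \<xi>. (h (\<xi> 0) :: ennreal) \<partial>\<nu> 1 t (tuple [x])) = (\<integral>\<^sup>+ \<xi>. h \<xi> \<partial>\<kappa>1 (t, x)))"
  using law1 AE_S1_pts
  by eventually_elim (auto simp: law1_integrals[OF T sol])

lemma bracket2:
  "AE (t, x, y) in S2 D T. (\<forall>f\<in>borel_measurable borel. (\<integral>\<xi>. (f (\<xi> 0, \<xi> 1) :: real) \<partial>\<nu> 2 t (tuple [x, y])) = (\<integral>\<xi>. f \<xi> \<partial>\<kappa>2 (t, x, y)) \<and>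
      (integrable (\<nu> 2 t (tuple [x, y])) (\<lambda>\<xi>. f (\<xi> 0, \<xi> 1)) \<longleftrightarrow> integrable (\<kappa>2 (t, x, y)) f)) \<and>
    (\<forall>h\<in>borel_measurable borel. (\<integral>\<^sup>+ \<xi>. (h (\<xi> 0, \<xi> 1) :: ennreal) \<partial>\<nu> 2 t (tuple [x, y])) = (\<integral>\<^sup>+ \<xi>. h \<xi> \<partial>\<kappa>2 (t, x, y)))"
  using law2 AE_S2_pts
  by eventually_elim (auto simp: law2_integrals[OF T sol])

lemma vanishing_borel: "g \<in> vanishing \<Longrightarrow> g \<in> borel_measurable borel"
  by (intro borel_measurable_continuous_onI vanishingD(1))

text \<open>The symmetry condition for the transposition of the two points.\<close>

lemma kernel_swap: "AE (t, x, y) in S2 D T. \<kappa>2 (t, y, x) = distr (\<kappa>2 (t, x, y)) borel prod.swap"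
proof -
  have "AE s in S2 D T. (case s of (t, x, y) \<Rightarrow> \<kappa>2 (t, y, x)) = (case s of (t, x, y) \<Rightarrow> distr (\<kappa>2 (t, x, y)) borel prod.swap)"
  proof (rule AE_measure_eqI)
    show "AE s in S2 D T. prob_space (case s of (t, x, y) \<Rightarrow> \<kappa>2 (t, y, x)) \<and> sets (case s of (t, x, y) \<Rightarrow> \<kappa>2 (t, y, x)) = sets borel"
      by (auto simp: prob_kernel)
    have "prob_space (distr (\<kappa>2 s) borel prod.swap)" for s
      by (rule prob_space.prob_space_distr) (auto simp: prob_kernel swap_borel cong: measurable_cong_sets)
    then show "AE s in S2 D T. prob_space (case s of (t, x, y) \<Rightarrow> distr (\<kappa>2 (t, x, y)) borel prod.swap) \<and>
        sets (case s of (t, x, y) \<Rightarrow> distr (\<kappa>2 (t, x, y)) borel prod.swap) = sets borel"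
      by auto
    fix g :: "'n phase \<times> 'n phase \<Rightarrow> real" assume g: "g \<in> vanishing"
    let ?\<sigma> = "Transposition.transpose 0 (1::nat)"
    have perm: "?\<sigma> permutes {..<2}" by (rule permutes_swap_id) auto
    have tup: "tuple [x, y] \<circ> ?\<sigma> = tuple [y, x]" for x y :: "real^'n"
    proof
      fix j show "(tuple [x, y] \<circ> ?\<sigma>) j = tuple [y, x] j"
      proof -
        consider "j = 0" | "j = 1" | "2 \<le> j" by linarith
        then show ?thesis by cases (simp_all add: tuple_def Transposition.transpose_def)
      qed
    qed
    have "AE (t, x) in spacetime D T 2. (\<integral>\<xi>. g (\<xi> 0, \<xi> 1) \<partial>\<nu> 2 t (x \<circ> ?\<sigma>)) = (\<integral>\<xi>. g ((\<xi> \<circ> ?\<sigma>) 0, (\<xi> \<circ> ?\<sigma>) 1) \<partial>\<nu> 2 t x)"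
    proof -
      have "symmetry_cond D T \<nu>" using sol by (simp add: statistical_solution_def)
      then show ?thesis
        using C0_of_vanishing_pair[OF g] perm order_refl[of 2] one_le_numeral unfolding symmetry_cond_def by blast
    qed
    from AE_spacetime2[OF T sol this]
    have "AE (t, x, y) in S2 D T. (\<integral>\<xi>. g (\<xi> 0, \<xi> 1) \<partial>\<nu> 2 t (tuple [y, x])) = (\<integral>\<xi>. g (\<xi> 1, \<xi> 0) \<partial>\<nu> 2 t (tuple [x, y]))"
      by (simp add: tup)
    then show "AE s in S2 D T. (\<integral>\<xi>. g \<xi> \<partial>(case s of (t, x, y) \<Rightarrow> \<kappa>2 (t, y, x))) = (\<integral>\<xi>. g \<xi> \<partial>(case s of (t, x, y) \<Rightarrow> distr (\<kappa>2 (t, x, y)) borel prod.swap))"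
      using bracket2 AE_S2_swap[OF bracket2]
    proof eventually_elim
      case (elim s)
      obtain t x y where s: "s = (t, x, y)" by (cases s)
      have gs: "(\<lambda>\<xi>. g (prod.swap \<xi>)) \<in> borel_measurable borel"
        by (rule measurable_compose[OF swap_borel vanishing_borel[OF g]])
      have "(\<integral>\<xi>. g \<xi> \<partial>distr (\<kappa>2 (t, x, y)) borel prod.swap) = (\<integral>\<xi>. g (prod.swap \<xi>) \<partial>\<kappa>2 (t, x, y))"
        by (rule integral_distr) (auto simp: swap_borel vanishing_borel[OF g] cong: measurable_cong_sets)
      also have "\<dots> = (\<integral>\<xi>. g (\<xi> 1, \<xi> 0) \<partial>\<nu> 2 t (tuple [x, y]))"
        using conjunct1[OF bspec[OF conjunct1[OF elim(2)[unfolded s prod.case]] gs]] by simp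
      also have "\<dots> = (\<integral>\<xi>. g \<xi> \<partial>\<kappa>2 (t, y, x))"
        using conjunct1[OF bspec[OF conjunct1[OF elim(3)[unfolded s prod.case]] vanishing_borel[OF g]]]
          elim(1)[unfolded s prod.case] by simp
      finally show ?case unfolding s by simp
    qed
  qed
  then show ?thesis by (simp add: case_prod_unfold)
qed

text \<open>The consistency condition, combined with the Borel versions of both laws.\<close>

lemma kernel_fst: "AE (t, x, y) in S2 D T. \<kappa>1 (t, x) = distr (\<kappa>2 (t, x, y)) borel fst"
proof -
  have "AE s in S2 D T. (case s of (t, x, y) \<Rightarrow> \<kappa>1 (t, x)) = (case s of (t, x, y) \<Rightarrow> distr (\<kappa>2 (t, x, y)) borel fst)"
  proof (rule AE_measure_eqI)
    show "AE s in S2 D T. prob_space (case s of (t, x, y) \<Rightarrow> \<kappa>1 (t, x)) \<and> sets (case s of (t, x, y) \<Rightarrow> \<kappa>1 (t, x)) = sets borel"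
      by (auto simp: prob_kernel)
    have "prob_space (distr (\<kappa>2 s) borel fst)" for s
      by (rule prob_space.prob_space_distr) (auto simp: prob_kernel fst_borel cong: measurable_cong_sets)
    then show "AE s in S2 D T. prob_space (case s of (t, x, y) \<Rightarrow> distr (\<kappa>2 (t, x, y)) borel fst) \<and>
        sets (case s of (t, x, y) \<Rightarrow> distr (\<kappa>2 (t, x, y)) borel fst) = sets borel"
      by auto
    fix g :: "'n phase \<Rightarrow> real" assume g: "g \<in> vanishing"
    have tup: "restrict (tuple [x, y]) {..<1} = tuple [x]" for x y :: "real^'n"
      by (auto simp: tuple_def fun_eq_iff)
    have eq: "(2::nat) - 1 = 1" by simp
    have "consistency_cond D T \<nu>" using sol by (simp add: statistical_solution_def)
    then have "\<forall>g\<in>C0 (2 - 1). AE (t, x) in spacetime D T 2.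
        (\<integral>\<xi>. g \<xi> \<partial>\<nu> 2 t x) = (\<integral>\<xi>. g \<xi> \<partial>\<nu> (2 - 1) t (restrict x {..<2 - 1}))"
      using order_refl[of 2] unfolding consistency_cond_def by blast
    from bspec[OF this[unfolded eq] C0_of_vanishing[OF g]]
    have "AE (t, x) in spacetime D T 2. (\<integral>\<xi>. g (\<xi> 0) \<partial>\<nu> 2 t x) = (\<integral>\<xi>. g (\<xi> 0) \<partial>\<nu> 1 t (restrict x {..<1}))" .
    from AE_spacetime2[OF T sol this]
    have "AE (t, x, y) in S2 D T. (\<integral>\<xi>. g (\<xi> 0) \<partial>\<nu> 2 t (tuple [x, y])) = (\<integral>\<xi>. g (\<xi> 0) \<partial>\<nu> 1 t (tuple [x]))"
      by (simp add: tup)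
    then show "AE s in S2 D T. (\<integral>\<xi>. g \<xi> \<partial>(case s of (t, x, y) \<Rightarrow> \<kappa>1 (t, x))) = (\<integral>\<xi>. g \<xi> \<partial>(case s of (t, x, y) \<Rightarrow> distr (\<kappa>2 (t, x, y)) borel fst))"
      using bracket2 AE_S2_of_S1[OF bracket1]
    proof eventually_elim
      case (elim s)
      obtain t x y where s: "s = (t, x, y)" by (cases s)
      have gs: "(\<lambda>\<xi> :: 'n phase \<times> 'n phase. g (fst \<xi>)) \<in> borel_measurable borel"
        by (rule measurable_compose[OF fst_borel vanishing_borel[OF g]])
      have "(\<integral>\<xi>. g \<xi> \<partial>distr (\<kappa>2 (t, x, y)) borel fst) = (\<integral>\<xi>. g (fst \<xi>) \<partial>\<kappa>2 (t, x, y))"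
        by (rule integral_distr) (auto simp: fst_borel vanishing_borel[OF g] cong: measurable_cong_sets)
      also have "\<dots> = (\<integral>\<xi>. g (\<xi> 0) \<partial>\<nu> 2 t (tuple [x, y]))"
        using conjunct1[OF bspec[OF conjunct1[OF elim(2)[unfolded s prod.case]] gs]] by simp
      also have "\<dots> = (\<integral>\<xi>. g \<xi> \<partial>\<kappa>1 (t, x))"
        using conjunct1[OF bspec[OF conjunct1[OF elim(3)[unfolded s prod.case]] vanishing_borel[OF g]]]
          elim(1)[unfolded s prod.case] by simp
      finally show ?case unfolding s by simp
    qed
  qed
  then show ?thesis by (simp add: case_prod_unfold)
qed

end

section \<open>Integrals over pairs of points and their phases\<close>

definition vL :: "'s \<times> 'n::finite phase \<times> 'n phase \<Rightarrow> real^'n" where "vL q = fst (fst (snd q))"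
definition pL :: "'s \<times> 'n::finite phase \<times> 'n phase \<Rightarrow> real" where "pL q = snd (fst (snd q))"
definition vR :: "'s \<times> 'n::finite phase \<times> 'n phase \<Rightarrow> real^'n" where "vR q = fst (snd (snd q))"
definition pR :: "'s \<times> 'n::finite phase \<times> 'n phase \<Rightarrow> real" where "pR q = snd (snd (snd q))"
definition tm :: "(real \<times> (real^'n) \<times> (real^'n)) \<times> 'x \<Rightarrow> real" where "tm q = fst (fst q)"
definition xL :: "(real \<times> (real^'n) \<times> (real^'n)) \<times> 'x \<Rightarrow> real^'n" where "xL q = fst (snd (fst q))"
definition xR :: "(real \<times> (real^'n) \<times> (real^'n)) \<times> 'x \<Rightarrow> real^'n" where "xR q = snd (snd (fst q))"

lemmas coords = vL_def pL_def vR_def pR_def tm_def xL_def xR_def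

abbreviation pair_space :: "((real \<times> (real^'n) \<times> (real^'n)) \<times> 'n::finite phase \<times> 'n phase) measure" where
  "pair_space \<equiv> (borel \<Otimes>\<^sub>M (borel \<Otimes>\<^sub>M borel)) \<Otimes>\<^sub>M borel"

lemma coords_measurable [measurable]:
  "vL \<in> borel_measurable (M \<Otimes>\<^sub>M borel)" "pL \<in> borel_measurable (M \<Otimes>\<^sub>M borel)"
  "vR \<in> borel_measurable (M \<Otimes>\<^sub>M borel)" "pR \<in> borel_measurable (M \<Otimes>\<^sub>M borel)"
  unfolding vL_def[abs_def] pL_def[abs_def] vR_def[abs_def] pR_def[abs_def]
  by (intro measurable_compose[OF measurable_snd] measurable_compose[OF fst_borel] measurable_compose[OF snd_borel] fst_borel snd_borel)+

lemma points_measurable [measurable]: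
  "tm \<in> borel_measurable ((borel \<Otimes>\<^sub>M (borel \<Otimes>\<^sub>M borel)) \<Otimes>\<^sub>M M)"
  "xL \<in> borel_measurable ((borel \<Otimes>\<^sub>M (borel \<Otimes>\<^sub>M borel)) \<Otimes>\<^sub>M M)"
  "xR \<in> borel_measurable ((borel \<Otimes>\<^sub>M (borel \<Otimes>\<^sub>M borel)) \<Otimes>\<^sub>M M)"
  unfolding tm_def[abs_def] xL_def[abs_def] xR_def[abs_def] by measurable

definition flip :: "(real \<times> (real^'n) \<times> (real^'n)) \<times> 'n::finite phase \<times> 'n phase \<Rightarrow> (real \<times> (real^'n) \<times> (real^'n)) \<times> 'n phase \<times> 'n phase" where
  "flip q = ((tm q, xR q, xL q), (vR q, pR q), (vL q, pL q))"

lemma flip_simps [simp]: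
  "vL (flip q) = vR q" "pL (flip q) = pR q" "vR (flip q) = vL q" "pR (flip q) = pL q"
  "tm (flip q) = tm q" "xL (flip q) = xR q" "xR (flip q) = xL q"
  by (simp_all add: flip_def coords)

lemma flip_measurable [measurable]: "flip \<in> pair_space \<rightarrow>\<^sub>M pair_space"
proof -
  have "(\<lambda>q. (tm q, xR q, xL q)) \<in> pair_space \<rightarrow>\<^sub>M borel \<Otimes>\<^sub>M (borel \<Otimes>\<^sub>M borel)" by measurable
  moreover have "(\<lambda>q. ((vR q, pR q), (vL q, pL q))) \<in> (pair_space :: (_ \<times> 'a phase \<times> 'a phase) measure) \<rightarrow>\<^sub>M (borel \<Otimes>\<^sub>M borel) \<Otimes>\<^sub>M (borel \<Otimes>\<^sub>M borel)"
    by measurable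
  then have "(\<lambda>q. ((vR q, pR q), (vL q, pL q))) \<in> (pair_space :: (_ \<times> 'a phase \<times> 'a phase) measure) \<rightarrow>\<^sub>M borel"
    by (simp only: borel_prod)
  ultimately show ?thesis unfolding flip_def[abs_def] by (rule measurable_Pair)
qed

definition strip :: "space_domain \<Rightarrow> real \<Rightarrow> real^'n \<Rightarrow> real^'n \<Rightarrow> real" where
  "strip D e x y = indicator (ball 0 e) (rep D (x - y))"

lemma strip_measurable [measurable]:
  assumes [measurable]: "f \<in> borel_measurable M" "g \<in> borel_measurable M"
  shows "(\<lambda>q. strip D e (f q) (g q)) \<in> borel_measurable M"
  unfolding strip_def by measurable

lemma strip_bounds [simp]: "0 \<le> strip D e x y" "strip D e x y \<le> 1"
  by (simp_all add: strip_def indicator_def)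

text \<open>The function rep fails to be odd only at half-integer coordinates.\<close>

lemma rep_minus_small:
  assumes "norm (rep D z) < e" "e \<le> 1/2"
  shows "rep D (- z) = - rep D z"
proof (cases D)
  case Torus
  have "round (- (z $ i)) = - round (z $ i)" for i
    using component_le_norm_cart[of "rep D z" i] assms
    by (intro round_unique) (auto simp: rep_def Torus abs_if split: if_splits)
  then show ?thesis by (simp add: rep_def Torus vec_eq_iff)
qed (simp add: rep_def)

lemma rep_reflect:
  assumes h: "\<And>z. e \<le> norm z \<Longrightarrow> h z = 0" and e: "e \<le> 1/2"
  shows "h (rep D (y - x)) = h (- rep D (x - y))"
proof (cases "norm (rep D (x - y)) < e")
  case True
  then show ?thesis using rep_minus_small[OF True e] by simp
next
  case False
  then have "\<not> norm (rep D (y - x)) < e" using rep_minus_small[of D "y - x" e] e by auto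
  then show ?thesis using False h by simp
qed

lemma strip_commute: "e \<le> 1/2 \<Longrightarrow> strip D e x y = strip D e y x"
  using rep_reflect[of e "indicator (ball 0 e)" D x y] by (simp add: strip_def indicator_def)

text \<open>
  This dominates all integrands in one phase, and the integrability condition makes it integrable over
  space-time.
\<close>

definition size1 :: "'n::finite phase \<Rightarrow> real" where
  "size1 a = (norm (fst a))\<^sup>2 + (norm (fst a))^3 + \<bar>snd a\<bar> powr (3/2)"

lemma size1_nonneg [simp]: "0 \<le> size1 a" by (simp add: size1_def)

lemma size1_measurable [measurable]: "size1 \<in> borel_measurable borel"
  unfolding size1_def[abs_def] borel_prod[symmetric] by measurable

definition sizes :: "'s \<times> 'n::finite phase \<times> 'n phase \<Rightarrow> real" where
  "sizes q = size1 (vL q, pL q) + size1 (vR q, pR q)"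

lemma sizes_nonneg [simp]: "0 \<le> sizes q" by (simp add: sizes_def)

lemma sizes_measurable [measurable]: "sizes \<in> borel_measurable (M \<Otimes>\<^sub>M borel)"
  unfolding sizes_def[abs_def] size1_def by measurable

lemma nn_integral_lebesgue_on:
  fixes f g :: "'a::euclidean_space \<Rightarrow> ennreal"
  assumes [measurable]: "A \<in> sets borel" "g \<in> borel_measurable borel"
    and ae: "AE x in lborel. x \<in> A \<longrightarrow> f x = g x"
  shows "(\<integral>\<^sup>+ x. f x \<partial>lebesgue_on A) = (\<integral>\<^sup>+ x. g x \<partial>density lborel (indicator A))"
proof -
  have "(\<integral>\<^sup>+ x. f x \<partial>lebesgue_on A) = (\<integral>\<^sup>+ x. f x * indicator A x \<partial>lebesgue)"
    by (rule nn_integral_restrict_space) simp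
  also have "\<dots> = (\<integral>\<^sup>+ x. f x * indicator A x \<partial>lborel)"
    by (rule nn_integral_completion)
  also have "\<dots> = (\<integral>\<^sup>+ x. indicator A x * g x \<partial>lborel)"
    using ae by (intro nn_integral_cong_AE) (auto elim!: eventually_mono simp: indicator_def)
  also have "\<dots> = (\<integral>\<^sup>+ x. g x \<partial>density lborel (indicator A))"
    by (subst nn_integral_density) auto
  finally show ?thesis .
qed

lemma AE_dom_measure_iff: "(AE x in dom_measure D. P x) \<longleftrightarrow> (AE x in lborel. x \<in> pts D \<longrightarrow> P x)"
  unfolding dom_measure_def by (subst AE_density) (auto simp: indicator_def)

lemma AE_time_measure_iff: "(AE t in time_measure T. P t) \<longleftrightarrow> (AE t in lborel. t \<in> {0..T} \<longrightarrow> P t)"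
  unfolding time_measure_def by (subst AE_density) (auto simp: indicator_def)

lemma distr_S2_assoc: "distr (S1 D T \<Otimes>\<^sub>M dom_measure D) (S2 D T) (\<lambda>p. (fst (fst p), snd (fst p), snd p)) = S2 D T"
proof (rule measure_eqI)
  have m [measurable]: "(\<lambda>p. (fst (fst p), snd (fst p), snd p)) \<in> S1 D T \<Otimes>\<^sub>M dom_measure D \<rightarrow>\<^sub>M S2 D T"
    unfolding S1_def S2_def by measurable
  fix A assume "A \<in> sets (distr (S1 D T \<Otimes>\<^sub>M dom_measure D) (S2 D T) (\<lambda>p. (fst (fst p), snd (fst p), snd p)))"
  then have A': "A \<in> sets (S2 D T)" by simp
  then have A [measurable]: "A \<in> sets (borel \<Otimes>\<^sub>M (borel \<Otimes>\<^sub>M borel))" by simp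
  have "emeasure (distr (S1 D T \<Otimes>\<^sub>M dom_measure D) (S2 D T) (\<lambda>p. (fst (fst p), snd (fst p), snd p))) A
      = (\<integral>\<^sup>+ s. indicator A s \<partial>distr (S1 D T \<Otimes>\<^sub>M dom_measure D) (S2 D T) (\<lambda>p. (fst (fst p), snd (fst p), snd p)))"
    using A' by simp
  also have "\<dots> = (\<integral>\<^sup>+ p. indicator A (fst (fst p), snd (fst p), snd p) \<partial>(S1 D T \<Otimes>\<^sub>M dom_measure D))"
    by (rule nn_integral_distr[OF m]) simp
  also have "\<dots> = (\<integral>\<^sup>+ r. (\<integral>\<^sup>+ y. indicator A (fst r, snd r, y) \<partial>dom_measure D) \<partial>S1 D T)"
    by (subst dom.nn_integral_fst[symmetric]) (simp_all add: case_prod_unfold)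
  also have "\<dots> = (\<integral>\<^sup>+ s. indicator A s \<partial>S2 D T)"
  proof -
    have "(\<integral>\<^sup>+ r. (\<integral>\<^sup>+ y. indicator A (fst r, snd r, y) \<partial>dom_measure D) \<partial>S1 D T) =
      (\<integral>\<^sup>+ t. (\<integral>\<^sup>+ x. (\<integral>\<^sup>+ y. indicator A (t, x, y) \<partial>dom_measure D) \<partial>dom_measure D) \<partial>time_measure T)"
      by (subst nn_integral_S1[where f="\<lambda>r. \<integral>\<^sup>+ y. indicator A (fst r, snd r, y) \<partial>dom_measure D"]) simp_all
    then show ?thesis using nn_integral_S2[of "indicator A" D T] A by simp
  qed
  also have "\<dots> = emeasure (S2 D T) A" using A' by simp
  finally show "emeasure (distr (S1 D T \<Otimes>\<^sub>M dom_measure D) (S2 D T) (\<lambda>p. (fst (fst p), snd (fst p), snd p))) A = emeasure (S2 D T) A" .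
qed simp

interpretation S1_dom: pair_sigma_finite "S1 D T" "dom_measure D'" ..

lemma integral_S2:
  fixes f :: "real \<times> (real^'n) \<times> (real^'n) \<Rightarrow> real"
  assumes f: "integrable (S2 D T) f"
  shows "(\<integral>s. f s \<partial>S2 D T) = (\<integral>r. (\<integral>y. f (fst r, snd r, y) \<partial>dom_measure D) \<partial>S1 D T)"
proof -
  have m: "(\<lambda>p. (fst (fst p), snd (fst p), snd p)) \<in> S1 D T \<Otimes>\<^sub>M dom_measure D \<rightarrow>\<^sub>M S2 D T"
    unfolding S1_def S2_def by measurable
  have fm: "f \<in> borel_measurable (S2 D T)" using f by simp
  have i: "integrable (S1 D T \<Otimes>\<^sub>M dom_measure D) (\<lambda>p. f (fst (fst p), snd (fst p), snd p))"
    using integrable_distr_eq[OF m fm] f unfolding distr_S2_assoc by simp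
  have "(\<integral>s. f s \<partial>S2 D T) = (\<integral>p. f (fst (fst p), snd (fst p), snd p) \<partial>(S1 D T \<Otimes>\<^sub>M dom_measure D))"
    using integral_distr[OF m fm] unfolding distr_S2_assoc .
  also have "\<dots> = (\<integral>r. (\<integral>y. f (fst r, snd r, y) \<partial>dom_measure D) \<partial>S1 D T)"
    using S1_dom.integral_fst'[OF i] by (simp add: case_prod_unfold)
  finally show ?thesis .
qed

context kernels begin

text \<open>The measure of a time, two points and the phases at these points.\<close>

definition \<mu>2 where "\<mu>2 = joint (S2 D T) \<kappa>2 borel"

lemma sets_\<mu>2 [simp, measurable_cong]: "sets \<mu>2 = sets pair_space"
  unfolding \<mu>2_def sets_joint[OF k2, simplified] ..

lemma space_\<mu>2 [simp]: "space \<mu>2 = UNIV"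
  using sets_eq_imp_space_eq[OF sets_\<mu>2] by (simp add: space_pair_measure)

lemma measurable_\<mu>2: "borel_measurable \<mu>2 = borel_measurable pair_space"
  by (rule measurable_cong_sets) simp_all

lemma measurable_S2_borel: "F \<in> borel_measurable pair_space \<Longrightarrow> F \<in> borel_measurable (S2 D T \<Otimes>\<^sub>M borel)"
  by (subst measurable_cong_sets[OF sets_pair_measure_cong[OF sets_S2 refl] refl])

lemma nn_integral_\<mu>2:
  "F \<in> borel_measurable pair_space \<Longrightarrow> (\<integral>\<^sup>+ q. F q \<partial>\<mu>2) = (\<integral>\<^sup>+ s. (\<integral>\<^sup>+ \<xi>. F (s, \<xi>) \<partial>\<kappa>2 s) \<partial>S2 D T)"
  unfolding \<mu>2_def by (rule nn_integral_joint[OF k2 measurable_S2_borel])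

lemma integral_\<mu>2:
  assumes "integrable \<mu>2 F"
  shows "AE s in S2 D T. integrable (\<kappa>2 s) (\<lambda>\<xi>. F (s, \<xi>) :: real)"
    "integrable (S2 D T) (\<lambda>s. \<integral>\<xi>. F (s, \<xi>) \<partial>\<kappa>2 s)"
    "(\<integral>q. F q \<partial>\<mu>2) = (\<integral>s. (\<integral>\<xi>. F (s, \<xi>) \<partial>\<kappa>2 s) \<partial>S2 D T)"
  using integral_joint[OF k2, of F] assms unfolding \<mu>2_def by simp_all

lemma nn_integral_flip:
  fixes F :: "_ \<Rightarrow> ennreal"
  assumes F [measurable]: "F \<in> borel_measurable pair_space"
  shows "(\<integral>\<^sup>+ q. F (flip q) \<partial>\<mu>2) = (\<integral>\<^sup>+ q. F q \<partial>\<mu>2)"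
proof -
  let ?H = "\<lambda>s. \<integral>\<^sup>+ \<xi>. F (s, \<xi>) \<partial>\<kappa>2 s"
  have H: "?H \<in> borel_measurable (S2 D T)"
    by (rule nn_integral_measurable_subprob_algebra2[OF _ kernel_subprob[OF k2]])
      (unfold case_prod_eta, rule measurable_S2_borel[OF F])
  have "(\<integral>\<^sup>+ q. F q \<partial>\<mu>2) = (\<integral>\<^sup>+ s. ?H s \<partial>S2 D T)"
    by (rule nn_integral_\<mu>2[OF F])
  also have "\<dots> = (\<integral>\<^sup>+ s. ?H s \<partial>distr (S2 D T) (S2 D T) (\<lambda>(t, x, y). (t, y, x)))"
    by (simp only: distr_S2_swap)
  also have "\<dots> = (\<integral>\<^sup>+ s. ?H (case s of (t, x, y) \<Rightarrow> (t, y, x)) \<partial>S2 D T)"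
    by (rule nn_integral_distr[OF swap_S2_measurable]) (use H in simp)
  also have "\<dots> = (\<integral>\<^sup>+ s. (\<integral>\<^sup>+ \<xi>. F (flip (s, \<xi>)) \<partial>\<kappa>2 s) \<partial>S2 D T)"
  proof (rule nn_integral_cong_AE)
    show "AE s in S2 D T. ?H (case s of (t, x, y) \<Rightarrow> (t, y, x)) = (\<integral>\<^sup>+ \<xi>. F (flip (s, \<xi>)) \<partial>\<kappa>2 s)"
      using kernel_swap
    proof eventually_elim
      case (elim s)
      obtain t x y where s: "s = (t, x, y)" by (cases s)
      have Fs: "(\<lambda>\<xi>. F ((t, y, x), \<xi>)) \<in> borel_measurable borel"
        by (rule measurable_compose[OF measurable_Pair1' F]) (simp add: space_pair_measure)
      have "(\<integral>\<^sup>+ \<xi>. F ((t, y, x), \<xi>) \<partial>distr (\<kappa>2 (t, x, y)) borel prod.swap) = (\<integral>\<^sup>+ \<xi>. F ((t, y, x), prod.swap \<xi>) \<partial>\<kappa>2 (t, x, y))"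
      proof (rule nn_integral_distr)
        show "prod.swap \<in> borel_measurable (\<kappa>2 (t, x, y))"
          by (subst measurable_cong_sets[OF sets_kernels(2) refl]) (rule swap_borel)
      qed (use Fs in simp)
      moreover have "((t, y, x), prod.swap \<xi>) = flip ((t, x, y), \<xi>)" for \<xi>
        by (cases \<xi>) (simp add: flip_def coords)
      ultimately show ?case using elim by (simp add: s)
    qed
  qed
  also have "\<dots> = (\<integral>\<^sup>+ q. F (flip q) \<partial>\<mu>2)"
    by (rule nn_integral_\<mu>2[symmetric]) measurable
  finally show ?thesis by simp
qed

lemma distr_flip: "distr \<mu>2 \<mu>2 flip = \<mu>2"
proof (rule measure_eqI)
  have m: "flip \<in> \<mu>2 \<rightarrow>\<^sub>M \<mu>2"
    by (subst measurable_cong_sets[OF sets_\<mu>2 sets_\<mu>2]) (rule flip_measurable)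
  fix A assume "A \<in> sets (distr \<mu>2 \<mu>2 flip)"
  then have A: "A \<in> sets pair_space" by simp
  have "emeasure (distr \<mu>2 \<mu>2 flip) A = (\<integral>\<^sup>+ q. indicator A q \<partial>distr \<mu>2 \<mu>2 flip)"
    using A by simp
  also have "\<dots> = (\<integral>\<^sup>+ q. indicator A (flip q) \<partial>\<mu>2)"
    by (rule nn_integral_distr[OF m]) (use A in simp)
  also have "\<dots> = (\<integral>\<^sup>+ q. indicator A q \<partial>\<mu>2)"
    by (rule nn_integral_flip) (use A in simp)
  also have "\<dots> = emeasure \<mu>2 A" using A by simp
  finally show "emeasure (distr \<mu>2 \<mu>2 flip) A = emeasure \<mu>2 A" .
qed simp

lemma integral_flip:
  fixes F :: "_ \<Rightarrow> real"
  assumes F: "F \<in> borel_measurable pair_space"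
  shows "(\<integral>q. F (flip q) \<partial>\<mu>2) = (\<integral>q. F q \<partial>\<mu>2)"
proof -
  have m: "flip \<in> \<mu>2 \<rightarrow>\<^sub>M \<mu>2"
    by (subst measurable_cong_sets[OF sets_\<mu>2 sets_\<mu>2]) (rule flip_measurable)
  have "F \<in> borel_measurable \<mu>2" using F by (simp add: measurable_\<mu>2)
  from integral_distr[OF m this] show ?thesis by (simp add: distr_flip)
qed

lemma kernel_fst_integrals:
  "AE (t, x, y) in S2 D T.
    (\<forall>h\<in>borel_measurable borel. (\<integral>\<^sup>+ \<xi>. (h (fst \<xi>) :: ennreal) \<partial>\<kappa>2 (t, x, y)) = (\<integral>\<^sup>+ a. h a \<partial>\<kappa>1 (t, x))) \<and>
    (\<forall>f\<in>borel_measurable borel. (\<integral>\<xi>. (f (fst \<xi>) :: real) \<partial>\<kappa>2 (t, x, y)) = (\<integral>a. f a \<partial>\<kappa>1 (t, x)))"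
  using kernel_fst
proof eventually_elim
  case (elim s)
  obtain t x y where s: "s = (t, x, y)" by (cases s)
  have m: "fst \<in> \<kappa>2 (t, x, y) \<rightarrow>\<^sub>M borel"
    by (subst measurable_cong_sets[OF sets_kernels(2) refl]) (rule fst_borel)
  have k: "\<kappa>1 (t, x) = distr (\<kappa>2 (t, x, y)) borel fst" using elim by (simp add: s)
  show ?case unfolding s prod.case k
    by (intro conjI ballI nn_integral_distr[OF m, symmetric] integral_distr[OF m, symmetric]) simp_all
qed

lemma marginal_nn:
  assumes K [measurable]: "K \<in> borel_measurable (borel \<Otimes>\<^sub>M (borel \<Otimes>\<^sub>M borel))"
    and h [measurable]: "h \<in> borel_measurable borel"
  shows "(\<integral>\<^sup>+ q. K (fst q) * h (vL q, pL q) \<partial>\<mu>2) =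
    (\<integral>\<^sup>+ t. (\<integral>\<^sup>+ x. (\<integral>\<^sup>+ y. K (t, x, y) \<partial>dom_measure D) * (\<integral>\<^sup>+ a. h a \<partial>\<kappa>1 (t, x)) \<partial>dom_measure D) \<partial>time_measure T)"
proof -
  have hp: "(\<lambda>q. h (vL q, pL q)) \<in> borel_measurable pair_space"
  proof -
    have "(\<lambda>q. h (fst (snd q))) \<in> borel_measurable pair_space"
      by (rule measurable_compose[OF measurable_snd measurable_compose[OF fst_borel h]])
    then show ?thesis by (simp add: coords)
  qed
  have Kh: "(\<lambda>q. K (fst q) * h (vL q, pL q)) \<in> borel_measurable pair_space"
    by (intro borel_measurable_times_ennreal hp measurable_compose[OF measurable_fst K])
  define H where "H r = (\<integral>\<^sup>+ a. h a \<partial>\<kappa>1 r)" for r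
  have hm: "H \<in> borel_measurable (S1 D T)"
    unfolding H_def[abs_def]
    by (rule measurable_compose[OF kernel_subprob[OF k1] nn_integral_measurable_subprob_algebra[OF h]])
  then have hm' [measurable]: "H \<in> borel_measurable (borel \<Otimes>\<^sub>M borel)"
    by (subst measurable_cong_sets[OF sets_S1[symmetric] refl])
  have "(\<integral>\<^sup>+ q. K (fst q) * h (vL q, pL q) \<partial>\<mu>2) = (\<integral>\<^sup>+ s. (\<integral>\<^sup>+ \<xi>. K s * h (fst \<xi>) \<partial>\<kappa>2 s) \<partial>S2 D T)"
    by (subst nn_integral_\<mu>2[OF Kh]) (simp add: coords)
  also have "\<dots> = (\<integral>\<^sup>+ s. K s * H (fst s, fst (snd s)) \<partial>S2 D T)"
  proof (rule nn_integral_cong_AE)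
    show "AE s in S2 D T. (\<integral>\<^sup>+ \<xi>. K s * h (fst \<xi>) \<partial>\<kappa>2 s) = K s * H (fst s, fst (snd s))"
      using kernel_fst_integrals
    proof eventually_elim
      case (elim s)
      have "(\<lambda>\<xi>. h (fst \<xi>)) \<in> borel_measurable (\<kappa>2 s)"
        by (subst measurable_cong_sets[OF sets_kernels(2) refl]) (rule measurable_compose[OF fst_borel h])
      then have "(\<integral>\<^sup>+ \<xi>. K s * h (fst \<xi>) \<partial>\<kappa>2 s) = K s * (\<integral>\<^sup>+ \<xi>. h (fst \<xi>) \<partial>\<kappa>2 s)"
        by (rule nn_integral_cmult)
      moreover have "(\<integral>\<^sup>+ \<xi>. h (fst \<xi>) \<partial>\<kappa>2 s) = H (fst s, fst (snd s))"
      proof -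
        obtain t x y where s: "s = (t, x, y)" by (cases s)
        show ?thesis using elim h unfolding s by (simp add: H_def)
      qed
      ultimately show ?case by simp
    qed
  qed
  also have "\<dots> = (\<integral>\<^sup>+ t. (\<integral>\<^sup>+ x. (\<integral>\<^sup>+ y. K (t, x, y) * H (t, x) \<partial>dom_measure D) \<partial>dom_measure D) \<partial>time_measure T)"
  proof -
    have "(\<lambda>s. K s * H (fst s, fst (snd s))) \<in> borel_measurable (borel \<Otimes>\<^sub>M (borel \<Otimes>\<^sub>M borel))"
      by measurable
    from nn_integral_S2[OF this] show ?thesis by simp
  qed
  also have "\<dots> = (\<integral>\<^sup>+ t. (\<integral>\<^sup>+ x. (\<integral>\<^sup>+ y. K (t, x, y) \<partial>dom_measure D) * H (t, x) \<partial>dom_measure D) \<partial>time_measure T)"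
  proof (intro nn_integral_cong nn_integral_multc)
    show "(\<lambda>y. K (t, x, y)) \<in> borel_measurable (dom_measure D)" for t x by measurable
  qed
  finally show ?thesis unfolding H_def .
qed

lemma bracket1_measurable:
  fixes h :: "'n phase \<Rightarrow> real"
  assumes h: "h \<in> borel_measurable borel"
  shows "(\<lambda>r. \<integral>a. h a \<partial>\<kappa>1 r) \<in> borel_measurable (S1 D T)"
  by (rule measurable_compose[OF kernel_subprob[OF k1] integral_measurable_subprob_algebra[OF h]])

text \<open>
  An observable of the left phase does not see the right point except through the weight, by the
  consistency of the two laws.
\<close>

lemma marginal:
  assumes K [measurable]: "K \<in> borel_measurable (borel \<Otimes>\<^sub>M (borel \<Otimes>\<^sub>M borel))"
    and h: "h \<in> borel_measurable (borel :: 'n phase measure)"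
    and int: "integrable \<mu>2 (\<lambda>q. K (fst q) * h (vL q, pL q) :: real)"
  shows "(\<integral>q. K (fst q) * h (vL q, pL q) \<partial>\<mu>2) =
    (\<integral>r. (\<integral>y. K (fst r, snd r, y) \<partial>dom_measure D) * (\<integral>a. h a \<partial>\<kappa>1 r) \<partial>S1 D T)"
proof -
  have ae: "AE s in S2 D T. (\<integral>\<xi>. K s * h (fst \<xi>) \<partial>\<kappa>2 s) = K s * (\<integral>a. h a \<partial>\<kappa>1 (fst s, fst (snd s)))"
    using kernel_fst_integrals
  proof eventually_elim
    case (elim s)
    obtain t x y where s: "s = (t, x, y)" by (cases s)
    have "(\<integral>\<xi>. h (fst \<xi>) \<partial>\<kappa>2 s) = (\<integral>a. h a \<partial>\<kappa>1 (fst s, fst (snd s)))"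
      using elim h unfolding s by simp
    then show ?case by simp
  qed
  have i1: "integrable (S2 D T) (\<lambda>s. \<integral>\<xi>. K s * h (fst \<xi>) \<partial>\<kappa>2 s)"
    using integral_\<mu>2(2)[OF int] by (simp add: coords)
  note hb = bracket1_measurable[OF h]
  have m2: "(\<lambda>s. K s * (\<integral>a. h a \<partial>\<kappa>1 (fst s, fst (snd s)))) \<in> borel_measurable (S2 D T)"
  proof -
    define H where "H = (\<lambda>r. \<integral>a. h a \<partial>\<kappa>1 r)"
    have [measurable]: "H \<in> borel_measurable (borel \<Otimes>\<^sub>M borel)"
      unfolding H_def using hb by (subst measurable_cong_sets[OF sets_S1[symmetric] refl])
    have "(\<lambda>s. K s * H (fst s, fst (snd s))) \<in> borel_measurable (borel \<Otimes>\<^sub>M (borel \<Otimes>\<^sub>M borel))"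
      by measurable
    then show ?thesis unfolding H_def by (subst measurable_cong_sets[OF sets_S2 refl])
  qed
  have m1: "(\<lambda>s. \<integral>\<xi>. K s * h (fst \<xi>) \<partial>\<kappa>2 s) \<in> borel_measurable (S2 D T)"
    using i1 by (rule borel_measurable_integrable)
  have i2: "integrable (S2 D T) (\<lambda>s. K s * (\<integral>a. h a \<partial>\<kappa>1 (fst s, fst (snd s))))"
    using integrable_cong_AE[OF m1 m2 ae] i1 by simp
  have "(\<integral>q. K (fst q) * h (vL q, pL q) \<partial>\<mu>2) = (\<integral>s. (\<integral>\<xi>. K s * h (fst \<xi>) \<partial>\<kappa>2 s) \<partial>S2 D T)"
    using integral_\<mu>2(3)[OF int] by (simp add: coords)
  also have "\<dots> = (\<integral>s. K s * (\<integral>a. h a \<partial>\<kappa>1 (fst s, fst (snd s))) \<partial>S2 D T)"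
    by (rule integral_cong_AE[OF m1 m2 ae])
  also have "\<dots> = (\<integral>r. (\<integral>y. K (fst r, snd r, y) * (\<integral>a. h a \<partial>\<kappa>1 r) \<partial>dom_measure D) \<partial>S1 D T)"
    using integral_S2[OF i2] by simp
  finally show ?thesis by simp
qed

end

section \<open>Bounds on the moments near the diagonal\<close>

lemma wrap_sub_rep:
  assumes "y \<in> pts D"
  shows "wrap D (x - rep D (x - y)) = y"
proof (cases D)
  case Torus
  have "frac (x $ i - (x $ i - y $ i - of_int (round (x $ i - y $ i)))) = y $ i" for i
  proof -
    have "0 \<le> y $ i" "y $ i < 1" using assms by (auto simp: pts_def Torus)
    then show ?thesis by (simp add: frac_unique_iff)
  qed
  then show ?thesis by (simp add: wrap_def rep_def Torus vec_eq_iff)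
qed (simp add: wrap_def rep_def)

lemma dball_iff:
  assumes e: "e \<le> 1/2"
  shows "y \<in> dball D x e \<longleftrightarrow> y \<in> pts D \<and> norm (rep D (x - y)) < e"
proof
  assume "y \<in> dball D x e"
  then obtain z' where z': "norm (x - z') < e" "y = wrap D z'"
    by (auto simp: dball_def dist_norm)
  then show "y \<in> pts D \<and> norm (rep D (x - y)) < e"
    using rep_wrap(1)[OF z'(1) e, of D x] wrap_pts by simp
next
  assume y: "y \<in> pts D \<and> norm (rep D (x - y)) < e"
  then have "y = wrap D (x - rep D (x - y))" by (simp add: wrap_sub_rep)
  moreover have "x - rep D (x - y) \<in> ball x e" using y by (simp add: dist_norm)
  ultimately show "y \<in> dball D x e" unfolding dball_def by blast
qed

definition ball_volume :: "'n::finite itself \<Rightarrow> real \<Rightarrow> real" where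
  "ball_volume _ e = measure lborel (ball (0::real^'n) e)"

lemma emeasure_ball: "emeasure lborel (ball (0::real^'n) e) = ennreal (ball_volume TYPE('n) e)"
  unfolding ball_volume_def using emeasure_bounded_finite[OF bounded_ball]
  by (intro emeasure_eq_ennreal_measure) (auto simp: less_top)

lemma nn_integral_weight:
  fixes k :: "real^'n \<Rightarrow> ennreal"
  assumes [measurable]: "k \<in> borel_measurable borel" and e: "0 < e" "e \<le> 1/2"
    and k: "\<And>z. e \<le> norm z \<Longrightarrow> k z = 0"
  shows "(\<integral>\<^sup>+ y. k (rep D (x - y)) \<partial>dom_measure D) = (\<integral>\<^sup>+ z. k z \<partial>lborel)"
proof -
  have i: "k z * indicator (ball 0 e) z = k z" for z
    using k by (auto simp: indicator_def)
  show ?thesis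
    using nn_integral_near_point[OF _ e, of "\<lambda>p. k (snd p)" D x] by (simp add: i)
qed

lemma nn_integral_strip:
  fixes x :: "real^'n"
  assumes "0 < e" "e \<le> 1/2"
  shows "(\<integral>\<^sup>+ y. ennreal (strip D e x y) \<partial>dom_measure D) = ennreal (ball_volume TYPE('n) e)"
  using nn_integral_weight[OF _ assms, of "indicator (ball 0 e)" D x]
  by (simp add: strip_def ennreal_indicator emeasure_ball)

context kernels begin

definition moment1 :: ennreal where
  "moment1 = (\<integral>\<^sup>+ t. (\<integral>\<^sup>+ x. (\<integral>\<^sup>+ a. ennreal (size1 a) \<partial>\<kappa>1 (t, x)) \<partial>dom_measure D) \<partial>time_measure T)"

lemma bracket1_nn_measurable:
  assumes "h \<in> borel_measurable borel"
  shows "(\<lambda>r. \<integral>\<^sup>+ a. h a \<partial>\<kappa>1 r) \<in> borel_measurable (borel \<Otimes>\<^sub>M borel)"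
  using measurable_compose[OF kernel_subprob[OF k1] nn_integral_measurable_subprob_algebra[OF assms]]
  by (subst measurable_cong_sets[OF sets_S1[symmetric] refl])

lemma bracket2_nn_measurable:
  assumes "h \<in> borel_measurable borel"
  shows "(\<lambda>r. \<integral>\<^sup>+ a. h a \<partial>\<kappa>2 r) \<in> borel_measurable (borel \<Otimes>\<^sub>M (borel \<Otimes>\<^sub>M borel))"
  using measurable_compose[OF kernel_subprob[OF k2] nn_integral_measurable_subprob_algebra[OF assms]]
  by (subst measurable_cong_sets[OF sets_S2[symmetric] refl])

lemma nested1:
  fixes h :: "'n phase \<Rightarrow> ennreal"
  assumes h: "h \<in> borel_measurable borel"
  shows "AE t in time_measure T. (\<integral>\<^sup>+ x. (\<integral>\<^sup>+ \<xi>. h (\<xi> 0) \<partial>\<nu> 1 t (tuple [x])) \<partial>lebesgue_on (pts D)) =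
      (\<integral>\<^sup>+ x. (\<integral>\<^sup>+ a. h a \<partial>\<kappa>1 (t, x)) \<partial>dom_measure D)"
    and "(\<integral>\<^sup>+ t. (\<integral>\<^sup>+ x. (\<integral>\<^sup>+ \<xi>. h (\<xi> 0) \<partial>\<nu> 1 t (tuple [x])) \<partial>lebesgue_on (pts D)) \<partial>lebesgue_on {0..T}) =
      (\<integral>\<^sup>+ t. (\<integral>\<^sup>+ x. (\<integral>\<^sup>+ a. h a \<partial>\<kappa>1 (t, x)) \<partial>dom_measure D) \<partial>time_measure T)"
proof -
  define H where "H = (\<lambda>r. \<integral>\<^sup>+ a. h a \<partial>\<kappa>1 r)"
  have Hm [measurable]: "H \<in> borel_measurable (borel \<Otimes>\<^sub>M borel)"
    unfolding H_def by (rule bracket1_nn_measurable[OF h])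
  have "AE r in S1 D T. (\<integral>\<^sup>+ \<xi>. h (\<xi> 0) \<partial>\<nu> 1 (fst r) (tuple [snd r])) = H r"
    using bracket1
  proof eventually_elim
    case (elim r)
    obtain t x where r: "r = (t, x)" by (cases r)
    show ?case using elim h unfolding r by (simp add: H_def)
  qed
  then have "AE t in time_measure T. AE x in dom_measure D. (\<integral>\<^sup>+ \<xi>. h (\<xi> 0) \<partial>\<nu> 1 t (tuple [x])) = H (t, x)"
    unfolding S1_def by (drule_tac time_dom.AE_pair) simp
  then have ae: "AE t in time_measure T. (\<integral>\<^sup>+ x. (\<integral>\<^sup>+ \<xi>. h (\<xi> 0) \<partial>\<nu> 1 t (tuple [x])) \<partial>lebesgue_on (pts D)) =
      (\<integral>\<^sup>+ x. H (t, x) \<partial>dom_measure D)"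
  proof eventually_elim
    case (elim t)
    then have "AE x in lborel. x \<in> pts D \<longrightarrow> (\<integral>\<^sup>+ \<xi>. h (\<xi> 0) \<partial>\<nu> 1 t (tuple [x])) = H (t, x)"
      unfolding AE_dom_measure_iff .
    then show ?case
      unfolding dom_measure_def by (rule nn_integral_lebesgue_on[rotated 2]) measurable
  qed
  then show "AE t in time_measure T. (\<integral>\<^sup>+ x. (\<integral>\<^sup>+ \<xi>. h (\<xi> 0) \<partial>\<nu> 1 t (tuple [x])) \<partial>lebesgue_on (pts D)) =
      (\<integral>\<^sup>+ x. (\<integral>\<^sup>+ a. h a \<partial>\<kappa>1 (t, x)) \<partial>dom_measure D)"
    unfolding H_def .
  have "(\<lambda>t. \<integral>\<^sup>+ x. H (t, x) \<partial>dom_measure D) \<in> borel_measurable borel" by measurable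
  from nn_integral_lebesgue_on[OF _ this ae[unfolded AE_time_measure_iff], folded time_measure_def]
  show "(\<integral>\<^sup>+ t. (\<integral>\<^sup>+ x. (\<integral>\<^sup>+ \<xi>. h (\<xi> 0) \<partial>\<nu> 1 t (tuple [x])) \<partial>lebesgue_on (pts D)) \<partial>lebesgue_on {0..T}) =
      (\<integral>\<^sup>+ t. (\<integral>\<^sup>+ x. (\<integral>\<^sup>+ a. h a \<partial>\<kappa>1 (t, x)) \<partial>dom_measure D) \<partial>time_measure T)"
    unfolding H_def by simp
qed

lemma emeasure_time: "emeasure (time_measure T) UNIV = ennreal T"
  using T unfolding time_measure_def by (subst emeasure_density) auto

text \<open>
  The energy is bounded at almost every time, hence integrable over the bounded time interval.
\<close>

lemma moment1_finite: "moment1 < \<infinity>"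
proof -
  let ?h1 = "\<lambda>a :: 'n phase. ennreal ((norm (fst a))\<^sup>2)"
  let ?h2 = "\<lambda>a :: 'n phase. ennreal ((norm (fst a))^3 + \<bar>snd a\<bar> powr (3/2))"
  have h1: "?h1 \<in> borel_measurable borel" and h2: "?h2 \<in> borel_measurable borel"
    unfolding borel_prod[symmetric] by measurable
  define H1 where "H1 = (\<lambda>r. \<integral>\<^sup>+ a. ?h1 a \<partial>\<kappa>1 r)"
  define H2 where "H2 = (\<lambda>r. \<integral>\<^sup>+ a. ?h2 a \<partial>\<kappa>1 r)"
  have [measurable]: "H1 \<in> borel_measurable (borel \<Otimes>\<^sub>M borel)" "H2 \<in> borel_measurable (borel \<Otimes>\<^sub>M borel)"
    unfolding H1_def H2_def by (rule bracket1_nn_measurable, fact)+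
  have "integrability_cond D T \<nu>" using sol by (simp add: statistical_solution_def)
  then obtain c where c: "AE t in lebesgue_on {0..T}.
        (\<integral>\<^sup>+ x. (\<integral>\<^sup>+ \<xi>. ?h1 (\<xi> 0) \<partial>\<nu> 1 t (tuple [x])) \<partial>lebesgue_on (pts D)) \<le> ennreal c"
    and fin2: "(\<integral>\<^sup>+ t. (\<integral>\<^sup>+ x. (\<integral>\<^sup>+ \<xi>. ?h2 (\<xi> 0) \<partial>\<nu> 1 t (tuple [x])) \<partial>lebesgue_on (pts D)) \<partial>lebesgue_on {0..T}) < \<infinity>"
    unfolding integrability_cond_def vel_def pres_def by blast
  have "AE t in time_measure T. (\<integral>\<^sup>+ x. (\<integral>\<^sup>+ \<xi>. ?h1 (\<xi> 0) \<partial>\<nu> 1 t (tuple [x])) \<partial>lebesgue_on (pts D)) \<le> ennreal c"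
    using c unfolding AE_time_measure_iff by (subst (asm) AE_restrict_space_iff) (simp_all add: AE_completion_iff)
  with nested1(1)[OF h1] have "AE t in time_measure T. (\<integral>\<^sup>+ x. H1 (t, x) \<partial>dom_measure D) \<le> ennreal c"
    unfolding H1_def by eventually_elim simp
  then have "(\<integral>\<^sup>+ t. (\<integral>\<^sup>+ x. H1 (t, x) \<partial>dom_measure D) \<partial>time_measure T) \<le> (\<integral>\<^sup>+ t. ennreal c \<partial>time_measure T)"
    by (rule nn_integral_mono_AE)
  also have "\<dots> < \<infinity>" by (simp add: emeasure_time ennreal_mult_less_top)
  finally have 1: "(\<integral>\<^sup>+ t. (\<integral>\<^sup>+ x. H1 (t, x) \<partial>dom_measure D) \<partial>time_measure T) < \<infinity>" .
  have 2: "(\<integral>\<^sup>+ t. (\<integral>\<^sup>+ x. H2 (t, x) \<partial>dom_measure D) \<partial>time_measure T) < \<infinity>"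
    using fin2 nested1(2)[OF h2] unfolding H2_def by simp
  have "(\<integral>\<^sup>+ a. ennreal (size1 a) \<partial>\<kappa>1 r) = H1 r + H2 r" for r
  proof -
    have "(\<integral>\<^sup>+ a. ennreal (size1 a) \<partial>\<kappa>1 r) = (\<integral>\<^sup>+ a. ?h1 a + ?h2 a \<partial>\<kappa>1 r)"
      by (intro nn_integral_cong) (simp add: size1_def add.assoc flip: ennreal_plus)
    also have "\<dots> = H1 r + H2 r"
      unfolding H1_def H2_def
      by (rule nn_integral_add; subst measurable_cong_sets[OF sets_kernels(1) refl]; fact)
    finally show ?thesis .
  qed
  then have "moment1 = (\<integral>\<^sup>+ t. (\<integral>\<^sup>+ x. H1 (t, x) + H2 (t, x) \<partial>dom_measure D) \<partial>time_measure T)"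
    by (simp add: moment1_def)
  also have "\<dots> = (\<integral>\<^sup>+ t. (\<integral>\<^sup>+ x. H1 (t, x) \<partial>dom_measure D) \<partial>time_measure T) + (\<integral>\<^sup>+ t. (\<integral>\<^sup>+ x. H2 (t, x) \<partial>dom_measure D) \<partial>time_measure T)"
    by (simp add: nn_integral_add)
  finally show ?thesis using 1 2 by simp
qed

text \<open>
  Each phase contributes the mass of k times the moment: the left one by integrating out the right
  point, and the right one after exchanging the points.
\<close>

lemma nn_integral_weight_sizes:
  fixes k :: "real^'n \<Rightarrow> ennreal"
  assumes k [measurable]: "k \<in> borel_measurable borel" and e: "0 < e" "e \<le> 1/2"
    and k0: "\<And>z. e \<le> norm z \<Longrightarrow> k z = 0"
  shows "(\<integral>\<^sup>+ q. k (rep D (xL q - xR q)) * ennreal (sizes q) \<partial>\<mu>2) = 2 * (\<integral>\<^sup>+ z. k z \<partial>lborel) * moment1"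
proof -
  have one: "(\<integral>\<^sup>+ q. l (rep D (xL q - xR q)) * ennreal (size1 (vL q, pL q)) \<partial>\<mu>2) = (\<integral>\<^sup>+ z. l z \<partial>lborel) * moment1"
    if l [measurable]: "l \<in> borel_measurable borel" and l0: "\<And>z. e \<le> norm z \<Longrightarrow> l z = 0" for l :: "real^'n \<Rightarrow> ennreal"
  proof -
    define H where "H = (\<lambda>r. \<integral>\<^sup>+ a. ennreal (size1 a) \<partial>\<kappa>1 r)"
    have [measurable]: "H \<in> borel_measurable (borel \<Otimes>\<^sub>M borel)"
      unfolding H_def by (rule bracket1_nn_measurable) measurable
    have "(\<lambda>s :: real \<times> (real^'n) \<times> (real^'n). l (rep D (fst (snd s) - snd (snd s)))) \<in> borel_measurable (borel \<Otimes>\<^sub>M (borel \<Otimes>\<^sub>M borel))"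
      by measurable
    from marginal_nn[OF this, of "\<lambda>a. ennreal (size1 a)"]
    have "(\<integral>\<^sup>+ q. l (rep D (xL q - xR q)) * ennreal (size1 (vL q, pL q)) \<partial>\<mu>2) =
      (\<integral>\<^sup>+ t. (\<integral>\<^sup>+ x. (\<integral>\<^sup>+ y. l (rep D (x - y)) \<partial>dom_measure D) * H (t, x) \<partial>dom_measure D) \<partial>time_measure T)"
      by (simp add: xL_def xR_def H_def)
    also have "\<dots> = (\<integral>\<^sup>+ t. (\<integral>\<^sup>+ x. (\<integral>\<^sup>+ z. l z \<partial>lborel) * H (t, x) \<partial>dom_measure D) \<partial>time_measure T)"
      by (simp add: nn_integral_weight[OF l e l0])
    also have "\<dots> = (\<integral>\<^sup>+ z. l z \<partial>lborel) * (\<integral>\<^sup>+ t. (\<integral>\<^sup>+ x. H (t, x) \<partial>dom_measure D) \<partial>time_measure T)"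
      by (simp add: nn_integral_cmult)
    also have "(\<integral>\<^sup>+ t. (\<integral>\<^sup>+ x. H (t, x) \<partial>dom_measure D) \<partial>time_measure T) = moment1"
      unfolding moment1_def H_def ..
    finally show ?thesis .
  qed
  have m: "(\<lambda>q. k (rep D (xL q - xR q)) * ennreal (size1 (vL q, pL q))) \<in> borel_measurable pair_space"
    "(\<lambda>q. k (rep D (xL q - xR q)) * ennreal (size1 (vR q, pR q))) \<in> borel_measurable pair_space"
    "(\<lambda>q. k (rep D (xL q - xR q)) * ennreal (sizes q)) \<in> borel_measurable pair_space"
    unfolding size1_def sizes_def by measurable
  have "(\<integral>\<^sup>+ q. k (rep D (xL q - xR q)) * ennreal (sizes q) \<partial>\<mu>2) =
     (\<integral>\<^sup>+ q. k (rep D (xL q - xR q)) * ennreal (size1 (vL q, pL q)) + k (rep D (xL q - xR q)) * ennreal (size1 (vR q, pR q)) \<partial>\<mu>2)"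
    by (intro nn_integral_cong) (simp add: sizes_def distrib_left)
  also have "\<dots> = (\<integral>\<^sup>+ q. k (rep D (xL q - xR q)) * ennreal (size1 (vL q, pL q)) \<partial>\<mu>2) +
      (\<integral>\<^sup>+ q. k (rep D (xL q - xR q)) * ennreal (size1 (vR q, pR q)) \<partial>\<mu>2)"
    by (rule nn_integral_add) (use m in \<open>simp_all only: measurable_\<mu>2\<close>)
  also have "(\<integral>\<^sup>+ q. k (rep D (xL q - xR q)) * ennreal (size1 (vR q, pR q)) \<partial>\<mu>2) =
      (\<integral>\<^sup>+ q. k (- rep D (xL q - xR q)) * ennreal (size1 (vL q, pL q)) \<partial>\<mu>2)"
    using nn_integral_flip[OF m(2)] by (simp add: rep_reflect[OF k0 e(2)])
  also have "\<dots> = (\<integral>\<^sup>+ z. k (- z) \<partial>lborel) * moment1"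
    by (rule one[where l="\<lambda>z. k (- z)"]) (simp_all add: k0)
  also have "(\<integral>\<^sup>+ z. k (- z) \<partial>lborel) = (\<integral>\<^sup>+ z. k z \<partial>lborel)"
    using nn_integral_lborel_reflect[OF k, of 0] by simp
  also have "(\<integral>\<^sup>+ q. k (rep D (xL q - xR q)) * ennreal (size1 (vL q, pL q)) \<partial>\<mu>2) = (\<integral>\<^sup>+ z. k z \<partial>lborel) * moment1"
    by (rule one[OF k k0])
  finally show ?thesis by (simp add: mult_2 distrib_right)
qed

lemma strip_sizes_finite:
  assumes e: "0 < e" "e \<le> 1/2"
  shows "(\<integral>\<^sup>+ q. ennreal (strip D e (xL q) (xR q) * sizes q) \<partial>\<mu>2) < \<infinity>"
proof -
  have "(\<integral>\<^sup>+ q. ennreal (strip D e (xL q) (xR q) * sizes q) \<partial>\<mu>2) =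
     2 * (\<integral>\<^sup>+ z. indicator (ball (0::real^'n) e) z \<partial>lborel) * moment1"
    using nn_integral_weight_sizes[OF _ e, of "indicator (ball 0 e)"]
    by (simp add: strip_def ennreal_mult' ennreal_indicator)
  also have "\<dots> < \<infinity>" using moment1_finite by (simp add: emeasure_ball ennreal_mult_less_top)
  finally show ?thesis .
qed

lemma integrable_\<mu>2:
  fixes F :: "_ \<Rightarrow> real"
  assumes F: "F \<in> borel_measurable pair_space" and e: "0 < e" "e \<le> 1/2"
    and bound: "\<And>q. \<bar>F q\<bar> \<le> C * (strip D e (xL q) (xR q) * sizes q)"
  shows "integrable \<mu>2 F"
proof (rule integrableI_bounded)
  show "F \<in> borel_measurable \<mu>2" using F by (simp only: measurable_\<mu>2)
  have m: "(\<lambda>q. ennreal (strip D e (xL q) (xR q) * sizes q)) \<in> borel_measurable \<mu>2"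
    unfolding measurable_\<mu>2 by measurable
  have "ennreal (norm (F q)) \<le> ennreal (max C 0) * ennreal (strip D e (xL q) (xR q) * sizes q)" for q
  proof -
    have "0 \<le> strip D e (xL q) (xR q) * sizes q" by simp
    then have "\<bar>F q\<bar> \<le> max C 0 * (strip D e (xL q) (xR q) * sizes q)"
      using order_trans[OF bound[of q] mult_right_mono[of C "max C 0"]] by simp
    then show ?thesis by (simp add: ennreal_mult'[symmetric] ennreal_leI)
  qed
  then have "(\<integral>\<^sup>+ q. ennreal (norm (F q)) \<partial>\<mu>2) \<le> (\<integral>\<^sup>+ q. ennreal (max C 0) * ennreal (strip D e (xL q) (xR q) * sizes q) \<partial>\<mu>2)"
    by (rule nn_integral_mono)
  also have "\<dots> = ennreal (max C 0) * (\<integral>\<^sup>+ q. ennreal (strip D e (xL q) (xR q) * sizes q) \<partial>\<mu>2)"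
    by (rule nn_integral_cmult[OF m])
  also have "\<dots> < \<infinity>" using strip_sizes_finite[OF e] by (simp add: ennreal_mult_less_top)
  finally show "(\<integral>\<^sup>+ q. ennreal (norm (F q)) \<partial>\<mu>2) < \<infinity>" .
qed

text \<open>
  A point y lies in the ball around x iff the representative of x - y is small; the laws are replaced
  by their Borel versions.
\<close>

lemma diag_mean_eq:
  fixes F :: "'n phase \<times> 'n phase \<Rightarrow> real"
  assumes F: "F \<in> borel_measurable borel" and e: "0 < e" "e \<le> 1/2"
  shows "diag_mean D T \<nu> (\<lambda>\<xi>. F (\<xi> 0, \<xi> 1)) e =
    (\<integral>\<^sup>+ q. ennreal (strip D e (xL q) (xR q)) * ennreal (F (snd q)) \<partial>\<mu>2) / ennreal (ball_volume TYPE('n) e)"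
proof -
  define G where "G = (\<lambda>s. \<integral>\<^sup>+ \<xi>. ennreal (F \<xi>) \<partial>\<kappa>2 s)"
  have F': "(\<lambda>\<xi>. ennreal (F \<xi>)) \<in> borel_measurable borel" using F by simp
  have Gm [measurable]: "G \<in> borel_measurable (borel \<Otimes>\<^sub>M (borel \<Otimes>\<^sub>M borel))"
    unfolding G_def by (rule bracket2_nn_measurable[OF F'])
  let ?f = "\<lambda>t x y. \<integral>\<^sup>+ \<xi>. ennreal (F (\<xi> 0, \<xi> 1)) \<partial>\<nu> 2 t (tuple [x, y])"
  let ?V = "ennreal (ball_volume TYPE('n) e)"
  have "AE s in S2 D T. ?f (fst s) (fst (snd s)) (snd (snd s)) = G s"
    using bracket2
  proof eventually_elim
    case (elim s)
    obtain t x y where s: "s = (t, x, y)" by (cases s)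
    show ?case
      using bspec[OF conjunct2[OF elim[unfolded s prod.case]] F'] unfolding s by (simp add: G_def)
  qed
  then have "AE t in time_measure T. AE p in dom_measure D \<Otimes>\<^sub>M dom_measure D. ?f t (fst p) (snd p) = G (t, p)"
    unfolding S2_def by (drule_tac time_dom2.AE_pair) simp
  then have ae: "AE t in time_measure T. AE x in dom_measure D. AE y in dom_measure D. ?f t x y = G (t, x, y)"
    by eventually_elim (drule dom_dom.AE_pair, simp)
  have db: "dball D x e \<in> sets borel" for x
  proof -
    have "dball D x e = {y \<in> pts D. norm (rep D (x - y)) < e}"
      by (auto simp: dball_iff[OF e(2)])
    also have "\<dots> = pts D \<inter> {y \<in> space borel. norm (rep D (x - y)) < e}" by auto
    also have "\<dots> \<in> sets borel" by (intro sets.Int pts_borel) measurable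
    finally show ?thesis .
  qed
  have ind: "indicator (dball D x e) y = indicator (pts D) y * ennreal (strip D e x y)" for x y
    by (simp add: indicator_def dball_iff[OF e(2)] strip_def)
  have vol: "emeasure lebesgue (dball D x e) = ?V" for x :: "real^'n"
  proof -
    have "emeasure lebesgue (dball D x e) = (\<integral>\<^sup>+ y. indicator (dball D x e) y \<partial>lborel)"
      using db[of x] by simp
    also have "\<dots> = (\<integral>\<^sup>+ y. ennreal (strip D e x y) \<partial>dom_measure D)"
      unfolding ind by (rule nn_integral_dom_measure[symmetric]) measurable
    finally show ?thesis by (simp add: nn_integral_strip[OF e])
  qed
  define g where "g = (\<lambda>r. (\<integral>\<^sup>+ y. ennreal (strip D e (snd r) y) * G (fst r, snd r, y) \<partial>dom_measure D))"
  have gm [measurable]: "g \<in> borel_measurable (borel \<Otimes>\<^sub>M borel)"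
    unfolding g_def by measurable
  have inner: "(\<integral>\<^sup>+ y. ?f t x y \<partial>lebesgue_on (dball D x e)) = g (t, x)"
    if "AE y in dom_measure D. ?f t x y = G (t, x, y)" for t x
  proof -
    have "(\<integral>\<^sup>+ y. ?f t x y \<partial>lebesgue_on (dball D x e)) = (\<integral>\<^sup>+ y. G (t, x, y) \<partial>density lborel (indicator (dball D x e)))"
    proof (rule nn_integral_lebesgue_on[OF db])
      show "AE y in lborel. y \<in> dball D x e \<longrightarrow> ?f t x y = G (t, x, y)"
        using that unfolding AE_dom_measure_iff by eventually_elim (simp add: dball_iff[OF e(2)])
    qed measurable
    also have "\<dots> = (\<integral>\<^sup>+ y. indicator (dball D x e) y * G (t, x, y) \<partial>lborel)"
      by (rule nn_integral_density) (use db in measurable)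
    also have "\<dots> = (\<integral>\<^sup>+ y. indicator (pts D) y * (ennreal (strip D e x y) * G (t, x, y)) \<partial>lborel)"
      unfolding ind by (simp add: mult.assoc)
    also have "\<dots> = g (t, x)"
      unfolding g_def fst_conv snd_conv by (rule nn_integral_dom_measure[symmetric]) measurable
    finally show ?thesis .
  qed
  have mid: "AE t in time_measure T. (\<integral>\<^sup>+ x. (\<integral>\<^sup>+ y. ?f t x y \<partial>lebesgue_on (dball D x e)) / emeasure lebesgue (dball D x e) \<partial>lebesgue_on (pts D))
      = (\<integral>\<^sup>+ x. g (t, x) / ?V \<partial>dom_measure D)"
    using ae
  proof eventually_elim
    case (elim t)
    have "AE x in lborel. x \<in> pts D \<longrightarrow> (\<integral>\<^sup>+ y. ?f t x y \<partial>lebesgue_on (dball D x e)) / emeasure lebesgue (dball D x e) = g (t, x) / ?V"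
      using elim[unfolded AE_dom_measure_iff[where P="\<lambda>x. AE y in dom_measure D. ?f t x y = G (t, x, y)"]]
      by eventually_elim (simp add: inner vol)
    from nn_integral_lebesgue_on[OF pts_borel _ this, folded dom_measure_def]
    show ?case by measurable
  qed
  have gV: "(\<lambda>t. \<integral>\<^sup>+ x. g (t, x) / ?V \<partial>dom_measure D) \<in> borel_measurable borel" by measurable
  have "diag_mean D T \<nu> (\<lambda>\<xi>. F (\<xi> 0, \<xi> 1)) e = (\<integral>\<^sup>+ t. (\<integral>\<^sup>+ x. g (t, x) / ?V \<partial>dom_measure D) \<partial>time_measure T)"
    unfolding diag_mean_def time_measure_def
    by (rule nn_integral_lebesgue_on[OF _ gV mid[unfolded AE_time_measure_iff]]) simp
  also have "\<dots> = (\<integral>\<^sup>+ t. (\<integral>\<^sup>+ x. g (t, x) \<partial>dom_measure D) \<partial>time_measure T) / ?V"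
    by (simp add: nn_integral_divide)
  also have "(\<integral>\<^sup>+ t. (\<integral>\<^sup>+ x. g (t, x) \<partial>dom_measure D) \<partial>time_measure T) = (\<integral>\<^sup>+ s. ennreal (strip D e (fst (snd s)) (snd (snd s))) * G s \<partial>S2 D T)"
  proof -
    have "(\<lambda>s. ennreal (strip D e (fst (snd s)) (snd (snd s))) * G s) \<in> borel_measurable (borel \<Otimes>\<^sub>M (borel \<Otimes>\<^sub>M borel))"
      by measurable
    from nn_integral_S2[OF this, of D T] show ?thesis by (simp add: g_def)
  qed
  also have "\<dots> = (\<integral>\<^sup>+ q. ennreal (strip D e (xL q) (xR q)) * ennreal (F (snd q)) \<partial>\<mu>2)"
  proof -
    have m: "(\<lambda>q. ennreal (strip D e (xL q) (xR q)) * ennreal (F (snd q))) \<in> borel_measurable pair_space"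
      by (intro borel_measurable_times_ennreal measurable_compose[OF measurable_snd F']) measurable
    have "(\<integral>\<^sup>+ \<xi>. ennreal (strip D e (fst (snd s)) (snd (snd s))) * ennreal (F \<xi>) \<partial>\<kappa>2 s)
        = ennreal (strip D e (fst (snd s)) (snd (snd s))) * G s" for s
      unfolding G_def by (rule nn_integral_cmult) (subst measurable_cong_sets[OF sets_kernels(2) refl], rule F')
    then show ?thesis
      by (subst nn_integral_\<mu>2[OF m]) (simp add: xL_def xR_def)
  qed
  finally show ?thesis .
qed

end

section \<open>Integrability of the moments\<close>

lemma powr_three_halves: "\<bar>p\<bar> powr (3/2) = sqrt \<bar>p\<bar> ^ 3"
proof (cases "p = 0")
  case False
  have "sqrt \<bar>p\<bar> ^ 3 = (\<bar>p\<bar> powr (1/2)) powr 3"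
    using False by (subst powr_numeral) (simp_all add: powr_half_sqrt)
  then show ?thesis by (simp add: powr_powr)
qed simp

lemma square_mult_le:
  fixes a b :: real
  assumes "0 \<le> a" "0 \<le> b"
  shows "a\<^sup>2 * b \<le> a ^ 3 + b ^ 3"
proof (cases "b \<le> a")
  case True
  then have "a\<^sup>2 * b \<le> a\<^sup>2 * a" by (intro mult_left_mono) auto
  then show ?thesis using assms by (simp add: power2_eq_square power3_eq_cube) (smt (verit) mult_nonneg_nonneg)
next
  case False
  then have "a\<^sup>2 * b \<le> b\<^sup>2 * b" using assms by (intro mult_right_mono power_mono) auto
  then show ?thesis using assms by (simp add: power2_eq_square power3_eq_cube) (smt (verit) mult_nonneg_nonneg)
qed

text \<open>The inequality of Young for the root of the pressure.\<close>

lemma pressure_mult_le: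
  fixes p b :: real
  assumes "0 \<le> b"
  shows "\<bar>p\<bar> * b \<le> \<bar>p\<bar> powr (3/2) + b ^ 3"
  using square_mult_le[of "sqrt \<bar>p\<bar>" b] assms by (simp add: powr_three_halves)

lemma square_mult_sizes:
  "(norm (vL q))\<^sup>2 * norm (vL q) \<le> sizes q" "(norm (vL q))\<^sup>2 * norm (vR q) \<le> sizes q"
  "(norm (vR q))\<^sup>2 * norm (vL q) \<le> sizes q" "(norm (vR q))\<^sup>2 * norm (vR q) \<le> sizes q"
  "\<bar>pL q\<bar> * norm (vR q) \<le> sizes q" "\<bar>pR q\<bar> * norm (vL q) \<le> sizes q" "\<bar>pL q\<bar> * norm (vL q) \<le> sizes q"
  "norm (vL q) * norm (vR q) \<le> sizes q" "(norm (vL q))\<^sup>2 \<le> sizes q"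
proof -
  let ?v = "norm (vL q)" and ?w = "norm (vR q)"
  have n: "0 \<le> ?v^2" "0 \<le> ?w^2" "0 \<le> ?v^3" "0 \<le> ?w^3" "0 \<le> \<bar>pL q\<bar> powr (3/2)" "0 \<le> \<bar>pR q\<bar> powr (3/2)"
    by simp_all
  have s: "sizes q = ?v\<^sup>2 + ?v^3 + \<bar>pL q\<bar> powr (3/2) + (?w\<^sup>2 + ?w^3 + \<bar>pR q\<bar> powr (3/2))"
    by (simp add: sizes_def size1_def)
  have c: "?v\<^sup>2 * ?v = ?v^3" "?w\<^sup>2 * ?w = ?w^3"
    by (simp_all add: power2_eq_square power3_eq_cube)
  have vw: "?v * ?w \<le> ?v\<^sup>2 + ?w\<^sup>2"
  proof -
    have "2 * (?v * ?w) \<le> ?v\<^sup>2 + ?w\<^sup>2" using sum_squares_bound[of ?v ?w] by (simp add: mult.assoc)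
    moreover have "0 \<le> ?v * ?w" by simp
    ultimately show ?thesis by linarith
  qed
  show "?v\<^sup>2 * ?v \<le> sizes q" "?v\<^sup>2 * ?w \<le> sizes q" "?w\<^sup>2 * ?v \<le> sizes q" "?w\<^sup>2 * ?w \<le> sizes q"
    "\<bar>pL q\<bar> * ?w \<le> sizes q" "\<bar>pR q\<bar> * ?v \<le> sizes q" "\<bar>pL q\<bar> * ?v \<le> sizes q" "?v * ?w \<le> sizes q" "?v\<^sup>2 \<le> sizes q"
    unfolding s using n c vw square_mult_le[of ?v ?w] square_mult_le[of ?w ?v]
      pressure_mult_le[of ?w "pL q"] pressure_mult_le[of ?v "pR q"] pressure_mult_le[of ?v "pL q"]
    unfolding c by (simp_all only: norm_ge_zero simp_thms) linarith+
qed

lemma inner_sizes: "\<bar>vL q \<bullet> vR q\<bar> \<le> sizes q"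
  using Cauchy_Schwarz_ineq2[of "vL q" "vR q"] square_mult_sizes(8)[of q] by linarith

context kernels begin

lemma AE_kernel1_finite: "AE r in S1 D T. (\<integral>\<^sup>+ a. ennreal (size1 a) \<partial>\<kappa>1 r) < \<infinity>"
proof -
  define H where "H = (\<lambda>r. \<integral>\<^sup>+ a. ennreal (size1 a) \<partial>\<kappa>1 r)"
  have Hm: "H \<in> borel_measurable (borel \<Otimes>\<^sub>M borel)"
    unfolding H_def by (rule bracket1_nn_measurable) measurable
  have "(\<integral>\<^sup>+ r. H r \<partial>S1 D T) = moment1"
    unfolding nn_integral_S1[OF Hm] by (simp add: moment1_def H_def)
  then have "(\<integral>\<^sup>+ r. H r \<partial>S1 D T) \<noteq> \<infinity>" using moment1_finite by simp
  moreover have "H \<in> borel_measurable (S1 D T)"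
    using Hm by (subst measurable_cong_sets[OF sets_S1 refl])
  ultimately have "AE r in S1 D T. H r \<noteq> \<infinity>" by (intro nn_integral_PInf_AE)
  then show ?thesis unfolding H_def by eventually_elim (simp add: less_top)
qed

lemma AE_kernel2_finite: "AE s in S2 D T. (\<integral>\<^sup>+ \<xi>. ennreal (sizes (s, \<xi>)) \<partial>\<kappa>2 s) < \<infinity>"
proof -
  have sm: "(\<lambda>a. ennreal (size1 a)) \<in> borel_measurable (borel :: 'n phase measure)" by measurable
  have f: "AE (t, x, y) in S2 D T. (\<integral>\<^sup>+ \<xi>. ennreal (size1 (fst \<xi>)) \<partial>\<kappa>2 (t, x, y)) < \<infinity>"
    using kernel_fst_integrals AE_S2_of_S1[OF AE_kernel1_finite]
  proof eventually_elim
    case (elim s)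
    obtain t x y where s: "s = (t, x, y)" by (cases s)
    show ?case using bspec[OF conjunct1[OF elim(1)[unfolded s prod.case]] sm] elim(2) unfolding s by simp
  qed
  show ?thesis
    using f AE_S2_swap[OF f] kernel_swap
  proof eventually_elim
    case (elim s)
    obtain t x y where s: "s = (t, x, y)" by (cases s)
    have m1: "(\<lambda>\<xi>. ennreal (size1 (fst \<xi>))) \<in> borel_measurable (borel :: ('n phase \<times> 'n phase) measure)"
      by (rule measurable_compose[OF fst_borel sm])
    have m2: "(\<lambda>\<xi>. ennreal (size1 (snd \<xi>))) \<in> borel_measurable (borel :: ('n phase \<times> 'n phase) measure)"
      by (rule measurable_compose[OF snd_borel sm])
    have "(\<integral>\<^sup>+ \<xi>. ennreal (size1 (fst \<xi>)) \<partial>distr (\<kappa>2 (t, x, y)) borel prod.swap) = (\<integral>\<^sup>+ \<xi>. ennreal (size1 (fst (prod.swap \<xi>))) \<partial>\<kappa>2 (t, x, y))"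
    proof (rule nn_integral_distr)
      show "prod.swap \<in> borel_measurable (\<kappa>2 (t, x, y))"
        by (subst measurable_cong_sets[OF sets_kernels(2) refl]) (rule swap_borel)
    qed (use m1 in simp)
    then have 2: "(\<integral>\<^sup>+ \<xi>. ennreal (size1 (snd \<xi>)) \<partial>\<kappa>2 s) < \<infinity>"
      using elim unfolding s by simp
    have 1: "(\<integral>\<^sup>+ \<xi>. ennreal (size1 (fst \<xi>)) \<partial>\<kappa>2 s) < \<infinity>"
      using elim unfolding s by simp
    have "(\<integral>\<^sup>+ \<xi>. ennreal (sizes (s, \<xi>)) \<partial>\<kappa>2 s) = (\<integral>\<^sup>+ \<xi>. ennreal (size1 (fst \<xi>)) + ennreal (size1 (snd \<xi>)) \<partial>\<kappa>2 s)"
      by (intro nn_integral_cong) (simp add: sizes_def coords flip: ennreal_plus)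
    also have "\<dots> = (\<integral>\<^sup>+ \<xi>. ennreal (size1 (fst \<xi>)) \<partial>\<kappa>2 s) + (\<integral>\<^sup>+ \<xi>. ennreal (size1 (snd \<xi>)) \<partial>\<kappa>2 s)"
      by (rule nn_integral_add; subst measurable_cong_sets[OF sets_kernels(2) refl]; fact)
    finally show ?case using 1 2 by simp
  qed
qed

lemma kernel1_integrable:
  fixes f :: "'n phase \<Rightarrow> real"
  assumes f: "f \<in> borel_measurable borel" and b: "\<And>a. \<bar>f a\<bar> \<le> C + C * size1 a" and C: "0 \<le> C"
    and fin: "(\<integral>\<^sup>+ a. ennreal (size1 a) \<partial>\<kappa>1 r) < \<infinity>"
  shows "integrable (\<kappa>1 r) f"
proof -
  interpret prob_space "\<kappa>1 r" by (rule prob_kernel)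
  have "integrable (\<kappa>1 r) size1"
    by (rule integrableI_bounded) (use fin in \<open>simp_all add: measurable_cong_sets[OF sets_kernels(1) refl]\<close>)
  then have "integrable (\<kappa>1 r) (\<lambda>a. C + C * size1 a)" by simp
  then show ?thesis
    by (rule Bochner_Integration.integrable_bound)
      (use f b in \<open>simp_all add: measurable_cong_sets[OF sets_kernels(1) refl] order_trans[OF _ abs_ge_self]\<close>)
qed

lemma kernel2_integrable:
  fixes f :: "'n phase \<times> 'n phase \<Rightarrow> real"
  assumes f: "f \<in> borel_measurable borel" and b: "\<And>\<xi>. \<bar>f \<xi>\<bar> \<le> C * sizes (s, \<xi>)"
    and fin: "(\<integral>\<^sup>+ \<xi>. ennreal (sizes (s, \<xi>)) \<partial>\<kappa>2 s) < \<infinity>"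
  shows "integrable (\<kappa>2 s) f"
proof -
  have m: "(\<lambda>\<xi>. sizes (s, \<xi>)) \<in> borel_measurable (borel :: ('n phase \<times> 'n phase) measure)"
    by (rule measurable_compose[OF _ sizes_measurable[where M="count_space UNIV"]]) simp
  have "integrable (\<kappa>2 s) (\<lambda>\<xi>. sizes (s, \<xi>))"
    by (rule integrableI_bounded) (use fin m in \<open>simp_all add: measurable_cong_sets[OF sets_kernels(2) refl]\<close>)
  then have "integrable (\<kappa>2 s) (\<lambda>\<xi>. C * sizes (s, \<xi>))" by simp
  then show ?thesis
    by (rule Bochner_Integration.integrable_bound)
      (use f b in \<open>simp_all add: measurable_cong_sets[OF sets_kernels(2) refl] order_trans[OF _ abs_ge_self]\<close>)
qed

end

section \<open>The regularised energy identity\<close>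

lemma test_functions_mono: "I \<subseteq> I' \<Longrightarrow> test_functions D k I \<subseteq> test_functions D k I'"
  unfolding test_functions_def by fast

lemma dt_test: "\<psi> \<in> test_functions D 1 I \<Longrightarrow> dt \<psi> \<in> test_functions D 1 I"
  unfolding dt_def by (rule test_functions_flow_deriv[OF _ shifts_1(1)])

lemma at_point_grad: "at_point (grad_at 0 \<psi>) t x $ i = at_point (flow_deriv (space_shift 0 i) \<psi>) t x"
  by (simp add: at_point_def grad_at_def)

lemma at_point_measurable:
  assumes "\<psi> \<in> test_functions D 1 I" and [measurable]: "f \<in> borel_measurable M" "g \<in> borel_measurable M"
  shows "(\<lambda>q. at_point \<psi> (f q) (g q)) \<in> borel_measurable M"
proof -
  have "(\<lambda>p. at_point \<psi> (fst p) (snd p)) \<in> borel_measurable borel"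
    using at_point_continuous[OF assms(1)] by (simp add: case_prod_unfold borel_measurable_continuous_onI)
  then have "(\<lambda>p. at_point \<psi> (fst p) (snd p)) \<in> borel_measurable (borel \<Otimes>\<^sub>M borel)"
    by (simp only: borel_prod)
  from measurable_compose[OF _ this, of "\<lambda>q. (f q, g q)" M] show ?thesis by simp
qed

lemma at_point_DERIV:
  assumes "\<psi> \<in> test_functions D 1 I"
  shows "((\<lambda>h. at_point \<psi> t (x + h *\<^sub>R axis i 1)) has_real_derivative
     at_point (flow_deriv (space_shift 0 i) \<psi>) t x) (at 0)"
proof -
  have "space_shift 0 i h (t, \<lambda>j. if j = 0 then x else 0) = (t, (\<lambda>j. if j = 0 then x + h *\<^sub>R axis i 1 else 0))" for h
    by (auto simp: space_shift_def coord_shift_def fun_eq_iff)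
  then show ?thesis
    using smooth_along_DERIV[OF test_functionsD(1)[OF assms] shifts_1(2), of i "(t, \<lambda>j. if j = 0 then x else 0)"]
    by (simp add: at_point_def)
qed

lemma at_point_grad_bounded:
  fixes \<psi> :: "real \<times> (nat \<Rightarrow> real^'n) \<Rightarrow> real"
  assumes "\<psi> \<in> test_functions D 1 I"
  obtains B where "0 \<le> B" "\<And>t x. norm (at_point (grad_at 0 \<psi>) t x) \<le> B"
proof -
  have "\<exists>B\<ge>0. \<forall>t x. \<bar>at_point (grad_at 0 \<psi>) t x $ i\<bar> \<le> B" for i
    using test_functions_bounded[OF test_functions_flow_deriv[OF assms shifts_1(2)], of i] unfolding at_point_grad by metis
  then obtain B where B: "\<And>i. 0 \<le> B i" "\<And>i t x. \<bar>at_point (grad_at 0 \<psi>) t x $ i\<bar> \<le> B i" by metis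
  show ?thesis
  proof
    show "0 \<le> (\<Sum>i\<in>UNIV. B i)" by (rule sum_nonneg) (rule B)
    show "norm (at_point (grad_at 0 \<psi>) t x) \<le> (\<Sum>i\<in>UNIV. B i)" for t x
      using norm_le_l1_cart[of "at_point (grad_at 0 \<psi>) t x"] sum_mono[OF B(2)] by (rule order_trans)
  qed
qed

lemma vanishes_on_sphere:
  fixes f :: "real^'n \<Rightarrow> real"
  assumes f: "continuous_on UNIV f" "vanishes_off e f" and z: "e \<le> norm z" and e: "0 < e"
  shows "f z = 0"
proof -
  have "(\<lambda>n. (1 + inverse (real (Suc n))) *\<^sub>R z) \<longlonglongrightarrow> (1 + 0) *\<^sub>R z"
    by (intro tendsto_intros LIMSEQ_inverse_real_of_nat)
  then have "(\<lambda>n. f ((1 + inverse (real (Suc n))) *\<^sub>R z)) \<longlonglongrightarrow> f z"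
    using f(1) continuous_on_tendsto_compose[of UNIV f] by simp
  moreover have "f ((1 + inverse (real (Suc n))) *\<^sub>R z) = 0" for n
  proof -
    have "norm ((1 + inverse (real (Suc n))) *\<^sub>R z) = (1 + inverse (real (Suc n))) * norm z"
      by simp
    moreover have "1 * norm z < (1 + inverse (real (Suc n))) * norm z"
      using z e by (intro mult_strict_right_mono) auto
    ultimately show ?thesis using f(2) z unfolding vanishes_off_def by auto
  qed
  ultimately show ?thesis by (simp add: LIMSEQ_const_iff)
qed

lemma compact_support_bounded:
  fixes f :: "real^'n \<Rightarrow> real"
  assumes "continuous_on UNIV f" "\<And>z. e \<le> norm z \<Longrightarrow> f z = 0"
  obtains M where "0 \<le> M" "\<And>z. \<bar>f z\<bar> \<le> M * indicator (ball 0 e) z"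
proof -
  obtain B where B: "\<forall>z\<in>cball 0 e. \<bar>f z\<bar> \<le> B" using continuous_on_cball_bounded[OF assms(1)] by blast
  have "\<bar>f z\<bar> \<le> \<bar>B\<bar> * indicator (ball 0 e) z" for z
    using bspec[OF B, of z] assms(2)[of z] by (cases "norm z < e") (auto simp: indicator_def)
  then show ?thesis using that[of "\<bar>B\<bar>"] by simp
qed

text \<open>
  The function g stands for a rescaled mollifier; its support is small enough that its
  periodisation is smooth.  The five weights below are psi and its derivatives at the left point, and
  g and its gradient at the difference of the points.
\<close>

locale test_pair = kernels D T \<nu> \<kappa>1 \<kappa>2
  for D :: space_domain and T :: real and \<nu> :: "'n::finite correlation" and \<kappa>1 and \<kappa>2 +
  fixes \<psi> :: "real \<times> (nat \<Rightarrow> real^'n) \<Rightarrow> real" and g :: "real^'n \<Rightarrow> real" and e :: real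
  assumes \<psi>: "\<psi> \<in> test_functions D 1 {0<..<T}"
    and g: "smooth_along (range coord_shift) g" and g0: "vanishes_off e g"
    and e: "0 < e" "e < 1/2"
begin

definition "P q = at_point \<psi> (tm q) (xL q)" for q :: "(real \<times> (real^'n) \<times> (real^'n)) \<times> 'n phase \<times> 'n phase"
definition "Pt q = at_point (dt \<psi>) (tm q) (xL q)" for q :: "(real \<times> (real^'n) \<times> (real^'n)) \<times> 'n phase \<times> 'n phase"
definition "Px q = at_point (grad_at 0 \<psi>) (tm q) (xL q)" for q :: "(real \<times> (real^'n) \<times> (real^'n)) \<times> 'n phase \<times> 'n phase"
definition "G q = g (rep D (xL q - xR q))" for q :: "(real \<times> (real^'n) \<times> (real^'n)) \<times> 'n phase \<times> 'n phase"
definition "Gx q = grad g (rep D (xL q - xR q))" for q :: "(real \<times> (real^'n) \<times> (real^'n)) \<times> 'n phase \<times> 'n phase"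

lemmas weights = P_def Pt_def Px_def G_def Gx_def

lemma e2: "e \<le> 1/2" using e by simp

lemma \<psi>_UNIV: "\<psi> \<in> test_functions D 1 UNIV"
  using \<psi> test_functions_mono[of "{0<..<T}" UNIV] by blast

lemma dg_smooth: "smooth_along (range coord_shift) (flow_deriv (coord_shift i) g)"
  by (rule smooth_along_flow_deriv[OF g]) simp

lemma g_zero: "e \<le> norm z \<Longrightarrow> g z = 0"
  using vanishes_on_sphere[OF smooth_along_continuous[OF g] g0 _ e(1)] .

lemma dg_zero: "e \<le> norm z \<Longrightarrow> flow_deriv (coord_shift i) g z = 0"
  using vanishes_on_sphere[OF smooth_along_continuous[OF dg_smooth] vanishes_off_deriv[OF g0] _ e(1)] .

lemma g_measurable [measurable]: "g \<in> borel_measurable borel"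
  "flow_deriv (coord_shift i) g \<in> borel_measurable borel"
  by (intro borel_measurable_continuous_onI smooth_along_continuous[OF g] smooth_along_continuous[OF dg_smooth])+

lemma grad_g_measurable [measurable]: "grad g \<in> borel_measurable borel"
  by (subst vec_measurable_iff) (simp add: grad_def)

lemma weights_measurable [measurable]:
  "P \<in> borel_measurable pair_space" "Pt \<in> borel_measurable pair_space" "Px \<in> borel_measurable pair_space"
  "G \<in> borel_measurable pair_space" "Gx \<in> borel_measurable pair_space"
proof -
  show "P \<in> borel_measurable pair_space" unfolding P_def[abs_def] by (rule at_point_measurable[OF \<psi>]) measurable
  show "Pt \<in> borel_measurable pair_space" unfolding Pt_def[abs_def] by (rule at_point_measurable[OF dt_test[OF \<psi>]]) measurable
  show "Px \<in> borel_measurable pair_space"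
    unfolding vec_measurable_iff Px_def at_point_grad
    by (intro allI at_point_measurable[OF test_functions_flow_deriv[OF \<psi> shifts_1(2)]]) measurable
  show "G \<in> borel_measurable pair_space" unfolding G_def[abs_def] by measurable
  show "Gx \<in> borel_measurable pair_space" unfolding Gx_def[abs_def] by measurable
qed

lemma bounded_weights:
  obtains C where "0 \<le> C"
    "\<And>q. \<bar>G q * Pt q\<bar> \<le> C * strip D e (xL q) (xR q)"
    "\<And>q. norm (G q *\<^sub>R Px q) \<le> C * strip D e (xL q) (xR q)"
    "\<And>q. norm (P q *\<^sub>R Gx q) \<le> C * strip D e (xL q) (xR q)"
    "\<And>q. norm (G q *\<^sub>R Px q + P q *\<^sub>R Gx q) \<le> C * strip D e (xL q) (xR q)"
proof -
  obtain B1 where B1: "0 \<le> B1" "\<And>t x. \<bar>at_point \<psi> t x\<bar> \<le> B1" using test_functions_bounded[OF \<psi>] by metis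
  obtain B2 where B2: "0 \<le> B2" "\<And>t x. \<bar>at_point (dt \<psi>) t x\<bar> \<le> B2" using test_functions_bounded[OF dt_test[OF \<psi>]] by metis
  obtain B3 where B3: "0 \<le> B3" "\<And>t x. norm (at_point (grad_at 0 \<psi>) t x) \<le> B3" using at_point_grad_bounded[OF \<psi>] by metis
  obtain M1 where M1: "0 \<le> M1" "\<And>z. \<bar>g z\<bar> \<le> M1 * indicator (ball 0 e) z"
    using compact_support_bounded[OF smooth_along_continuous[OF g] g_zero] by metis
  have "\<exists>M\<ge>0. \<forall>z. \<bar>grad g z $ i\<bar> \<le> M * indicator (ball 0 e) z" for i
    using compact_support_bounded[OF smooth_along_continuous[OF dg_smooth[of i]] dg_zero] unfolding grad_def vec_lambda_beta by metis
  then obtain N where N: "\<And>i. 0 \<le> N i" "\<And>i z. \<bar>grad g z $ i\<bar> \<le> N i * indicator (ball 0 e) z" by metis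
  define M2 where "M2 = (\<Sum>i\<in>UNIV. N i)"
  have M2: "0 \<le> M2" "norm (grad g z) \<le> M2 * indicator (ball 0 e) z" for z
  proof -
    show "0 \<le> M2" unfolding M2_def by (rule sum_nonneg) (rule N)
    show "norm (grad g z) \<le> M2 * indicator (ball 0 e) z"
      unfolding M2_def sum_distrib_right
      using norm_le_l1_cart[of "grad g z"] sum_mono[OF N(2)] by (rule order_trans)
  qed
  define C where "C = B2 * M1 + B3 * M1 + B1 * M2"
  have C: "B2 * M1 \<le> C" "B3 * M1 \<le> C" "B1 * M2 \<le> C" "B3 * M1 + B1 * M2 \<le> C" "0 \<le> C"
    unfolding C_def using B1(1) B2(1) B3(1) M1(1) M2(1) by (simp_all add: add_nonneg_nonneg)
  have a: "\<bar>G q * Pt q\<bar> \<le> (B2 * M1) * strip D e (xL q) (xR q)" for q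
    using mult_mono[OF M1(2)[of "rep D (xL q - xR q)"] B2(2)[of "tm q" "xL q"]] B2(1) M1(1)
    unfolding weights strip_def abs_mult by (simp add: mult.commute mult.left_commute)
  have b: "norm (G q *\<^sub>R Px q) \<le> (B3 * M1) * strip D e (xL q) (xR q)" for q
    using mult_mono[OF M1(2)[of "rep D (xL q - xR q)"] B3(2)[of "tm q" "xL q"]] B3(1) M1(1)
    unfolding weights strip_def norm_scaleR by (simp add: mult.commute mult.left_commute)
  have c: "norm (P q *\<^sub>R Gx q) \<le> (B1 * M2) * strip D e (xL q) (xR q)" for q
    using mult_mono[OF B1(2)[of "tm q" "xL q"] M2(2)[of "rep D (xL q - xR q)"]] B1(1) M2(1)
    unfolding weights strip_def norm_scaleR by (simp add: mult.assoc)
  have up: "x \<le> C * strip D e y z" if "x \<le> K * strip D e y z" "K \<le> C" for x y z K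
    using that by (meson mult_right_mono order_trans strip_bounds(1))
  show ?thesis
  proof
    show "norm (G q *\<^sub>R Px q + P q *\<^sub>R Gx q) \<le> C * strip D e (xL q) (xR q)" for q
      using norm_triangle_ineq[of "G q *\<^sub>R Px q" "P q *\<^sub>R Gx q"] b[of q] c[of q]
      by (intro up[OF _ C(4)]) (simp add: distrib_right)
  qed (rule C(5) up[OF a C(1)] up[OF b C(2)] up[OF c C(3)])+
qed

lemma integrable_inner:
  assumes a: "a \<in> borel_measurable pair_space" and f: "f \<in> borel_measurable pair_space"
    and bound: "\<And>q. norm (a q :: real^'n) \<le> C * strip D e (xL q) (xR q)" "\<And>q. norm (f q) \<le> sizes q"
  shows "integrable \<mu>2 (\<lambda>q. f q \<bullet> a q)"
proof (rule integrable_\<mu>2[OF _ e(1) e2])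
  show "(\<lambda>q. f q \<bullet> a q) \<in> borel_measurable pair_space" using a f by measurable
  show "\<bar>f q \<bullet> a q\<bar> \<le> C * (strip D e (xL q) (xR q) * sizes q)" for q
  proof -
    have "\<bar>f q \<bullet> a q\<bar> \<le> norm (f q) * norm (a q)" by (rule Cauchy_Schwarz_ineq2)
    also have "\<dots> \<le> sizes q * (C * strip D e (xL q) (xR q))"
      using bound by (intro mult_mono) (auto intro: order_trans[OF norm_ge_zero])
    finally show ?thesis by (simp add: mult_ac)
  qed
qed

lemma integrable_scalar:
  assumes a: "a \<in> borel_measurable pair_space" and f: "f \<in> borel_measurable pair_space"
    and bound: "\<And>q. \<bar>a q\<bar> \<le> C * strip D e (xL q) (xR q)" "\<And>q. \<bar>f q :: real\<bar> \<le> sizes q"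
  shows "integrable \<mu>2 (\<lambda>q. f q * a q)"
proof (rule integrable_\<mu>2[OF _ e(1) e2])
  show "(\<lambda>q. f q * a q) \<in> borel_measurable pair_space" using a f by measurable
  show "\<bar>f q * a q\<bar> \<le> C * (strip D e (xL q) (xR q) * sizes q)" for q
  proof -
    have "\<bar>f q * a q\<bar> \<le> sizes q * (C * strip D e (xL q) (xR q))"
      unfolding abs_mult using bound by (intro mult_mono) (auto intro: order_trans[OF abs_ge_zero])
    then show ?thesis by (simp add: mult_ac)
  qed
qed

lemma cubic_norms:
  "norm ((norm (vL q))\<^sup>2 *\<^sub>R vL q) \<le> sizes q" "norm ((norm (vL q))\<^sup>2 *\<^sub>R vR q) \<le> sizes q"
  "norm ((norm (vR q))\<^sup>2 *\<^sub>R vL q) \<le> sizes q" "norm ((norm (vR q))\<^sup>2 *\<^sub>R vR q) \<le> sizes q"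
  "norm (pL q *\<^sub>R vR q) \<le> sizes q" "norm (pR q *\<^sub>R vL q) \<le> sizes q"
  "norm ((vL q \<bullet> vR q) *\<^sub>R vL q) \<le> sizes q" "norm ((vL q \<bullet> vR q) *\<^sub>R vR q) \<le> sizes q"
proof -
  show "norm ((norm (vL q))\<^sup>2 *\<^sub>R vL q) \<le> sizes q" "norm ((norm (vL q))\<^sup>2 *\<^sub>R vR q) \<le> sizes q"
    "norm ((norm (vR q))\<^sup>2 *\<^sub>R vL q) \<le> sizes q" "norm ((norm (vR q))\<^sup>2 *\<^sub>R vR q) \<le> sizes q"
    "norm (pL q *\<^sub>R vR q) \<le> sizes q" "norm (pR q *\<^sub>R vL q) \<le> sizes q"
    using square_mult_sizes[of q] by simp_all
  have c: "\<bar>vL q \<bullet> vR q\<bar> \<le> norm (vL q) * norm (vR q)" by (rule Cauchy_Schwarz_ineq2)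
  have "norm ((vL q \<bullet> vR q) *\<^sub>R vL q) \<le> norm (vL q) * norm (vR q) * norm (vL q)"
    using mult_right_mono[OF c norm_ge_zero[of "vL q"]] by simp
  also have "\<dots> = (norm (vL q))\<^sup>2 * norm (vR q)" by (simp add: power2_eq_square mult_ac)
  finally show "norm ((vL q \<bullet> vR q) *\<^sub>R vL q) \<le> sizes q" using square_mult_sizes(2)[of q] by linarith
  have "norm ((vL q \<bullet> vR q) *\<^sub>R vR q) \<le> norm (vL q) * norm (vR q) * norm (vR q)"
    using mult_right_mono[OF c norm_ge_zero[of "vR q"]] by simp
  also have "\<dots> = (norm (vR q))\<^sup>2 * norm (vL q)" by (simp add: power2_eq_square mult_ac)
  finally show "norm ((vL q \<bullet> vR q) *\<^sub>R vR q) \<le> sizes q" using square_mult_sizes(3)[of q] by linarith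
qed

text \<open>
  The next lemmas treat the fluxes of one phase only: their weights have integral zero in the other
  point.
\<close>

lemma flux_single_zero:
  assumes K: "K \<in> borel_measurable (borel \<Otimes>\<^sub>M (borel \<Otimes>\<^sub>M borel))"
    and int: "integrable \<mu>2 (\<lambda>q. K (fst q) * h (vL q, pL q))"
    and h: "h \<in> borel_measurable (borel :: 'n phase measure)"
    and zero: "\<And>t x. (\<integral>y. K (t, x, y) \<partial>dom_measure D) = 0"
  shows "(\<integral>q. K (fst q) * h (vL q, pL q) \<partial>\<mu>2) = (0::real)"
  using marginal[OF K h int] by (simp add: zero)

lemma integral_derivative_zero: "(\<integral>z. flow_deriv (coord_shift i) g z \<partial>lborel) = 0"
proof (rule integral_directional_derivative[where a="axis i 1" and R=e])
  show "((\<lambda>h. g (z + h *\<^sub>R axis i 1)) has_real_derivative flow_deriv (coord_shift i) g z) (at 0)" for z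
    using smooth_along_DERIV[OF g, of "coord_shift i" z] by (simp add: coord_shift_def)
qed (auto intro: smooth_along_continuous[OF g] smooth_along_continuous[OF dg_smooth] g_zero)

lemma integral_product_derivative_zero:
  "(\<integral>z. at_point (flow_deriv (space_shift 0 i) \<psi>) t (x + z) * g z + at_point \<psi> t (x + z) * flow_deriv (coord_shift i) g z \<partial>lborel) = 0"
proof (rule integral_directional_derivative[where a="axis i 1" and R=e and f="\<lambda>z. at_point \<psi> t (x + z) * g z"])
  have c: "continuous_on UNIV (\<lambda>z. at_point \<phi> t (x + z))" if "\<phi> \<in> test_functions D 1 {0<..<T}" for \<phi>
  proof -
    have "continuous_on UNIV (\<lambda>z. (t, x + z))" by (intro continuous_intros)
    from continuous_on_compose2[OF at_point_continuous[OF that] this subset_UNIV]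
    show ?thesis by simp
  qed
  note c1 = c[OF \<psi>] and c2 = c[OF test_functions_flow_deriv[OF \<psi> shifts_1(2)]]
  show "continuous_on UNIV (\<lambda>z. at_point \<psi> t (x + z) * g z)"
    by (intro continuous_on_mult c1 smooth_along_continuous[OF g])
  show "continuous_on UNIV (\<lambda>z. at_point (flow_deriv (space_shift 0 i) \<psi>) t (x + z) * g z + at_point \<psi> t (x + z) * flow_deriv (coord_shift i) g z)"
    by (intro continuous_on_mult continuous_on_add c1 c2 smooth_along_continuous[OF g] smooth_along_continuous[OF dg_smooth])
  fix z
  have d1: "((\<lambda>h. at_point \<psi> t (x + z + h *\<^sub>R axis i 1)) has_real_derivative at_point (flow_deriv (space_shift 0 i) \<psi>) t (x + z)) (at 0)"
    by (rule at_point_DERIV[OF \<psi>])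
  have d2: "((\<lambda>h. g (z + h *\<^sub>R axis i 1)) has_real_derivative flow_deriv (coord_shift i) g z) (at 0)"
    using smooth_along_DERIV[OF g, of "coord_shift i" z] by (simp add: coord_shift_def)
  show "((\<lambda>h. at_point \<psi> t (x + (z + h *\<^sub>R axis i 1)) * g (z + h *\<^sub>R axis i 1)) has_real_derivative
      (at_point (flow_deriv (space_shift 0 i) \<psi>) t (x + z) * g z + at_point \<psi> t (x + z) * flow_deriv (coord_shift i) g z)) (at 0)"
    using DERIV_mult'[OF d1 d2] by (simp add: add.assoc algebra_simps)
qed (simp add: g_zero)

lemma sum_inner: "x \<bullet> y = (\<Sum>i\<in>UNIV. x $ i * (y::real^'n) $ i)"
  by (simp add: inner_vec_def)

lemma flux_left_zero: "(\<integral>q. ((norm (vL q))\<^sup>2 *\<^sub>R vL q) \<bullet> (P q *\<^sub>R Gx q) \<partial>\<mu>2) = 0"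
proof -
  obtain C where C: "0 \<le> C" "\<And>q. norm (P q *\<^sub>R Gx q) \<le> C * strip D e (xL q) (xR q)" using bounded_weights by metis
  have z: "(\<integral>q. ((norm (vL q))\<^sup>2 * vL q $ i) * (P q * Gx q $ i) \<partial>\<mu>2) = 0 \<and> integrable \<mu>2 (\<lambda>q. ((norm (vL q))\<^sup>2 * vL q $ i) * (P q * Gx q $ i))" for i
  proof -
    let ?K = "\<lambda>s. at_point \<psi> (fst s) (fst (snd s)) * flow_deriv (coord_shift i) g (rep D (fst (snd s) - snd (snd s)))"
    let ?h = "\<lambda>a :: 'n phase. (norm (fst a))\<^sup>2 * fst a $ i"
    have int: "integrable \<mu>2 (\<lambda>q. ((norm (vL q))\<^sup>2 * vL q $ i) * (P q * Gx q $ i))"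
    proof (rule integrable_scalar[where C=C])
      show "\<bar>P q * Gx q $ i\<bar> \<le> C * strip D e (xL q) (xR q)" for q
        using order_trans[OF component_le_norm_cart C(2), of q i] by simp
      show "\<bar>(norm (vL q))\<^sup>2 * vL q $ i\<bar> \<le> sizes q" for q
        using order_trans[OF component_le_norm_cart cubic_norms(1), of q i] by simp
    qed measurable
    have eq: "((norm (vL q))\<^sup>2 * vL q $ i) * (P q * Gx q $ i) = ?K (fst q) * ?h (vL q, pL q)" for q
      by (simp add: weights grad_def coords)
    have [measurable]: "(\<lambda>s. at_point \<psi> (fst s) (fst (snd s))) \<in> borel_measurable (borel \<Otimes>\<^sub>M (borel \<Otimes>\<^sub>M borel))"
      by (rule at_point_measurable[OF \<psi>]) measurable
    have "(\<integral>q. ?K (fst q) * ?h (vL q, pL q) \<partial>\<mu>2) = 0"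
    proof (rule flux_single_zero)
      show "?K \<in> borel_measurable (borel \<Otimes>\<^sub>M (borel \<Otimes>\<^sub>M borel))" by measurable
      show "?h \<in> borel_measurable borel" unfolding borel_prod[symmetric] by measurable
      show "integrable \<mu>2 (\<lambda>q. ?K (fst q) * ?h (vL q, pL q))" using int unfolding eq .
      show "(\<integral>y. ?K (t, x, y) \<partial>dom_measure D) = 0" for t x
        using integral_near_point[OF _ e(1) e2, of "\<lambda>p. flow_deriv (coord_shift i) g (snd p)" D x]
        by (simp add: dg_zero integral_derivative_zero)
    qed
    then show ?thesis using int unfolding eq by simp
  qed
  have "(\<integral>q. ((norm (vL q))\<^sup>2 *\<^sub>R vL q) \<bullet> (P q *\<^sub>R Gx q) \<partial>\<mu>2) = (\<integral>q. (\<Sum>i\<in>UNIV. ((norm (vL q))\<^sup>2 * vL q $ i) * (P q * Gx q $ i)) \<partial>\<mu>2)"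
    by (simp only: sum_inner vector_scaleR_component real_scaleR_def)
  also have "\<dots> = 0"
    using z by (subst Bochner_Integration.integral_sum) auto
  finally show ?thesis .
qed

text \<open>
  Here the weight is the gradient of psi times g in the left point.  The points are exchanged in order
  to integrate out that point.
\<close>

lemma flux_right_zero: "(\<integral>q. ((norm (vR q))\<^sup>2 *\<^sub>R vR q) \<bullet> (G q *\<^sub>R Px q + P q *\<^sub>R Gx q) \<partial>\<mu>2) = 0"
proof -
  obtain C where C: "0 \<le> C" "\<And>q. norm (G q *\<^sub>R Px q + P q *\<^sub>R Gx q) \<le> C * strip D e (xL q) (xR q)" using bounded_weights by metis
  have z: "(\<integral>q. ((norm (vR q))\<^sup>2 * vR q $ i) * (G q * Px q $ i + P q * Gx q $ i) \<partial>\<mu>2) = 0 \<and> integrable \<mu>2 (\<lambda>q. ((norm (vR q))\<^sup>2 * vR q $ i) * (G q * Px q $ i + P q * Gx q $ i))" for i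
  proof -
    let ?dg = "flow_deriv (coord_shift i) g" and ?d\<psi> = "flow_deriv (space_shift 0 i) \<psi>"
    let ?K = "\<lambda>s. g (- rep D (fst (snd s) - snd (snd s))) * at_point ?d\<psi> (fst s) (snd (snd s)) +
        at_point \<psi> (fst s) (snd (snd s)) * ?dg (- rep D (fst (snd s) - snd (snd s)))"
    let ?h = "\<lambda>a :: 'n phase. (norm (fst a))\<^sup>2 * fst a $ i"
    let ?F = "\<lambda>q. ((norm (vR q))\<^sup>2 * vR q $ i) * (G q * Px q $ i + P q * Gx q $ i)"
    have Fm: "?F \<in> borel_measurable pair_space" by measurable
    have int: "integrable \<mu>2 ?F"
    proof (rule integrable_scalar[where C=C])
      show "\<bar>G q * Px q $ i + P q * Gx q $ i\<bar> \<le> C * strip D e (xL q) (xR q)" for q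
        using order_trans[OF component_le_norm_cart C(2), of q i] by simp
      show "\<bar>(norm (vR q))\<^sup>2 * vR q $ i\<bar> \<le> sizes q" for q
        using order_trans[OF component_le_norm_cart cubic_norms(4), of q i] by simp
    qed measurable
    have d\<psi>: "?d\<psi> \<in> test_functions D 1 {0<..<T}" by (rule test_functions_flow_deriv[OF \<psi> shifts_1(2)])
    have [measurable]: "(\<lambda>s. at_point \<psi> (fst s) (snd (snd s))) \<in> borel_measurable (borel \<Otimes>\<^sub>M (borel \<Otimes>\<^sub>M borel))"
      "(\<lambda>s. at_point ?d\<psi> (fst s) (snd (snd s))) \<in> borel_measurable (borel \<Otimes>\<^sub>M (borel \<Otimes>\<^sub>M borel))"
      by (rule at_point_measurable[OF \<psi>], measurable) (rule at_point_measurable[OF d\<psi>], measurable)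
    have eq: "?F (flip q) = ?K (fst q) * ?h (vL q, pL q)" for q
    proof -
      have r1: "g (rep D (xR q - xL q)) = g (- rep D (xL q - xR q))" by (rule rep_reflect[OF g_zero e2])
      have r2: "?dg (rep D (xR q - xL q)) = ?dg (- rep D (xL q - xR q))" by (rule rep_reflect[OF dg_zero e2])
      show ?thesis
        unfolding weights flip_simps at_point_grad grad_def vec_lambda_beta r1 r2 by (simp add: coords)
    qed
    have intf: "integrable \<mu>2 (\<lambda>q. ?F (flip q))"
    proof -
      have m: "flip \<in> \<mu>2 \<rightarrow>\<^sub>M \<mu>2"
        by (subst measurable_cong_sets[OF sets_\<mu>2 sets_\<mu>2]) (rule flip_measurable)
      show ?thesis using integrable_distr[OF m, of ?F] int unfolding distr_flip by blast
    qed
    have "(\<integral>q. ?K (fst q) * ?h (vL q, pL q) \<partial>\<mu>2) = 0"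
    proof (rule flux_single_zero)
      show "?K \<in> borel_measurable (borel \<Otimes>\<^sub>M (borel \<Otimes>\<^sub>M borel))" by measurable
      show "?h \<in> borel_measurable borel" unfolding borel_prod[symmetric] by measurable
      show "integrable \<mu>2 (\<lambda>q. ?K (fst q) * ?h (vL q, pL q))" using intf unfolding eq .
      fix t x
      let ?k = "\<lambda>p. g (- snd p) * at_point ?d\<psi> t (fst p) + at_point \<psi> t (fst p) * ?dg (- snd p)"
      have [measurable]: "(\<lambda>p. at_point \<psi> t (fst p)) \<in> borel_measurable (borel \<Otimes>\<^sub>M borel)"
        "(\<lambda>p. at_point ?d\<psi> t (fst p)) \<in> borel_measurable (borel \<Otimes>\<^sub>M borel)"
        by (rule at_point_measurable[OF \<psi>], measurable) (rule at_point_measurable[OF d\<psi>], measurable)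
      have km: "?k \<in> borel_measurable (borel \<Otimes>\<^sub>M borel)" by measurable
      have "(\<integral>y. ?K (t, x, y) \<partial>dom_measure D) = (\<integral>z. ?k (wrap D (x - z), z) \<partial>lborel)"
        using integral_near_point[OF km e(1) e2, of D x] by (simp add: g_zero dg_zero)
      also have "\<dots> = (\<integral>z. g (- z) * at_point ?d\<psi> t (x - z) + at_point \<psi> t (x - z) * ?dg (- z) \<partial>lborel)"
        by (simp add: at_point_wrap[OF \<psi>] at_point_wrap[OF d\<psi>])
      also have "\<dots> = (\<integral>z. at_point ?d\<psi> t (x + z) * g z + at_point \<psi> t (x + z) * ?dg z \<partial>lborel)"
      proof -
        have [measurable]: "(\<lambda>z. at_point \<psi> t (x + z)) \<in> borel_measurable borel" "(\<lambda>z. at_point ?d\<psi> t (x + z)) \<in> borel_measurable borel"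
          by (rule at_point_measurable[OF \<psi>], measurable) (rule at_point_measurable[OF d\<psi>], measurable)
        have r: "lborel = distr lborel borel (\<lambda>z. - z :: real^'n)"
          using lborel_affine[of "-1" "0 :: real^'n"] by (simp add: density_1)
        have "(\<integral>z. at_point ?d\<psi> t (x + z) * g z + at_point \<psi> t (x + z) * ?dg z \<partial>lborel) =
          (\<integral>z. at_point ?d\<psi> t (x + z) * g z + at_point \<psi> t (x + z) * ?dg z \<partial>distr lborel borel (\<lambda>z. - z))"
          using r by simp
        also have "\<dots> = (\<integral>z. at_point ?d\<psi> t (x + - z) * g (- z) + at_point \<psi> t (x + - z) * ?dg (- z) \<partial>lborel)"
          by (rule integral_distr) measurable
        finally show ?thesis by (simp add: mult.commute)
      qed
      also have "\<dots> = 0" by (rule integral_product_derivative_zero)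
      finally show "(\<integral>y. ?K (t, x, y) \<partial>dom_measure D) = 0" .
    qed
    then have "(\<integral>q. ?F q \<partial>\<mu>2) = 0" using integral_flip[OF Fm] unfolding eq by simp
    then show ?thesis using int by simp
  qed
  have "(\<integral>q. ((norm (vR q))\<^sup>2 *\<^sub>R vR q) \<bullet> (G q *\<^sub>R Px q + P q *\<^sub>R Gx q) \<partial>\<mu>2) =
      (\<integral>q. (\<Sum>i\<in>UNIV. ((norm (vR q))\<^sup>2 * vR q $ i) * (G q * Px q $ i + P q * Gx q $ i)) \<partial>\<mu>2)"
    by (simp only: sum_inner vector_scaleR_component vector_add_component real_scaleR_def)
  also have "\<dots> = 0"
    using z by (subst Bochner_Integration.integral_sum) auto
  finally show ?thesis .
qed

text \<open>
  The integrals of the three families of products in the evolution equation are collected into one,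
  which is possible as they exist separately.
\<close>

lemma evolution_bracket:
  assumes i1: "integrable N (\<lambda>\<xi>. \<Prod>j<2. vel \<xi> j $ i)"
    and i2: "\<And>l. l < 2 \<Longrightarrow> integrable N (\<lambda>\<xi>. (\<Prod>j<2. vel \<xi> j $ i) *\<^sub>R (vel \<xi> l :: real^'n))"
    and i3: "\<And>l. l < 2 \<Longrightarrow> integrable N (\<lambda>\<xi>. pres \<xi> l * (\<Prod>j\<in>{..<2} - {l}. vel \<xi> j $ i))"
  shows "(\<integral>\<xi>. (\<Prod>j<2. vel \<xi> j $ i) \<partial>N) * d
     + (\<Sum>l<2. (\<integral>\<xi>. (\<Prod>j<2. vel \<xi> j $ i) *\<^sub>R vel \<xi> l \<partial>N) \<bullet> a l)
     + (\<Sum>l<2. (\<integral>\<xi>. pres \<xi> l * (\<Prod>j\<in>{..<2} - {l}. vel \<xi> j $ i) \<partial>N) * (a l $ i)) =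
   (\<integral>\<xi>. vel \<xi> 0 $ i * vel \<xi> 1 $ i * d + (vel \<xi> 0 $ i * vel \<xi> 1 $ i) * (vel \<xi> 0 \<bullet> a 0) + (vel \<xi> 0 $ i * vel \<xi> 1 $ i) * (vel \<xi> 1 \<bullet> a 1)
      + pres \<xi> 0 * vel \<xi> 1 $ i * a 0 $ i + pres \<xi> 1 * vel \<xi> 0 $ i * a 1 $ i \<partial>N)"
proof -
  have s2: "(\<Sum>l<2. f l) = f 0 + f 1" "(\<Prod>l<2. h l) = h 0 * h 1" for f h :: "nat \<Rightarrow> real"
    by (simp_all add: numeral_2_eq_2 One_nat_def)
  have d: "{..<2} - {0} = {1::nat}" "{..<2} - {1} = {0::nat}" by auto
  note i3' = i3[of 0, simplified d] i3[of 1, simplified d]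
  note i2' = i2[of 0, unfolded s2] i2[of 1, unfolded s2]
  have j2: "integrable N (\<lambda>\<xi>. (vel \<xi> 0 $ i * vel \<xi> 1 $ i) * (vel \<xi> 0 \<bullet> a 0))" "integrable N (\<lambda>\<xi>. (vel \<xi> 0 $ i * vel \<xi> 1 $ i) * (vel \<xi> 1 \<bullet> a 1))"
    using integrable_inner_left[of "a 0", OF i2'(1)] integrable_inner_left[of "a 1", OF i2'(2)] by simp_all
  have v2: "(\<integral>\<xi>. (vel \<xi> 0 $ i * vel \<xi> 1 $ i) *\<^sub>R vel \<xi> 0 \<partial>N) \<bullet> a 0 = (\<integral>\<xi>. (vel \<xi> 0 $ i * vel \<xi> 1 $ i) * (vel \<xi> 0 \<bullet> a 0) \<partial>N)"
     "(\<integral>\<xi>. (vel \<xi> 0 $ i * vel \<xi> 1 $ i) *\<^sub>R vel \<xi> 1 \<partial>N) \<bullet> a 1 = (\<integral>\<xi>. (vel \<xi> 0 $ i * vel \<xi> 1 $ i) * (vel \<xi> 1 \<bullet> a 1) \<partial>N)"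
    using integral_inner_left[of "a 0", OF i2'(1)] integral_inner_left[of "a 1", OF i2'(2)] by simp_all
  have j1: "integrable N (\<lambda>\<xi>. vel \<xi> 0 $ i * vel \<xi> 1 $ i * d)" using i1[unfolded s2] by simp
  have j3: "integrable N (\<lambda>\<xi>. pres \<xi> 0 * vel \<xi> 1 $ i * a 0 $ i)" "integrable N (\<lambda>\<xi>. pres \<xi> 1 * vel \<xi> 0 $ i * a 1 $ i)"
    using i3' by (simp_all add: d)
  show ?thesis
    unfolding s2 d v2 using j1 j2 j3 by (simp add: v2)
qed

text \<open>
  The evolution equation for the products of the i-th components of both velocities, with test
  function psi(t,x) g(x - y), is summed over i.
\<close>

lemma evolution_zero:
  "(\<integral>q. (vL q \<bullet> vR q) * (G q * Pt q) + ((vL q \<bullet> vR q) *\<^sub>R vL q) \<bullet> (G q *\<^sub>R Px q + P q *\<^sub>R Gx q)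
      - ((vL q \<bullet> vR q) *\<^sub>R vR q) \<bullet> (P q *\<^sub>R Gx q)
      + (pL q *\<^sub>R vR q) \<bullet> (G q *\<^sub>R Px q + P q *\<^sub>R Gx q) - (pR q *\<^sub>R vL q) \<bullet> (P q *\<^sub>R Gx q) \<partial>\<mu>2) = 0"
proof -
  obtain C where C: "0 \<le> C" "\<And>q. \<bar>G q * Pt q\<bar> \<le> C * strip D e (xL q) (xR q)"
    "\<And>q. norm (G q *\<^sub>R Px q) \<le> C * strip D e (xL q) (xR q)"
    "\<And>q. norm (P q *\<^sub>R Gx q) \<le> C * strip D e (xL q) (xR q)"
    "\<And>q. norm (G q *\<^sub>R Px q + P q *\<^sub>R Gx q) \<le> C * strip D e (xL q) (xR q)"
    using bounded_weights by metis
  let ?A = "\<lambda>q. G q *\<^sub>R Px q + P q *\<^sub>R Gx q" and ?B = "\<lambda>q. P q *\<^sub>R Gx q"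
  define E where "E i q = (vL q $ i * vR q $ i) * (G q * Pt q) + (vL q $ i * vR q $ i) * (vL q \<bullet> ?A q)
      - (vL q $ i * vR q $ i) * (vR q \<bullet> ?B q)
      + (pL q * vR q $ i) * ?A q $ i - (pR q * vL q $ i) * ?B q $ i" for i q
  let ?\<phi> = "pair_test D \<psi> g 0 1"
  have ab: "{0, 1} = {0, 1::nat}" ..
  have \<phi>: "?\<phi> \<in> test_functions D 2 {0<..<T}"
    by (rule pair_test_mem[OF \<psi> g g0 e(2) ab])
  note der = pair_test_derivs[OF \<psi> g g0 e(2) ab]
  have z: "integrable \<mu>2 (E i) \<and> (\<integral>q. E i q \<partial>\<mu>2) = 0" for i
  proof -
    have comp: "\<bar>x $ i * y $ i\<bar> \<le> norm x * norm y" for x y :: "real^'n"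
      unfolding abs_mult by (intro mult_mono component_le_norm_cart) auto
    have nn: "\<bar>vL q $ i * vR q $ i\<bar> \<le> sizes q" for q :: "(real \<times> (real^'n) \<times> (real^'n)) \<times> 'n phase \<times> 'n phase"
      using comp[of "vL q" "vR q"] square_mult_sizes(8)[of q] by linarith
    have n1: "norm ((vL q $ i * vR q $ i) *\<^sub>R vL q) \<le> sizes q" for q :: "(real \<times> (real^'n) \<times> (real^'n)) \<times> 'n phase \<times> 'n phase"
      using mult_right_mono[OF comp[of "vL q" "vR q"] norm_ge_zero[of "vL q"]] square_mult_sizes(2)[of q]
      by (simp add: power2_eq_square mult_ac)
    have n2: "norm ((vL q $ i * vR q $ i) *\<^sub>R vR q) \<le> sizes q" for q :: "(real \<times> (real^'n) \<times> (real^'n)) \<times> 'n phase \<times> 'n phase"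
      using mult_right_mono[OF comp[of "vL q" "vR q"] norm_ge_zero[of "vR q"]] square_mult_sizes(3)[of q]
      by (simp add: power2_eq_square mult_ac)
    have n3: "\<bar>pL q * vR q $ i\<bar> \<le> sizes q" for q :: "(real \<times> (real^'n) \<times> (real^'n)) \<times> 'n phase \<times> 'n phase"
      using order_trans[OF component_le_norm_cart cubic_norms(5), of q i] by simp
    have n4: "\<bar>pR q * vL q $ i\<bar> \<le> sizes q" for q :: "(real \<times> (real^'n) \<times> (real^'n)) \<times> 'n phase \<times> 'n phase"
      using order_trans[OF component_le_norm_cart cubic_norms(6), of q i] by simp
    have a3: "\<bar>?A q $ i\<bar> \<le> C * strip D e (xL q) (xR q)" "\<bar>?B q $ i\<bar> \<le> C * strip D e (xL q) (xR q)" for q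
      using order_trans[OF component_le_norm_cart C(5), of q i] order_trans[OF component_le_norm_cart C(4), of q i] by simp_all
    have t1: "integrable \<mu>2 (\<lambda>q. (vL q $ i * vR q $ i) * (G q * Pt q))"
      by (rule integrable_scalar[OF _ _ C(2) nn]) measurable
    have t2: "integrable \<mu>2 (\<lambda>q. (vL q $ i * vR q $ i) * (vL q \<bullet> ?A q))"
      using integrable_inner[OF _ _ C(5) n1] by simp
    have t3: "integrable \<mu>2 (\<lambda>q. (vL q $ i * vR q $ i) * (vR q \<bullet> ?B q))"
      using integrable_inner[OF _ _ C(4) n2] by (simp add: mult_ac)
    have t4: "integrable \<mu>2 (\<lambda>q. (pL q * vR q $ i) * ?A q $ i)"
      by (rule integrable_scalar[OF _ _ a3(1) n3]) measurable
    have t5: "integrable \<mu>2 (\<lambda>q. (pR q * vL q $ i) * ?B q $ i)"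
      by (rule integrable_scalar[OF _ _ a3(2) n4]) measurable
    have int: "integrable \<mu>2 (E i)"
      unfolding E_def by (intro Bochner_Integration.integrable_add Bochner_Integration.integrable_diff t1 t2 t3 t4 t5)
    have Em: "E i \<in> borel_measurable pair_space" using int by (simp add: measurable_\<mu>2[symmetric])
    have ev: "evolution_cond D T \<nu>" using sol by (simp add: statistical_solution_def)
    have br: "AE_bracket_defined D T \<nu> 2 (\<lambda>\<xi>. \<Prod>j<2. vel \<xi> j $ i)"
      "\<forall>l<2. AE_bracket_defined D T \<nu> 2 (\<lambda>\<xi>. (\<Prod>j<2. vel \<xi> j $ i) *\<^sub>R vel \<xi> l)"
      "\<forall>l<2. AE_bracket_defined D T \<nu> 2 (\<lambda>\<xi>. pres \<xi> l * (\<Prod>j\<in>{..<2} - {l}. vel \<xi> j $ i))"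
      "(\<integral>p. evolution_integrand \<nu> 2 (\<lambda>_. i) ?\<phi> p \<partial>spacetime D T 2) = 0"
      using ev[unfolded evolution_cond_def, rule_format, of 2 "\<lambda>_. i"] \<phi> by simp_all
    have l2: "0 < (2::nat)" "1 < (2::nat)" by simp_all
    have br': "AE (t, x, y) in S2 D T. integrable (\<nu> 2 t (tuple [x, y])) (\<lambda>\<xi>. \<Prod>j<2. vel \<xi> j $ i)"
      "AE (t, x, y) in S2 D T. integrable (\<nu> 2 t (tuple [x, y])) (\<lambda>\<xi>. (\<Prod>j<2. vel \<xi> j $ i) *\<^sub>R vel \<xi> 0)"
      "AE (t, x, y) in S2 D T. integrable (\<nu> 2 t (tuple [x, y])) (\<lambda>\<xi>. (\<Prod>j<2. vel \<xi> j $ i) *\<^sub>R vel \<xi> 1)"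
      "AE (t, x, y) in S2 D T. integrable (\<nu> 2 t (tuple [x, y])) (\<lambda>\<xi>. pres \<xi> 0 * (\<Prod>j\<in>{..<2} - {0}. vel \<xi> j $ i))"
      "AE (t, x, y) in S2 D T. integrable (\<nu> 2 t (tuple [x, y])) (\<lambda>\<xi>. pres \<xi> 1 * (\<Prod>j\<in>{..<2} - {1}. vel \<xi> j $ i))"
      using AE_spacetime2[OF T sol br(1)[unfolded AE_bracket_defined_def]]
        AE_spacetime2[OF T sol br(2)[rule_format, OF l2(1), unfolded AE_bracket_defined_def]]
        AE_spacetime2[OF T sol br(2)[rule_format, OF l2(2), unfolded AE_bracket_defined_def]]
        AE_spacetime2[OF T sol br(3)[rule_format, OF l2(1), unfolded AE_bracket_defined_def]]
        AE_spacetime2[OF T sol br(3)[rule_format, OF l2(2), unfolded AE_bracket_defined_def]] by blast+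
    have "AE (t, x, y) in S2 D T. evolution_integrand \<nu> 2 (\<lambda>_. i) ?\<phi> (t, tuple [x, y]) = (\<integral>\<xi>. E i ((t, x, y), \<xi>) \<partial>\<kappa>2 (t, x, y))"
      using br' bracket2
    proof eventually_elim
      case (elim s)
      obtain t x y where s: "s = (t, x, y)" by (cases s)
      have tup: "tuple [x, y] 0 = x" "tuple [x, y] 1 = y" by (simp_all add: tuple_def)
      let ?a = "\<lambda>l. grad_at l ?\<phi> (t, tuple [x, y])"
      have Es: "(\<lambda>\<zeta>. E i (s, \<zeta>)) \<in> borel_measurable borel"
        by (rule measurable_compose[OF measurable_Pair1' Em]) (simp add: space_pair_measure)
      have il: "integrable (\<nu> 2 t (tuple [x, y])) (\<lambda>\<xi>. (\<Prod>j<2. vel \<xi> j $ i) *\<^sub>R vel \<xi> l)"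
        "integrable (\<nu> 2 t (tuple [x, y])) (\<lambda>\<xi>. pres \<xi> l * (\<Prod>j\<in>{..<2} - {l}. vel \<xi> j $ i))" if "l < 2" for l
        using elim(2-5)[unfolded s prod.case] that by (auto simp: less_2_cases_iff One_nat_def)
      have "evolution_integrand \<nu> 2 (\<lambda>_. i) ?\<phi> (t, tuple [x, y]) =
        (\<integral>\<xi>. vel \<xi> 0 $ i * vel \<xi> 1 $ i * dt ?\<phi> (t, tuple [x, y]) + (vel \<xi> 0 $ i * vel \<xi> 1 $ i) * (vel \<xi> 0 \<bullet> ?a 0) + (vel \<xi> 0 $ i * vel \<xi> 1 $ i) * (vel \<xi> 1 \<bullet> ?a 1)
          + pres \<xi> 0 * vel \<xi> 1 $ i * ?a 0 $ i + pres \<xi> 1 * vel \<xi> 0 $ i * ?a 1 $ i \<partial>\<nu> 2 t (tuple [x, y]))"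
        unfolding evolution_integrand_def prod.case
        by (rule evolution_bracket) (use elim(1)[unfolded s prod.case] il in auto)
      also have "\<dots> = (\<integral>\<xi>. E i ((t, x, y), (\<xi> 0, \<xi> 1)) \<partial>\<nu> 2 t (tuple [x, y]))"
      proof (rule Bochner_Integration.integral_cong[OF refl])
        fix \<xi> :: "nat \<Rightarrow> 'n phase"
        have w: "G ((t, x, y), (\<xi> 0, \<xi> 1)) = g (rep D (x - y))" "P ((t, x, y), (\<xi> 0, \<xi> 1)) = at_point \<psi> t x"
          "Pt ((t, x, y), (\<xi> 0, \<xi> 1)) = at_point (dt \<psi>) t x" "Px ((t, x, y), (\<xi> 0, \<xi> 1)) = at_point (grad_at 0 \<psi>) t x"
          "Gx ((t, x, y), (\<xi> 0, \<xi> 1)) = grad g (rep D (x - y))"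
          "vL ((t, x, y), (\<xi> 0, \<xi> 1)) = vel \<xi> 0" "vR ((t, x, y), (\<xi> 0, \<xi> 1)) = vel \<xi> 1"
          "pL ((t, x, y), (\<xi> 0, \<xi> 1)) = pres \<xi> 0" "pR ((t, x, y), (\<xi> 0, \<xi> 1)) = pres \<xi> 1"
          by (simp_all add: weights coords vel_def pres_def)
        show "vel \<xi> 0 $ i * vel \<xi> 1 $ i * dt ?\<phi> (t, tuple [x, y]) + (vel \<xi> 0 $ i * vel \<xi> 1 $ i) * (vel \<xi> 0 \<bullet> ?a 0) + (vel \<xi> 0 $ i * vel \<xi> 1 $ i) * (vel \<xi> 1 \<bullet> ?a 1)
          + pres \<xi> 0 * vel \<xi> 1 $ i * ?a 0 $ i + pres \<xi> 1 * vel \<xi> 0 $ i * ?a 1 $ i = E i ((t, x, y), (\<xi> 0, \<xi> 1))"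
          unfolding E_def w der tup by (simp add: inner_minus_right)
      qed
      also have "\<dots> = (\<integral>\<zeta>. E i (s, \<zeta>) \<partial>\<kappa>2 s)"
        using conjunct1[OF bspec[OF conjunct1[OF elim(6)[unfolded s prod.case]] Es]] unfolding s .
      finally show ?case unfolding s by simp
    qed
    then have "AE (t, x, y) in S2 D T. evolution_integrand \<nu> 2 (\<lambda>_. i) ?\<phi> (t, tuple [x, y]) = (\<lambda>s. \<integral>\<xi>. E i (s, \<xi>) \<partial>\<kappa>2 s) (t, x, y)"
      by simp
    from integral_spacetime2[OF T sol borel_measurable_integrable[OF integral_\<mu>2(2)[OF int]] this]
    have "(\<integral>s. (\<integral>\<xi>. E i (s, \<xi>) \<partial>\<kappa>2 s) \<partial>S2 D T) = 0" using br(4) by simp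
    then show ?thesis using int integral_\<mu>2(3)[OF int] by simp
  qed
  have "(\<Sum>i\<in>UNIV. E i q) = (vL q \<bullet> vR q) * (G q * Pt q) + ((vL q \<bullet> vR q) *\<^sub>R vL q) \<bullet> ?A q
      - ((vL q \<bullet> vR q) *\<^sub>R vR q) \<bullet> ?B q + (pL q *\<^sub>R vR q) \<bullet> ?A q - (pR q *\<^sub>R vL q) \<bullet> ?B q" for q
    unfolding E_def sum.distrib sum_subtractf inner_scaleR_left
    unfolding sum_inner[of "vL q" "vR q"] sum_inner[of "vR q" "?A q"] sum_inner[of "vL q" "?B q"]
    by (simp only: sum_distrib_right sum_distrib_left mult.assoc)
  then have "(\<integral>q. (vL q \<bullet> vR q) * (G q * Pt q) + ((vL q \<bullet> vR q) *\<^sub>R vL q) \<bullet> ?A q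
      - ((vL q \<bullet> vR q) *\<^sub>R vR q) \<bullet> ?B q + (pL q *\<^sub>R vR q) \<bullet> ?A q - (pR q *\<^sub>R vL q) \<bullet> ?B q \<partial>\<mu>2) = (\<integral>q. (\<Sum>i\<in>UNIV. E i q) \<partial>\<mu>2)"
    by simp
  also have "\<dots> = 0" using z by (subst Bochner_Integration.integral_sum) auto
  finally show ?thesis .
qed

text \<open>
  The derivative falls on the second point.  With a = 0, b = 1 this is the point at which only g is
  evaluated; with a = 1, b = 0 it is the point of psi.
\<close>

lemma divergence_zero:
  fixes \<kappa> :: "'n phase \<Rightarrow> real" and a b :: nat
  assumes \<kappa>: "continuous_on UNIV \<kappa>" and k1: "\<And>z. \<bar>\<kappa> z\<bar> \<le> 1 + size1 z"
    and k2: "\<And>q :: (real \<times> (real^'n) \<times> (real^'n)) \<times> 'n phase \<times> 'n phase. norm (\<kappa> (vL q, pL q) *\<^sub>R vR q) \<le> sizes q"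
    and ab: "{a, b} = {0, 1}"
    and A: "A \<in> borel_measurable pair_space" "\<And>q. norm (A q) \<le> C * strip D e (xL q) (xR q)"
    and grad: "\<And>t x y \<zeta>. grad_at 1 (pair_test D \<psi> g a b) (t, tuple [x, y]) = A ((t, x, y), \<zeta>)"
  shows "(\<integral>q. (\<kappa> (vL q, pL q) *\<^sub>R vR q) \<bullet> A q \<partial>\<mu>2) = 0"
proof -
  let ?\<phi> = "pair_test D \<psi> g a b"
  let ?F = "\<lambda>q. (\<kappa> (vL q, pL q) *\<^sub>R vR q) \<bullet> A q"
  have \<kappa>m: "\<kappa> \<in> borel_measurable borel" using \<kappa> by (rule borel_measurable_continuous_onI)
  have f1: "(\<lambda>\<zeta>. \<kappa> (fst \<zeta>)) \<in> borel_measurable (borel :: ('n phase \<times> 'n phase) measure)"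
    by (rule measurable_compose[OF fst_borel \<kappa>m])
  have f2: "(\<lambda>\<zeta>. fst (snd \<zeta>)) \<in> borel_measurable (borel :: ('n phase \<times> 'n phase) measure)"
    by (rule measurable_compose[OF snd_borel fst_borel])
  have fm: "(\<lambda>\<zeta>. \<kappa> (fst \<zeta>) *\<^sub>R fst (snd \<zeta>)) \<in> borel_measurable (borel :: ('n phase \<times> 'n phase) measure)"
    using f1 f2 by (rule borel_measurable_scaleR)
  have fm': "(\<lambda>q. \<kappa> (vL q, pL q) *\<^sub>R vR q) \<in> borel_measurable pair_space"
    unfolding coords prod.collapse by (rule measurable_compose[OF measurable_snd fm])
  have int: "integrable \<mu>2 ?F" by (rule integrable_inner[OF A(1) fm' A(2) k2])
  have \<phi>: "?\<phi> \<in> test_functions D 2 UNIV" by (rule pair_test_mem[OF \<psi>_UNIV g g0 e(2) ab])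
  have fin: "AE (t, x, y) in S2 D T. \<forall>i. integrable (\<nu> 2 t (tuple [x, y])) (\<lambda>\<xi>. \<kappa> (\<xi> 0) * vel \<xi> 1 $ i)"
    using AE_kernel2_finite bracket2
  proof eventually_elim
    case (elim s)
    obtain t x y where s: "s = (t, x, y)" by (cases s)
    have "integrable (\<nu> 2 t (tuple [x, y])) (\<lambda>\<xi>. \<kappa> (\<xi> 0) * vel \<xi> 1 $ i)" for i
    proof -
      have m: "(\<lambda>\<zeta>. \<kappa> (fst \<zeta>) * fst (snd \<zeta>) $ i) \<in> borel_measurable (borel :: ('n phase \<times> 'n phase) measure)"
        using f1 f2 by measurable
      have "integrable (\<kappa>2 s) (\<lambda>\<zeta>. \<kappa> (fst \<zeta>) * fst (snd \<zeta>) $ i)"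
      proof (rule kernel2_integrable[OF m, where C=1 and s=s])
        show "\<bar>\<kappa> (fst \<zeta>) * fst (snd \<zeta>) $ i\<bar> \<le> 1 * sizes (s, \<zeta>)" for \<zeta>
          using order_trans[OF component_le_norm_cart k2, of "(s, \<zeta>)" i] by (simp add: coords)
      qed (use elim in simp)
      then have "integrable (\<nu> 2 t (tuple [x, y])) (\<lambda>\<xi>. (\<lambda>\<zeta>. \<kappa> (fst \<zeta>) * fst (snd \<zeta>) $ i) (\<xi> 0, \<xi> 1))"
        using conjunct2[OF bspec[OF conjunct1[OF elim(2)[unfolded s prod.case]] m]] unfolding s by blast
      then show ?thesis by (simp add: vel_def)
    qed
    then show ?case unfolding s by simp
  qed
  have fin': "AE (t, x, y) in S2 D T. integrable (\<nu> 2 t (tuple [x, y])) (\<lambda>\<xi>. \<kappa> (\<xi> 0) *\<^sub>R vel \<xi> 1)"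
    using fin
  proof eventually_elim
    case (elim s)
    obtain t x y where s: "s = (t, x, y)" by (cases s)
    have "integrable (\<nu> 2 t (tuple [x, y])) (\<lambda>\<xi>. \<Sum>i\<in>UNIV. (\<kappa> (\<xi> 0) * vel \<xi> 1 $ i) *\<^sub>R axis i (1::real))"
      using elim unfolding s by (intro Bochner_Integration.integrable_sum integrable_scaleR_left) simp
    moreover have "(\<Sum>i\<in>UNIV. (\<kappa> (\<xi> 0) * vel \<xi> 1 $ i) *\<^sub>R axis i (1::real)) = \<kappa> (\<xi> 0) *\<^sub>R vel \<xi> 1" for \<xi> :: "nat \<Rightarrow> 'n phase"
      using basis_expansion[of "\<kappa> (\<xi> 0) *\<^sub>R vel \<xi> 1"] by (simp add: scalar_mult_eq_scaleR)
    ultimately show ?case unfolding s by simp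
  qed
  have b2: "AE_bracket_defined D T \<nu> 2 (\<lambda>\<xi>. \<kappa> (\<xi> 0) *\<^sub>R vel \<xi> (2 - 1))"
  proof -
    interpret coding "S2 D T" "base D T 2" "enc2 D T" "\<lambda>p. (fst p, snd p 0, snd p 1)" by (rule coding2[OF T])
    have eq: "(2::nat) - 1 = 1" by simp
    show ?thesis
      unfolding AE_bracket_defined_def spacetime_base eq
      by (rule AE_code) (use fin' AE_S2_pts in \<open>eventually_elim, auto simp: enc_on_points\<close>)
  qed
  have b1: "AE_bracket_defined D T \<nu> (2 - 1) (\<lambda>\<xi>. \<kappa> (\<xi> 0))"
  proof -
    interpret coding "S1 D T" "base D T 1" "enc1 D T" "\<lambda>p. (fst p, snd p 0)" by (rule coding1[OF T])
    have eq: "(2::nat) - 1 = 1" by simp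
    have fin1: "AE (t, x) in S1 D T. integrable (\<nu> 1 t (tuple [x])) (\<lambda>\<xi>. \<kappa> (\<xi> 0))"
      using AE_kernel1_finite bracket1
    proof eventually_elim
      case (elim r)
      obtain t x where r: "r = (t, x)" by (cases r)
      have "integrable (\<kappa>1 r) \<kappa>"
        by (rule kernel1_integrable[OF \<kappa>m, where C=1]) (use k1 elim in auto)
      then show ?case
        using conjunct2[OF bspec[OF conjunct1[OF elim(2)[unfolded r prod.case]] \<kappa>m]] unfolding r by simp
    qed
    show ?thesis
      unfolding AE_bracket_defined_def spacetime_base eq
      by (rule AE_code) (use fin1 AE_S1_pts in \<open>eventually_elim, auto simp: enc_on_points\<close>)
  qed
  have ae: "AE (t, x, y) in S2 D T. (\<lambda>(t, x). grad_at (2 - 1) ?\<phi> (t, x) \<bullet> (\<integral>\<xi>. \<kappa> (\<xi> 0) *\<^sub>R vel \<xi> (2 - 1) \<partial>\<nu> 2 t x)) (t, tuple [x, y]) =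
      (\<lambda>s. \<integral>\<zeta>. ?F (s, \<zeta>) \<partial>\<kappa>2 s) (t, x, y)"
    using fin' bracket2
  proof eventually_elim
    case (elim s)
    obtain t x y where s: "s = (t, x, y)" by (cases s)
    let ?c = "grad_at 1 ?\<phi> (t, tuple [x, y])"
    have eq: "(2::nat) - 1 = 1" by simp
    have m: "(\<lambda>\<zeta>. (\<kappa> (fst \<zeta>) *\<^sub>R fst (snd \<zeta>)) \<bullet> ?c) \<in> borel_measurable (borel :: ('n phase \<times> 'n phase) measure)"
      using fm by measurable
    have "?c \<bullet> (\<integral>\<xi>. \<kappa> (\<xi> 0) *\<^sub>R vel \<xi> 1 \<partial>\<nu> 2 t (tuple [x, y])) = (\<integral>\<xi>. (\<kappa> (\<xi> 0) *\<^sub>R vel \<xi> 1) \<bullet> ?c \<partial>\<nu> 2 t (tuple [x, y]))"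
      using integral_inner_left[of ?c, OF elim(1)[unfolded s prod.case]] by (simp only: inner_commute[of ?c])
    also have "\<dots> = (\<integral>\<xi>. (\<lambda>\<zeta>. (\<kappa> (fst \<zeta>) *\<^sub>R fst (snd \<zeta>)) \<bullet> ?c) (\<xi> 0, \<xi> 1) \<partial>\<nu> 2 t (tuple [x, y]))"
      by (simp add: vel_def)
    also have "\<dots> = (\<integral>\<zeta>. (\<kappa> (fst \<zeta>) *\<^sub>R fst (snd \<zeta>)) \<bullet> ?c \<partial>\<kappa>2 s)"
      using conjunct1[OF bspec[OF conjunct1[OF elim(2)[unfolded s prod.case]] m]] unfolding s .
    also have "\<dots> = (\<integral>\<zeta>. ?F (s, \<zeta>) \<partial>\<kappa>2 s)"
      unfolding s grad[of t x y] by (intro Bochner_Integration.integral_cong refl) (simp add: coords grad[of t x y, symmetric])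
    finally show ?case unfolding s prod.case eq by simp
  qed
  note st = integrable_spacetime2[OF T sol borel_measurable_integrable[OF integral_\<mu>2(2)[OF int]] ae]
    integral_spacetime2[OF T sol borel_measurable_integrable[OF integral_\<mu>2(2)[OF int]] ae]
  have b3: "integrable (spacetime D T 2) (\<lambda>(t, x). grad_at (2 - 1) ?\<phi> (t, x) \<bullet> (\<integral>\<xi>. \<kappa> (\<xi> 0) *\<^sub>R vel \<xi> (2 - 1) \<partial>\<nu> 2 t x))"
    using st(1) integral_\<mu>2(2)[OF int] by simp
  have b4: "continuous_on UNIV (\<lambda>\<xi> :: nat \<Rightarrow> 'n phase. \<kappa> (\<xi> 0))"
    by (rule continuous_on_compose2[OF \<kappa> continuous_on_product_coordinates subset_UNIV])
  have b5: "depends_on_first (2 - 1) (\<lambda>\<xi> :: nat \<Rightarrow> 'n phase. \<kappa> (\<xi> 0))"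
    by (simp add: depends_on_first_def)
  have dv: "divergence_free_cond D T \<nu>" using sol by (simp add: statistical_solution_def)
  have "(\<integral>(t, x). grad_at (2 - 1) ?\<phi> (t, x) \<bullet> (\<integral>\<xi>. \<kappa> (\<xi> 0) *\<^sub>R vel \<xi> (2 - 1) \<partial>\<nu> 2 t x) \<partial>spacetime D T 2) = 0"
    using dv \<phi> b1 b2 b3 b4 b5 one_le_numeral[where 'a=nat and n="num.Bit0 num.One"] unfolding divergence_free_cond_def by blast
  then show ?thesis using st(2) integral_\<mu>2(3)[OF int] by simp
qed

lemma abs_le_one_plus_powr: "\<bar>p :: real\<bar> \<le> 1 + \<bar>p\<bar> powr (3/2)"
proof (cases "\<bar>p\<bar> \<le> 1")
  case False
  then have "\<bar>p\<bar> powr 1 \<le> \<bar>p\<bar> powr (3/2)" by (intro powr_mono) auto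
  with False show ?thesis by simp
qed (simp add: add_increasing2)

text \<open>
  The second equation is the condition for the test function with exchanged entries, transported by
  the exchange of the points.
\<close>

lemma weighted_flux_zero:
  fixes \<kappa> :: "'n phase \<Rightarrow> real"
  assumes \<kappa>: "continuous_on UNIV \<kappa>" and k1: "\<And>z. \<bar>\<kappa> z\<bar> \<le> 1 + size1 z"
    and k2: "\<And>q :: (real \<times> (real^'n) \<times> (real^'n)) \<times> 'n phase \<times> 'n phase. norm (\<kappa> (vL q, pL q) *\<^sub>R vR q) \<le> sizes q"
  shows "(\<integral>q. (\<kappa> (vL q, pL q) *\<^sub>R vR q) \<bullet> (P q *\<^sub>R Gx q) \<partial>\<mu>2) = 0"
    and "(\<integral>q. (\<kappa> (vR q, pR q) *\<^sub>R vL q) \<bullet> (G q *\<^sub>R Px q + P q *\<^sub>R Gx q) \<partial>\<mu>2) = 0"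
proof -
  obtain C where C: "0 \<le> C" "\<And>q. norm (P q *\<^sub>R Gx q) \<le> C * strip D e (xL q) (xR q)"
    "\<And>q. norm (G q *\<^sub>R Px q + P q *\<^sub>R Gx q) \<le> C * strip D e (xL q) (xR q)"
    using bounded_weights by metis
  let ?A = "\<lambda>q. G q *\<^sub>R Px q + P q *\<^sub>R Gx q"
  have tup: "tuple [x, y] 0 = x" "tuple [x, y] 1 = y" for x y :: "real^'n" by (simp_all add: tuple_def)
  have "(\<integral>q. (\<kappa> (vL q, pL q) *\<^sub>R vR q) \<bullet> - (P q *\<^sub>R Gx q) \<partial>\<mu>2) = 0"
  proof (rule divergence_zero[where a=0 and b=1 and C=C, OF \<kappa> k1 k2])
    show "(\<lambda>q. - (P q *\<^sub>R Gx q)) \<in> borel_measurable pair_space" by measurable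
    show "grad_at 1 (pair_test D \<psi> g 0 1) (t, tuple [x, y]) = - (P ((t, x, y), \<zeta>) *\<^sub>R Gx ((t, x, y), \<zeta>))" for t x y \<zeta>
      unfolding pair_test_derivs(3)[OF \<psi> g g0 e(2) refl] tup by (simp add: weights coords)
  qed (use C in simp_all)
  then show "(\<integral>q. (\<kappa> (vL q, pL q) *\<^sub>R vR q) \<bullet> (P q *\<^sub>R Gx q) \<partial>\<mu>2) = 0"
    unfolding inner_minus_right by simp
  have "(\<integral>q. (\<kappa> (vL q, pL q) *\<^sub>R vR q) \<bullet> ?A (flip q) \<partial>\<mu>2) = 0"
  proof (rule divergence_zero[where a=1 and b=0 and C=C, OF \<kappa> k1 k2])
    have m: "?A \<in> borel_measurable pair_space" by measurable
    show "(\<lambda>q. ?A (flip q)) \<in> borel_measurable pair_space" by (rule measurable_compose[OF flip_measurable m])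
    show "norm (?A (flip q)) \<le> C * strip D e (xL q) (xR q)" for q
      using C(3)[of "flip q"] strip_commute[OF e2, of D "xR q" "xL q"] by simp
    show "grad_at 1 (pair_test D \<psi> g 1 0) (t, tuple [x, y]) = ?A (flip ((t, x, y), \<zeta>))" for t x y \<zeta>
    proof -
      have "{1, 0} = {0, 1::nat}" by auto
      from pair_test_derivs(2)[OF \<psi> g g0 e(2) this, of t "tuple [x, y]"]
      show ?thesis unfolding tup weights flip_simps by (simp add: coords)
    qed
  qed (use C in auto)
  moreover have "(\<lambda>q. (\<kappa> (vR q, pR q) *\<^sub>R vL q) \<bullet> ?A q) \<in> borel_measurable pair_space"
  proof -
    have "(\<lambda>q. \<kappa> (snd (snd q))) \<in> borel_measurable pair_space"
      by (rule measurable_compose[OF measurable_snd measurable_compose[OF snd_borel borel_measurable_continuous_onI[OF \<kappa>]]])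
    then have [measurable]: "(\<lambda>q. \<kappa> (vR q, pR q)) \<in> borel_measurable pair_space"
      unfolding coords prod.collapse .
    show ?thesis by measurable
  qed
  ultimately show "(\<integral>q. (\<kappa> (vR q, pR q) *\<^sub>R vL q) \<bullet> ?A q \<partial>\<mu>2) = 0"
    using integral_flip[of "\<lambda>q. (\<kappa> (vR q, pR q) *\<^sub>R vL q) \<bullet> ?A q"] unfolding flip_simps by simp
qed

lemma speed_flux_zero:
  "(\<integral>q. ((norm (vL q))\<^sup>2 *\<^sub>R vR q) \<bullet> (P q *\<^sub>R Gx q) \<partial>\<mu>2) = 0"
  "(\<integral>q. ((norm (vR q))\<^sup>2 *\<^sub>R vL q) \<bullet> (G q *\<^sub>R Px q + P q *\<^sub>R Gx q) \<partial>\<mu>2) = 0"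
proof -
  have c: "continuous_on UNIV (\<lambda>z :: 'n phase. (norm (fst z))\<^sup>2)" by (intro continuous_intros)
  have b: "\<bar>(norm (fst z))\<^sup>2\<bar> \<le> 1 + size1 z" for z :: "'n phase" by (simp add: size1_def)
  show "(\<integral>q. ((norm (vL q))\<^sup>2 *\<^sub>R vR q) \<bullet> (P q *\<^sub>R Gx q) \<partial>\<mu>2) = 0"
    by (rule weighted_flux_zero(1)[OF c b, unfolded fst_conv, OF cubic_norms(2)])
  show "(\<integral>q. ((norm (vR q))\<^sup>2 *\<^sub>R vL q) \<bullet> (G q *\<^sub>R Px q + P q *\<^sub>R Gx q) \<partial>\<mu>2) = 0"
    by (rule weighted_flux_zero(2)[OF c b, unfolded fst_conv, OF cubic_norms(2)])
qed

lemma pressure_flux_zero: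
  "(\<integral>q. (pL q *\<^sub>R vR q) \<bullet> (P q *\<^sub>R Gx q) \<partial>\<mu>2) = 0"
  "(\<integral>q. (pR q *\<^sub>R vL q) \<bullet> (G q *\<^sub>R Px q + P q *\<^sub>R Gx q) \<partial>\<mu>2) = 0"
proof -
  have c: "continuous_on UNIV (snd :: 'n phase \<Rightarrow> real)" by (intro continuous_intros)
  have b: "\<bar>snd z\<bar> \<le> 1 + size1 z" for z :: "'n phase"
    using abs_le_one_plus_powr[of "snd z"] zero_le_power[OF norm_ge_zero[of "fst z"], of 2] zero_le_power[OF norm_ge_zero[of "fst z"], of 3]
    unfolding size1_def by linarith
  show "(\<integral>q. (pL q *\<^sub>R vR q) \<bullet> (P q *\<^sub>R Gx q) \<partial>\<mu>2) = 0"
    by (rule weighted_flux_zero(1)[OF c b, unfolded snd_conv, OF cubic_norms(5)])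
  show "(\<integral>q. (pR q *\<^sub>R vL q) \<bullet> (G q *\<^sub>R Px q + P q *\<^sub>R Gx q) \<partial>\<mu>2) = 0"
    by (rule weighted_flux_zero(2)[OF c b, unfolded snd_conv, OF cubic_norms(5)])
qed

definition "cubic q = ((norm (vL q - vR q))\<^sup>2 *\<^sub>R (vL q - vR q)) \<bullet> (P q *\<^sub>R Gx q)"
  for q :: "(real \<times> (real^'n) \<times> (real^'n)) \<times> 'n phase \<times> 'n phase"

text \<open>What remains of the cubic term when all gradients of g have cancelled.\<close>

definition "balance q = G q * (Px q \<bullet> ((norm (vR q))\<^sup>2 *\<^sub>R vR q - (norm (vR q))\<^sup>2 *\<^sub>R vL q + (2 * (vL q \<bullet> vR q)) *\<^sub>R vL q
     + (2 * pL q) *\<^sub>R vR q + (2 * pR q) *\<^sub>R vL q) + 2 * (vL q \<bullet> vR q) * Pt q)"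
  for q :: "(real \<times> (real^'n) \<times> (real^'n)) \<times> 'n phase \<times> 'n phase"

text \<open>
  The difference of the two sides is, pointwise, a linear combination of integrands whose integrals
  vanish by the preceding lemmas.
\<close>

lemma cubic_balance:
  "integrable \<mu>2 cubic" "integrable \<mu>2 balance" "(\<integral>q. cubic q \<partial>\<mu>2) = (\<integral>q. balance q \<partial>\<mu>2)"
proof -
  obtain C where C: "0 \<le> C" "\<And>q. \<bar>G q * Pt q\<bar> \<le> C * strip D e (xL q) (xR q)"
    "\<And>q. norm (G q *\<^sub>R Px q) \<le> C * strip D e (xL q) (xR q)"
    "\<And>q. norm (P q *\<^sub>R Gx q) \<le> C * strip D e (xL q) (xR q)"
    "\<And>q. norm (G q *\<^sub>R Px q + P q *\<^sub>R Gx q) \<le> C * strip D e (xL q) (xR q)"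
    using bounded_weights by metis
  let ?X = "\<lambda>q. G q *\<^sub>R Px q" and ?B = "\<lambda>q. P q *\<^sub>R Gx q"
  let ?A = "\<lambda>q. ?X q + ?B q"
  let ?f1 = "\<lambda>q. (norm (vL q))\<^sup>2 *\<^sub>R vL q" and ?f2 = "\<lambda>q. (norm (vL q))\<^sup>2 *\<^sub>R vR q" and ?f3 = "\<lambda>q. (norm (vR q))\<^sup>2 *\<^sub>R vL q"
    and ?f4 = "\<lambda>q. (norm (vR q))\<^sup>2 *\<^sub>R vR q" and ?f5 = "\<lambda>q. pL q *\<^sub>R vR q" and ?f6 = "\<lambda>q. pR q *\<^sub>R vL q"
    and ?f7 = "\<lambda>q. (vL q \<bullet> vR q) *\<^sub>R vL q" and ?f8 = "\<lambda>q. (vL q \<bullet> vR q) *\<^sub>R vR q"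
  have m: "?f1 \<in> borel_measurable pair_space" "?f2 \<in> borel_measurable pair_space" "?f3 \<in> borel_measurable pair_space"
    "?f4 \<in> borel_measurable pair_space" "?f5 \<in> borel_measurable pair_space" "?f6 \<in> borel_measurable pair_space"
    "?f7 \<in> borel_measurable pair_space" "?f8 \<in> borel_measurable pair_space"
    "?X \<in> borel_measurable pair_space" "?B \<in> borel_measurable pair_space" by measurable
  note iX = integrable_inner[OF m(9) _ C(3)] and iB = integrable_inner[OF m(10) _ C(4)]
  note X = iX[OF m(1) cubic_norms(1)] iX[OF m(2) cubic_norms(2)] iX[OF m(3) cubic_norms(3)] iX[OF m(4) cubic_norms(4)]
    iX[OF m(5) cubic_norms(5)] iX[OF m(6) cubic_norms(6)] iX[OF m(7) cubic_norms(7)] iX[OF m(8) cubic_norms(8)]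
  note B = iB[OF m(1) cubic_norms(1)] iB[OF m(2) cubic_norms(2)] iB[OF m(3) cubic_norms(3)] iB[OF m(4) cubic_norms(4)]
    iB[OF m(5) cubic_norms(5)] iB[OF m(6) cubic_norms(6)] iB[OF m(7) cubic_norms(7)] iB[OF m(8) cubic_norms(8)]
  have S: "integrable \<mu>2 (\<lambda>q. (vL q \<bullet> vR q) * (G q * Pt q))"
    by (rule integrable_scalar[OF _ _ C(2) inner_sizes]) measurable
  have sq: "(norm (v - w))\<^sup>2 = (norm v)\<^sup>2 - 2 * (v \<bullet> w) + (norm w)\<^sup>2" for v w :: "real^'n"
    by (simp add: power2_norm_eq_inner inner_diff_left inner_diff_right inner_commute)
  have cub: "cubic q = ?f1 q \<bullet> ?B q - ?f2 q \<bullet> ?B q - 2 * (?f7 q \<bullet> ?B q) + 2 * (?f8 q \<bullet> ?B q) + ?f3 q \<bullet> ?B q - ?f4 q \<bullet> ?B q" for q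
    unfolding cubic_def sq by (simp add: inner_diff_left algebra_simps)
  have bal: "balance q = ?f4 q \<bullet> ?X q - ?f3 q \<bullet> ?X q + 2 * (?f7 q \<bullet> ?X q) + 2 * (?f5 q \<bullet> ?X q) + 2 * (?f6 q \<bullet> ?X q)
     + 2 * ((vL q \<bullet> vR q) * (G q * Pt q))" for q
    unfolding balance_def by (simp add: inner_diff_right inner_add_right inner_commute[of "Px q"] algebra_simps)
  show ci: "integrable \<mu>2 cubic"
    unfolding cub[abs_def]
    by (intro Bochner_Integration.integrable_add Bochner_Integration.integrable_diff integrable_mult_right B)
  show bi: "integrable \<mu>2 balance"
    unfolding bal[abs_def]
    by (intro Bochner_Integration.integrable_add Bochner_Integration.integrable_diff integrable_mult_right X S)
  note ev = evolution_zero and s = speed_flux_zero and p = pressure_flux_zero and l = flux_left_zero and r = flux_right_zero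
  have A: "integrable \<mu>2 (\<lambda>q. ?f3 q \<bullet> ?A q)" "integrable \<mu>2 (\<lambda>q. ?f4 q \<bullet> ?A q)" "integrable \<mu>2 (\<lambda>q. ?f6 q \<bullet> ?A q)"
    "integrable \<mu>2 (\<lambda>q. ?f7 q \<bullet> ?A q)" "integrable \<mu>2 (\<lambda>q. ?f5 q \<bullet> ?A q)"
    unfolding inner_add_right by (intro Bochner_Integration.integrable_add X B)+
  let ?E = "\<lambda>q. (vL q \<bullet> vR q) * (G q * Pt q) + ?f7 q \<bullet> ?A q - ?f8 q \<bullet> ?B q + ?f5 q \<bullet> ?A q - ?f6 q \<bullet> ?B q"
  have Ei: "integrable \<mu>2 ?E"
    by (intro Bochner_Integration.integrable_add Bochner_Integration.integrable_diff A B S)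
  let ?L = "\<lambda>q. ?f1 q \<bullet> ?B q - ?f2 q \<bullet> ?B q + ?f3 q \<bullet> ?A q - ?f4 q \<bullet> ?A q - 2 * ?E q + 2 * (?f5 q \<bullet> ?B q) - 2 * (?f6 q \<bullet> ?A q)"
  have id: "cubic q - balance q = ?L q" for q
    unfolding cub bal inner_add_right by (simp only: algebra_simps)
  have "(\<integral>q. ?L q \<partial>\<mu>2) = (\<integral>q. ?f1 q \<bullet> ?B q \<partial>\<mu>2) - (\<integral>q. ?f2 q \<bullet> ?B q \<partial>\<mu>2) + (\<integral>q. ?f3 q \<bullet> ?A q \<partial>\<mu>2) - (\<integral>q. ?f4 q \<bullet> ?A q \<partial>\<mu>2)
      - 2 * (\<integral>q. ?E q \<partial>\<mu>2) + 2 * (\<integral>q. ?f5 q \<bullet> ?B q \<partial>\<mu>2) - 2 * (\<integral>q. ?f6 q \<bullet> ?A q \<partial>\<mu>2)"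
    by (simp only: Bochner_Integration.integral_add Bochner_Integration.integral_diff Bochner_Integration.integrable_add
        Bochner_Integration.integrable_diff integrable_mult_right integral_mult_right_zero A B Ei)
  also have "\<dots> = 0" unfolding ev s p l r by simp
  finally have "(\<integral>q. cubic q - balance q \<partial>\<mu>2) = 0" unfolding id .
  then show "(\<integral>q. cubic q \<partial>\<mu>2) = (\<integral>q. balance q \<partial>\<mu>2)" using ci bi by simp
qed

end

section \<open>The defect integral as an integral over pairs of phases\<close>

abbreviation endpoints :: "space_domain \<Rightarrow> real \<times> (real^'n) \<times> (real^'n) \<Rightarrow> real \<times> (real^'n) \<times> (real^'n)" where
  "endpoints D \<equiv> (\<lambda>(t, x, z). (t, x, wrap D (x - z)))"

abbreviation strip_at :: "space_domain \<Rightarrow> real \<Rightarrow> real \<times> (real^'n) \<times> (real^'n) \<Rightarrow> real" where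
  "strip_at D e \<equiv> (\<lambda>(t, x, y). strip D e x y)"

lemma endpoints_measurable: "endpoints D \<in> borel \<rightarrow>\<^sub>M (borel \<Otimes>\<^sub>M (borel \<Otimes>\<^sub>M borel))"
  unfolding borel_prod[symmetric] case_prod_unfold by measurable

lemma defect_region_borel: "defect_region D T e \<in> sets borel"
  unfolding defect_region_def borel_prod[symmetric] by (intro pair_measureI) auto

text \<open>For fixed x, small vectors z correspond bijectively to points near x.\<close>

lemma nn_integral_endpoints:
  fixes f :: "real \<times> (real^'n) \<times> (real^'n) \<Rightarrow> ennreal"
  assumes f [measurable]: "f \<in> borel_measurable (borel \<Otimes>\<^sub>M (borel \<Otimes>\<^sub>M borel))" and e: "0 < e" "e \<le> 1/2"
  shows "(\<integral>\<^sup>+ q. f (endpoints D q) * indicator (defect_region D T e) q \<partial>lborel) =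
    (\<integral>\<^sup>+ s. f s * ennreal (strip_at D e s) \<partial>S2 D T)"
proof -
  let ?F = "\<lambda>t x z. f (t, x, wrap D (x - z)) * (indicator {0..T} t * (indicator (pts D) x * indicator (ball 0 e) z))"
  have "(\<integral>\<^sup>+ q. f (endpoints D q) * indicator (defect_region D T e) q \<partial>lborel) =
    (\<integral>\<^sup>+ q. ?F (fst q) (fst (snd q)) (snd (snd q)) \<partial>(lborel \<Otimes>\<^sub>M (lborel \<Otimes>\<^sub>M lborel)))"
    unfolding lborel_prod by (intro nn_integral_cong) (auto simp: defect_region_def indicator_def split: prod.splits)
  also have "\<dots> = (\<integral>\<^sup>+ t. (\<integral>\<^sup>+ p. ?F t (fst p) (snd p) \<partial>(lborel \<Otimes>\<^sub>M lborel)) \<partial>lborel)"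
  proof -
    have "(\<lambda>q. ?F (fst q) (fst (snd q)) (snd (snd q))) \<in> borel_measurable (lborel \<Otimes>\<^sub>M lborel)"
      unfolding lborel_prod[symmetric] by measurable
    from lborel.nn_integral_fst[OF this] show ?thesis unfolding lborel_prod by simp
  qed
  also have "\<dots> = (\<integral>\<^sup>+ t. (\<integral>\<^sup>+ x. (\<integral>\<^sup>+ z. ?F t x z \<partial>lborel) \<partial>lborel) \<partial>lborel)"
    by (intro nn_integral_cong) (subst lborel.nn_integral_fst[symmetric], simp_all)
  also have "\<dots> = (\<integral>\<^sup>+ t. (\<integral>\<^sup>+ x. indicator {0..T} t * (indicator (pts D) x *
      (\<integral>\<^sup>+ y. f (t, x, y) * indicator (ball 0 e) (rep D (x - y)) \<partial>dom_measure D)) \<partial>lborel) \<partial>lborel)"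
  proof (intro nn_integral_cong)
    fix t :: real and x :: "real^'n"
    have "(\<integral>\<^sup>+ z. ?F t x z \<partial>lborel) = (\<integral>\<^sup>+ z. (indicator {0..T} t * indicator (pts D) x) * (f (t, x, wrap D (x - z)) * indicator (ball 0 e) z) \<partial>lborel)"
      by (simp add: mult_ac)
    also have "\<dots> = (indicator {0..T} t * indicator (pts D) x) * (\<integral>\<^sup>+ z. f (t, x, wrap D (x - z)) * indicator (ball 0 e) z \<partial>lborel)"
      by (rule nn_integral_cmult) measurable
    also have "(\<integral>\<^sup>+ z. f (t, x, wrap D (x - z)) * indicator (ball 0 e) z \<partial>lborel) =
      (\<integral>\<^sup>+ y. f (t, x, y) * indicator (ball 0 e) (rep D (x - y)) \<partial>dom_measure D)"
    proof -
      have "(\<lambda>p. f (t, x, fst p)) \<in> borel_measurable (borel \<Otimes>\<^sub>M borel)" by measurable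
      from nn_integral_near_point[OF this e, of D x] show ?thesis by simp
    qed
    finally show "(\<integral>\<^sup>+ z. ?F t x z \<partial>lborel) = indicator {0..T} t * (indicator (pts D) x *
      (\<integral>\<^sup>+ y. f (t, x, y) * indicator (ball 0 e) (rep D (x - y)) \<partial>dom_measure D))" by (simp add: mult_ac)
  qed
  also have "\<dots> = (\<integral>\<^sup>+ t. (\<integral>\<^sup>+ x. (\<integral>\<^sup>+ y. f (t, x, y) * indicator (ball 0 e) (rep D (x - y)) \<partial>dom_measure D) \<partial>dom_measure D) \<partial>time_measure T)"
    unfolding dom_measure_def[of D] time_measure_def
    by (simp add: nn_integral_density nn_integral_cmult)
  also have "\<dots> = (\<integral>\<^sup>+ s. f s * ennreal (strip_at D e s) \<partial>S2 D T)"
    by (subst nn_integral_S2) (simp_all add: strip_def ennreal_indicator case_prod_unfold)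
  finally show ?thesis .
qed

lemma distr_endpoints:
  assumes e: "0 < e" "e \<le> 1/2"
  shows "distr (density lborel (indicator (defect_region D T e))) (S2 D T) (endpoints D) =
    density (S2 D T) (\<lambda>s. ennreal (strip_at D e s))" (is "?L = ?R")
proof (rule measure_eqI)
  have m: "endpoints D \<in> density lborel (indicator (defect_region D T e)) \<rightarrow>\<^sub>M S2 D T"
    using endpoints_measurable by (subst measurable_cong_sets[OF _ sets_S2]) simp_all
  have sm: "(\<lambda>s. ennreal (strip_at D e s)) \<in> borel_measurable (S2 D T)"
    by (subst measurable_cong_sets[OF sets_S2 refl]) (unfold case_prod_unfold, measurable)
  fix A assume "A \<in> sets ?L"
  then have A: "A \<in> sets (S2 D T)" by simp
  then have Ab: "A \<in> sets (borel \<Otimes>\<^sub>M (borel \<Otimes>\<^sub>M borel))" by simp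
  have pm: "(\<lambda>q. indicator A (endpoints D q) :: ennreal) \<in> borel_measurable lborel"
    using measurable_compose[OF endpoints_measurable borel_measurable_indicator[OF Ab]] by simp
  have "emeasure ?L A = (\<integral>\<^sup>+ s. indicator A s \<partial>?L)" using A by simp
  also have "\<dots> = (\<integral>\<^sup>+ q. indicator A (endpoints D q) \<partial>density lborel (indicator (defect_region D T e)))"
    by (rule nn_integral_distr[OF m]) (use A in simp)
  also have "\<dots> = (\<integral>\<^sup>+ q. indicator A (endpoints D q) * indicator (defect_region D T e) q \<partial>lborel)"
    by (subst nn_integral_density) (use pm in \<open>simp_all add: mult.commute borel_measurable_indicator defect_region_borel\<close>)
  also have "\<dots> = (\<integral>\<^sup>+ s. indicator A s * ennreal (strip_at D e s) \<partial>S2 D T)"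
    by (rule nn_integral_endpoints[OF _ e]) (use Ab in simp)
  also have "\<dots> = emeasure ?R A"
    using emeasure_density[OF sm A] by (simp add: mult.commute)
  finally show "emeasure ?L A = emeasure ?R A" .
qed simp

lemma AE_endpoints:
  fixes Q :: "real \<times> (real^'n) \<times> (real^'n) \<Rightarrow> bool"
  assumes Q: "AE s in S2 D T. Q s" and e: "0 < e" "e \<le> 1/2"
  shows "AE q in lborel. q \<in> defect_region D T e \<longrightarrow> Q (endpoints D q)"
proof -
  obtain N where N: "N \<in> null_sets (S2 D T)" and Q': "\<And>s. s \<in> space (S2 D T) - N \<Longrightarrow> Q s"
    using AE_E3[OF Q] by blast
  have N2: "Q s" if "s \<notin> N" for s using Q'[of s] that by simp
  have Nm: "N \<in> sets (borel \<Otimes>\<^sub>M (borel \<Otimes>\<^sub>M borel))" using null_setsD2[OF N] by (simp only: sets_S2)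
  have "(\<integral>\<^sup>+ q. indicator N (endpoints D q) * indicator (defect_region D T e) q \<partial>lborel) =
    (\<integral>\<^sup>+ s. indicator N s * ennreal (strip_at D e s) \<partial>S2 D T)"
    by (rule nn_integral_endpoints[OF _ e]) (use Nm in simp)
  also have "\<dots> = (\<integral>\<^sup>+ s. 0 \<partial>(S2 D T :: (real \<times> (real^'n) \<times> (real^'n)) measure))"
    by (rule nn_integral_cong_AE) (use AE_not_in[OF N] in \<open>eventually_elim, simp\<close>)
  finally have z: "(\<integral>\<^sup>+ q. indicator N (endpoints D q) * indicator (defect_region D T e) q \<partial>lborel) = 0" by simp
  have "(\<lambda>q. indicator N (endpoints D q) * indicator (defect_region D T e) q :: ennreal) \<in> borel_measurable lborel"
    using measurable_compose[OF endpoints_measurable borel_measurable_indicator[OF Nm]]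
    by (intro borel_measurable_times_ennreal) (simp_all add: borel_measurable_indicator defect_region_borel)
  from nn_integral_0_iff_AE[OF this] z
  have "AE q in lborel. indicator N (endpoints D q) * indicator (defect_region D T e) q = (0 :: ennreal)" by simp
  then show ?thesis
  proof eventually_elim
    case (elim q)
    show ?case
    proof
      assume "q \<in> defect_region D T e"
      then have "endpoints D q \<notin> N" using elim by (simp add: indicator_def split: if_splits)
      then show "Q (endpoints D q)" by (rule N2)
    qed
  qed
qed

lemma defect_region_transfer:
  fixes h :: "real \<times> (real^'n) \<times> (real^'n) \<Rightarrow> real"
  assumes h: "h \<in> borel_measurable (borel \<Otimes>\<^sub>M (borel \<Otimes>\<^sub>M borel))" and e: "0 < e" "e \<le> 1/2"
    and off: "\<And>s. strip_at D e s = 0 \<Longrightarrow> h s = 0"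
    and ae: "AE q in lborel. q \<in> defect_region D T e \<longrightarrow> f q = h (endpoints D q)"
  shows "integrable (lebesgue_on (defect_region D T e)) f \<longleftrightarrow> integrable (S2 D T) h"
    and "(\<integral>q. f q \<partial>lebesgue_on (defect_region D T e)) = (\<integral>s. h s \<partial>S2 D T)"
proof -
  let ?R = "defect_region D T e"
  let ?N = "density lborel (\<lambda>q. ennreal (indicator ?R q))"
  have m: "endpoints D \<in> ?N \<rightarrow>\<^sub>M S2 D T"
    using endpoints_measurable by (subst measurable_cong_sets[OF _ sets_S2]) simp_all
  have dist: "distr ?N (S2 D T) (endpoints D) = density (S2 D T) (\<lambda>s. ennreal (strip_at D e s))"
    using distr_endpoints[OF e] by (simp add: ennreal_indicator)
  have sm: "strip_at D e \<in> borel_measurable (S2 D T)"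
    by (subst measurable_cong_sets[OF sets_S2 refl]) (unfold case_prod_unfold, measurable)
  have s0: "0 \<le> strip_at D e s" for s :: "real \<times> (real^'n) \<times> (real^'n)" by (cases s) simp
  have hm: "h \<in> borel_measurable (S2 D T)" using h by (subst measurable_cong_sets[OF sets_S2 refl])
  have hc: "(\<lambda>q. h (endpoints D q)) \<in> borel_measurable borel"
    by (rule measurable_compose[OF endpoints_measurable h])
  have Rl: "?R \<inter> space lebesgue \<in> sets lebesgue" using defect_region_borel[of D T e] by auto
  have sh: "strip_at D e s *\<^sub>R h s = h s" for s
  proof (cases "strip_at D e s = 0")
    case False
    then have "strip_at D e s = 1" by (cases s) (auto simp: strip_def indicator_def split: if_splits)
    then show ?thesis by simp
  qed (simp add: off)
  have g: "(\<lambda>q. indicator ?R q *\<^sub>R h (endpoints D q)) \<in> borel_measurable lborel"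
    using hc by (intro borel_measurable_scaleR borel_measurable_indicator) (simp_all add: defect_region_borel)
  have ae': "AE q in lborel. indicator ?R q *\<^sub>R f q = indicator ?R q *\<^sub>R h (endpoints D q)"
    using ae by eventually_elim (simp add: indicator_def)
  have "integrable (lebesgue_on ?R) f \<longleftrightarrow> integrable lborel (\<lambda>q. indicator ?R q *\<^sub>R h (endpoints D q))"
    unfolding integrable_restrict_space[OF Rl] by (rule completion_AE_eq(2)[OF g ae'])
  also have "\<dots> \<longleftrightarrow> integrable ?N (\<lambda>q. h (endpoints D q))"
    by (rule integrable_density[symmetric]) (use hc in \<open>simp_all add: borel_measurable_indicator defect_region_borel\<close>)
  also have "\<dots> \<longleftrightarrow> integrable (density (S2 D T) (\<lambda>s. ennreal (strip_at D e s))) h"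
    unfolding dist[symmetric] by (rule integrable_distr_eq[OF m hm, symmetric])
  also have "\<dots> \<longleftrightarrow> integrable (S2 D T) (\<lambda>s. strip_at D e s *\<^sub>R h s)"
    by (rule integrable_density[OF hm sm]) (simp add: s0)
  finally show "integrable (lebesgue_on ?R) f \<longleftrightarrow> integrable (S2 D T) h" unfolding sh .
  have "(\<integral>q. f q \<partial>lebesgue_on ?R) = (\<integral>q. indicator ?R q *\<^sub>R h (endpoints D q) \<partial>lborel)"
    unfolding integral_restrict_space[OF Rl] by (rule completion_AE_eq(3)[OF g ae'])
  also have "\<dots> = (\<integral>q. h (endpoints D q) \<partial>?N)"
    by (rule integral_density[symmetric]) (use hc in \<open>simp_all add: borel_measurable_indicator defect_region_borel\<close>)
  also have "\<dots> = (\<integral>s. h s \<partial>density (S2 D T) (\<lambda>s. ennreal (strip_at D e s)))"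
    unfolding dist[symmetric] by (rule integral_distr[OF m hm, symmetric])
  also have "\<dots> = (\<integral>s. strip_at D e s *\<^sub>R h s \<partial>S2 D T)"
    by (rule integral_density[OF hm sm]) (simp add: s0)
  finally show "(\<integral>q. f q \<partial>lebesgue_on ?R) = (\<integral>s. h s \<partial>S2 D T)" unfolding sh .
qed

lemma cube_diff_le:
  fixes v w :: "'a::real_normed_vector"
  shows "norm (v - w) ^ 3 \<le> 4 * (norm v ^ 3 + norm w ^ 3)"
proof -
  let ?a = "norm v" and ?b = "norm w"
  have "norm (v - w) ^ 3 \<le> (?a + ?b) ^ 3" by (intro power_mono norm_triangle_ineq4) simp
  also have "\<dots> \<le> 4 * (?a ^ 3 + ?b ^ 3)"
  proof -
    have "4 * (?a ^ 3 + ?b ^ 3) - (?a + ?b) ^ 3 = 3 * (?a + ?b) * (?a - ?b)\<^sup>2"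
      by (simp add: power2_eq_square power3_eq_cube algebra_simps)
    moreover have "0 \<le> 3 * (?a + ?b) * (?a - ?b)\<^sup>2" by simp
    ultimately show ?thesis by linarith
  qed
  finally show ?thesis .
qed

lemma cubic_increment_sizes: "norm ((norm (vL q - vR q))\<^sup>2 *\<^sub>R (vL q - vR q)) \<le> 4 * sizes q"
proof -
  have "norm ((norm (vL q - vR q))\<^sup>2 *\<^sub>R (vL q - vR q)) = norm (vL q - vR q) ^ 3"
    by (simp add: power2_eq_square power3_eq_cube)
  also note cube_diff_le[of "vL q" "vR q"]
  also have "4 * (norm (vL q) ^ 3 + norm (vR q) ^ 3) \<le> 4 * sizes q"
    by (simp add: sizes_def size1_def add_increasing add_increasing2)
  finally show ?thesis .
qed

context test_pair begin

text \<open>The increments are integrable under almost every correlation measure, so the pairing with a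
  vector may be moved inside.\<close>

lemma cubic_bracket:
  "AE (t, x, y) in S2 D T. integrable (\<nu> 2 t (tuple [x, y])) cubic_increment \<and>
     (\<forall>c. c \<bullet> (\<integral>\<xi>. cubic_increment \<xi> \<partial>\<nu> 2 t (tuple [x, y])) =
       (\<integral>\<zeta>. ((norm (fst (fst \<zeta>) - fst (snd \<zeta>)))\<^sup>2 *\<^sub>R (fst (fst \<zeta>) - fst (snd \<zeta>))) \<bullet> c \<partial>\<kappa>2 (t, x, y)))"
  using AE_kernel2_finite bracket2
proof eventually_elim
  case (elim s)
  obtain t x y where s: "s = (t, x, y)" by (cases s)
  let ?N = "\<nu> 2 t (tuple [x, y])"
  let ?f = "\<lambda>\<zeta> :: 'n phase \<times> 'n phase. (norm (fst (fst \<zeta>) - fst (snd \<zeta>)))\<^sup>2 *\<^sub>R (fst (fst \<zeta>) - fst (snd \<zeta>))"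
  have fm: "?f \<in> borel_measurable borel"
    by (intro borel_measurable_continuous_onI continuous_intros)
  have f: "?f (\<xi> 0, \<xi> 1) = cubic_increment \<xi>" for \<xi> :: "nat \<Rightarrow> 'n phase" by (simp add: vel_def)
  have comp: "integrable ?N (\<lambda>\<xi>. cubic_increment \<xi> $ i)" for i
  proof -
    have m: "(\<lambda>\<zeta>. ?f \<zeta> $ i) \<in> borel_measurable borel" using fm by measurable
    have "integrable (\<kappa>2 s) (\<lambda>\<zeta>. ?f \<zeta> $ i)"
    proof (rule kernel2_integrable[OF m, where C=4 and s=s])
      show "\<bar>?f \<zeta> $ i\<bar> \<le> 4 * sizes (s, \<zeta>)" for \<zeta>
        using order_trans[OF component_le_norm_cart cubic_increment_sizes[of "(s, \<zeta>)"], of i] by (simp add: coords)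
    qed (use elim in simp)
    then have "integrable ?N (\<lambda>\<xi>. (\<lambda>\<zeta>. ?f \<zeta> $ i) (\<xi> 0, \<xi> 1))"
      using conjunct2[OF bspec[OF conjunct1[OF elim(2)[unfolded s prod.case]] m]] unfolding s by blast
    then show ?thesis by (simp only: f)
  qed
  have "integrable ?N (\<lambda>\<xi>. \<Sum>i\<in>UNIV. (cubic_increment \<xi> $ i) *\<^sub>R axis i (1::real))"
    by (intro Bochner_Integration.integrable_sum integrable_scaleR_left comp)
  moreover have "(\<Sum>i\<in>UNIV. (cubic_increment \<xi> $ i) *\<^sub>R axis i (1::real)) = cubic_increment \<xi>" for \<xi> :: "nat \<Rightarrow> 'n phase"
    using basis_expansion[of "cubic_increment \<xi>"] unfolding scalar_mult_eq_scaleR .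
  ultimately have int: "integrable ?N cubic_increment" by (simp only:)
  have "c \<bullet> (\<integral>\<xi>. cubic_increment \<xi> \<partial>?N) = (\<integral>\<zeta>. ?f \<zeta> \<bullet> c \<partial>\<kappa>2 (t, x, y))" for c
  proof -
    have m: "(\<lambda>\<zeta>. ?f \<zeta> \<bullet> c) \<in> borel_measurable borel" using fm by (intro borel_measurable_inner) simp_all
    have "c \<bullet> (\<integral>\<xi>. cubic_increment \<xi> \<partial>?N) = (\<integral>\<xi>. cubic_increment \<xi> \<bullet> c \<partial>?N)"
      using integral_inner_left[of c, OF int] by (simp only: inner_commute[of c])
    also have "\<dots> = (\<integral>\<xi>. (\<lambda>\<zeta>. ?f \<zeta> \<bullet> c) (\<xi> 0, \<xi> 1) \<partial>?N)" by (simp only: f)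
    also have "\<dots> = (\<integral>\<zeta>. ?f \<zeta> \<bullet> c \<partial>\<kappa>2 (t, x, y))"
      using conjunct1[OF bspec[OF conjunct1[OF elim(2)[unfolded s prod.case]] m]] .
    finally show ?thesis .
  qed
  with int show ?case unfolding s by simp
qed

lemma defect_transfer:
  defines "f \<equiv> \<lambda>(t, x, z). \<psi> (t, tuple [x]) * (grad g z \<bullet> (\<integral>\<xi>. cubic_increment \<xi> \<partial>\<nu> 2 t (tuple [x, wrap D (x - z)])))"
  shows "AE (t, x, z) in lebesgue_on (defect_region D T e). integrable (\<nu> 2 t (tuple [x, wrap D (x - z)])) cubic_increment"
    and "integrable (lebesgue_on (defect_region D T e)) f"
    and "(\<integral>q. f q \<partial>lebesgue_on (defect_region D T e)) = (\<integral>q. cubic q \<partial>\<mu>2)"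
proof -
  let ?Q = "\<lambda>t x y. integrable (\<nu> 2 t (tuple [x, y])) cubic_increment \<and>
     (\<forall>c. c \<bullet> (\<integral>\<xi>. cubic_increment \<xi> \<partial>\<nu> 2 t (tuple [x, y])) =
       (\<integral>\<zeta>. ((norm (fst (fst \<zeta>) - fst (snd \<zeta>)))\<^sup>2 *\<^sub>R (fst (fst \<zeta>) - fst (snd \<zeta>))) \<bullet> c \<partial>\<kappa>2 (t, x, y)))"
  let ?R = "defect_region D T e"
  have ae: "AE q in lborel. q \<in> ?R \<longrightarrow> (case endpoints D q of (t, x, y) \<Rightarrow> ?Q t x y)"
    by (rule AE_endpoints[OF cubic_bracket e(1) e2])
  define h where "h = (\<lambda>s. \<integral>\<zeta>. cubic (s, \<zeta>) \<partial>\<kappa>2 s)"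
  have hi: "integrable (S2 D T) h" unfolding h_def by (rule integral_\<mu>2(2)[OF cubic_balance(1)])
  then have hm: "h \<in> borel_measurable (borel \<Otimes>\<^sub>M (borel \<Otimes>\<^sub>M borel))"
    using borel_measurable_integrable[OF hi] by (simp only: measurable_cong_sets[OF sets_S2 refl])
  have off: "h s = 0" if "strip_at D e s = 0" for s
  proof -
    obtain t x y where s: "s = (t, x, y)" by (cases s)
    have "e \<le> norm (rep D (x - y))" using that by (auto simp: s strip_def indicator_def split: if_splits)
    then have "grad g (rep D (x - y)) = 0" by (simp add: grad_def dg_zero vec_eq_iff)
    then show ?thesis by (simp add: h_def s cubic_def weights coords)
  qed
  have fh: "AE q in lborel. q \<in> ?R \<longrightarrow> f q = h (endpoints D q)"
    using ae
  proof eventually_elim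
    case (elim q)
    obtain t x z where q: "q = (t, x, z)" by (cases q)
    show ?case
    proof
      assume R: "q \<in> ?R"
      then have Q: "?Q t x (wrap D (x - z))" using elim unfolding q by simp
      have r: "rep D (x - wrap D (x - z)) = z"
        using R e2 by (intro rep_wrap(1)[where e=e]) (auto simp: q defect_region_def)
      have "f q = at_point \<psi> t x * (grad g z \<bullet> (\<integral>\<xi>. cubic_increment \<xi> \<partial>\<nu> 2 t (tuple [x, wrap D (x - z)])))"
        unfolding f_def q prod.case at_point_eq[OF \<psi>] by (simp add: tuple_def)
      also have "\<dots> = at_point \<psi> t x * (\<integral>\<zeta>. ((norm (fst (fst \<zeta>) - fst (snd \<zeta>)))\<^sup>2 *\<^sub>R (fst (fst \<zeta>) - fst (snd \<zeta>))) \<bullet> grad g z \<partial>\<kappa>2 (t, x, wrap D (x - z)))"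
        using conjunct2[OF Q] by simp
      also have "\<dots> = h (endpoints D q)"
        unfolding h_def q prod.case cubic_def weights integral_mult_right_zero[symmetric]
        by (intro Bochner_Integration.integral_cong refl) (simp add: coords r)
      finally show "f q = h (endpoints D q)" .
    qed
  qed
  note tr = defect_region_transfer[OF hm e(1) e2 off fh]
  show "integrable (lebesgue_on ?R) f" using tr(1) hi by simp
  show "(\<integral>q. f q \<partial>lebesgue_on ?R) = (\<integral>q. cubic q \<partial>\<mu>2)"
    using tr(2) integral_\<mu>2(3)[OF cubic_balance(1)] unfolding h_def by simp
  have "AE q in lebesgue. q \<in> ?R \<longrightarrow> (case endpoints D q of (t, x, y) \<Rightarrow> ?Q t x y)"
    by (rule AE_completion[OF ae])
  then have "AE q in lebesgue_on ?R. (case endpoints D q of (t, x, y) \<Rightarrow> ?Q t x y)"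
    by (subst AE_restrict_space_iff) (use defect_region_borel[of D T e] in auto)
  then show "AE (t, x, z) in lebesgue_on ?R. integrable (\<nu> 2 t (tuple [x, wrap D (x - z)])) cubic_increment"
    by eventually_elim auto
qed

end

section \<open>The energy density\<close>

context kernels begin

text \<open>The energy integrand, with the Borel version of the one-point law.\<close>

definition energy_density :: "(real \<times> (nat \<Rightarrow> real^'n) \<Rightarrow> real) \<Rightarrow> real \<times> (real^'n) \<Rightarrow> real" where
  "energy_density \<psi> r = (\<integral>a. (norm (fst a))\<^sup>2 \<partial>\<kappa>1 r) * at_point (dt \<psi>) (fst r) (snd r)
     + (\<Sum>k\<in>UNIV. (\<integral>a. (norm (fst a))\<^sup>2 * fst a $ k + 2 * fst a $ k * snd a \<partial>\<kappa>1 r) * at_point (grad_at 0 \<psi>) (fst r) (snd r) $ k)"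

lemma norm_integral_le_nn:
  fixes h :: "'b \<Rightarrow> real"
  shows "ennreal \<bar>\<integral>a. h a \<partial>M\<bar> \<le> (\<integral>\<^sup>+ a. ennreal \<bar>h a\<bar> \<partial>M)"
proof (cases "integrable M h")
  case True
  then show ?thesis using integral_norm_bound_ennreal[of M h] by simp
qed (simp add: not_integrable_integral_eq)

lemma weighted_bracket1:
  fixes h :: "'n phase \<Rightarrow> real" and w :: "real \<times> (real^'n) \<Rightarrow> real"
  assumes h: "h \<in> borel_measurable borel" "\<And>a. \<bar>h a\<bar> \<le> C * size1 a"
    and w: "w \<in> borel_measurable (borel \<Otimes>\<^sub>M borel)" "\<And>r. \<bar>w r\<bar> \<le> B"
    and CB: "0 \<le> C" "0 \<le> B"
  shows "integrable (S1 D T) (\<lambda>r. (\<integral>a. h a \<partial>\<kappa>1 r) * w r)"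
    and "\<bar>\<integral>r. (\<integral>a. h a \<partial>\<kappa>1 r) * w r \<partial>S1 D T\<bar> \<le> C * B * enn2real moment1"
proof -
  define H where "H = (\<lambda>r. \<integral>\<^sup>+ a. ennreal (size1 a) \<partial>\<kappa>1 r)"
  have Hm: "H \<in> borel_measurable (borel \<Otimes>\<^sub>M borel)"
    unfolding H_def by (rule bracket1_nn_measurable) measurable
  have Hi: "(\<integral>\<^sup>+ r. H r \<partial>S1 D T) = moment1"
    unfolding nn_integral_S1[OF Hm] by (simp add: moment1_def H_def)
  have HmS: "H \<in> borel_measurable (S1 D T)" using Hm by (subst measurable_cong_sets[OF sets_S1 refl])
  have wm: "w \<in> borel_measurable (S1 D T)" using w(1) by (subst measurable_cong_sets[OF sets_S1 refl])
  have sm: "(\<lambda>a. ennreal (size1 a)) \<in> borel_measurable (\<kappa>1 r)" for r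
    by (subst measurable_cong_sets[OF sets_kernels(1) refl]) measurable
  have point: "ennreal \<bar>(\<integral>a. h a \<partial>\<kappa>1 r) * w r\<bar> \<le> ennreal (C * B) * H r" for r
  proof -
    have "ennreal \<bar>\<integral>a. h a \<partial>\<kappa>1 r\<bar> \<le> (\<integral>\<^sup>+ a. ennreal \<bar>h a\<bar> \<partial>\<kappa>1 r)" by (rule norm_integral_le_nn)
    also have "\<dots> \<le> (\<integral>\<^sup>+ a. ennreal C * ennreal (size1 a) \<partial>\<kappa>1 r)"
      using h(2) CB by (intro nn_integral_mono) (simp add: ennreal_mult'[symmetric] ennreal_leI)
    also have "\<dots> = ennreal C * H r" unfolding H_def by (rule nn_integral_cmult[OF sm])
    finally have "ennreal \<bar>\<integral>a. h a \<partial>\<kappa>1 r\<bar> * ennreal \<bar>w r\<bar> \<le> ennreal C * H r * ennreal B"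
      by (rule mult_mono) (use w(2) in \<open>simp_all add: ennreal_leI\<close>)
    then show ?thesis using CB by (simp add: abs_mult ennreal_mult mult_ac)
  qed
  have "(\<integral>\<^sup>+ r. ennreal \<bar>(\<integral>a. h a \<partial>\<kappa>1 r) * w r\<bar> \<partial>S1 D T) \<le> (\<integral>\<^sup>+ r. ennreal (C * B) * H r \<partial>S1 D T)"
    by (intro nn_integral_mono point)
  also have "\<dots> = ennreal (C * B) * moment1" unfolding nn_integral_cmult[OF HmS] Hi ..
  finally have nn: "(\<integral>\<^sup>+ r. ennreal \<bar>(\<integral>a. h a \<partial>\<kappa>1 r) * w r\<bar> \<partial>S1 D T) \<le> ennreal (C * B) * moment1" .
  have fin: "ennreal (C * B) * moment1 < \<infinity>" using moment1_finite by (simp add: ennreal_mult_less_top)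
  show int: "integrable (S1 D T) (\<lambda>r. (\<integral>a. h a \<partial>\<kappa>1 r) * w r)"
  proof (rule integrableI_bounded)
    show "(\<lambda>r. (\<integral>a. h a \<partial>\<kappa>1 r) * w r) \<in> borel_measurable (S1 D T)"
      by (rule borel_measurable_times[OF bracket1_measurable[OF h(1)] wm])
    show "(\<integral>\<^sup>+ r. ennreal (norm ((\<integral>a. h a \<partial>\<kappa>1 r) * w r)) \<partial>S1 D T) < \<infinity>"
      unfolding real_norm_def by (rule order_le_less_trans[OF nn fin])
  qed
  have "ennreal \<bar>\<integral>r. (\<integral>a. h a \<partial>\<kappa>1 r) * w r \<partial>S1 D T\<bar> \<le> ennreal (C * B) * moment1"
    by (rule order_trans[OF norm_integral_le_nn nn])
  also have "\<dots> = ennreal (C * B * enn2real moment1)"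
    using moment1_finite CB by (simp add: ennreal_mult less_top)
  finally show "\<bar>\<integral>r. (\<integral>a. h a \<partial>\<kappa>1 r) * w r \<partial>S1 D T\<bar> \<le> C * B * enn2real moment1"
    by (subst (asm) ennreal_le_iff) (use CB in \<open>simp_all only: mult_nonneg_nonneg enn2real_nonneg\<close>)
qed

lemma energy_functions:
  fixes k :: 'n
  shows "(\<lambda>a :: 'n phase. (norm (fst a))\<^sup>2) \<in> borel_measurable borel"
    and "(\<lambda>a :: 'n phase. (norm (fst a))\<^sup>2 * fst a $ k + 2 * fst a $ k * snd a) \<in> borel_measurable borel"
    and "\<bar>(norm (fst a))\<^sup>2\<bar> \<le> 3 * size1 (a :: 'n phase)"
    and "\<bar>(norm (fst a))\<^sup>2 * fst a $ k + 2 * fst a $ k * snd a\<bar> \<le> 3 * size1 (a :: 'n phase)"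
proof -
  show "(\<lambda>a :: 'n phase. (norm (fst a))\<^sup>2) \<in> borel_measurable borel"
    "(\<lambda>a :: 'n phase. (norm (fst a))\<^sup>2 * fst a $ k + 2 * fst a $ k * snd a) \<in> borel_measurable borel"
    by (intro borel_measurable_continuous_onI continuous_intros)+
  let ?v = "norm (fst a)"
  have n: "0 \<le> ?v ^ 2" "0 \<le> ?v ^ 3" "0 \<le> \<bar>snd a\<bar> powr (3/2)" by simp_all
  then show "\<bar>?v\<^sup>2\<bar> \<le> 3 * size1 a" unfolding size1_def by simp
  have "\<bar>?v\<^sup>2 * fst a $ k\<bar> \<le> ?v ^ 3"
    using mult_left_mono[OF component_le_norm_cart[of "fst a" k] n(1)] by (simp add: abs_mult power2_eq_square power3_eq_cube)
  moreover have "\<bar>2 * fst a $ k * snd a\<bar> \<le> 2 * (\<bar>snd a\<bar> * ?v)"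
    using mult_left_mono[OF component_le_norm_cart[of "fst a" k] abs_ge_zero[of "snd a"]] by (simp add: abs_mult mult_ac)
  moreover have "\<bar>snd a\<bar> * ?v \<le> \<bar>snd a\<bar> powr (3/2) + ?v ^ 3" by (rule pressure_mult_le) simp
  moreover have "size1 a = ?v ^ 2 + ?v ^ 3 + \<bar>snd a\<bar> powr (3/2)" by (simp add: size1_def)
  ultimately show "\<bar>?v\<^sup>2 * fst a $ k + 2 * fst a $ k * snd a\<bar> \<le> 3 * size1 a"
    using n abs_triangle_ineq[of "?v\<^sup>2 * fst a $ k" "2 * fst a $ k * snd a"] by argo
qed

lemma test_weights:
  fixes \<psi> :: "real \<times> (nat \<Rightarrow> real^'n) \<Rightarrow> real"
  assumes \<psi>: "\<psi> \<in> test_functions D 1 I"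
  shows "(\<lambda>r. at_point (dt \<psi>) (fst r) (snd r)) \<in> borel_measurable (borel \<Otimes>\<^sub>M borel)"
    "(\<lambda>r. at_point (grad_at 0 \<psi>) (fst r) (snd r) $ k) \<in> borel_measurable (borel \<Otimes>\<^sub>M borel)"
  unfolding at_point_grad
  by (rule at_point_measurable[OF dt_test[OF \<psi>]], measurable)
    (rule at_point_measurable[OF test_functions_flow_deriv[OF \<psi> shifts_1(2)]], measurable)

lemma energy_density_integrable:
  fixes \<psi> :: "real \<times> (nat \<Rightarrow> real^'n) \<Rightarrow> real"
  assumes \<psi>: "\<psi> \<in> test_functions D 1 I"
    and B: "\<And>t x. \<bar>at_point (dt \<psi>) t x\<bar> \<le> B" "\<And>t x k. \<bar>at_point (grad_at 0 \<psi>) t x $ k\<bar> \<le> B" "0 \<le> B"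
  shows "integrable (S1 D T) (\<lambda>r. (\<integral>a. (norm (fst a))\<^sup>2 \<partial>\<kappa>1 r) * at_point (dt \<psi>) (fst r) (snd r))"
    and "integrable (S1 D T) (\<lambda>r. (\<integral>a. (norm (fst a))\<^sup>2 * fst a $ k + 2 * fst a $ k * snd a \<partial>\<kappa>1 r) * at_point (grad_at 0 \<psi>) (fst r) (snd r) $ k)"
    and "integrable (S1 D T) (energy_density \<psi>)"
    and "\<bar>\<integral>r. energy_density \<psi> r \<partial>S1 D T\<bar> \<le> 3 * (1 + real CARD('n)) * enn2real moment1 * B"
proof -
  let ?a = "\<lambda>r. (\<integral>a. (norm (fst a))\<^sup>2 \<partial>\<kappa>1 r) * at_point (dt \<psi>) (fst r) (snd r)"
  let ?b = "\<lambda>k r. (\<integral>a. (norm (fst a))\<^sup>2 * fst a $ k + 2 * fst a $ k * snd a \<partial>\<kappa>1 r) * at_point (grad_at 0 \<psi>) (fst r) (snd r) $ k"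
  have C: "0 \<le> (3::real)" by simp
  note A = weighted_bracket1[OF energy_functions(1,3) test_weights(1)[OF \<psi>] B(1) C B(3)]
  note G = weighted_bracket1[OF energy_functions(2,4) test_weights(2)[OF \<psi>] B(2) C B(3)]
  show A1: "integrable (S1 D T) ?a" by (rule A(1))
  show G1: "integrable (S1 D T) (?b k)" for k by (rule G(1))
  show "integrable (S1 D T) (energy_density \<psi>)"
    unfolding energy_density_def[abs_def] by (intro Bochner_Integration.integrable_add Bochner_Integration.integrable_sum A1 G1)
  have GS: "integrable (S1 D T) (\<lambda>r. \<Sum>k\<in>UNIV. ?b k r)"
    by (rule Bochner_Integration.integrable_sum) (rule G1)
  have "(\<integral>r. energy_density \<psi> r \<partial>S1 D T) = (\<integral>r. ?a r \<partial>S1 D T) + (\<integral>r. (\<Sum>k\<in>UNIV. ?b k r) \<partial>S1 D T)"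
    unfolding energy_density_def by (rule Bochner_Integration.integral_add[OF A1 GS])
  also have "(\<integral>r. (\<Sum>k\<in>UNIV. ?b k r) \<partial>S1 D T) = (\<Sum>k\<in>UNIV. \<integral>r. ?b k r \<partial>S1 D T)"
    by (rule Bochner_Integration.integral_sum) (rule G1)
  finally have eq: "(\<integral>r. energy_density \<psi> r \<partial>S1 D T) = (\<integral>r. ?a r \<partial>S1 D T) + (\<Sum>k\<in>UNIV. \<integral>r. ?b k r \<partial>S1 D T)" .
  have "\<bar>\<integral>r. energy_density \<psi> r \<partial>S1 D T\<bar> \<le> \<bar>\<integral>r. ?a r \<partial>S1 D T\<bar> + (\<Sum>k\<in>UNIV. \<bar>\<integral>r. ?b k r \<partial>S1 D T\<bar>)"
    unfolding eq by (rule order_trans[OF abs_triangle_ineq add_left_mono[OF sum_abs]])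
  also have "\<dots> \<le> 3 * B * enn2real moment1 + (\<Sum>k\<in>(UNIV :: 'n set). 3 * B * enn2real moment1)"
    by (rule add_mono[OF A(2) sum_mono[OF G(2)]])
  also have "\<dots> = 3 * (1 + real CARD('n)) * enn2real moment1 * B" by (simp add: algebra_simps)
  finally show "\<bar>\<integral>r. energy_density \<psi> r \<partial>S1 D T\<bar> \<le> 3 * (1 + real CARD('n)) * enn2real moment1 * B" .
qed

lemma weights_bounded:
  fixes \<psi> :: "real \<times> (nat \<Rightarrow> real^'n) \<Rightarrow> real"
  assumes \<psi>: "\<psi> \<in> test_functions D 1 I"
  obtains B where "0 \<le> B" "\<And>t x. \<bar>at_point (dt \<psi>) t x\<bar> \<le> B" "\<And>t x. norm (at_point (grad_at 0 \<psi>) t x) \<le> B"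
    "\<And>t x k. \<bar>at_point (grad_at 0 \<psi>) t x $ k\<bar> \<le> B"
proof -
  obtain B1 where B1: "0 \<le> B1" "\<And>t x. \<bar>at_point (dt \<psi>) t x\<bar> \<le> B1" using test_functions_bounded[OF dt_test[OF \<psi>]] by metis
  obtain B2 where B2: "0 \<le> B2" "\<And>t x. norm (at_point (grad_at 0 \<psi>) t x) \<le> B2" using at_point_grad_bounded[OF \<psi>] by metis
  show ?thesis
  proof
    show "0 \<le> B1 + B2" using B1 B2 by simp
    show "\<bar>at_point (dt \<psi>) t x\<bar> \<le> B1 + B2" "norm (at_point (grad_at 0 \<psi>) t x) \<le> B1 + B2" for t x
      using B1(2)[of t x] B2(2)[of t x] B1(1) B2(1) by linarith+
    then show "\<bar>at_point (grad_at 0 \<psi>) t x $ k\<bar> \<le> B1 + B2" for t x k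
      using component_le_norm_cart[of "at_point (grad_at 0 \<psi>) t x" k] order_trans by blast
  qed
qed

lemma energy_brackets:
  "AE_bracket_defined D T \<nu> 1 (\<lambda>\<xi>. (norm (vel \<xi> 0))\<^sup>2)"
  "AE_bracket_defined D T \<nu> 1 (\<lambda>\<xi>. (norm (vel \<xi> 0))\<^sup>2 * vel \<xi> 0 $ k + 2 * vel \<xi> 0 $ k * pres \<xi> 0)"
proof -
  have def: "AE_bracket_defined D T \<nu> 1 (\<lambda>\<xi>. f (\<xi> 0))"
    if f: "f \<in> borel_measurable borel" "\<And>a. \<bar>f a\<bar> \<le> 3 * size1 a" for f :: "'n phase \<Rightarrow> real"
  proof -
    interpret coding "S1 D T" "base D T 1" "enc1 D T" "\<lambda>p. (fst p, snd p 0)" by (rule coding1[OF T])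
    have fin: "AE (t, x) in S1 D T. integrable (\<nu> 1 t (tuple [x])) (\<lambda>\<xi>. f (\<xi> 0))"
      using AE_kernel1_finite bracket1
    proof eventually_elim
      case (elim r)
      obtain t x where r: "r = (t, x)" by (cases r)
      have "integrable (\<kappa>1 r) f"
      proof (rule kernel1_integrable[OF f(1), where C=3])
        show "\<bar>f a\<bar> \<le> 3 + 3 * size1 a" for a using f(2)[of a] by linarith
      qed (use elim in simp_all)
      then show ?case
        using conjunct2[OF bspec[OF conjunct1[OF elim(2)[unfolded r prod.case]] f(1)]] unfolding r by simp
    qed
    show ?thesis
      unfolding AE_bracket_defined_def spacetime_base
      by (rule AE_code) (use fin AE_S1_pts in \<open>eventually_elim, auto simp: enc_on_points\<close>)
  qed
  show "AE_bracket_defined D T \<nu> 1 (\<lambda>\<xi>. (norm (vel \<xi> 0))\<^sup>2)"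
    unfolding vel_def by (rule def[OF energy_functions(1,3)])
  show "AE_bracket_defined D T \<nu> 1 (\<lambda>\<xi>. (norm (vel \<xi> 0))\<^sup>2 * vel \<xi> 0 $ k + 2 * vel \<xi> 0 $ k * pres \<xi> 0)"
    unfolding vel_def pres_def by (rule def[OF energy_functions(2,4)])
qed

lemma energy_integrand_density:
  fixes \<psi> :: "real \<times> (nat \<Rightarrow> real^'n) \<Rightarrow> real"
  assumes \<psi>: "\<psi> \<in> test_functions D 1 I"
  shows "integrable (spacetime D T 1) (energy_integrand \<nu> \<psi>)"
    and "(\<integral>p. energy_integrand \<nu> \<psi> p \<partial>spacetime D T 1) = (\<integral>r. energy_density \<psi> r \<partial>S1 D T)"
proof -
  obtain B where B: "0 \<le> B" "\<And>t x. \<bar>at_point (dt \<psi>) t x\<bar> \<le> B" "\<And>t x k. \<bar>at_point (grad_at 0 \<psi>) t x $ k\<bar> \<le> B"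
    using weights_bounded[OF \<psi>] by metis
  have int: "integrable (S1 D T) (energy_density \<psi>)" by (rule energy_density_integrable(3)[OF \<psi> B(2,3,1)])
  have ae: "AE (t, x) in S1 D T. energy_integrand \<nu> \<psi> (t, tuple [x]) = energy_density \<psi> (t, x)"
    using bracket1
  proof eventually_elim
    case (elim r)
    obtain t x where r: "r = (t, x)" by (cases r)
    have gp: "grad_at 0 \<psi> (t, tuple [x]) $ k = at_point (grad_at 0 \<psi>) t x $ k" for k
      unfolding at_point_grad using at_point_eq[OF test_functions_flow_deriv[OF \<psi> shifts_1(2)], of k t "tuple [x]"]
      by (simp add: grad_at_def tuple_def)
    have dp: "dt \<psi> (t, tuple [x]) = at_point (dt \<psi>) t x"
      using at_point_eq[OF dt_test[OF \<psi>], of t "tuple [x]"] by (simp add: tuple_def)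
    have br: "(\<integral>\<xi>. f (\<xi> 0) \<partial>\<nu> 1 t (tuple [x])) = (\<integral>a. f a \<partial>\<kappa>1 (t, x))"
      if "f \<in> borel_measurable borel" for f :: "'n phase \<Rightarrow> real"
      using conjunct1[OF bspec[OF conjunct1[OF elim[unfolded r prod.case]] that]] .
    show ?case
      unfolding r prod.case energy_integrand_def energy_density_def vel_def pres_def br[OF energy_functions(1)] br[OF energy_functions(2)] gp dp fst_conv snd_conv ..
  qed
  show "integrable (spacetime D T 1) (energy_integrand \<nu> \<psi>)"
    using integrable_spacetime1[OF T sol borel_measurable_integrable[OF int] ae] int by simp
  show "(\<integral>p. energy_integrand \<nu> \<psi> p \<partial>spacetime D T 1) = (\<integral>r. energy_density \<psi> r \<partial>S1 D T)"
    by (rule integral_spacetime1[OF T sol borel_measurable_integrable[OF int] ae])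
qed

end

section \<open>Comparison of the two phases\<close>

text \<open>Either h is at most delta * a, or a is at most h / delta.\<close>

lemma young_absorb:
  fixes a h \<delta> :: real
  assumes "0 \<le> a" "0 \<le> h" and \<delta>: "0 < \<delta>" "\<delta> \<le> 1"
  shows "a\<^sup>2 * h \<le> \<delta> * a ^ 3 + h ^ 3 / \<delta>\<^sup>2" "a * h\<^sup>2 \<le> \<delta> * a ^ 3 + h ^ 3 / \<delta>\<^sup>2" "a * h \<le> \<delta> * a\<^sup>2 + h\<^sup>2 / \<delta>\<^sup>2"
proof -
  have d2: "\<delta>\<^sup>2 \<le> \<delta>" using mult_left_mono[of \<delta> 1 \<delta>] \<delta> by (simp add: power2_eq_square)
  have q: "0 \<le> h ^ 3 / \<delta>\<^sup>2" "0 \<le> h\<^sup>2 / \<delta>\<^sup>2" "0 \<le> \<delta> * a ^ 3" "0 \<le> \<delta> * a\<^sup>2" using assms by simp_all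
  have "a\<^sup>2 * h \<le> \<delta> * a ^ 3 + h ^ 3 / \<delta>\<^sup>2 \<and> a * h\<^sup>2 \<le> \<delta> * a ^ 3 + h ^ 3 / \<delta>\<^sup>2 \<and> a * h \<le> \<delta> * a\<^sup>2 + h\<^sup>2 / \<delta>\<^sup>2"
  proof (cases "h \<le> \<delta> * a")
    case True
    have "a\<^sup>2 * h \<le> a\<^sup>2 * (\<delta> * a)" using True by (intro mult_left_mono) simp_all
    also have "\<dots> = \<delta> * a ^ 3" by (simp add: power2_eq_square power3_eq_cube)
    finally have 1: "a\<^sup>2 * h \<le> \<delta> * a ^ 3" .
    have "a * h\<^sup>2 \<le> a * (\<delta> * a)\<^sup>2" using True assms by (intro mult_left_mono power_mono)
    also have "\<dots> = \<delta>\<^sup>2 * a ^ 3" by (simp add: power2_eq_square power3_eq_cube)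
    also have "\<dots> \<le> \<delta> * a ^ 3" using d2 assms by (intro mult_right_mono) simp_all
    finally have 2: "a * h\<^sup>2 \<le> \<delta> * a ^ 3" .
    have "a * h \<le> a * (\<delta> * a)" using True assms by (intro mult_left_mono)
    then have 3: "a * h \<le> \<delta> * a\<^sup>2" by (simp add: power2_eq_square mult_ac)
    show ?thesis using 1 2 3 q by linarith
  next
    case False
    then have a: "a \<le> h / \<delta>" using \<delta> by (simp add: field_simps)
    have w: "x / \<delta> \<le> x / \<delta>\<^sup>2" if "0 \<le> x" for x :: real
      using that d2 \<delta> by (intro divide_left_mono) simp_all
    have "a\<^sup>2 * h \<le> (h / \<delta>)\<^sup>2 * h" using a assms by (intro mult_right_mono power_mono)
    then have 1: "a\<^sup>2 * h \<le> h ^ 3 / \<delta>\<^sup>2" by (simp add: power_divide power2_eq_square power3_eq_cube)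
    have "a * h\<^sup>2 \<le> (h / \<delta>) * h\<^sup>2" using a by (intro mult_right_mono) simp_all
    then have 2: "a * h\<^sup>2 \<le> h ^ 3 / \<delta>\<^sup>2" using w[of "h ^ 3"] assms by (simp add: power2_eq_square power3_eq_cube)
    have "a * h \<le> (h / \<delta>) * h" using a assms by (intro mult_right_mono)
    then have 3: "a * h \<le> h\<^sup>2 / \<delta>\<^sup>2" using w[of "h\<^sup>2"] assms by (simp add: power2_eq_square)
    show ?thesis using 1 2 3 q by linarith
  qed
  then show "a\<^sup>2 * h \<le> \<delta> * a ^ 3 + h ^ 3 / \<delta>\<^sup>2" "a * h\<^sup>2 \<le> \<delta> * a ^ 3 + h ^ 3 / \<delta>\<^sup>2" "a * h \<le> \<delta> * a\<^sup>2 + h\<^sup>2 / \<delta>\<^sup>2"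
    by blast+
qed

text \<open>The quantity whose mean near the diagonal tends to zero by diagonal continuity.\<close>

definition gap :: "'n::finite phase \<times> 'n phase \<Rightarrow> real" where
  "gap \<zeta> = norm (fst (fst \<zeta>) - fst (snd \<zeta>)) ^ 2 + norm (fst (fst \<zeta>) - fst (snd \<zeta>)) ^ 3
     + \<bar>snd (fst \<zeta>) - snd (snd \<zeta>)\<bar> powr (3/2)"

lemma gap_measurable: "gap \<in> borel_measurable borel"
  unfolding gap_def[abs_def]
  by (intro borel_measurable_add powr_real_measurable borel_measurable_const borel_measurable_continuous_onI continuous_intros)

lemma gap_nonneg [simp]: "0 \<le> gap \<zeta>" by (simp add: gap_def)

text \<open>
  Each term of the difference of both fluxes contains an increment, and is split by the inequality of
  Young into a small multiple of the moments and a large multiple of the gap.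
\<close>

lemma flux_difference:
  fixes v w X :: "real^'n" and p r s :: real
  assumes X: "norm X \<le> K" "\<bar>s\<bar> \<le> K" and \<delta>: "0 < \<delta>" "\<delta> \<le> 1"
  shows "\<bar>(X \<bullet> ((norm w)\<^sup>2 *\<^sub>R w - (norm w)\<^sup>2 *\<^sub>R v + (2 * (v \<bullet> w)) *\<^sub>R v + (2 * p) *\<^sub>R w + (2 * r) *\<^sub>R v) + 2 * (v \<bullet> w) * s)
      - (X \<bullet> ((2 * (norm v)\<^sup>2) *\<^sub>R v + (4 * p) *\<^sub>R v) + 2 * (norm v)\<^sup>2 * s)\<bar>
    \<le> 10 * K * (\<delta> * (size1 (v, p) + size1 (w, r)) + gap ((v, p), (w, r)) / \<delta>\<^sup>2)" (is "\<bar>?l\<bar> \<le> _")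
proof -
  let ?h = "norm (v - w)" and ?q = "sqrt \<bar>p - r\<bar>" and ?sp = "sqrt \<bar>p\<bar>"
  define E where "E = (norm w)\<^sup>2 *\<^sub>R (w - v) + (2 * (v \<bullet> (w - v))) *\<^sub>R v + (2 * p) *\<^sub>R (w - v) + (2 * (r - p)) *\<^sub>R v"
  have l: "?l = X \<bullet> E + 2 * (v \<bullet> (w - v)) * s"
    unfolding E_def inner_add_right inner_diff_right inner_scaleR_right power2_norm_eq_inner by (simp add: algebra_simps)
  have K: "0 \<le> K" using X(2) by linarith
  have hw: "norm (w - v) = ?h" by (rule norm_minus_commute)
  have vw: "\<bar>v \<bullet> (w - v)\<bar> \<le> norm v * ?h" using Cauchy_Schwarz_ineq2[of v "w - v"] unfolding hw .
  have e1: "norm ((norm w)\<^sup>2 *\<^sub>R (w - v)) = (norm w)\<^sup>2 * ?h" by (simp add: hw)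
  have e2: "norm ((2 * (v \<bullet> (w - v))) *\<^sub>R v) \<le> 2 * ((norm v)\<^sup>2 * ?h)"
    using mult_right_mono[OF vw norm_ge_zero[of v]] by (simp add: abs_mult power2_eq_square mult_ac)
  have e3: "norm ((2 * p) *\<^sub>R (w - v)) = 2 * (?sp\<^sup>2 * ?h)" by (simp add: hw abs_mult)
  have e4: "norm ((2 * (r - p)) *\<^sub>R v) = 2 * (norm v * ?q\<^sup>2)"
    unfolding norm_scaleR abs_mult abs_minus_commute[of r p] by simp
  have nE: "norm E \<le> (norm w)\<^sup>2 * ?h + 2 * ((norm v)\<^sup>2 * ?h) + 2 * (?sp\<^sup>2 * ?h) + 2 * (norm v * ?q\<^sup>2)"
    unfolding E_def using e2 unfolding e1[symmetric] e3[symmetric] e4[symmetric]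
    by (intro norm_triangle_le add_mono) simp_all
  have "\<bar>?l\<bar> \<le> \<bar>X \<bullet> E\<bar> + \<bar>2 * (v \<bullet> (w - v)) * s\<bar>" unfolding l by (rule abs_triangle_ineq)
  also have "\<bar>X \<bullet> E\<bar> \<le> K * norm E"
    using Cauchy_Schwarz_ineq2[of X E] mult_right_mono[OF X(1) norm_ge_zero[of E]] by linarith
  also have "\<bar>2 * (v \<bullet> (w - v)) * s\<bar> \<le> K * (2 * (norm v * ?h))"
    using mult_mono[OF vw X(2)] K by (simp add: abs_mult mult_ac)
  finally have b: "\<bar>?l\<bar> \<le> K * (norm E + 2 * (norm v * ?h))" by (simp add: distrib_left)
  have y: "(norm w)\<^sup>2 * ?h \<le> \<delta> * norm w ^ 3 + ?h ^ 3 / \<delta>\<^sup>2" "(norm v)\<^sup>2 * ?h \<le> \<delta> * norm v ^ 3 + ?h ^ 3 / \<delta>\<^sup>2"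
    "?sp\<^sup>2 * ?h \<le> \<delta> * ?sp ^ 3 + ?h ^ 3 / \<delta>\<^sup>2" "norm v * ?q\<^sup>2 \<le> \<delta> * norm v ^ 3 + ?q ^ 3 / \<delta>\<^sup>2"
    "norm v * ?h \<le> \<delta> * (norm v)\<^sup>2 + ?h\<^sup>2 / \<delta>\<^sup>2"
    by (rule young_absorb; use \<delta> in simp)+
  have sz: "size1 (v, p) + size1 (w, r) = (norm v)\<^sup>2 + norm v ^ 3 + ?sp ^ 3 + ((norm w)\<^sup>2 + norm w ^ 3 + \<bar>r\<bar> powr (3/2))"
    "gap ((v, p), (w, r)) / \<delta>\<^sup>2 = ?h\<^sup>2 / \<delta>\<^sup>2 + ?h ^ 3 / \<delta>\<^sup>2 + ?q ^ 3 / \<delta>\<^sup>2"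
    by (simp_all add: size1_def gap_def powr_three_halves add_divide_distrib)
  have pos: "0 \<le> \<delta> * (norm v)\<^sup>2" "0 \<le> \<delta> * norm v ^ 3" "0 \<le> \<delta> * ?sp ^ 3" "0 \<le> \<delta> * (norm w)\<^sup>2" "0 \<le> \<delta> * norm w ^ 3" "0 \<le> \<delta> * \<bar>r\<bar> powr (3/2)"
    "0 \<le> ?h\<^sup>2 / \<delta>\<^sup>2" "0 \<le> ?h ^ 3 / \<delta>\<^sup>2" "0 \<le> ?q ^ 3 / \<delta>\<^sup>2" using \<delta> by simp_all
  have "norm E + 2 * (norm v * ?h) \<le> 10 * (\<delta> * (size1 (v, p) + size1 (w, r)) + gap ((v, p), (w, r)) / \<delta>\<^sup>2)"
    unfolding sz distrib_left using nE y pos by linarith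
  from mult_left_mono[OF this K] b show ?thesis by (simp add: mult_ac)
qed

section \<open>The local part of the regularised energy flux\<close>

context test_pair begin

text \<open>The expression balance with the right phase replaced by the left one.\<close>

definition "diagonal_balance q = G q * (Px q \<bullet> ((2 * (norm (vL q))\<^sup>2) *\<^sub>R vL q + (4 * pL q) *\<^sub>R vL q) + 2 * (norm (vL q))\<^sup>2 * Pt q)"
  for q :: "(real \<times> (real^'n) \<times> (real^'n)) \<times> 'n phase \<times> 'n phase"

lemma left_marginal:
  fixes w :: "real \<Rightarrow> real^'n \<Rightarrow> real" and h :: "'n phase \<Rightarrow> real"
  assumes w [measurable]: "(\<lambda>r. w (fst r) (snd r)) \<in> borel_measurable (borel \<Otimes>\<^sub>M borel)" and B: "\<And>t x. \<bar>w t x\<bar> \<le> B" "0 \<le> B"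
    and h: "h \<in> borel_measurable borel" "\<And>a. \<bar>h a\<bar> \<le> 3 * size1 a"
    and mass: "(\<integral>z. g z \<partial>lborel) = 1"
  defines "F \<equiv> \<lambda>q. (2 * (G q * w (tm q) (xL q))) * h (vL q, pL q)"
  shows "integrable \<mu>2 F" and "(\<integral>q. F q \<partial>\<mu>2) = 2 * (\<integral>r. (\<integral>a. h a \<partial>\<kappa>1 r) * w (fst r) (snd r) \<partial>S1 D T)"
proof -
  obtain M where M: "0 \<le> M" "\<And>z. \<bar>g z\<bar> \<le> M * indicator (ball 0 e) z"
    using compact_support_bounded[OF smooth_along_continuous[OF g] g_zero] by metis
  let ?K = "\<lambda>s. 2 * (g (rep D (fst (snd s) - snd (snd s))) * w (fst s) (fst (snd s)))"
  have wm: "(\<lambda>s. w (fst s) (fst (snd s))) \<in> borel_measurable (borel \<Otimes>\<^sub>M (borel \<Otimes>\<^sub>M borel))"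
    using measurable_compose[OF _ w, of "\<lambda>s. (fst s, fst (snd s))" "borel \<Otimes>\<^sub>M (borel \<Otimes>\<^sub>M borel)"] by simp
  have Km: "?K \<in> borel_measurable (borel \<Otimes>\<^sub>M (borel \<Otimes>\<^sub>M borel))"
    by (intro borel_measurable_times borel_measurable_const wm) measurable
  have F: "F = (\<lambda>q. ?K (fst q) * h (vL q, pL q))" by (simp add: F_def weights coords)
  have hm: "(\<lambda>q. h (vL q, pL q)) \<in> borel_measurable pair_space"
    unfolding coords prod.collapse by (rule measurable_compose[OF measurable_snd measurable_compose[OF fst_borel h(1)]])
  have Fm: "F \<in> borel_measurable pair_space"
    unfolding F by (rule borel_measurable_times[OF measurable_compose[OF measurable_fst Km] hm])
  show int: "integrable \<mu>2 F"
  proof (rule integrable_\<mu>2[OF Fm e(1) e2, where C="6 * M * B"])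
    fix q :: "(real \<times> (real^'n) \<times> (real^'n)) \<times> 'n phase \<times> 'n phase"
    have G: "\<bar>G q\<bar> \<le> M * strip D e (xL q) (xR q)" unfolding G_def strip_def by (rule M)
    have "\<bar>h (vL q, pL q)\<bar> \<le> 3 * sizes q"
      using h(2)[of "(vL q, pL q)"] size1_nonneg[of "(vR q, pR q)"] unfolding sizes_def distrib_left by linarith
    then have "\<bar>G q\<bar> * \<bar>w (tm q) (xL q)\<bar> * \<bar>h (vL q, pL q)\<bar> \<le> (M * strip D e (xL q) (xR q)) * B * (3 * sizes q)"
      using G B M(1) by (intro mult_mono) (auto intro!: mult_nonneg_nonneg)
    then show "\<bar>F q\<bar> \<le> 6 * M * B * (strip D e (xL q) (xR q) * sizes q)"
      unfolding F_def by (simp add: abs_mult mult_ac)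
  qed
  have y: "(\<integral>y. g (rep D (x - y)) \<partial>dom_measure D) = 1" for x
    using integral_near_point[OF _ e(1) e2, of "\<lambda>p. g (snd p)" D x] g_zero mass by simp
  have "(\<integral>q. F q \<partial>\<mu>2) = (\<integral>r. (\<integral>y. ?K (fst r, snd r, y) \<partial>dom_measure D) * (\<integral>a. h a \<partial>\<kappa>1 r) \<partial>S1 D T)"
    using marginal[OF Km h(1)] int unfolding F by blast
  also have "\<dots> = (\<integral>r. 2 * ((\<integral>a. h a \<partial>\<kappa>1 r) * w (fst r) (snd r)) \<partial>S1 D T)"
  proof (rule Bochner_Integration.integral_cong[OF refl])
    fix r
    have "(\<integral>y. ?K (fst r, snd r, y) \<partial>dom_measure D) = 2 * w (fst r) (snd r)"
      unfolding fst_conv snd_conv integral_mult_right_zero integral_mult_left_zero y by simp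
    then show "(\<integral>y. ?K (fst r, snd r, y) \<partial>dom_measure D) * (\<integral>a. h a \<partial>\<kappa>1 r) = 2 * ((\<integral>a. h a \<partial>\<kappa>1 r) * w (fst r) (snd r))"
      by (simp only: mult_ac)
  qed
  finally show "(\<integral>q. F q \<partial>\<mu>2) = 2 * (\<integral>r. (\<integral>a. h a \<partial>\<kappa>1 r) * w (fst r) (snd r) \<partial>S1 D T)"
    unfolding integral_mult_right_zero .
qed

text \<open>The right point occurs in the weight g only, which has mass one.\<close>

lemma diagonal_balance_integral:
  assumes mass: "(\<integral>z. g z \<partial>lborel) = 1"
  shows "integrable \<mu>2 diagonal_balance" and "(\<integral>q. diagonal_balance q \<partial>\<mu>2) = 2 * (\<integral>r. energy_density \<psi> r \<partial>S1 D T)"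
proof -
  obtain B where B: "0 \<le> B" "\<And>t x. \<bar>at_point (dt \<psi>) t x\<bar> \<le> B" "\<And>t x k. \<bar>at_point (grad_at 0 \<psi>) t x $ k\<bar> \<le> B"
    using weights_bounded[OF \<psi>] by metis
  let ?a = "\<lambda>q. (2 * (G q * at_point (dt \<psi>) (tm q) (xL q))) * (norm (fst (vL q, pL q)))\<^sup>2"
  let ?b = "\<lambda>k q. (2 * (G q * at_point (grad_at 0 \<psi>) (tm q) (xL q) $ k)) *
    ((norm (fst (vL q, pL q)))\<^sup>2 * fst (vL q, pL q) $ k + 2 * fst (vL q, pL q) $ k * snd (vL q, pL q))"
  note A = left_marginal[OF test_weights(1)[OF \<psi>] B(2,1) energy_functions(1,3) mass]
  note b = left_marginal[OF test_weights(2)[OF \<psi>] B(3,1) energy_functions(2,4) mass]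
  have A1: "integrable \<mu>2 ?a" by (rule A(1))
  have b1: "integrable \<mu>2 (?b k)" for k by (rule b(1))
  have bs: "integrable \<mu>2 (\<lambda>q. \<Sum>k\<in>UNIV. ?b k q)" by (rule Bochner_Integration.integrable_sum) (rule b1)
  have eq: "diagonal_balance q = ?a q + (\<Sum>k\<in>UNIV. ?b k q)" for q
  proof -
    have "Px q \<bullet> ((2 * (norm (vL q))\<^sup>2) *\<^sub>R vL q + (4 * pL q) *\<^sub>R vL q) =
      (\<Sum>k\<in>UNIV. Px q $ k * (2 * ((norm (vL q))\<^sup>2 * vL q $ k + 2 * vL q $ k * pL q)))"
      unfolding inner_vec_def inner_real_def by (intro sum.cong refl) (simp add: algebra_simps)
    then show ?thesis
      unfolding diagonal_balance_def weights(2,3) fst_conv snd_conv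
      by (simp add: distrib_left sum_distrib_left mult_ac)
  qed
  show "integrable \<mu>2 diagonal_balance"
    unfolding eq[abs_def] by (rule Bochner_Integration.integrable_add[OF A1 bs])
  let ?A = "\<lambda>r. (\<integral>a. (norm (fst a))\<^sup>2 \<partial>\<kappa>1 r) * at_point (dt \<psi>) (fst r) (snd r)"
  let ?B = "\<lambda>k r. (\<integral>a. (norm (fst a))\<^sup>2 * fst a $ k + 2 * fst a $ k * snd a \<partial>\<kappa>1 r) * at_point (grad_at 0 \<psi>) (fst r) (snd r) $ k"
  note ei = energy_density_integrable(1,2)[OF \<psi> B(2,3,1)]
  have Bs: "integrable (S1 D T) (\<lambda>r. \<Sum>k\<in>UNIV. ?B k r)"
    by (rule Bochner_Integration.integrable_sum) (rule ei(2))
  have "(\<integral>q. diagonal_balance q \<partial>\<mu>2) = (\<integral>q. ?a q \<partial>\<mu>2) + (\<integral>q. (\<Sum>k\<in>UNIV. ?b k q) \<partial>\<mu>2)"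
    unfolding eq by (rule Bochner_Integration.integral_add[OF A1 bs])
  also have "(\<integral>q. (\<Sum>k\<in>UNIV. ?b k q) \<partial>\<mu>2) = (\<Sum>k\<in>UNIV. \<integral>q. ?b k q \<partial>\<mu>2)"
    by (rule Bochner_Integration.integral_sum) (rule b1)
  also have "\<dots> = (\<Sum>k\<in>UNIV. 2 * (\<integral>r. ?B k r \<partial>S1 D T))" by (rule sum.cong[OF refl b(2)])
  also have "\<dots> = 2 * (\<Sum>k\<in>UNIV. \<integral>r. ?B k r \<partial>S1 D T)" by (rule sum_distrib_left[symmetric])
  also have "(\<Sum>k\<in>UNIV. \<integral>r. ?B k r \<partial>S1 D T) = (\<integral>r. (\<Sum>k\<in>UNIV. ?B k r) \<partial>S1 D T)"
    by (rule Bochner_Integration.integral_sum[symmetric]) (rule ei(2))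
  also have "(\<integral>q. ?a q \<partial>\<mu>2) = 2 * (\<integral>r. ?A r \<partial>S1 D T)" by (rule A(2))
  also have "2 * (\<integral>r. ?A r \<partial>S1 D T) + 2 * (\<integral>r. (\<Sum>k\<in>UNIV. ?B k r) \<partial>S1 D T) = 2 * (\<integral>r. energy_density \<psi> r \<partial>S1 D T)"
    unfolding energy_density_def Bochner_Integration.integral_add[OF ei(1) Bs] by (rule distrib_left[symmetric])
  finally show "(\<integral>q. diagonal_balance q \<partial>\<mu>2) = 2 * (\<integral>r. energy_density \<psi> r \<partial>S1 D T)" .
qed

text \<open>
  The mass of g turns the moments at both points into a bound that does not depend on the support of
  g; only the gap feels how far the points are apart.
\<close>

lemma cubic_remainder:
  assumes g1: "\<And>z. 0 \<le> g z" and mass: "(\<integral>z. g z \<partial>lborel) = 1"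
    and B: "\<And>t x. \<bar>at_point (dt \<psi>) t x\<bar> \<le> B" "\<And>t x. norm (at_point (grad_at 0 \<psi>) t x) \<le> B" "0 \<le> B"
    and \<delta>: "0 < \<delta>" "\<delta> \<le> 1"
  shows "ennreal \<bar>(\<integral>q. cubic q \<partial>\<mu>2) - 2 * (\<integral>r. energy_density \<psi> r \<partial>S1 D T)\<bar> \<le>
    ennreal (10 * B) * (ennreal \<delta> * (2 * moment1) + ennreal (1 / \<delta>\<^sup>2) * (\<integral>\<^sup>+ q. ennreal (G q) * ennreal (gap (snd q)) \<partial>\<mu>2))"
proof -
  note d = diagonal_balance_integral[OF mass]
  have "(\<integral>q. cubic q \<partial>\<mu>2) - 2 * (\<integral>r. energy_density \<psi> r \<partial>S1 D T) = (\<integral>q. balance q - diagonal_balance q \<partial>\<mu>2)"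
    unfolding cubic_balance(3) d(2)[symmetric] by (rule Bochner_Integration.integral_diff[OF cubic_balance(2) d(1), symmetric])
  then have "ennreal \<bar>(\<integral>q. cubic q \<partial>\<mu>2) - 2 * (\<integral>r. energy_density \<psi> r \<partial>S1 D T)\<bar> \<le> (\<integral>\<^sup>+ q. ennreal \<bar>balance q - diagonal_balance q\<bar> \<partial>\<mu>2)"
    using norm_integral_le_nn[of \<mu>2 "\<lambda>q. balance q - diagonal_balance q"] by (simp only:)
  also have "\<dots> \<le> (\<integral>\<^sup>+ q. ennreal (10 * B) * (ennreal \<delta> * (ennreal (G q) * ennreal (sizes q)) + ennreal (1 / \<delta>\<^sup>2) * (ennreal (G q) * ennreal (gap (snd q)))) \<partial>\<mu>2)"
  proof (rule nn_integral_mono)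
    fix q :: "(real \<times> (real^'n) \<times> (real^'n)) \<times> 'n phase \<times> 'n phase"
    have G0: "0 \<le> G q" unfolding G_def by (rule g1)
    have gp: "gap ((vL q, pL q), (vR q, pR q)) = gap (snd q)" by (simp add: coords)
    have X: "norm (Px q) \<le> B" "\<bar>Pt q\<bar> \<le> B" unfolding weights using B by simp_all
    have "balance q - diagonal_balance q = G q * ((Px q \<bullet> ((norm (vR q))\<^sup>2 *\<^sub>R vR q - (norm (vR q))\<^sup>2 *\<^sub>R vL q + (2 * (vL q \<bullet> vR q)) *\<^sub>R vL q
        + (2 * pL q) *\<^sub>R vR q + (2 * pR q) *\<^sub>R vL q) + 2 * (vL q \<bullet> vR q) * Pt q)
      - (Px q \<bullet> ((2 * (norm (vL q))\<^sup>2) *\<^sub>R vL q + (4 * pL q) *\<^sub>R vL q) + 2 * (norm (vL q))\<^sup>2 * Pt q))"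
      unfolding balance_def diagonal_balance_def by (rule right_diff_distrib[symmetric])
    then have "\<bar>balance q - diagonal_balance q\<bar> \<le> G q * (10 * B * (\<delta> * sizes q + gap (snd q) / \<delta>\<^sup>2))"
      using mult_left_mono[OF flux_difference[OF X \<delta>, of "vR q" "vL q" "pL q" "pR q"] G0] G0
      unfolding gp sizes_def[symmetric] by (simp only: abs_mult abs_of_nonneg)
    also have "\<dots> = 10 * B * (\<delta> * (G q * sizes q) + 1 / \<delta>\<^sup>2 * (G q * gap (snd q)))" by (simp add: algebra_simps)
    finally have "ennreal \<bar>balance q - diagonal_balance q\<bar> \<le> ennreal (10 * B * (\<delta> * (G q * sizes q) + 1 / \<delta>\<^sup>2 * (G q * gap (snd q))))"
      by (rule ennreal_leI)
    also have "\<dots> = ennreal (10 * B) * (ennreal \<delta> * (ennreal (G q) * ennreal (sizes q)) + ennreal (1 / \<delta>\<^sup>2) * (ennreal (G q) * ennreal (gap (snd q))))"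
    proof -
      have en: "ennreal (K * (d * (a * b) + c * (a * b'))) = ennreal K * (ennreal d * (ennreal a * ennreal b) + ennreal c * (ennreal a * ennreal b'))"
        if "0 \<le> K" "0 \<le> d" "0 \<le> a" "0 \<le> b" "0 \<le> c" "0 \<le> b'" for K d a b c b' :: real
        using that by (simp add: ennreal_mult ennreal_plus)
      show ?thesis by (rule en) (use G0 \<delta> B(3) in simp_all)
    qed
    finally show "ennreal \<bar>balance q - diagonal_balance q\<bar> \<le>
      ennreal (10 * B) * (ennreal \<delta> * (ennreal (G q) * ennreal (sizes q)) + ennreal (1 / \<delta>\<^sup>2) * (ennreal (G q) * ennreal (gap (snd q))))" .
  qed
  also have "\<dots> = ennreal (10 * B) * (ennreal \<delta> * (\<integral>\<^sup>+ q. ennreal (G q) * ennreal (sizes q) \<partial>\<mu>2) + ennreal (1 / \<delta>\<^sup>2) * (\<integral>\<^sup>+ q. ennreal (G q) * ennreal (gap (snd q)) \<partial>\<mu>2))"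
  proof -
    have m1: "(\<lambda>q. ennreal (G q) * ennreal (sizes q)) \<in> borel_measurable \<mu>2"
      by (subst measurable_cong_sets[OF sets_\<mu>2 refl]) measurable
    have gm: "(\<lambda>q. gap (snd q)) \<in> borel_measurable pair_space" by (rule measurable_compose[OF measurable_snd gap_measurable])
    have m2: "(\<lambda>q. ennreal (G q) * ennreal (gap (snd q))) \<in> borel_measurable \<mu>2"
      by (subst measurable_cong_sets[OF sets_\<mu>2 refl]) (use gm in measurable)
    have m: "(\<lambda>q. ennreal \<delta> * (ennreal (G q) * ennreal (sizes q))) \<in> borel_measurable \<mu>2"
      "(\<lambda>q. ennreal (1 / \<delta>\<^sup>2) * (ennreal (G q) * ennreal (gap (snd q)))) \<in> borel_measurable \<mu>2"
      by (rule borel_measurable_times_ennreal[OF borel_measurable_const m1] borel_measurable_times_ennreal[OF borel_measurable_const m2])+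
    show ?thesis
      unfolding nn_integral_cmult[OF borel_measurable_add[OF m]] nn_integral_add[OF m] nn_integral_cmult[OF m1] nn_integral_cmult[OF m2] ..
  qed
  also have "(\<integral>\<^sup>+ q. ennreal (G q) * ennreal (sizes q) \<partial>\<mu>2) = 2 * moment1"
  proof -
    have "integrable lborel g" using mass not_integrable_integral_eq[of lborel g] by fastforce
    then have "(\<integral>\<^sup>+ z. ennreal (g z) \<partial>lborel) = 1" using nn_integral_eq_integral[of lborel g] g1 mass by simp
    then show ?thesis
      using nn_integral_weight_sizes[of "\<lambda>z. ennreal (g z)", OF _ e(1) e2] g_zero unfolding G_def by simp
  qed
  finally show ?thesis .
qed

end

section \<open>Rescaled mollifiers\<close>

lemma
  fixes \<rho> :: "real^'n \<Rightarrow> real"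
  assumes \<rho>: "smooth_along (range coord_shift) \<rho>" and \<epsilon>: "0 < \<epsilon>"
  shows rescale_smooth: "smooth_along (range coord_shift) (rescale \<rho> \<epsilon>)"
    and rescale_deriv: "flow_deriv (coord_shift i) (rescale \<rho> \<epsilon>) z = flow_deriv (coord_shift i) \<rho> (z /\<^sub>R \<epsilon>) / \<epsilon> ^ Suc CARD('n)"
proof -
  have flow: "coord_shift i h z /\<^sub>R \<epsilon> = coord_shift i (inverse \<epsilon> * h) (z /\<^sub>R \<epsilon>)" for i h and z :: "real^'n"
    by (simp add: coord_shift_def scaleR_add_right)
  have r: "rescale \<rho> \<epsilon> = (\<lambda>z. (1 / \<epsilon> ^ CARD('n)) * \<rho> (z /\<^sub>R \<epsilon>))" by (simp add: rescale_def fun_eq_iff)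
  show "smooth_along (range coord_shift) (rescale \<rho> \<epsilon>)"
    unfolding r
  proof (rule smooth_along_compose[OF \<rho>])
    show "continuous_on UNIV (\<lambda>z :: real^'n. z /\<^sub>R \<epsilon>)" by (intro continuous_intros)
    show "\<exists>s\<in>range coord_shift. \<exists>c. \<forall>h z. \<tau> h z /\<^sub>R \<epsilon> = s (c * h) (z /\<^sub>R \<epsilon>)" if "\<tau> \<in> range coord_shift" for \<tau> :: "real \<Rightarrow> real^'n \<Rightarrow> real^'n"
      using that flow by blast
  qed
  have "((\<lambda>h. rescale \<rho> \<epsilon> (coord_shift i h p)) has_real_derivative
      (1 / \<epsilon> ^ CARD('n)) * (inverse \<epsilon> * flow_deriv (coord_shift i) \<rho> (p /\<^sub>R \<epsilon>))) (at 0)" for p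
    unfolding r
    by (rule DERIV_cmult[OF flow_deriv_compose[where \<Phi>="\<lambda>z. z /\<^sub>R \<epsilon>" and s="coord_shift i" and \<tau>="coord_shift i", OF \<rho> rangeI flow]])
  from flow_derivI[of "rescale \<rho> \<epsilon>" "coord_shift i", OF this]
  show "flow_deriv (coord_shift i) (rescale \<rho> \<epsilon>) z = flow_deriv (coord_shift i) \<rho> (z /\<^sub>R \<epsilon>) / \<epsilon> ^ Suc CARD('n)"
    by (simp add: divide_inverse mult_ac)
qed

lemma rescaled_ball: "0 < \<epsilon> \<Longrightarrow> z /\<^sub>R \<epsilon> \<in> ball 0 1 \<longleftrightarrow> z \<in> ball (0 :: real^'n) \<epsilon>"
  by (simp add: divide_simps)

lemma rescale_mass:
  fixes \<rho> :: "real^'n \<Rightarrow> real"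
  assumes m: "\<rho> \<in> borel_measurable borel" and \<epsilon>: "0 < \<epsilon>"
  shows "(\<integral>z. rescale \<rho> \<epsilon> z \<partial>lborel) = (\<integral>z. \<rho> z \<partial>lborel)"
proof -
  let ?r = "rescale \<rho> \<epsilon>"
  have rm: "?r \<in> borel_measurable borel"
    unfolding rescale_def[abs_def] using m by measurable
  have "(\<integral>z. ?r z \<partial>lborel) = (\<integral>z. ?r z \<partial>density (distr lborel borel (\<lambda>x. 0 + \<epsilon> *\<^sub>R x)) (\<lambda>_. ennreal (\<bar>\<epsilon>\<bar> ^ DIM(real^'n))))"
    using lborel_affine[of \<epsilon> "0 :: real^'n"] \<epsilon> by (simp only: less_imp_neq[symmetric] simp_thms ennreal_power abs_ge_zero)
  also have "\<dots> = (\<integral>z. \<epsilon> ^ CARD('n) *\<^sub>R ?r z \<partial>distr lborel borel (\<lambda>x. 0 + \<epsilon> *\<^sub>R x))"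
    using \<epsilon> rm by (subst integral_density) simp_all
  also have "\<dots> = (\<integral>x. \<epsilon> ^ CARD('n) *\<^sub>R ?r (0 + \<epsilon> *\<^sub>R x) \<partial>lborel)"
    by (rule integral_distr) (use rm in measurable)
  also have "\<dots> = (\<integral>z. \<rho> z \<partial>lborel)" using \<epsilon> by (simp add: rescale_def)
  finally show ?thesis .
qed

lemma ball_volume_power: "0 < e \<Longrightarrow> ball_volume TYPE('n::finite) e = unit_ball_vol (real CARD('n)) * e ^ CARD('n)"
  unfolding ball_volume_def by (simp add: content_ball)

lemma mollifier_bounds:
  fixes \<rho> :: "real^'n \<Rightarrow> real"
  assumes "rot_sym_mollifier \<rho>"
  obtains M where "0 \<le> M" "\<And>\<epsilon> z. 0 < \<epsilon> \<Longrightarrow> \<bar>rescale \<rho> \<epsilon> z\<bar> \<le> M / \<epsilon> ^ CARD('n) * indicator (ball 0 \<epsilon>) z"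
    "\<And>\<epsilon> z. 0 < \<epsilon> \<Longrightarrow> norm (grad (rescale \<rho> \<epsilon>) z) \<le> M / \<epsilon> ^ Suc CARD('n) * indicator (ball 0 \<epsilon>) z"
proof -
  have \<rho>: "smooth_along (range coord_shift) \<rho>" and z: "\<And>z. z \<notin> ball 0 1 \<Longrightarrow> \<rho> z = 0"
    using assms unfolding rot_sym_mollifier_def by blast+
  have van: "vanishes_off 1 \<rho>" using z by (auto simp: vanishes_off_def)
  have z': "1 \<le> norm z \<Longrightarrow> \<rho> z = 0" for z using z[of z] by simp
  have dz: "1 \<le> norm z \<Longrightarrow> flow_deriv (coord_shift i) \<rho> z = 0" for i z
    using vanishes_on_sphere[OF smooth_along_continuous[OF smooth_along_flow_deriv[OF \<rho> rangeI]] vanishes_off_deriv[OF van]] by simp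
  obtain M0 where M0: "0 \<le> M0" "\<And>z. \<bar>\<rho> z\<bar> \<le> M0 * indicator (ball 0 1) z"
    using compact_support_bounded[OF smooth_along_continuous[OF \<rho>] z'] by metis
  have "\<exists>N\<ge>0. \<forall>z. \<bar>flow_deriv (coord_shift i) \<rho> z\<bar> \<le> N * indicator (ball 0 1) z" for i
    using compact_support_bounded[OF smooth_along_continuous[OF smooth_along_flow_deriv[OF \<rho> rangeI]] dz] by metis
  then obtain N where N: "\<And>i. 0 \<le> N i" "\<And>i z. \<bar>flow_deriv (coord_shift i) \<rho> z\<bar> \<le> N i * indicator (ball 0 1) z" by metis
  define M where "M = M0 + (\<Sum>i\<in>UNIV. N i)"
  have S: "0 \<le> (\<Sum>i\<in>UNIV. N i)" by (rule sum_nonneg) (rule N)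
  show ?thesis
  proof
    show "0 \<le> M" unfolding M_def using M0(1) S by simp
    fix \<epsilon> :: real and z :: "real^'n" assume \<epsilon>: "0 < \<epsilon>"
    have ind: "indicator (ball 0 1) (z /\<^sub>R \<epsilon>) = (indicator (ball 0 \<epsilon>) z :: real)"
      using rescaled_ball[OF \<epsilon>, of z] by (simp only: indicator_def)
    have "\<bar>rescale \<rho> \<epsilon> z\<bar> = \<bar>\<rho> (z /\<^sub>R \<epsilon>)\<bar> / \<epsilon> ^ CARD('n)" using \<epsilon> by (simp add: rescale_def)
    also have "\<dots> \<le> M0 * indicator (ball 0 \<epsilon>) z / \<epsilon> ^ CARD('n)"
      using M0(2)[of "z /\<^sub>R \<epsilon>"] \<epsilon> unfolding ind by (intro divide_right_mono) simp_all
    also have "\<dots> \<le> M * indicator (ball 0 \<epsilon>) z / \<epsilon> ^ CARD('n)"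
      unfolding M_def using S \<epsilon> by (intro divide_right_mono mult_right_mono) simp_all
    finally show "\<bar>rescale \<rho> \<epsilon> z\<bar> \<le> M / \<epsilon> ^ CARD('n) * indicator (ball 0 \<epsilon>) z" by simp
    have "norm (grad (rescale \<rho> \<epsilon>) z) \<le> (\<Sum>i\<in>UNIV. \<bar>flow_deriv (coord_shift i) \<rho> (z /\<^sub>R \<epsilon>)\<bar> / \<epsilon> ^ Suc CARD('n))"
      using norm_le_l1_cart[of "grad (rescale \<rho> \<epsilon>) z"] \<epsilon>
      unfolding grad_def vec_lambda_beta rescale_deriv[OF \<rho> \<epsilon>] by (simp add: abs_divide)
    also have "\<dots> \<le> (\<Sum>i\<in>UNIV. N i * indicator (ball 0 \<epsilon>) z / \<epsilon> ^ Suc CARD('n))"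
      using N(2)[of _ "z /\<^sub>R \<epsilon>"] \<epsilon> unfolding ind by (intro sum_mono divide_right_mono) simp_all
    also have "\<dots> = (\<Sum>i\<in>UNIV. N i) * indicator (ball 0 \<epsilon>) z / \<epsilon> ^ Suc CARD('n)"
      by (simp only: sum_divide_distrib sum_distrib_right)
    also have "\<dots> \<le> M * indicator (ball 0 \<epsilon>) z / \<epsilon> ^ Suc CARD('n)"
      unfolding M_def using M0(1) \<epsilon> by (intro divide_right_mono mult_right_mono) simp_all
    finally show "norm (grad (rescale \<rho> \<epsilon>) z) \<le> M / \<epsilon> ^ Suc CARD('n) * indicator (ball 0 \<epsilon>) z" by simp
  qed
qed

section \<open>The limit of the defect integrals\<close>

lemma
  fixes \<rho> :: "real^'n \<Rightarrow> real"
  assumes "rot_sym_mollifier \<rho>" and \<epsilon>: "0 < \<epsilon>"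
  shows rescale_nonneg: "0 \<le> rescale \<rho> \<epsilon> z"
    and rescale_vanishes: "vanishes_off \<epsilon> (rescale \<rho> \<epsilon>)"
    and rescale_unit_mass: "(\<integral>z. rescale \<rho> \<epsilon> z \<partial>lborel) = 1"
proof -
  have \<rho>: "smooth_along (range coord_shift) \<rho>" "\<And>z. 0 \<le> \<rho> z" "\<And>z. z \<notin> ball 0 1 \<Longrightarrow> \<rho> z = 0" "(\<integral>z. \<rho> z \<partial>lebesgue) = 1"
    using assms unfolding rot_sym_mollifier_def by blast+
  show "0 \<le> rescale \<rho> \<epsilon> z" using \<rho>(2) \<epsilon> by (simp add: rescale_def)
  show "vanishes_off \<epsilon> (rescale \<rho> \<epsilon>)"
    unfolding vanishes_off_def
  proof (intro allI impI)
    fix z :: "real^'n" assume "\<epsilon> < norm z"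
    then have "z /\<^sub>R \<epsilon> \<notin> ball 0 1" unfolding rescaled_ball[OF \<epsilon>] by simp
    then show "rescale \<rho> \<epsilon> z = 0" by (simp add: rescale_def \<rho>(3))
  qed
  have m: "\<rho> \<in> borel_measurable borel" by (rule borel_measurable_continuous_onI[OF smooth_along_continuous[OF \<rho>(1)]])
  have "(\<integral>z. \<rho> z \<partial>lebesgue) = (\<integral>z. \<rho> z \<partial>lborel)" using m by (intro integral_completion) simp
  then show "(\<integral>z. rescale \<rho> \<epsilon> z \<partial>lborel) = 1" unfolding rescale_mass[OF m \<epsilon>] using \<rho>(4) by simp
qed

context kernels begin

lemma strip_diag_mean:
  fixes F :: "'n phase \<times> 'n phase \<Rightarrow> real"
  assumes F: "F \<in> borel_measurable borel" and e: "0 < e" "e \<le> 1/2"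
  shows "(\<integral>\<^sup>+ q. ennreal (strip D e (xL q) (xR q)) * ennreal (F (snd q)) \<partial>\<mu>2) =
    ennreal (unit_ball_vol (real CARD('n)) * e ^ CARD('n)) * diag_mean D T \<nu> (\<lambda>\<xi>. F (\<xi> 0, \<xi> 1)) e" (is "?X = ennreal ?V * _")
proof -
  have V: "0 < ?V" using e by simp
  have "diag_mean D T \<nu> (\<lambda>\<xi>. F (\<xi> 0, \<xi> 1)) e = ?X / ennreal ?V"
    unfolding diag_mean_eq[OF F e] ball_volume_power[OF e(1)] ..
  moreover have "ennreal v * (x / ennreal v) = x" if "0 < v" for v x
    unfolding ennreal_times_divide mult.commute[of "ennreal v"] using that by (intro mult_divide_eq_ennreal) simp_all
  ultimately show ?thesis using V by (simp only:)
qed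

text \<open>The volume of the ball compensates the factor in front of the strip.\<close>

lemma weighted_diag_mean:
  fixes F :: "'n phase \<times> 'n phase \<Rightarrow> real"
  assumes F: "F \<in> borel_measurable borel" and e: "0 < e" "e \<le> 1/2" and M: "0 \<le> M"
    and w: "\<And>q. W q \<le> M / e ^ CARD('n) * strip D e (xL q) (xR q)"
  shows "(\<integral>\<^sup>+ q. ennreal (W q) * ennreal (F (snd q)) \<partial>\<mu>2) \<le>
    ennreal (M * unit_ball_vol (real CARD('n))) * diag_mean D T \<nu> (\<lambda>\<xi>. F (\<xi> 0, \<xi> 1)) e"
proof -
  let ?n = "CARD('n)"
  have m: "(\<lambda>q. ennreal (strip D e (xL q) (xR q)) * ennreal (F (snd q))) \<in> borel_measurable \<mu>2"
  proof (subst measurable_cong_sets[OF sets_\<mu>2 refl])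
    have "(\<lambda>q. F (snd q)) \<in> borel_measurable pair_space" by (rule measurable_compose[OF measurable_snd F])
    then show "(\<lambda>q. ennreal (strip D e (xL q) (xR q)) * ennreal (F (snd q))) \<in> borel_measurable pair_space" by measurable
  qed
  have c: "0 \<le> M / e ^ ?n" using M e by simp
  have "(\<integral>\<^sup>+ q. ennreal (W q) * ennreal (F (snd q)) \<partial>\<mu>2) \<le>
    (\<integral>\<^sup>+ q. ennreal (M / e ^ ?n) * (ennreal (strip D e (xL q) (xR q)) * ennreal (F (snd q))) \<partial>\<mu>2)"
  proof (rule nn_integral_mono)
    fix q
    show "ennreal (W q) * ennreal (F (snd q)) \<le> ennreal (M / e ^ ?n) * (ennreal (strip D e (xL q) (xR q)) * ennreal (F (snd q)))"
      using mult_right_mono[OF ennreal_leI[OF w[of q]], of "ennreal (F (snd q))"] c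
      by (simp only: ennreal_mult strip_bounds mult.assoc zero_le)
  qed
  also have "\<dots> = ennreal (M / e ^ ?n) * (ennreal (unit_ball_vol (real ?n) * e ^ ?n) * diag_mean D T \<nu> (\<lambda>\<xi>. F (\<xi> 0, \<xi> 1)) e)"
    unfolding nn_integral_cmult[OF m] strip_diag_mean[OF F e] ..
  also have "\<dots> = ennreal (M * unit_ball_vol (real ?n)) * diag_mean D T \<nu> (\<lambda>\<xi>. F (\<xi> 0, \<xi> 1)) e"
  proof -
    have "ennreal (M / e ^ ?n) * ennreal (unit_ball_vol (real ?n) * e ^ ?n) = ennreal (M * unit_ball_vol (real ?n))"
      using c e by (subst ennreal_mult[symmetric]) simp_all
    then show ?thesis by (simp only: mult.assoc[symmetric])
  qed
  finally show ?thesis .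
qed

lemma mollified_pair:
  assumes \<psi>: "\<psi> \<in> test_functions D 1 {0<..<T}" and \<rho>: "rot_sym_mollifier \<rho>" and \<epsilon>: "0 < \<epsilon>" "\<epsilon> < 1/2"
  shows "test_pair D T \<nu> \<kappa>1 \<kappa>2 \<psi> (rescale \<rho> \<epsilon>) \<epsilon>"
proof
  show "smooth_along (range coord_shift) (rescale \<rho> \<epsilon>)"
    by (rule rescale_smooth[OF _ \<epsilon>(1)]) (use \<rho> in \<open>simp add: rot_sym_mollifier_def\<close>)
qed (use \<psi> \<epsilon> rescale_vanishes[OF \<rho> \<epsilon>(1)] in simp_all)

lemma defect_integral_cubic:
  assumes \<psi>: "\<psi> \<in> test_functions D 1 {0<..<T}" and \<rho>: "rot_sym_mollifier \<rho>" and \<epsilon>: "0 < \<epsilon>" "\<epsilon> < 1/2"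
  shows "defect_integral_defined D T \<nu> \<rho> \<psi> \<epsilon>"
    and "defect_integral D T \<nu> \<rho> \<psi> \<epsilon> = (\<integral>q. test_pair.cubic D \<psi> (rescale \<rho> \<epsilon>) q \<partial>\<mu>2)"
proof -
  interpret tp: test_pair D T \<nu> \<kappa>1 \<kappa>2 \<psi> "rescale \<rho> \<epsilon>" \<epsilon> by (rule mollified_pair[OF \<psi> \<rho> \<epsilon>])
  show "defect_integral_defined D T \<nu> \<rho> \<psi> \<epsilon>"
    unfolding defect_integral_defined_def defect_integrand_def using tp.defect_transfer(1,2) by blast
  show "defect_integral D T \<nu> \<rho> \<psi> \<epsilon> = (\<integral>q. tp.cubic q \<partial>\<mu>2)"
    unfolding defect_integral_def defect_integrand_def by (rule tp.defect_transfer(3))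
qed

lemma diagonal_gap: "((\<lambda>\<epsilon>. diag_mean D T \<nu> (\<lambda>\<xi>. gap (\<xi> 0, \<xi> 1)) \<epsilon>) \<longlongrightarrow> 0) (at_right 0)"
  using sol unfolding statistical_solution_def diagonal_cond_def gap_def vel_def pres_def fst_conv snd_conv by blast

text \<open>
  The constants do not depend on epsilon, which enters through the mean of the gap only.
\<close>

lemma defect_remainder:
  assumes \<psi>: "\<psi> \<in> test_functions D 1 {0<..<T}" and \<rho>: "rot_sym_mollifier \<rho>"
  shows "\<exists>A C. 0 \<le> A \<and> 0 \<le> C \<and> (\<forall>\<epsilon> \<delta> d. 0 < \<epsilon> \<longrightarrow> \<epsilon> < 1/2 \<longrightarrow> 0 < \<delta> \<longrightarrow> \<delta> \<le> 1 \<longrightarrow> 0 \<le> d \<longrightarrow>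
    diag_mean D T \<nu> (\<lambda>\<xi>. gap (\<xi> 0, \<xi> 1)) \<epsilon> \<le> ennreal d \<longrightarrow>
    \<bar>defect_integral D T \<nu> \<rho> \<psi> \<epsilon> - 2 * (\<integral>r. energy_density \<psi> r \<partial>S1 D T)\<bar> \<le> A * \<delta> + C * d / \<delta>\<^sup>2)"
proof -
  obtain B where B: "0 \<le> B" "\<And>t x. \<bar>at_point (dt \<psi>) t x\<bar> \<le> B" "\<And>t x. norm (at_point (grad_at 0 \<psi>) t x) \<le> B"
    using weights_bounded[OF \<psi>] by metis
  obtain M where M: "0 \<le> M" "\<And>\<epsilon> z. 0 < \<epsilon> \<Longrightarrow> \<bar>rescale \<rho> \<epsilon> z\<bar> \<le> M / \<epsilon> ^ CARD('n) * indicator (ball 0 \<epsilon>) z"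
    using mollifier_bounds[OF \<rho>] by metis
  let ?V = "unit_ball_vol (real CARD('n))" and ?m = "enn2real moment1"
  have m: "moment1 = ennreal ?m" using moment1_finite by (simp add: less_top)
  have MV: "0 \<le> M * ?V" using M(1) by simp
  show ?thesis
  proof (rule exI[of _ "10 * B * (2 * ?m)"], rule exI[of _ "10 * B * (M * ?V)"], intro conjI allI impI)
    show "0 \<le> 10 * B * (2 * ?m)" using B(1) by simp
    show "0 \<le> 10 * B * (M * ?V)" using B(1) MV by simp
    fix \<epsilon> \<delta> d :: real
    assume \<epsilon>: "0 < \<epsilon>" "\<epsilon> < 1/2" and \<delta>: "0 < \<delta>" "\<delta> \<le> 1" and d: "0 \<le> d" "diag_mean D T \<nu> (\<lambda>\<xi>. gap (\<xi> 0, \<xi> 1)) \<epsilon> \<le> ennreal d"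
    interpret tp: test_pair D T \<nu> \<kappa>1 \<kappa>2 \<psi> "rescale \<rho> \<epsilon>" \<epsilon> by (rule mollified_pair[OF \<psi> \<rho> \<epsilon>])
    have G: "tp.G q \<le> M / \<epsilon> ^ CARD('n) * strip D \<epsilon> (xL q) (xR q)" for q
      using M(2)[OF \<epsilon>(1), of "rep D (xL q - xR q)"] unfolding tp.G_def strip_def by linarith
    have "(\<integral>\<^sup>+ q. ennreal (tp.G q) * ennreal (gap (snd q)) \<partial>\<mu>2) \<le> ennreal (M * ?V) * diag_mean D T \<nu> (\<lambda>\<xi>. gap (\<xi> 0, \<xi> 1)) \<epsilon>"
      by (rule weighted_diag_mean[OF gap_measurable \<epsilon>(1) _ M(1) G]) (use \<epsilon> in simp)
    also have "\<dots> \<le> ennreal (M * ?V) * ennreal d" by (rule mult_left_mono[OF d(2)]) simp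
    finally have H: "(\<integral>\<^sup>+ q. ennreal (tp.G q) * ennreal (gap (snd q)) \<partial>\<mu>2) \<le> ennreal (M * ?V) * ennreal d" .
    have "ennreal \<bar>defect_integral D T \<nu> \<rho> \<psi> \<epsilon> - 2 * (\<integral>r. energy_density \<psi> r \<partial>S1 D T)\<bar> \<le>
      ennreal (10 * B) * (ennreal \<delta> * (2 * moment1) + ennreal (1 / \<delta>\<^sup>2) * (\<integral>\<^sup>+ q. ennreal (tp.G q) * ennreal (gap (snd q)) \<partial>\<mu>2))"
      unfolding defect_integral_cubic(2)[OF \<psi> \<rho> \<epsilon>]
      by (rule tp.cubic_remainder[OF rescale_nonneg[OF \<rho> \<epsilon>(1)] rescale_unit_mass[OF \<rho> \<epsilon>(1)] B(2,3,1) \<delta>])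
    also have "\<dots> \<le> ennreal (10 * B) * (ennreal \<delta> * (2 * ennreal ?m) + ennreal (1 / \<delta>\<^sup>2) * (ennreal (M * ?V) * ennreal d))"
      unfolding m[symmetric] by (intro mult_left_mono add_left_mono H) simp_all
    also have "\<dots> = ennreal (10 * B * (2 * ?m) * \<delta> + 10 * B * (M * ?V) * d / \<delta>\<^sup>2)"
    proof -
      have "ennreal K * (ennreal a * (2 * ennreal b) + ennreal c * (ennreal v * ennreal w)) = ennreal (K * (2 * b) * a + K * v * w * c)"
        if "0 \<le> K" "0 \<le> a" "0 \<le> b" "0 \<le> c" "0 \<le> v" "0 \<le> w" for K a b c v w :: real
      proof -
        have "(2 :: ennreal) = ennreal 2" by simp
        then show ?thesis using that
          by (simp only: ennreal_mult[symmetric] ennreal_plus[symmetric] mult_nonneg_nonneg add_nonneg_nonneg zero_le_numeral)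
            (simp add: algebra_simps)
      qed
      from this[of "10 * B" \<delta> ?m "1 / \<delta>\<^sup>2" "M * ?V" d] show ?thesis using B(1) \<delta> d(1) MV by simp
    qed
    finally show "\<bar>defect_integral D T \<nu> \<rho> \<psi> \<epsilon> - 2 * (\<integral>r. energy_density \<psi> r \<partial>S1 D T)\<bar> \<le>
      10 * B * (2 * ?m) * \<delta> + 10 * B * (M * ?V) * d / \<delta>\<^sup>2"
      by (subst (asm) ennreal_le_iff) (use B(1) \<delta> d(1) MV in \<open>simp_all\<close>)
  qed
qed

lemma eventually_small: "\<forall>\<^sub>F \<epsilon> in at_right 0. (0::real) < \<epsilon> \<and> \<epsilon> < 1/2"
  using eventually_at_right_real[of 0 "1/2"] by (simp add: greaterThanLessThan_iff)

text \<open>First delta is chosen in terms of the moments, then epsilon in terms of delta.\<close>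

lemma defect_limit:
  assumes \<psi>: "\<psi> \<in> test_functions D 1 {0<..<T}" and \<rho>: "rot_sym_mollifier \<rho>"
  shows "(defect_integral D T \<nu> \<rho> \<psi> \<longlongrightarrow> 2 * (\<integral>r. energy_density \<psi> r \<partial>S1 D T)) (at_right 0)"
proof (rule tendstoI)
  fix \<eta> :: real assume \<eta>: "0 < \<eta>"
  obtain A C where A: "0 \<le> A" and C: "0 \<le> C" and AC: "\<forall>\<epsilon> \<delta> d. 0 < \<epsilon> \<longrightarrow> \<epsilon> < 1/2 \<longrightarrow> 0 < \<delta> \<longrightarrow> \<delta> \<le> 1 \<longrightarrow> 0 \<le> d \<longrightarrow>
    diag_mean D T \<nu> (\<lambda>\<xi>. gap (\<xi> 0, \<xi> 1)) \<epsilon> \<le> ennreal d \<longrightarrow>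
    \<bar>defect_integral D T \<nu> \<rho> \<psi> \<epsilon> - 2 * (\<integral>r. energy_density \<psi> r \<partial>S1 D T)\<bar> \<le> A * \<delta> + C * d / \<delta>\<^sup>2"
    using defect_remainder[OF \<psi> \<rho>] by blast
  \<comment> \<open>With these choices, both parts of the bound are at most eta / 4.\<close>
  define \<delta> where "\<delta> = min 1 (\<eta> / (4 * (A + 1)))"
  have \<delta>: "0 < \<delta>" "\<delta> \<le> 1" "\<delta> \<le> \<eta> / (4 * (A + 1))" unfolding \<delta>_def using \<eta> A by simp_all
  define d where "d = \<eta> * \<delta>\<^sup>2 / (4 * (C + 1))"
  have d: "0 < d" unfolding d_def using \<eta> \<delta>(1) C by simp
  have q: "x * (\<eta> / (4 * (x + 1))) \<le> \<eta> / 4" if "0 \<le> x" for x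
    using that \<eta> by (simp add: field_simps)
  have "A * \<delta> \<le> \<eta> / 4" using mult_left_mono[OF \<delta>(3) A] q[OF A] by linarith
  moreover have "C * d / \<delta>\<^sup>2 \<le> \<eta> / 4"
    using q[OF C] \<delta>(1) unfolding d_def by simp
  ultimately have small: "A * \<delta> + C * d / \<delta>\<^sup>2 < \<eta>" using \<eta> by linarith
  have "\<forall>\<^sub>F \<epsilon> in at_right 0. diag_mean D T \<nu> (\<lambda>\<xi>. gap (\<xi> 0, \<xi> 1)) \<epsilon> < ennreal d"
    by (rule order_tendstoD(2)[OF diagonal_gap]) (use d in simp)
  then show "\<forall>\<^sub>F \<epsilon> in at_right 0. dist (defect_integral D T \<nu> \<rho> \<psi> \<epsilon>) (2 * (\<integral>r. energy_density \<psi> r \<partial>S1 D T)) < \<eta>"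
    using eventually_small
  proof eventually_elim
    case (elim \<epsilon>)
    show ?case
      unfolding dist_real_def
      by (rule order_le_less_trans[OF AC[rule_format] small]) (use elim \<delta> d in \<open>simp_all add: less_imp_le\<close>)
  qed
qed

lemma energy_defect_eq:
  assumes \<psi>: "\<psi> \<in> test_functions D 1 {0<..<T}" and \<rho>: "rot_sym_mollifier \<rho>"
  shows "energy_defect D T \<nu> \<rho> \<psi> = - (\<integral>r. energy_density \<psi> r \<partial>S1 D T)"
  unfolding energy_defect_def tendsto_Lim[OF trivial_limit_at_right_real defect_limit[OF \<psi> \<rho>]] by simp

text \<open>
  The gradient of the rescaled mollifier exceeds the density of the mean by a factor of order
  1 / epsilon, so the regularity condition bounds a sequence of defect integrals.  As these
  converge, one sequence suffices.
\<close>

lemma energy_defect_regular: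
  assumes \<psi>: "\<psi> \<in> test_functions D 1 {0<..<T}" and \<rho>: "rot_sym_mollifier \<rho>" and reg: "regularity_cond D T \<nu>"
  shows "energy_defect D T \<nu> \<rho> \<psi> = 0"
proof (rule ccontr)
  let ?L = "2 * (\<integral>r. energy_density \<psi> r \<partial>S1 D T)"
  let ?n = "CARD('n)"
  define cube where "cube = (\<lambda>\<zeta> :: 'n phase \<times> 'n phase. norm (fst (fst \<zeta>) - fst (snd \<zeta>)) ^ 3)"
  let ?dm = "\<lambda>\<epsilon>. diag_mean D T \<nu> (\<lambda>\<xi>. cube (\<xi> 0, \<xi> 1)) \<epsilon>"
  have cm: "cube \<in> borel_measurable borel"
    unfolding cube_def by (intro borel_measurable_continuous_onI continuous_intros)
  have lim: "Liminf (at_right 0) (\<lambda>\<epsilon>. ennreal (1 / \<epsilon>) * ?dm \<epsilon>) = 0"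
    using reg unfolding regularity_cond_def cube_def vel_def fst_conv snd_conv .
  assume "energy_defect D T \<nu> \<rho> \<psi> \<noteq> 0"
  then have L: "0 < \<bar>?L\<bar>" unfolding energy_defect_eq[OF \<psi> \<rho>] by simp
  obtain B where B: "0 \<le> B" "\<And>t x. \<bar>at_point \<psi> t x\<bar> \<le> B" using test_functions_bounded[OF \<psi>] by metis
  obtain M where M: "0 \<le> M" "\<And>\<epsilon> z. 0 < \<epsilon> \<Longrightarrow> norm (grad (rescale \<rho> \<epsilon>) z) \<le> M / \<epsilon> ^ Suc ?n * indicator (ball 0 \<epsilon>) z"
    using mollifier_bounds[OF \<rho>] by metis
  define K where "K = B * M * unit_ball_vol (real ?n)"
  have K: "0 \<le> K" unfolding K_def using B(1) M(1) by simp
  have bound: "ennreal \<bar>defect_integral D T \<nu> \<rho> \<psi> \<epsilon>\<bar> \<le> ennreal K * (ennreal (1 / \<epsilon>) * ?dm \<epsilon>)" if \<epsilon>: "0 < \<epsilon>" "\<epsilon> < 1/2" for \<epsilon>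
  proof -
    interpret tp: test_pair D T \<nu> \<kappa>1 \<kappa>2 \<psi> "rescale \<rho> \<epsilon>" \<epsilon> by (rule mollified_pair[OF \<psi> \<rho> \<epsilon>])
    have w: "norm (tp.P q *\<^sub>R tp.Gx q) \<le> (B * M / \<epsilon>) / \<epsilon> ^ ?n * strip D \<epsilon> (xL q) (xR q)" for q
    proof -
      have "\<bar>tp.P q\<bar> * norm (tp.Gx q) \<le> B * (M / \<epsilon> ^ Suc ?n * strip D \<epsilon> (xL q) (xR q))"
        unfolding tp.P_def tp.Gx_def strip_def by (intro mult_mono B M(2)[OF \<epsilon>(1)]) simp_all
      then show ?thesis by (simp add: mult_ac)
    qed
    have "ennreal \<bar>defect_integral D T \<nu> \<rho> \<psi> \<epsilon>\<bar> \<le> (\<integral>\<^sup>+ q. ennreal \<bar>tp.cubic q\<bar> \<partial>\<mu>2)"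
      unfolding defect_integral_cubic(2)[OF \<psi> \<rho> \<epsilon>] by (rule norm_integral_le_nn)
    also have "\<dots> \<le> (\<integral>\<^sup>+ q. ennreal (norm (tp.P q *\<^sub>R tp.Gx q)) * ennreal (cube (snd q)) \<partial>\<mu>2)"
    proof (rule nn_integral_mono)
      fix q :: "(real \<times> (real^'n) \<times> (real^'n)) \<times> 'n phase \<times> 'n phase"
      have "\<bar>tp.cubic q\<bar> \<le> norm ((norm (vL q - vR q))\<^sup>2 *\<^sub>R (vL q - vR q)) * norm (tp.P q *\<^sub>R tp.Gx q)"
        unfolding tp.cubic_def by (rule Cauchy_Schwarz_ineq2)
      also have "norm ((norm (vL q - vR q))\<^sup>2 *\<^sub>R (vL q - vR q)) = cube (snd q)"
        unfolding cube_def coords by (simp add: power2_eq_square power3_eq_cube)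
      finally show "ennreal \<bar>tp.cubic q\<bar> \<le> ennreal (norm (tp.P q *\<^sub>R tp.Gx q)) * ennreal (cube (snd q))"
        by (subst ennreal_mult[symmetric]) (simp_all add: cube_def mult.commute ennreal_leI)
    qed
    also have "\<dots> \<le> ennreal (B * M / \<epsilon> * unit_ball_vol (real ?n)) * ?dm \<epsilon>"
      by (rule weighted_diag_mean[OF cm \<epsilon>(1) _ _ w]) (use \<epsilon> B(1) M(1) in simp_all)
    also have "\<dots> = ennreal K * (ennreal (1 / \<epsilon>) * ?dm \<epsilon>)"
    proof -
      have "ennreal (B * M / \<epsilon> * unit_ball_vol (real ?n)) = ennreal K * ennreal (1 / \<epsilon>)"
        using K \<epsilon> by (subst ennreal_mult[symmetric]) (simp_all add: K_def)
      then show ?thesis by (simp only: mult.assoc)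
    qed
    finally show ?thesis .
  qed
  \<comment> \<open>Means below c would keep the defect integrals below half of their limit.\<close>
  define c where "c = \<bar>?L\<bar> / (2 * (K + 1))"
  have c: "0 < c" unfolding c_def using L K by simp
  have Kc: "K * c \<le> \<bar>?L\<bar> / 2" unfolding c_def using K L by (simp add: field_simps)
  have "((\<lambda>\<epsilon>. \<bar>defect_integral D T \<nu> \<rho> \<psi> \<epsilon>\<bar>) \<longlongrightarrow> \<bar>?L\<bar>) (at_right 0)"
    by (rule tendsto_rabs[OF defect_limit[OF \<psi> \<rho>]])
  then have "\<forall>\<^sub>F \<epsilon> in at_right 0. \<bar>?L\<bar> / 2 < \<bar>defect_integral D T \<nu> \<rho> \<psi> \<epsilon>\<bar>"
    by (rule order_tendstoD(1)) (use L in simp)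
  then have "\<forall>\<^sub>F \<epsilon> in at_right 0. ennreal c \<le> ennreal (1 / \<epsilon>) * ?dm \<epsilon>"
    using eventually_small
  proof eventually_elim
    case (elim \<epsilon>)
    show ?case
    proof (rule ccontr)
      assume "\<not> ennreal c \<le> ennreal (1 / \<epsilon>) * ?dm \<epsilon>"
      then have "ennreal K * (ennreal (1 / \<epsilon>) * ?dm \<epsilon>) \<le> ennreal K * ennreal c" by (intro mult_left_mono) simp_all
      then have "ennreal \<bar>defect_integral D T \<nu> \<rho> \<psi> \<epsilon>\<bar> \<le> ennreal (K * c)"
        using bound[of \<epsilon>] elim(2) K c by (simp add: ennreal_mult)
      then have "\<bar>defect_integral D T \<nu> \<rho> \<psi> \<epsilon>\<bar> \<le> K * c" using K c by (simp add: ennreal_le_iff)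
      then show False using Kc elim(1) by linarith
    qed
  qed
  then have "ennreal c \<le> Liminf (at_right 0) (\<lambda>\<epsilon>. ennreal (1 / \<epsilon>) * ?dm \<epsilon>)" by (rule Liminf_bounded)
  then show False using c unfolding lim by simp
qed

end

section \<open>The defect as a distribution\<close>

lemma test_functions_linear_combination:
  fixes \<phi> \<psi> :: "real \<times> (nat \<Rightarrow> real^'n) \<Rightarrow> real"
  assumes \<phi>: "\<phi> \<in> test_functions D k I" and \<psi>: "\<psi> \<in> test_functions D k I"
  shows "(\<lambda>p. a * \<phi> p + b * \<psi> p) \<in> test_functions D k I"
proof -
  obtain J R where J: "compact J" "J \<subseteq> I" "support_within D k J R \<phi>" using test_functionsD(4)[OF \<phi>] by blast
  obtain J' R' where J': "compact J'" "J' \<subseteq> I" "support_within D k J' R' \<psi>" using test_functionsD(4)[OF \<psi>] by blast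
  have "support_within D k (J \<union> J') (max R R') (\<lambda>p. a * \<phi> p + b * \<psi> p)"
    unfolding support_within_def
  proof (intro allI impI)
    fix t x assume "a * \<phi> (t, x) + b * \<psi> (t, x) \<noteq> 0"
    then have "\<phi> (t, x) \<noteq> 0 \<or> \<psi> (t, x) \<noteq> 0" by auto
    then show "t \<in> J \<union> J' \<and> (D = Whole \<longrightarrow> (\<forall>l<k. norm (x l) \<le> max R R'))"
      using J(3) J'(3) unfolding support_within_def by (metis Un_iff max.coboundedI1 max.coboundedI2)
  qed
  then have "\<exists>J R. compact J \<and> J \<subseteq> I \<and> support_within D k J R (\<lambda>p. a * \<phi> p + b * \<psi> p)"
    using J(1,2) J'(1,2) compact_Un[of J J'] Un_least[of J I J'] by blast
  moreover have "depends_on_first k (\<lambda>x. a * \<phi> (t, x) + b * \<psi> (t, x))" for t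
    unfolding depends_on_first_def
  proof (intro allI impI)
    fix x y :: "nat \<Rightarrow> real^'n" assume xy: "\<forall>j<k. x j = y j"
    then show "a * \<phi> (t, x) + b * \<psi> (t, x) = a * \<phi> (t, y) + b * \<psi> (t, y)"
      using test_functionsD(2)[OF \<phi>, of x y t] test_functionsD(2)[OF \<psi>, of x y t] by simp
  qed
  moreover have "D = Torus \<longrightarrow> (\<forall>t x. \<forall>l<k. \<forall>i. a * \<phi> (t, x(l := x l + axis i 1)) + b * \<psi> (t, x(l := x l + axis i 1)) = a * \<phi> (t, x) + b * \<psi> (t, x))"
    using test_functionsD(3)[OF \<phi>] test_functionsD(3)[OF \<psi>] by simp
  ultimately show ?thesis
    using smooth_along_linear_combination[OF test_functionsD(1)[OF \<phi>] test_functionsD(1)[OF \<psi>]]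
    unfolding test_functions_def mem_Collect_eq by blast
qed

context kernels begin

lemma energy_density_linear:
  assumes \<phi>: "\<phi> \<in> test_functions D 1 I" and \<psi>: "\<psi> \<in> test_functions D 1 I"
  shows "energy_density (\<lambda>p. a * \<phi> p + b * \<psi> p) r = a * energy_density \<phi> r + b * energy_density \<psi> r"
proof -
  have lin: "flow_deriv s (\<lambda>p. a * \<phi> p + b * \<psi> p) = (\<lambda>p. a * flow_deriv s \<phi> p + b * flow_deriv s \<psi> p)"
    if "s \<in> shifts 1" for s
    by (rule flow_derivI) (auto intro!: derivative_eq_intros smooth_along_DERIV[OF test_functionsD(1)[OF \<phi>] that]
        smooth_along_DERIV[OF test_functionsD(1)[OF \<psi>] that])
  have dt: "at_point (dt (\<lambda>p. a * \<phi> p + b * \<psi> p)) t x = a * at_point (dt \<phi>) t x + b * at_point (dt \<psi>) t x" for t x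
    unfolding dt_def lin[OF shifts_1(1)] by (simp add: at_point_def)
  have gr: "at_point (grad_at 0 (\<lambda>p. a * \<phi> p + b * \<psi> p)) t x $ k = a * at_point (grad_at 0 \<phi>) t x $ k + b * at_point (grad_at 0 \<psi>) t x $ k" for t x k
    unfolding at_point_grad lin[OF shifts_1(2)] by (simp add: at_point_def)
  show ?thesis
    unfolding energy_density_def dt gr
    by (simp only: distrib_left distrib_right sum.distrib sum_distrib_left mult_ac add_ac)
qed

text \<open>
  The defect only involves first derivatives of the test function, with integrable coefficients.
\<close>

lemma energy_defect_distribution:
  assumes \<rho>: "rot_sym_mollifier \<rho>"
  shows "distribution D T (energy_defect D T \<nu> \<rho>)"
  unfolding distribution_def
proof (intro conjI ballI allI impI)
  have int: "integrable (S1 D T) (energy_density \<psi>)" if t: "\<psi> \<in> test_functions D 1 {0<..<T}" for \<psi>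
  proof -
    obtain B where "0 \<le> B" "\<And>t x. \<bar>at_point (dt \<psi>) t x\<bar> \<le> B" "\<And>t x k. \<bar>at_point (grad_at 0 \<psi>) t x $ k\<bar> \<le> B"
      using weights_bounded[OF t] by metis
    then show ?thesis using energy_density_integrable(3)[OF t] by blast
  qed
  fix \<phi> \<psi> :: "real \<times> (nat \<Rightarrow> real^'n) \<Rightarrow> real" and a b :: real
  assume t: "\<phi> \<in> test_functions D 1 {0<..<T}" "\<psi> \<in> test_functions D 1 {0<..<T}"
  have i: "integrable (S1 D T) (\<lambda>r. a * energy_density \<phi> r)" "integrable (S1 D T) (\<lambda>r. b * energy_density \<psi> r)"
    using int[OF t(1)] int[OF t(2)] by (simp_all only: integrable_mult_right)
  show "energy_defect D T \<nu> \<rho> (\<lambda>p. a * \<phi> p + b * \<psi> p) = a * energy_defect D T \<nu> \<rho> \<phi> + b * energy_defect D T \<nu> \<rho> \<psi>"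
    unfolding energy_defect_eq[OF t(1) \<rho>] energy_defect_eq[OF t(2) \<rho>] energy_defect_eq[OF test_functions_linear_combination[OF t] \<rho>]
      energy_density_linear[OF t] Bochner_Integration.integral_add[OF i] integral_mult_right_zero by simp
next
  fix J :: "real set" and R :: real
  show "\<exists>C N. \<forall>\<psi>\<in>test_functions D 1 {0<..<T}. support_within D 1 J R \<psi> \<longrightarrow>
    (\<forall>M. (\<forall>ss\<in>lists (shifts 1). length ss \<le> N \<longrightarrow> (\<forall>p. \<bar>foldr flow_deriv ss \<psi> p\<bar> \<le> M)) \<longrightarrow>
      \<bar>energy_defect D T \<nu> \<rho> \<psi>\<bar> \<le> C * M)"
  proof (intro exI ballI allI impI)
    fix \<psi> :: "real \<times> (nat \<Rightarrow> real^'n) \<Rightarrow> real" and M :: real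
    assume t: "\<psi> \<in> test_functions D 1 {0<..<T}"
      and M: "\<forall>ss\<in>lists (shifts 1). length ss \<le> 1 \<longrightarrow> (\<forall>p. \<bar>foldr flow_deriv ss \<psi> p\<bar> \<le> M)"
    have one: "\<bar>flow_deriv s \<psi> p\<bar> \<le> M" if "s \<in> shifts 1" for s p
    proof -
      have "[s] \<in> lists (shifts 1)" "length [s] \<le> 1" using that by (simp_all add: One_nat_def)
      then have "\<bar>foldr flow_deriv [s] \<psi> p\<bar> \<le> M" using M by blast
      then show ?thesis by simp
    qed
    have d: "\<bar>at_point (dt \<psi>) u x\<bar> \<le> M" for u x using one[OF shifts_1(1)] by (simp add: at_point_def dt_def)
    have g: "\<bar>at_point (grad_at 0 \<psi>) u x $ k\<bar> \<le> M" for u x k unfolding at_point_grad using one[OF shifts_1(2)] by (simp add: at_point_def)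
    have M0: "0 \<le> M" using order_trans[OF abs_ge_zero d] .
    show "\<bar>energy_defect D T \<nu> \<rho> \<psi>\<bar> \<le> 3 * (1 + real CARD('n)) * enn2real moment1 * M"
      unfolding energy_defect_eq[OF t \<rho>] abs_minus_cancel by (rule energy_density_integrable(4)[OF t d g M0])
  qed
qed

lemma energy_defect_balance:
  assumes \<rho>: "rot_sym_mollifier \<rho>"
  shows "energy_balance D T \<nu> (energy_defect D T \<nu> \<rho>)"
  unfolding energy_balance_def
proof (intro conjI allI ballI)
  show "AE_bracket_defined D T \<nu> 1 (\<lambda>\<xi>. (norm (vel \<xi> 0))\<^sup>2)" by (rule energy_brackets(1))
  show "AE_bracket_defined D T \<nu> 1 (\<lambda>\<xi>. (norm (vel \<xi> 0))\<^sup>2 * vel \<xi> 0 $ k + 2 * vel \<xi> 0 $ k * pres \<xi> 0)" for k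
    by (rule energy_brackets(2))
  fix \<psi> :: "real \<times> (nat \<Rightarrow> real^'n) \<Rightarrow> real" assume t: "\<psi> \<in> test_functions D 1 {0<..<T}"
  show "integrable (spacetime D T 1) (energy_integrand \<nu> \<psi>)" by (rule energy_integrand_density(1)[OF t])
  show "- (\<integral>p. energy_integrand \<nu> \<psi> p \<partial>spacetime D T 1) = energy_defect D T \<nu> \<rho> \<psi>"
    unfolding energy_integrand_density(2)[OF t] energy_defect_eq[OF t \<rho>] ..
qed

end

theorem theorem3p8:
  fixes D :: space_domain and T :: real and \<nu> :: "'n::finite correlation"
    and \<rho> :: "real^'n \<Rightarrow> real"
  assumes "T > 0"
    and "statistical_solution D T \<nu>"
    and "rot_sym_mollifier \<rho>"
  shows "(\<forall>\<psi>\<in>test_functions D 1 {0<..<T}.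
            (\<forall>\<^sub>F \<epsilon> in at_right 0. defect_integral_defined D T \<nu> \<rho> \<psi> \<epsilon>) \<and>
            (\<exists>L. (defect_integral D T \<nu> \<rho> \<psi> \<longlongrightarrow> L) (at_right 0))) \<and>
         distribution D T (energy_defect D T \<nu> \<rho>) \<and>
         (\<forall>\<rho>'. rot_sym_mollifier \<rho>' \<longrightarrow>
            (\<forall>\<psi>\<in>test_functions D 1 {0<..<T}.
               energy_defect D T \<nu> \<rho>' \<psi> = energy_defect D T \<nu> \<rho> \<psi>)) \<and>
         energy_balance D T \<nu> (energy_defect D T \<nu> \<rho>) \<and>
         (regularity_cond D T \<nu> \<longrightarrow>
            (\<forall>\<psi>\<in>test_functions D 1 {0<..<T}. energy_defect D T \<nu> \<rho> \<psi> = 0))"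
proof -
  obtain \<kappa>1 where k1: "\<kappa>1 \<in> S1 D T \<rightarrow>\<^sub>M prob_algebra borel" "AE (t, x) in S1 D T. law1 \<nu> t x = \<kappa>1 (t, x)"
    using exists_kernel1[OF assms(1,2)] by blast
  obtain \<kappa>2 where k2: "\<kappa>2 \<in> S2 D T \<rightarrow>\<^sub>M prob_algebra borel" "AE (t, x, y) in S2 D T. law2 \<nu> t x y = \<kappa>2 (t, x, y)"
    using exists_kernel2[OF assms(1,2)] by blast
  interpret kernels D T \<nu> \<kappa>1 \<kappa>2
    by (intro kernels.intro assms k1 k2)
  have "\<forall>\<^sub>F \<epsilon> in at_right 0. defect_integral_defined D T \<nu> \<rho> \<psi> \<epsilon>" if "\<psi> \<in> test_functions D 1 {0<..<T}" for \<psi>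
    using eventually_small by eventually_elim (use defect_integral_cubic(1)[OF that assms(3)] in blast)
  moreover have "energy_defect D T \<nu> \<rho>' \<psi> = energy_defect D T \<nu> \<rho> \<psi>"
    if "rot_sym_mollifier \<rho>'" "\<psi> \<in> test_functions D 1 {0<..<T}" for \<rho>' \<psi>
    unfolding energy_defect_eq[OF that(2,1)] energy_defect_eq[OF that(2) assms(3)] ..
  ultimately show ?thesis
    using defect_limit[OF _ assms(3)] energy_defect_distribution[OF assms(3)] energy_defect_balance[OF assms(3)]
      energy_defect_regular[OF _ assms(3)] by blast
qed

end
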